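(* Suppose the kernel conditions (K1)–(K4) and the distributional conditions (D1)–(D4) of the context hold with $\alpha(p)=O(1)$. Suppose $|\Delta|=\|\Sigma_X-\Sigma_Y\|_F=0$ and there are positive constants $L_4,U_4<\infty$ (not depending on $p$) and exponents $0\le\delta_5,\delta_6,\delta_7<1$ with $1+\max\{\delta_5,\delta_6\}\ne2\delta_7$ and $\max\{\delta_5,\delta_6,\delta_7\}>0$ such that $$L_4p^{\delta_5}\le\sum_{j_1,j_2,j_3=1}^p\big(\mathrm{cum}(\tilde x_{1j_1},\tilde x_{1j_2},\tilde x_{1j_3})-\mathrm{cum}(\tilde y_{1j_1},\tilde y_{1j_2},\tilde y_{1j_3})\big)^2\le U_4p^{\delta_5},$$ $$L_4p^{\delta_6}\le\sum_{j_2=1}^p\Big(\sum_{j_1=1}^p\big\{\mathrm{Cov}(\tilde x_{1j_1}^2-\sigma_{X,j_1}^2,\tilde x_{1j_2})-\mathrm{Cov}(\tilde y_{1j_1}^2-\sigma_{Y,j_1}^2,\tilde y_{1j_2})\big\}\Big)^2\le U_4p^{\delta_6},$$ $$L_4p^{2\delta_7}\le\Big(\sum_{j_1,j_2=1}^p\big\{\mathrm{Cov}(\tilde x_{1j_1}^2-\sigma_{X,j_1}^2,\tilde x_{1j_2}^2-\sigma_{X,j_2}^2)-\mathrm{Cov}(\tilde y_{1j_1}^2-\sigma_{Y,j_1}^2,\tilde y_{1j_2}^2-\sigma_{Y,j_2}^2)\big\}\Big)^2\le U_4p^{2\delta_7}.$$ Assume that for any $k=k^{(p)}$ in a sequence of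 $\mathcal{C}$, $\mathbb{E}[k^4(Z_1,Z_2)]<\infty$, and that $n/N=\rho+O(1/N)$ as $n,m\to\infty$ for some $0<\rho<1$, where $N=n+m$. Then for any $C>0$, $\mathbb{P}(T_{n,m,p}^k>C)\to1$ when $n,m,p\to\infty$ as long as $p=o\big(N^{1/(7-2\max\{1+\max\{\delta_5,\delta_6\},2\delta_7\})}\big)$.
   Context: Kernel: a kernel on $\mathbb{R}^p$ is a symmetric function $k:\mathbb{R}^p\times\mathbb{R}^p\to\mathbb{R}$ satisfying either (a) $k\ge0$, $k(x,y)=0$ iff $x=y$, and for all Borel probability measures $P\ne Q$ with $\int k(z,z_0)\,dP(z)<\infty$ and $\int k(z,z_0)\,dQ(z)<\infty$ for some $z_0$, one has $\int k\,d([P-Q]\times[P-Q])<0$; or (b) $-k$ is the reproducing kernel of an RKHS on $\mathbb{R}^p$ and is characteristic (the mean embedding map on Borel probability measures is injective). $\mathcal{C}$ is a set of sequences $(k^{(p)})_{p\ge1}$ of kernels, $k^{(p)}$ on $\mathbb{R}^p$. Write $a_0^k=k(x,x)$ (constant in $x$ here). Sampling: for each $p$, $X=(x_1,\dots,x_p)^\top$, $Y=(y_1,\dots,y_p)^\top$ are random vectors in $\mathbb{R}^p$ with covariance matrices $\Sigma_X,\Sigma_Y$; $X_1,\dots,X_n$ are i.i.d. copies of $X$, $Y_1,\dots,Y_m$ i.i.d. copies of $Y$, the two samples independent. $Z$ equals $X$ with probability $\rho$ and $Y$ with probability $1-\rho$; $Z_1,Z_2,\dots$ are i.i.d. copies of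 $Z$. $\Delta=\mathbb{E}X-\mathbb{E}Y$; $\tilde x_{1j},\tilde y_{1j}$ are the $j$-th coordinates of $X_1-\mathbb{E}X$, $Y_1-\mathbb{E}Y$; $\sigma_{X,j}^2,\sigma_{Y,j}^2$ are the variances of $x_j,y_j$; $\mathrm{cum}$ denotes joint cumulant; $|\cdot|$ is the Euclidean norm, $\|\cdot\|_F$ the Frobenius norm. $A=\mathbb{E}|Z_1-Z_2|^2$, $A^X=\mathbb{E}|X_1-X_2|^2$, $A^{XY}=\mathbb{E}|X_1-Y_1|^2$, $A^Y=\mathbb{E}|Y_1-Y_2|^2$; $A_0=A^{1/2}$, $A_0^{XY}=(A^{XY})^{1/2}$. Kernel conditions: each $k^{(p)}$ occurring in $\mathcal{C}$ has the form $k^{(p)}(x,y)=f^{(p)}(|x-y|)$; $D$ is the domain of $f^{(p)}$, $D_0\subseteq D$ contains $A_0$ and $A_0^{XY}$; $f_i^{(p)}$ is the $i$-th derivative ($f_0^{(p)}=f^{(p)}$), and below $f_i=f_i^{(p)}$. (K1) For each $f^{(p)}$, all $s\in D$, $s_0\in D_0$: $f(s)=\sum_{i=0}^6\frac{1}{i!}f_i(s_0)(s-s_0)^i+\frac1{7!}f_7(\xi)(s-s_0)^7$ for some $\xi=\xi(s,s_0)$ between $s$ and $s_0$. (K2) There is $\tilde M<\infty$ such that for any $f^{(p)}$ and $s_0\in D_0$: $\max_{1\le i\le7}\sup_{s\in D}|f_i(s)|\cdot|s_0^i|\le\tilde M|f_0(s_0)|$. (K3) There is $\hat M<\infty$ such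 that for any $f^{(p)}$ and $s_0\in D_0$: $|f_0(s_0)|\le\hat M\min\{|\tfrac12f_1(s_0)s_0|,\ |-\tfrac18f_1(s_0)s_0+\tfrac18f_2(s_0)s_0^2|\}$. (K4) There is $\hat M<\infty$ such that for any $f^{(p)}$ and $s_0\in D_0$: $|f_0(s_0)|\le\hat M\min\{|\tfrac1{16}f_1(s_0)s_0-\tfrac1{16}f_2(s_0)s_0^2+\tfrac1{48}f_3(s_0)s_0^3|,\ |-\tfrac5{128}f_1(s_0)s_0+\tfrac5{128}f_2(s_0)s_0^2-\tfrac1{64}f_3(s_0)s_0^3+\tfrac1{384}f_4(s_0)s_0^4|\}$. Distributional conditions (constants not depending on $p$): (D1) There is an integer $1\le\alpha(p)$ with $\alpha(p)=o(p)$ such that for any $1\le j\le p-\alpha(p)-1$ and $\ell>\alpha(p)$, $\{x_i\}_{i\le j}$ is independent of $\{x_i\}_{i\ge j+\ell}$ and $\{y_i\}_{i\le j}$ is independent of $\{y_i\}_{i\ge j+\ell}$. (D2) There is $0<U^*<\infty$ with $\max_{1\le j\le p}\max_{1\le r\le128}\{\mathbb{E}|x_j|^r,\mathbb{E}|y_j|^r\}<U^*$. (D3) There are $0<L_0,U_0<\infty$ with $L_0p\le\min\{A^X,A^{XY},A^Y\}\le\max\{A^X,A^{XY},A^Y\}\le U_0p$. (D4) There are $0<L_0^*,U_0^*<\infty$ with $L_0^*\alpha(p)p\le\min\{\|\Sigma_X\|_F^2,\|\Sigma_Y\|_F^2\}\le\max\{\|\Sigma_X\|_F^2,\|\Sigma_Y\|_F^2\}\le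 U_0^*\alpha(p)p$. Test statistic: $\mathcal{E}_{n,m}^k(X,Y)=\frac{2}{nm}\sum_{i=1}^n\sum_{j=1}^m k(X_i,Y_j)-\binom n2^{-1}\sum_{1\le i<j\le n}k(X_i,X_j)-\binom m2^{-1}\sum_{1\le i<j\le m}k(Y_i,Y_j)$; $c_{n,m}=\frac{2}{n(n-1)}+\frac{4}{nm}+\frac{2}{m(m-1)}$. Let $W_1,\dots,W_N$ be the pooled sample ($W_s=X_s$ for $s\le n$, $W_s=Y_{s-n}$ for $s>n$), $a_{s,t}=k(W_s,W_t)$ for $1\le s,t\le N$, $\tilde a_{\cdot t}=\frac{1}{N-2}\sum_{i=1}^N a_{i,t}$, $\tilde a_{s\cdot}=\frac1{N-2}\sum_{j=1}^Na_{s,j}$, $\tilde a_{\cdot\cdot}=\frac{1}{(N-1)(N-2)}\sum_{i,j=1}^Na_{i,j}$, $A^*_{s,t}=a_{s,t}-\tilde a_{\cdot t}-\tilde a_{s\cdot}+\tilde a_{\cdot\cdot}$, and $\mathcal{V}_{n,m}^{k*}(X,Y)=\frac{1}{N(N-3)}\sum_{s\ne t}(A^*_{s,t})^2-\frac{(a_0^k)^2}{(N-1)(N-3)}$. Finally $T_{n,m,p}^k=\mathcal{E}_{n,m}^k(X,Y)\big/\sqrt{c_{n,m}\mathcal{V}_{n,m}^{k*}(X,Y)}$. *)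

theory Defs
  imports
    "HOL-Probability.Probability"
    "HOL-Library.Disjoint_Sets"
    "HOL-Library.Landau_Symbols"
begin

section \<open>The space of real p-vectors\<close>

text \<open>
  The dimension p tends to infinity, so a p-vector is a function on \<open>{1..p}\<close>, extended by
  \<open>undefined\<close>, and the Borel sigma-algebra of p-space is the product sigma-algebra.
\<close>

type_synonym rvec = "nat \<Rightarrow> real"

definition Rp :: "nat \<Rightarrow> rvec measure" where
  "Rp p = (\<Pi>\<^sub>M j\<in>{1..p}. borel)"

definition edist :: "nat \<Rightarrow> rvec \<Rightarrow> rvec \<Rightarrow> real" where
  "edist p x y = L2_set (\<lambda>j. x j - y j) {1..p}"

definition frob_norm :: "nat \<Rightarrow> (nat \<Rightarrow> nat \<Rightarrow> real) \<Rightarrow> real" where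
  "frob_norm p S = sqrt (\<Sum>i=1..p. \<Sum>j=1..p. (S i j)\<^sup>2)"

definition borel_prob :: "nat \<Rightarrow> rvec measure \<Rightarrow> bool" where
  "borel_prob p P \<longleftrightarrow> prob_space P \<and> sets P = sets (Rp p)"


section \<open>Kernels\<close>

text \<open>
  \<open>rkhs S H ip K\<close>: the set \<open>H\<close> of real functions on \<open>S\<close>, with inner product \<open>ip\<close>, is a
  Hilbert space with reproducing kernel \<open>K\<close>.  A function on \<open>S\<close> is represented by its
  extension by zero, so that the vector space operations are the pointwise ones.
\<close>

definition rkhs ::
  "'x set \<Rightarrow> ('x \<Rightarrow> real) set \<Rightarrow> (('x \<Rightarrow> real) \<Rightarrow> ('x \<Rightarrow> real) \<Rightarrow> real) \<Rightarrow> ('x \<Rightarrow> 'x \<Rightarrow> real) \<Rightarrow> bool"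
where
  "rkhs S H ip K \<longleftrightarrow>
     (\<forall>h\<in>H. \<forall>x. x \<notin> S \<longrightarrow> h x = 0) \<and>
     (\<lambda>x. 0) \<in> H \<and>
     (\<forall>g\<in>H. \<forall>h\<in>H. (\<lambda>x. g x + h x) \<in> H) \<and>
     (\<forall>c. \<forall>h\<in>H. (\<lambda>x. c * h x) \<in> H) \<and>
     (\<forall>g\<in>H. \<forall>h\<in>H. ip g h = ip h g) \<and>
     (\<forall>g\<in>H. \<forall>g'\<in>H. \<forall>h\<in>H. ip (\<lambda>x. g x + g' x) h = ip g h + ip g' h) \<and>
     (\<forall>c. \<forall>g\<in>H. \<forall>h\<in>H. ip (\<lambda>x. c * g x) h = c * ip g h) \<and>
     (\<forall>h\<in>H. 0 \<le> ip h h) \<and>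
     (\<forall>h\<in>H. ip h h = 0 \<longrightarrow> h = (\<lambda>x. 0)) \<and>
     Metric_space.mcomplete H (\<lambda>g h. sqrt (ip (\<lambda>x. g x - h x) (\<lambda>x. g x - h x))) \<and>
     (\<forall>x\<in>S. (\<lambda>y. if y \<in> S then K y x else 0) \<in> H \<and>
            (\<forall>h\<in>H. ip h (\<lambda>y. if y \<in> S then K y x else 0) = h x))"

text \<open>The mean embedding of \<open>P\<close> represents the functional \<open>g \<mapsto> \<integral> g dP\<close> on \<open>H\<close>.\<close>

definition mean_embedding ::
  "('x \<Rightarrow> real) set \<Rightarrow> (('x \<Rightarrow> real) \<Rightarrow> ('x \<Rightarrow> real) \<Rightarrow> real) \<Rightarrow> 'x measure \<Rightarrow> ('x \<Rightarrow> real) \<Rightarrow> bool"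
where
  "mean_embedding H ip P h \<longleftrightarrow>
     h \<in> H \<and> (\<forall>g\<in>H. integrable P g \<and> ip g h = (\<integral>x. g x \<partial>P))"

definition characteristic ::
  "nat \<Rightarrow> (rvec \<Rightarrow> real) set \<Rightarrow> ((rvec \<Rightarrow> real) \<Rightarrow> (rvec \<Rightarrow> real) \<Rightarrow> real) \<Rightarrow> bool"
where
  "characteristic p H ip \<longleftrightarrow>
     (\<forall>P. borel_prob p P \<longrightarrow> (\<exists>h. mean_embedding H ip P h)) \<and>
     (\<forall>P Q h. borel_prob p P \<and> borel_prob p Q \<and>
        mean_embedding H ip P h \<and> mean_embedding H ip Q h \<longrightarrow> P = Q)"

text \<open>
  The integral of \<open>k\<close> against the signed measure \<open>(P - Q) \<times> (P - Q)\<close>, expanded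
  into its four terms.  All of them are finite under the conditions in \<open>strong_negative_type\<close>:
  applied to finitely supported measures these make \<open>sqrt k\<close> a metric, whence
  \<open>k x y \<le> 2 * k x z0 + 2 * k y z0\<close>.
\<close>

definition diff_integral :: "(rvec \<Rightarrow> rvec \<Rightarrow> real) \<Rightarrow> rvec measure \<Rightarrow> rvec measure \<Rightarrow> real" where
  "diff_integral k P Q =
     (\<integral>(x, y). k x y \<partial>(P \<Otimes>\<^sub>M P)) - (\<integral>(x, y). k x y \<partial>(P \<Otimes>\<^sub>M Q))
   - (\<integral>(x, y). k x y \<partial>(Q \<Otimes>\<^sub>M P)) + (\<integral>(x, y). k x y \<partial>(Q \<Otimes>\<^sub>M Q))"

definition strong_negative_type :: "nat \<Rightarrow> (rvec \<Rightarrow> rvec \<Rightarrow> real) \<Rightarrow> bool" where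
  "strong_negative_type p k \<longleftrightarrow>
     (\<lambda>(x, y). k x y) \<in> borel_measurable (Rp p \<Otimes>\<^sub>M Rp p) \<and>
     (\<forall>x\<in>space (Rp p). \<forall>y\<in>space (Rp p). 0 \<le> k x y \<and> (k x y = 0 \<longleftrightarrow> x = y)) \<and>
     (\<forall>P Q. borel_prob p P \<and> borel_prob p Q \<and> P \<noteq> Q \<and>
        (\<exists>z\<^sub>0\<in>space (Rp p). integrable P (\<lambda>z. k z z\<^sub>0) \<and> integrable Q (\<lambda>z. k z z\<^sub>0))
        \<longrightarrow> diff_integral k P Q < 0)"

definition is_kernel :: "nat \<Rightarrow> (rvec \<Rightarrow> rvec \<Rightarrow> real) \<Rightarrow> bool" where
  "is_kernel p k \<longleftrightarrow>
     (\<forall>x\<in>space (Rp p). \<forall>y\<in>space (Rp p). k x y = k y x) \<and>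
     (strong_negative_type p k \<or>
      (\<exists>H ip. rkhs (space (Rp p)) H ip (\<lambda>x y. - k x y) \<and> characteristic p H ip))"

text \<open>A sequence of kernels, the p-th one on p-space (p at least 1; index 0 is irrelevant).\<close>

type_synonym kernel_seq = "nat \<Rightarrow> rvec \<Rightarrow> rvec \<Rightarrow> real"


section \<open>Conditions on radial kernels\<close>

text \<open>
  Below, \<open>\<C>\<close> is a set of kernel sequences, and for \<open>k \<in> \<C>\<close> and \<open>p \<ge> 1\<close>, \<open>f k p\<close> is the
  radial profile of \<open>k p\<close>, \<open>D k p\<close> is its domain and \<open>D0 k p\<close> the set of expansion points.
  Derivatives are taken within the domain, hence one-sided at an end point such as 0.
\<close>

definition nth_deriv :: "real set \<Rightarrow> nat \<Rightarrow> (real \<Rightarrow> real) \<Rightarrow> real \<Rightarrow> real" where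
  "nth_deriv D i g = ((\<lambda>h s. vector_derivative h (at s within D)) ^^ i) g"

definition radial_kernels ::
  "kernel_seq set \<Rightarrow> (kernel_seq \<Rightarrow> nat \<Rightarrow> real \<Rightarrow> real) \<Rightarrow> (kernel_seq \<Rightarrow> nat \<Rightarrow> real set) \<Rightarrow> bool"
where
  "radial_kernels \<C> f D \<longleftrightarrow>
     (\<forall>k\<in>\<C>. \<forall>p\<ge>1.
        is_kernel p (k p) \<and>
        is_interval (D k p) \<and> {0..} \<subseteq> D k p \<and>
        (\<forall>i<7. \<forall>s\<in>D k p. nth_deriv (D k p) i (f k p) differentiable (at s within D k p)) \<and>
        (\<forall>x\<in>space (Rp p). \<forall>y\<in>space (Rp p). k p x y = f k p (edist p x y)))"

definition cond_K1 where
  "cond_K1 \<C> f D D0 \<longleftrightarrow>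
     (\<forall>k\<in>(\<C> :: kernel_seq set). \<forall>p\<ge>(1::nat). \<forall>s\<in>D k p. \<forall>s\<^sub>0\<in>D0 k p.
        \<exists>\<xi>\<in>closed_segment s s\<^sub>0.
          f k p s = (\<Sum>i=0..6. 1 / fact i * nth_deriv (D k p) i (f k p) s\<^sub>0 * (s - s\<^sub>0) ^ i)
                    + 1 / fact 7 * nth_deriv (D k p) 7 (f k p) \<xi> * (s - s\<^sub>0) ^ 7)"

definition cond_K2 where
  "cond_K2 \<C> f D D0 \<longleftrightarrow>
     (\<exists>M::real. \<forall>k\<in>(\<C> :: kernel_seq set). \<forall>p\<ge>(1::nat). \<forall>s\<^sub>0\<in>D0 k p. \<forall>i\<in>{1..7}. \<forall>s\<in>D k p.
        \<bar>nth_deriv (D k p) i (f k p) s\<bar> * \<bar>s\<^sub>0 ^ i\<bar> \<le> M * \<bar>f k p s\<^sub>0\<bar>)"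

definition cond_K3 where
  "cond_K3 \<C> f D D0 \<longleftrightarrow>
     (\<exists>M::real. \<forall>k\<in>(\<C> :: kernel_seq set). \<forall>p\<ge>(1::nat). \<forall>s\<^sub>0\<in>D0 k p.
        let d = (\<lambda>i. nth_deriv (D k p) i (f k p) s\<^sub>0) in
        \<bar>f k p s\<^sub>0\<bar> \<le> M * min \<bar>1/2 * d 1 * s\<^sub>0\<bar> \<bar>- 1/8 * d 1 * s\<^sub>0 + 1/8 * d 2 * s\<^sub>0\<^sup>2\<bar>)"

definition cond_K4 where
  "cond_K4 \<C> f D D0 \<longleftrightarrow>
     (\<exists>M::real. \<forall>k\<in>(\<C> :: kernel_seq set). \<forall>p\<ge>(1::nat). \<forall>s\<^sub>0\<in>D0 k p.
        let d = (\<lambda>i. nth_deriv (D k p) i (f k p) s\<^sub>0) in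
        \<bar>f k p s\<^sub>0\<bar> \<le> M * min
          \<bar>1/16 * d 1 * s\<^sub>0 - 1/16 * d 2 * s\<^sub>0\<^sup>2 + 1/48 * d 3 * s\<^sub>0 ^ 3\<bar>
          \<bar>- 5/128 * d 1 * s\<^sub>0 + 5/128 * d 2 * s\<^sub>0\<^sup>2 - 1/64 * d 3 * s\<^sub>0 ^ 3 + 1/384 * d 4 * s\<^sub>0 ^ 4\<bar>)"


section \<open>Moments\<close>

definition mean :: "rvec measure \<Rightarrow> nat \<Rightarrow> real" where
  "mean P j = (\<integral>x. x j \<partial>P)"

definition cov :: "'a measure \<Rightarrow> ('a \<Rightarrow> real) \<Rightarrow> ('a \<Rightarrow> real) \<Rightarrow> real" where
  "cov P g h = (\<integral>x. (g x - (\<integral>y. g y \<partial>P)) * (h x - (\<integral>y. h y \<partial>P)) \<partial>P)"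

definition cov_matrix :: "rvec measure \<Rightarrow> nat \<Rightarrow> nat \<Rightarrow> real" where
  "cov_matrix P i j = cov P (\<lambda>x. x i) (\<lambda>x. x j)"

definition cumulant :: "'a measure \<Rightarrow> ('a \<Rightarrow> real) list \<Rightarrow> real" where
  "cumulant P gs =
     (\<Sum>\<pi> | partition_on {..<length gs} \<pi>.
        (-1) ^ (card \<pi> - 1) * fact (card \<pi> - 1) * (\<Prod>B\<in>\<pi>. \<integral>x. (\<Prod>i\<in>B. (gs ! i) x) \<partial>P))"

definition ctr :: "rvec measure \<Rightarrow> nat \<Rightarrow> rvec \<Rightarrow> real" where
  "ctr P j x = x j - mean P j"

definition ctr_sq :: "rvec measure \<Rightarrow> nat \<Rightarrow> rvec \<Rightarrow> real" where
  "ctr_sq P j x = (ctr P j x)\<^sup>2 - cov_matrix P j j"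

text \<open>\<open>mean_sq_dist p P Q\<close> is the expectation of \<open>|U - V|\<^sup>2\<close> for independent \<open>U ~ P\<close>, \<open>V ~ Q\<close>.\<close>

definition mean_sq_dist :: "nat \<Rightarrow> rvec measure \<Rightarrow> rvec measure \<Rightarrow> real" where
  "mean_sq_dist p P Q = (\<integral>(u, v). (edist p u v)\<^sup>2 \<partial>(P \<Otimes>\<^sub>M Q))"

definition mixture :: "real \<Rightarrow> 'a measure \<Rightarrow> 'a measure \<Rightarrow> 'a measure" where
  "mixture \<rho> P Q = measure_pmf (bernoulli_pmf \<rho>) \<bind> (\<lambda>b. if b then P else Q)"


section \<open>Sampling and distributional conditions\<close>

text \<open>
  \<open>PX p\<close> and \<open>PY p\<close> are the laws of the two random p-vectors; the samples
  \<open>X p 1, X p 2, \<dots>\<close> and \<open>Y p 1, Y p 2, \<dots>\<close> live on the probability space \<open>M p\<close>.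
\<close>

definition two_samples ::
  "(nat \<Rightarrow> 'a measure) \<Rightarrow> (nat \<Rightarrow> rvec measure) \<Rightarrow> (nat \<Rightarrow> rvec measure) \<Rightarrow>
   (nat \<Rightarrow> nat \<Rightarrow> 'a \<Rightarrow> rvec) \<Rightarrow> (nat \<Rightarrow> nat \<Rightarrow> 'a \<Rightarrow> rvec) \<Rightarrow> bool"
where
  "two_samples M PX PY X Y \<longleftrightarrow>
     (\<forall>p\<ge>1. prob_space (M p) \<and>
        (\<forall>i\<ge>1. X p i \<in> M p \<rightarrow>\<^sub>M Rp p \<and> distr (M p) (Rp p) (X p i) = PX p) \<and>
        (\<forall>j\<ge>1. Y p j \<in> M p \<rightarrow>\<^sub>M Rp p \<and> distr (M p) (Rp p) (Y p j) = PY p) \<and>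
        prob_space.indep_vars (M p) (\<lambda>_. Rp p) (case_sum (X p) (Y p)) ({1..} <+> {1..}))"

definition cond_D1 :: "(nat \<Rightarrow> nat) \<Rightarrow> (nat \<Rightarrow> rvec measure) \<Rightarrow> (nat \<Rightarrow> rvec measure) \<Rightarrow> bool" where
  "cond_D1 \<alpha> PX PY \<longleftrightarrow>
     (\<forall>p\<ge>1. 1 \<le> \<alpha> p) \<and>
     (\<lambda>p. real (\<alpha> p)) \<in> o(\<lambda>p. real p) \<and>
     (\<forall>p\<ge>1. \<forall>j l. 1 \<le> j \<and> j + \<alpha> p + 1 \<le> p \<and> \<alpha> p < l \<longrightarrow>
        (\<forall>P\<in>{PX p, PY p}.
           prob_space.indep_var P
             (\<Pi>\<^sub>M i\<in>{1..j}. borel) (\<lambda>x. restrict x {1..j})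
             (\<Pi>\<^sub>M i\<in>{j + l..p}. borel) (\<lambda>x. restrict x {j + l..p})))"

definition cond_D2 :: "(nat \<Rightarrow> rvec measure) \<Rightarrow> (nat \<Rightarrow> rvec measure) \<Rightarrow> bool" where
  "cond_D2 PX PY \<longleftrightarrow>
     (\<exists>U>0. \<forall>p\<ge>1. \<forall>j\<in>{1..p}. \<forall>r\<in>{1..128}. \<forall>P\<in>{PX p, PY p}.
        (\<integral>\<^sup>+x. ennreal (\<bar>x j\<bar> ^ r) \<partial>P) < ennreal U)"

definition cond_D3 :: "(nat \<Rightarrow> rvec measure) \<Rightarrow> (nat \<Rightarrow> rvec measure) \<Rightarrow> bool" where
  "cond_D3 PX PY \<longleftrightarrow>
     (\<exists>L U. 0 < L \<and> 0 < U \<and>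
        (\<forall>p\<ge>1. \<forall>a\<in>{mean_sq_dist p (PX p) (PX p), mean_sq_dist p (PX p) (PY p),
                    mean_sq_dist p (PY p) (PY p)}.
           L * real p \<le> a \<and> a \<le> U * real p))"

definition cond_D4 :: "(nat \<Rightarrow> nat) \<Rightarrow> (nat \<Rightarrow> rvec measure) \<Rightarrow> (nat \<Rightarrow> rvec measure) \<Rightarrow> bool" where
  "cond_D4 \<alpha> PX PY \<longleftrightarrow>
     (\<exists>L U. 0 < L \<and> 0 < U \<and>
        (\<forall>p\<ge>1. \<forall>P\<in>{PX p, PY p}.
           L * real (\<alpha> p) * real p \<le> (frob_norm p (cov_matrix P))\<^sup>2 \<and>
           (frob_norm p (cov_matrix P))\<^sup>2 \<le> U * real (\<alpha> p) * real p))"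


section \<open>The test statistic\<close>

definition energy_stat ::
  "('b \<Rightarrow> 'b \<Rightarrow> real) \<Rightarrow> nat \<Rightarrow> nat \<Rightarrow> (nat \<Rightarrow> 'b) \<Rightarrow> (nat \<Rightarrow> 'b) \<Rightarrow> real"
where
  "energy_stat k n m x y =
     2 / (real n * real m) * (\<Sum>i=1..n. \<Sum>j=1..m. k (x i) (y j))
     - 1 / real (n choose 2) * (\<Sum>i=1..n. \<Sum>j=i+1..n. k (x i) (x j))
     - 1 / real (m choose 2) * (\<Sum>i=1..m. \<Sum>j=i+1..m. k (y i) (y j))"

definition c_nm :: "nat \<Rightarrow> nat \<Rightarrow> real" where
  "c_nm n m = 2 / (real n * (real n - 1)) + 4 / (real n * real m) + 2 / (real m * (real m - 1))"

definition pooled :: "nat \<Rightarrow> (nat \<Rightarrow> 'b) \<Rightarrow> (nat \<Rightarrow> 'b) \<Rightarrow> nat \<Rightarrow> 'b" where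
  "pooled n x y s = (if s \<le> n then x s else y (s - n))"

definition A_star :: "nat \<Rightarrow> (nat \<Rightarrow> nat \<Rightarrow> real) \<Rightarrow> nat \<Rightarrow> nat \<Rightarrow> real" where
  "A_star N a s t =
     a s t
     - 1 / (real N - 2) * (\<Sum>i=1..N. a i t)
     - 1 / (real N - 2) * (\<Sum>j=1..N. a s j)
     + 1 / ((real N - 1) * (real N - 2)) * (\<Sum>i=1..N. \<Sum>j=1..N. a i j)"

text \<open>
  \<open>a\<^sub>0\<close> is the constant value of \<open>k\<close> on the diagonal.  For \<open>N \<ge> 4\<close> the term involving \<open>a\<^sub>0\<close> exactly
  cancels the contribution of the diagonal entries \<open>a s s = a\<^sub>0\<close>, so that \<open>V_star\<close> is nonnegative
  and the square root in \<open>T_stat\<close> is a genuine one.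
\<close>

definition V_star ::
  "('b \<Rightarrow> 'b \<Rightarrow> real) \<Rightarrow> real \<Rightarrow> nat \<Rightarrow> nat \<Rightarrow> (nat \<Rightarrow> 'b) \<Rightarrow> (nat \<Rightarrow> 'b) \<Rightarrow> real"
where
  "V_star k a\<^sub>0 n m x y =
     (let N = n + m; w = pooled n x y; a = (\<lambda>s t. k (w s) (w t)) in
      1 / (real N * (real N - 3)) * (\<Sum>s=1..N. \<Sum>t\<in>{1..N} - {s}. (A_star N a s t)\<^sup>2)
      - a\<^sub>0\<^sup>2 / ((real N - 1) * (real N - 3)))"

definition T_stat ::
  "nat \<Rightarrow> (rvec \<Rightarrow> rvec \<Rightarrow> real) \<Rightarrow> nat \<Rightarrow> nat \<Rightarrow> (nat \<Rightarrow> rvec) \<Rightarrow> (nat \<Rightarrow> rvec) \<Rightarrow> real"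
where
  "T_stat p k n m x y =
     (let o\<^sub>p = (\<lambda>j\<in>{1..p}. 0) in
      energy_stat k n m x y / sqrt (c_nm n m * V_star k (k o\<^sub>p o\<^sub>p) n m x y))"

end

theory Submission imports Defs begin

text \<open>
  The kernel is conditionally negative definite. Applying this to the empirical measure of the
  \<open>X\<close>-sample minus that of the \<open>Y\<close>-sample plus a multiple of a finitely supported signed measure
  \<open>g\<close> of mass zero bounds the energy statistic below by \<open>\<gamma>\<^sup>2\<close>, up to a constant and an
  \<open>O(1/N)\<close> bias, where \<open>\<gamma>\<close> is the difference under the two laws of the mean of the potential
  \<open>\<Sum>\<^sub>l g\<^sub>l k(x, z\<^sub>l)\<close>. The variance estimator is a squared projection of the kernel matrix and is
  bounded by the second moment of the kernel. So it suffices to choose \<open>g\<close> with \<open>\<surd>N \<gamma>\<close> tending to infinity.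

  On points at distance of order \<open>\<surd>p\<close> from the common mean the kernel is a polynomial of degree 4 in
  \<open>L = |x - z|\<^sup>2 / A - 1\<close> up to \<open>O(L\<^sup>5)\<close>, and \<open>E |L|\<^sup>r = O(p\<^bsup>-r/2\<^esup>)\<close> because \<open>L\<close> is a normalised
  sum of weakly dependent terms. Since the laws agree up to second order, the cubic coefficient, which (K4)
  keeps away from zero, decides. If the third-order conditions dominate, points \<open>\<beta> v \<plusminus> \<zeta> e\<^sub>l\<close>
  on one sphere isolate the difference of a single third cumulant, which by the pigeonhole principle can be
  taken of order \<open>p\<^bsup>(\<delta> - 1)/2\<^esup>\<close>, \<open>\<delta> = max \<delta>\<^sub>5 \<delta>\<^sub>6\<close>; this gives \<open>\<gamma>\<close> of order
  \<open>p\<^bsup>\<delta>/2 - 2\<^esup>\<close>. Otherwise points on two spheres detect the difference of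
  \<open>Var |x - E x|\<^sup>2\<close>, with \<open>\<gamma>\<close> of order \<open>p\<^bsup>\<delta>\<^sub>7 - 5/2\<^esup>\<close>. In both cases \<open>\<surd>N \<gamma>\<close> diverges under
  the rate condition.
\<close>

section \<open>Taylor expansion in the squared distance\<close>

text \<open>No limit law of the statistic and no variance of the energy statistic is computed. A
  lower bound for the numerator and an upper bound for the denominator, both sharp only up to
  constants, suffice because their ratio diverges. The random inputs are the empirical version of
  \<gamma> and the average squared radius of the sample; one application of Markov's inequality
  controls both.

  The length of the expansion is dictated by the size of \<gamma>. In the cubic case an error of
  order L^4, that is p^(-2), would be as large as \<gamma> when \<delta> = 0. Hence the quartic term
  is kept, and weak dependence bounds its contribution by p^(-5/2). In the other case
  \<open>\<delta>\<^sub>7\<close> exceeds 1/2 and an error of order p^(-2) is harmless.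

  The obstacle is u = |x - E x|^2 - E |x - E x|^2: its third and fourth moments may differ between
  the laws in an unknown way. The weights have mass zero and the radii are prescribed exactly so
  that these moments cancel.

  As the dimension and the sample sizes grow together, all constants are explicit functions of
  bounds that do not depend on p.\<close>

lemma power_le_of_quadratic:
  fixes h L :: real
  assumes h: "-1 \<le> h" and L: "L = h * (h + 2)" and e: "5 \<le> e" "e \<le> 10"
  shows "\<bar>h\<bar> ^ e \<le> \<bar>L\<bar> ^ 5"
proof -
  have abs_L: "\<bar>L\<bar> = \<bar>h\<bar> * (h + 2)" using h L by (simp add: abs_mult)
  have 1: "\<bar>h\<bar> \<le> \<bar>L\<bar>" using h mult_left_mono[of 1 "h + 2" "\<bar>h\<bar>"] by (simp add: abs_L)
  have 2: "\<bar>h\<bar>\<^sup>2 \<le> \<bar>L\<bar>"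
    using h mult_left_mono[of "\<bar>h\<bar>" "h + 2" "\<bar>h\<bar>"] by (simp add: abs_L power2_eq_square)
  have ee: "10 - e + 2 * (e - 5) = e" using e by arith
  \<comment> \<open>The power splits into 10 - e factors |h| and e - 5 factors h^2, five factors in
    all, each at most |L|. Exponent 5 matters for small h, exponent 10 for large h, where L grows
    like h^2.\<close>
  have "\<bar>h\<bar> ^ e = \<bar>h\<bar> ^ (10 - e) * (\<bar>h\<bar>\<^sup>2) ^ (e - 5)"
    by (simp only: power_mult[symmetric] power_add[symmetric] ee)
  also have "\<dots> \<le> \<bar>L\<bar> ^ (10 - e) * \<bar>L\<bar> ^ (e - 5)"
    by (intro mult_mono power_mono 1 2) auto
  also have "\<dots> = \<bar>L\<bar> ^ 5" using e by (simp flip: power_add)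
  finally show ?thesis .
qed

text \<open>
  With \<open>L = h (h + 2)\<close>, that is \<open>1 + h = sqrt (1 + L)\<close>, a Taylor polynomial in \<open>h\<close> is rewritten as
  one in \<open>L\<close>; the coefficients are those in conditions (K3) and (K4).
\<close>

lemma taylor_in_square:
  fixes h L B g :: real and d :: "nat \<Rightarrow> real"
  assumes h: "-1 \<le> h" and L: "L = h * (h + 2)"
    and d: "\<And>i. i \<in> {1..7} \<Longrightarrow> \<bar>d i\<bar> \<le> B"
    and g: "g = (\<Sum>i=0..6. 1 / fact i * d i * h ^ i) + 1 / fact 7 * d 7 * h ^ 7"
  shows "\<bar>g - (d 0 + (1/2 * d 1) * L + (- 1/8 * d 1 + 1/8 * d 2) * L\<^sup>2
            + (1/16 * d 1 - 1/16 * d 2 + 1/48 * d 3) * L ^ 3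
            + (- 5/128 * d 1 + 5/128 * d 2 - 1/64 * d 3 + 1/384 * d 4) * L ^ 4)\<bar>
         \<le> 8 * B * \<bar>L\<bar> ^ 5"
proof -
  \<comment> \<open>\<open>?c1\<close> is what remains of h = sqrt (1 + L) - 1 after its Taylor
    polynomial of degree 4 in L. Since h^2 / 2 = L / 2 - h, the same remainder with opposite sign
    serves the second-order term. \<open>?c3\<close> and \<open>?c4\<close> belong to h^3 / 6 and
    h^4 / 24. The bounds obtained below add up to less than 8.\<close>
  let ?c1 = "7/8*h^5 + 7/8*h^6 + 5/16*h^7 + 5/128*h^8"
  let ?c3 = "3/8*h^5 + 17/48*h^6 + 1/8*h^7 + 1/64*h^8"
  let ?c4 = "- 1/12*h^5 - 1/16*h^6 - 1/48*h^7 - 1/384*h^8"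
  have p: "\<bar>h ^ e\<bar> \<le> \<bar>L\<bar> ^ 5" if "5 \<le> e" "e \<le> 10" for e
    using power_le_of_quadratic[OF h L that] by (simp add: power_abs)
  have g': "g = d 0 + d 1 * h + d 2 * (h^2/2) + d 3 * (h^3/6) + d 4 * (h^4/24)
        + d 5 * (h^5/120) + d 6 * (h^6/720) + d 7 * (h^7/5040)"
    unfolding g by (simp add: sum.atLeast0_atMost_Suc numeral_eq_Suc algebra_simps)
  have 1: "h - (1/2 * L - 1/8 * L\<^sup>2 + 1/16 * L^3 - 5/128 * L^4) = ?c1"
    unfolding L by (simp add: field_simps power2_eq_square eval_nat_numeral)
  have 2: "h^2/2 - (1/8 * L\<^sup>2 - 1/16 * L^3 + 5/128 * L^4) = - ?c1"
    unfolding L by (simp add: field_simps power2_eq_square eval_nat_numeral)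
  have 3: "h^3/6 - (1/48 * L^3 - 1/64 * L^4) = ?c3"
    unfolding L by (simp add: field_simps power2_eq_square eval_nat_numeral)
  have 4: "h^4/24 - 1/384 * L^4 = ?c4"
    unfolding L by (simp add: field_simps power2_eq_square eval_nat_numeral)
  have "g - (d 0 + (1/2 * d 1) * L + (- 1/8 * d 1 + 1/8 * d 2) * L\<^sup>2
            + (1/16 * d 1 - 1/16 * d 2 + 1/48 * d 3) * L ^ 3
            + (- 5/128 * d 1 + 5/128 * d 2 - 1/64 * d 3 + 1/384 * d 4) * L ^ 4)
      = d 1 * (h - (1/2 * L - 1/8 * L\<^sup>2 + 1/16 * L^3 - 5/128 * L^4))
        + d 2 * (h^2/2 - (1/8 * L\<^sup>2 - 1/16 * L^3 + 5/128 * L^4))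
        + d 3 * (h^3/6 - (1/48 * L^3 - 1/64 * L^4))
        + d 4 * (h^4/24 - 1/384 * L^4)
        + d 5 * (h^5/120) + d 6 * (h^6/720) + d 7 * (h^7/5040)"
    unfolding g' by (simp add: algebra_simps)
  also have "\<dots> = d 1 * ?c1 + d 2 * (- ?c1) + d 3 * ?c3 + d 4 * ?c4
        + d 5 * (h^5/120) + d 6 * (h^6/720) + d 7 * (h^7/5040)"
    unfolding 1 2 3 4 ..
  finally have eq: "g - (d 0 + (1/2 * d 1) * L + (- 1/8 * d 1 + 1/8 * d 2) * L\<^sup>2
            + (1/16 * d 1 - 1/16 * d 2 + 1/48 * d 3) * L ^ 3
            + (- 5/128 * d 1 + 5/128 * d 2 - 1/64 * d 3 + 1/384 * d 4) * L ^ 4)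
     = d 1 * ?c1 + d 2 * (- ?c1) + d 3 * ?c3 + d 4 * ?c4
        + d 5 * (h^5/120) + d 6 * (h^6/720) + d 7 * (h^7/5040)" .
  have L5: "0 \<le> \<bar>L\<bar> ^ 5" by simp
  have B: "0 \<le> B" using d[of 1] by simp
  have bd: "\<bar>d i * c\<bar> \<le> B * (q * \<bar>L\<bar> ^ 5)" if "i \<in> {1..7}" "\<bar>c\<bar> \<le> q * \<bar>L\<bar> ^ 5" for i c q
    unfolding abs_mult using d[OF that(1)] that(2) B by (intro mult_mono) auto
  have p5678: "h ^ e \<le> \<bar>L\<bar> ^ 5 \<and> - (h ^ e) \<le> \<bar>L\<bar> ^ 5" if "e \<in> {5, 6, 7, 8}" for e
    using p[of e] that by (auto simp: abs_le_iff)
  note p5678 = p5678[of 5, simplified] p5678[of 6, simplified] p5678[of 7, simplified] p5678[of 8, simplified]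
  have c1: "\<bar>?c1\<bar> \<le> 5/2 * \<bar>L\<bar> ^ 5" using p5678 L5 by (intro abs_leI; linarith)
  have c1': "\<bar>- ?c1\<bar> \<le> 5/2 * \<bar>L\<bar> ^ 5" using c1 by (simp only: abs_minus_cancel)
  have c3: "\<bar>?c3\<bar> \<le> 1 * \<bar>L\<bar> ^ 5" using p5678 L5 by (intro abs_leI; linarith)
  have c4: "\<bar>?c4\<bar> \<le> 1/4 * \<bar>L\<bar> ^ 5" using p5678 L5 by (intro abs_leI; linarith)
  have c5: "\<bar>h^5/120\<bar> \<le> 1/120 * \<bar>L\<bar> ^ 5" "\<bar>h^6/720\<bar> \<le> 1/720 * \<bar>L\<bar> ^ 5"
    "\<bar>h^7/5040\<bar> \<le> 1/5040 * \<bar>L\<bar> ^ 5" using p5678 L5 by (intro abs_leI; linarith)+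
  have "\<bar>d 1 * ?c1 + d 2 * (- ?c1) + d 3 * ?c3 + d 4 * ?c4
        + d 5 * (h^5/120) + d 6 * (h^6/720) + d 7 * (h^7/5040)\<bar>
      \<le> B * (5/2 * \<bar>L\<bar> ^ 5) + B * (5/2 * \<bar>L\<bar> ^ 5) + B * (1 * \<bar>L\<bar> ^ 5) + B * (1/4 * \<bar>L\<bar> ^ 5)
        + B * (1/120 * \<bar>L\<bar> ^ 5) + B * (1/720 * \<bar>L\<bar> ^ 5) + B * (1/5040 * \<bar>L\<bar> ^ 5)"
    by (intro order_trans[OF abs_triangle_ineq] add_mono bd c1 c1' c3 c4 c5) auto
  also have "\<dots> \<le> 8 * B * \<bar>L\<bar> ^ 5"
    using mult_nonneg_nonneg[OF B L5] by (simp add: algebra_simps)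
  finally show ?thesis unfolding eq .
qed

section \<open>Double sums over pairs of indices\<close>

lemma sum_upper_triangle:
  fixes g :: "nat \<Rightarrow> nat \<Rightarrow> real"
  assumes "\<And>i j. g i j = g j i"
  shows "(\<Sum>i=1..n. \<Sum>j=1..n. g i j) = 2 * (\<Sum>i=1..n. \<Sum>j=i+1..n. g i j) + (\<Sum>i=1..n. g i i)"
proof (induction n)
  case (Suc n)
  have 1: "(\<Sum>i=1..Suc n. \<Sum>j=1..Suc n. g i j)
      = (\<Sum>i=1..n. \<Sum>j=1..n. g i j) + 2 * (\<Sum>i=1..n. g i (Suc n)) + g (Suc n) (Suc n)"
    using assms by (simp add: sum.distrib)
  have 2: "(\<Sum>i=1..Suc n. \<Sum>j=i+1..Suc n. g i j)
      = (\<Sum>i=1..n. \<Sum>j=i+1..n. g i j) + (\<Sum>i=1..n. g i (Suc n))"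
    by (simp add: sum.distrib)
  show ?case unfolding 1 2 using Suc.IH by simp
qed simp

lemma sum_off_diagonal:
  fixes g :: "nat \<Rightarrow> nat \<Rightarrow> real"
  shows "(\<Sum>s=1..N. \<Sum>t\<in>{1..N} - {s}. g s t) = (\<Sum>s=1..N. \<Sum>t=1..N. if s = t then 0 else g s t)"
proof (rule sum.cong)
  fix s assume s: "s \<in> {1..N}"
  have "(\<Sum>t=1..N. if s = t then 0 else g s t)
      = (\<Sum>t\<in>{1..N} - {s}. if s = t then 0 else g s t)"
    by (rule sum.mono_neutral_right) auto
  also have "\<dots> = (\<Sum>t\<in>{1..N} - {s}. g s t)" by (intro sum.cong) auto
  finally show "(\<Sum>t\<in>{1..N} - {s}. g s t) = (\<Sum>t=1..N. if s = t then 0 else g s t)" ..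
qed simp

section \<open>The variance estimator and the energy statistic\<close>

lemma A_star_linear:
  "A_star N (\<lambda>s t. x * a s t + y * b s t) s t = x * A_star N a s t + y * A_star N b s t"
  unfolding A_star_def
  by (simp add: sum.distrib sum_distrib_left[symmetric] algebra_simps add_divide_distrib)

text \<open>
  The U-centering \<open>B\<close> of a matrix \<open>b\<close> with zero diagonal has zero off-diagonal row sums, so it is
  the orthogonal projection of \<open>b\<close> onto the complement of the matrices \<open>r s + r t\<close>.
\<close>

locale u_centering =
  fixes N :: nat and b :: "nat \<Rightarrow> nat \<Rightarrow> real"
  assumes N: "4 \<le> N" and sym: "\<And>s t. b s t = b t s" and diag: "\<And>s. b s s = 0"
begin

definition "R s = (\<Sum>t=1..N. b s t)"
definition "S = (\<Sum>s=1..N. R s)"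
text \<open>The grand mean in \<open>A_star\<close> is shared equally between row and column, so
  that the whole correction takes the form r s + r t with a single function r.\<close>

definition "r s = R s / (real N - 2) - S / (2 * ((real N - 1) * (real N - 2)))"
definition "B s t = (if s = t then 0 else b s t - r s - r t)"

lemma col: "(\<Sum>i=1..N. b i t) = R t"
  unfolding R_def using sym by (intro sum.cong) auto

lemma A_star_eq: "s \<noteq> t \<Longrightarrow> A_star N b s t = B s t"
proof -
  assume "s \<noteq> t"
  moreover have "S / ((real N - 1) * (real N - 2)) = 2 * (S / (2 * ((real N - 1) * (real N - 2))))"
    by simp
  ultimately show ?thesis
    unfolding A_star_def col B_def r_def
    by (simp add: R_def[symmetric] S_def[symmetric] del: One_nat_def)
qed

lemma B_sym: "B s t = B t s"
  unfolding B_def using sym by auto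

lemma sum_r: "(\<Sum>t=1..N. r t) = S / (2 * (real N - 1))"
proof -
  have "(\<Sum>t=1..N. r t) = S / (real N - 2) - real N * (S / (2 * ((real N - 1) * (real N - 2))))"
    unfolding r_def by (simp add: sum_subtractf S_def sum_divide_distrib)
  also have "\<dots> = S / (2 * (real N - 1))"
  proof -
    have "real N - 2 \<noteq> 0" "real N - 1 \<noteq> 0" using N by auto
    then show ?thesis by (simp add: divide_simps) (simp add: algebra_simps)
  qed
  finally show ?thesis .
qed

text \<open>Summing b s t - r s - r t over all t includes a spurious diagonal entry -2 (r s), which
  must be added back. This leaves N - 2 copies of r s and explains the divisor N - 2 in the
  centering.\<close>

lemma row_B: assumes s: "s \<in> {1..N}" shows "(\<Sum>t=1..N. B s t) = 0"
proof -
  have nz: "real N - 2 \<noteq> 0" "real N - 1 \<noteq> 0" using N by auto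
  have "(\<Sum>t=1..N. B s t) = (\<Sum>t=1..N. b s t - r s - r t + (if s = t then 2 * r s else 0))"
    unfolding B_def by (intro sum.cong) (auto simp: diag)
  also have "\<dots> = R s - real N * r s - S / (2 * (real N - 1)) + 2 * r s"
    using s sum_r by (simp add: sum.distrib sum_subtractf R_def)
  also have "\<dots> = R s - (real N - 2) * r s - S / (2 * (real N - 1))" by (simp add: algebra_simps)
  also have "(real N - 2) * r s = R s - S / (2 * (real N - 1))"
    unfolding r_def using nz by (simp add: divide_simps)
  finally show ?thesis by simp
qed

lemma B_orthogonal: "(\<Sum>s=1..N. \<Sum>t=1..N. B s t * (q s + q t)) = 0"
proof -
  have 1: "(\<Sum>s=1..N. \<Sum>t=1..N. B s t * q s) = 0"
    using row_B by (simp add: sum_distrib_right[symmetric])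
  have 2: "(\<Sum>s=1..N. \<Sum>t=1..N. B s t * q t) = 0"
    using 1 by (subst sum.swap) (simp add: B_sym)
  show ?thesis using 1 2 by (simp add: distrib_left sum.distrib)
qed

lemma B_sq_le: "(\<Sum>s=1..N. \<Sum>t=1..N. (B s t)\<^sup>2) \<le> (\<Sum>s=1..N. \<Sum>t=1..N. (b s t)\<^sup>2)"
proof -
  have "(\<Sum>s=1..N. \<Sum>t=1..N. B s t * b s t) - (\<Sum>s=1..N. \<Sum>t=1..N. (B s t)\<^sup>2)
      = (\<Sum>s=1..N. \<Sum>t=1..N. B s t * (r s + r t))"
    unfolding sum_subtractf[symmetric]
    by (intro sum.cong refl) (auto simp: B_def power2_eq_square algebra_simps)
  then have eq: "(\<Sum>s=1..N. \<Sum>t=1..N. B s t * b s t) = (\<Sum>s=1..N. \<Sum>t=1..N. (B s t)\<^sup>2)"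
    using B_orthogonal[of r] by linarith
  have "0 \<le> (\<Sum>s=1..N. \<Sum>t=1..N. (b s t - B s t)\<^sup>2)" by (intro sum_nonneg) auto
  also have "\<dots> = (\<Sum>s=1..N. \<Sum>t=1..N. (b s t)\<^sup>2) - 2 * (\<Sum>s=1..N. \<Sum>t=1..N. B s t * b s t)
      + (\<Sum>s=1..N. \<Sum>t=1..N. (B s t)\<^sup>2)"
    by (simp add: power2_diff sum.distrib sum_subtractf sum_distrib_left mult_ac)
  finally show ?thesis using eq by simp
qed

text \<open>A constant shift is orthogonal to \<open>B\<close> because the rows of \<open>B\<close>
  sum to zero. With e = a0 / (N - 1) the extra term is exactly what the correction in
  \<open>V_star\<close> subtracts.\<close>

lemma shifted_sq:
  "(\<Sum>s=1..N. \<Sum>t\<in>{1..N} - {s}. (B s t - e)\<^sup>2)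
     = (\<Sum>s=1..N. \<Sum>t=1..N. (B s t)\<^sup>2) + real N * (real N - 1) * e\<^sup>2"
proof -
  have "(\<Sum>s=1..N. \<Sum>t\<in>{1..N} - {s}. (B s t - e)\<^sup>2)
      = (\<Sum>s=1..N. \<Sum>t=1..N. (B s t)\<^sup>2 - 2 * e * B s t + e\<^sup>2 - (if s = t then e\<^sup>2 else 0))"
    unfolding sum_off_diagonal
    by (intro sum.cong refl) (auto simp: B_def power2_diff)
  also have "\<dots> = (\<Sum>s=1..N. \<Sum>t=1..N. (B s t)\<^sup>2) + real N * (real N * e\<^sup>2) - real N * e\<^sup>2"
    by (simp add: sum.distrib sum_subtractf row_B sum_distrib_left[symmetric] del: One_nat_def)
  finally show ?thesis by (simp add: algebra_simps)
qed

end

section \<open>The centred kernel matrix of a pooled sample\<close>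

locale two_sample_values =
  fixes k :: "'b \<Rightarrow> 'b \<Rightarrow> real" and a0 c :: real and n m :: nat and x y :: "nat \<Rightarrow> 'b"
  assumes nm: "2 \<le> n" "2 \<le> m"
    and k_sym: "\<And>s t. k (pooled n x y s) (pooled n x y t) = k (pooled n x y t) (pooled n x y s)"
    and k_diag: "\<And>s. k (pooled n x y s) (pooled n x y s) = a0"
begin

abbreviation "N \<equiv> n + m"
text \<open>The constant \<open>c\<close> is free: off the diagonal it equals c/2 + c/2, a matrix of
  the kind that centering removes, so the estimator does not see it. It is later taken to be f(sqrt
  A), around which the kernel values concentrate.\<close>

definition "b s t = (if s = t then 0 else k (pooled n x y s) (pooled n x y t) - c)"

sublocale u_centering N b
  using nm k_sym by unfold_locales (auto simp: b_def)

text \<open>The kernel matrix is \<open>b\<close> plus c times the all-ones matrix plus (a0 - c)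
  times the identity. Off the diagonal both of these matrices are centred to -1 / (N - 1), so
  \<open>c\<close> drops out.\<close>

lemma A_star_pooled:
  assumes "s \<noteq> t" "s \<in> {1..N}" "t \<in> {1..N}"
  shows "A_star N (\<lambda>s t. k (pooled n x y s) (pooled n x y t)) s t = B s t - a0 / (real N - 1)"
proof -
  have nz: "real N - 2 \<noteq> 0" "real N - 1 \<noteq> 0" using N by auto
  let ?E = "\<lambda>s t :: nat. if s = t then 1 else 0 :: real"
  have rows: "(\<Sum>i=1..N. ?E i t) = 1" "(\<Sum>j=1..N. ?E s j) = 1" "(\<Sum>i=1..N. \<Sum>j=1..N. ?E i j) = real N"
    using assms by simp_all
  have E: "A_star N ?E s t = - 1 / (real N - 1)"
    unfolding A_star_def rows using nz assms(1)
    by (simp add: divide_simps)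
  have C: "A_star N (\<lambda>_ _. 1) s t = - 1 / (real N - 1)"
    unfolding A_star_def using nz assms(1)
    by (simp add: divide_simps) (simp add: algebra_simps)
  have "(\<lambda>s t. k (pooled n x y s) (pooled n x y t))
      = (\<lambda>s t. 1 * b s t + 1 * (c * 1 + (a0 - c) * ?E s t))"
    using k_diag by (auto simp: b_def fun_eq_iff)
  then have "A_star N (\<lambda>s t. k (pooled n x y s) (pooled n x y t)) s t
      = 1 * A_star N b s t + 1 * (c * A_star N (\<lambda>_ _. 1) s t + (a0 - c) * A_star N ?E s t)"
    by (simp only: A_star_linear)
  then show ?thesis using A_star_eq[OF assms(1)] E C by (simp add: algebra_simps add_divide_distrib)
qed

lemma V_star_eq: "V_star k a0 n m x y = 1 / (real N * (real N - 3)) * (\<Sum>s=1..N. \<Sum>t=1..N. (B s t)\<^sup>2)"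
proof -
  have nz: "real N - 3 \<noteq> 0" "real N - 1 \<noteq> 0" "real N \<noteq> 0" using N by auto
  have "(\<Sum>s=1..N. \<Sum>t\<in>{1..N} - {s}. (A_star N (\<lambda>s t. k (pooled n x y s) (pooled n x y t)) s t)\<^sup>2)
      = (\<Sum>s=1..N. \<Sum>t\<in>{1..N} - {s}. (B s t - a0 / (real N - 1))\<^sup>2)"
    by (intro sum.cong refl arg_cong2[of _ _ _ _ "(^)"] A_star_pooled) auto
  also have "\<dots> = (\<Sum>s=1..N. \<Sum>t=1..N. (B s t)\<^sup>2) + real N * (real N - 1) * (a0 / (real N - 1))\<^sup>2"
    by (rule shifted_sq)
  finally have "V_star k a0 n m x y
    = 1 / (real N * (real N - 3)) * ((\<Sum>s=1..N. \<Sum>t=1..N. (B s t)\<^sup>2) + real N * (real N - 1) * (a0 / (real N - 1))\<^sup>2)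
      - a0\<^sup>2 / ((real N - 1) * (real N - 3))"
    unfolding V_star_def Let_def by simp
  also have "\<dots> = 1 / (real N * (real N - 3)) * (\<Sum>s=1..N. \<Sum>t=1..N. (B s t)\<^sup>2)"
    using nz by (simp add: distrib_left power2_eq_square)
  finally show ?thesis .
qed

lemma V_star_nonneg: "0 \<le> V_star k a0 n m x y"
  unfolding V_star_eq using N by (intro mult_nonneg_nonneg sum_nonneg) auto

lemma V_star_le:
  "V_star k a0 n m x y
     \<le> 1 / (real N * (real N - 3)) * (\<Sum>s=1..N. \<Sum>t=1..N. (k (pooled n x y s) (pooled n x y t) - c)\<^sup>2)"
proof -
  have "(\<Sum>s=1..N. \<Sum>t=1..N. (b s t)\<^sup>2) \<le> (\<Sum>s=1..N. \<Sum>t=1..N. (k (pooled n x y s) (pooled n x y t) - c)\<^sup>2)"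
    by (intro sum_mono) (auto simp: b_def)
  then show ?thesis unfolding V_star_eq using N B_sq_le
    by (intro mult_left_mono) auto
qed

text \<open>Division by zero gives 0, so a vanishing denominator would spoil a large numerator. A
  zero estimator forces the kernel values off the diagonal to be additive, q s + q t, and the energy
  statistic annihilates additive kernels.\<close>

lemma V_star_pos:
  assumes "energy_stat k n m x y \<noteq> 0"
  shows "0 < V_star k a0 n m x y"
proof (rule ccontr)
  assume "\<not> 0 < V_star k a0 n m x y"
  then have "V_star k a0 n m x y = 0" using V_star_nonneg by simp
  then have "(\<Sum>s=1..N. \<Sum>t=1..N. (B s t)\<^sup>2) = 0" unfolding V_star_eq using N by auto
  then have "\<forall>s\<in>{1..N}. \<forall>t\<in>{1..N}. (B s t)\<^sup>2 = 0"
    by (simp add: sum_nonneg_eq_0_iff sum_nonneg)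
  then have k: "k (pooled n x y s) (pooled n x y t) = (c/2 + r s) + (c/2 + r t)"
    if "s \<in> {1..N}" "t \<in> {1..N}" "s \<noteq> t" for s t
    using that by (fastforce simp: B_def b_def)
  define q where "q s = c/2 + r s" for s
  have kx: "k (x i) (x j) = q i + q j" if "i \<in> {1..n}" "j \<in> {1..n}" "i \<noteq> j" for i j
    using k[of i j] that by (auto simp: pooled_def q_def)
  have ky: "k (y i) (y j) = q (n+i) + q (n+j)" if "i \<in> {1..m}" "j \<in> {1..m}" "i \<noteq> j" for i j
    using k[of "n+i" "n+j"] that by (auto simp: pooled_def q_def)
  have kxy: "k (x i) (y j) = q i + q (n+j)" if "i \<in> {1..n}" "j \<in> {1..m}" for i j
    using k[of i "n+j"] that by (auto simp: pooled_def q_def)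
  have tri: "(\<Sum>i=1..N. \<Sum>j=i+1..N. h i + h j) = (real N - 1) * (\<Sum>i=1..N. h i)"
    for N and h :: "nat \<Rightarrow> real"
  proof -
    have "(\<Sum>i=1..N. \<Sum>j=1..N. h i + h j) = 2 * (\<Sum>i=1..N. \<Sum>j=i+1..N. h i + h j) + (\<Sum>i=1..N. h i + h i)"
      by (rule sum_upper_triangle) simp
    moreover have "(\<Sum>i=1..N. \<Sum>j=1..N. h i + h j) = 2 * (real N * (\<Sum>i=1..N. h i))"
      by (simp add: sum.distrib sum_distrib_left mult_ac)
    moreover have "(\<Sum>i=1..N. h i + h i) = 2 * (\<Sum>i=1..N. h i)"
      by (simp add: sum_distrib_left)
    moreover have "(real N - 1) * (\<Sum>i=1..N. h i) = real N * (\<Sum>i=1..N. h i) - (\<Sum>i=1..N. h i)"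
      by (simp add: algebra_simps)
    ultimately show ?thesis by linarith
  qed
  have ch: "1 / real (N choose 2) = 2 / (real N * (real N - 1))" if "N \<ge> 2" for N
    using that by (simp add: choose_two of_nat_diff real_of_nat_div)
  have X: "(\<Sum>i=1..n. \<Sum>j=i+1..n. k (x i) (x j)) = (real n - 1) * (\<Sum>i=1..n. q i)"
  proof -
    have "(\<Sum>i=1..n. \<Sum>j=i+1..n. k (x i) (x j)) = (\<Sum>i=1..n. \<Sum>j=i+1..n. q i + q j)"
      by (intro sum.cong refl kx) auto
    with tri[where N = n and h = q] show ?thesis by simp
  qed
  have Y: "(\<Sum>i=1..m. \<Sum>j=i+1..m. k (y i) (y j)) = (real m - 1) * (\<Sum>i=1..m. q (n+i))"
  proof -
    have "(\<Sum>i=1..m. \<Sum>j=i+1..m. k (y i) (y j)) = (\<Sum>i=1..m. \<Sum>j=i+1..m. q (n+i) + q (n+j))"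
      by (intro sum.cong refl ky) auto
    with tri[where N = m and h = "\<lambda>i. q (n+i)"] show ?thesis by simp
  qed
  have XY: "(\<Sum>i=1..n. \<Sum>j=1..m. k (x i) (y j)) = real m * (\<Sum>i=1..n. q i) + real n * (\<Sum>j=1..m. q (n+j))"
  proof -
    have "(\<Sum>i=1..n. \<Sum>j=1..m. k (x i) (y j)) = (\<Sum>i=1..n. \<Sum>j=1..m. q i + q (n+j))"
      by (intro sum.cong refl kxy) auto
    then show ?thesis by (simp add: sum.distrib sum_distrib_left)
  qed
  have "real n - 1 \<noteq> 0" "real m - 1 \<noteq> 0" "real n \<noteq> 0" "real m \<noteq> 0" using nm by auto
  then have "energy_stat k n m x y = 0"
    unfolding energy_stat_def X Y XY ch[OF nm(1)] ch[OF nm(2)] by (simp add: field_simps)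
  with assms show False by simp
qed

end

text \<open>
  Conditional negative definiteness applied to the empirical signed measure plus a multiple of a
  test measure \<open>g\<close> on finitely many points; the bias terms stem from the diagonal.
\<close>

lemma energy_stat_lower:
  fixes k :: "'b \<Rightarrow> 'b \<Rightarrow> real" and g :: "'l \<Rightarrow> real" and z :: "'l \<Rightarrow> 'b" and J :: "'l set"
  defines "G \<equiv> \<lambda>u. \<Sum>l\<in>J. g l * k u (z l)"
  assumes cnd: "\<And>(w :: nat + nat + 'l \<Rightarrow> real) pts I. finite I \<Longrightarrow> (\<Sum>i\<in>I. w i) = 0 \<Longrightarrow> pts ` I \<subseteq> Sp \<Longrightarrow>
      (\<Sum>i\<in>I. \<Sum>j\<in>I. w i * w j * k (pts i) (pts j)) \<le> 0"
    and Sp: "\<And>i. x i \<in> Sp" "\<And>i. y i \<in> Sp" "\<And>l. l \<in> J \<Longrightarrow> z l \<in> Sp"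
    and sym: "\<And>u v. u \<in> Sp \<Longrightarrow> v \<in> Sp \<Longrightarrow> k u v = k v u"
    and diag: "\<And>u. u \<in> Sp \<Longrightarrow> k u u = a0"
    and J: "finite J" "(\<Sum>l\<in>J. g l) = 0"
    and nm: "2 \<le> n" "2 \<le> m"
    and B: "0 < B" "- (\<Sum>l\<in>J. \<Sum>l'\<in>J. g l * g l' * k (z l) (z l')) \<le> B"
  shows "energy_stat k n m x y \<ge>
      ((1 / real n) * (\<Sum>i=1..n. G (x i)) - (1 / real m) * (\<Sum>j=1..m. G (y j)))\<^sup>2 / B
      - ((\<Sum>i=1..n. \<Sum>j=1..n. k (x i) (x j)) / (real n)\<^sup>2 - a0) / (real n - 1)
      - ((\<Sum>i=1..m. \<Sum>j=1..m. k (y i) (y j)) / (real m)\<^sup>2 - a0) / (real m - 1)"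
proof -
  define SX where "SX = (\<Sum>i=1..n. \<Sum>j=1..n. k (x i) (x j))"
  define SY where "SY = (\<Sum>i=1..m. \<Sum>j=1..m. k (y i) (y j))"
  define SXY where "SXY = (\<Sum>i=1..n. \<Sum>j=1..m. k (x i) (y j))"
  define GX where "GX = (\<Sum>i=1..n. G (x i))"
  define GY where "GY = (\<Sum>j=1..m. G (y j))"
  define Q where "Q = (\<Sum>l\<in>J. \<Sum>l'\<in>J. g l * g l' * k (z l) (z l'))"
  have nz: "real n \<noteq> 0" "real m \<noteq> 0" "real n - 1 \<noteq> 0" "real m - 1 \<noteq> 0" using nm by auto
  have quad: "SX / (real n)\<^sup>2 - 2 / (real n * real m) * SXY + SY / (real m)\<^sup>2
      + 2 * t * ((1 / real n) * GX - (1 / real m) * GY) + t\<^sup>2 * Q \<le> 0" for t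
  proof -
    define w :: "nat + nat + 'l \<Rightarrow> real" where
      "w = case_sum (\<lambda>_. 1 / real n) (case_sum (\<lambda>_. - 1 / real m) (\<lambda>l. t * g l))"
    define pts where "pts = case_sum x (case_sum y z)"
    let ?I = "{1..n} <+> {1..m} <+> J"
    have sP: "(\<Sum>i\<in>?I. h i) = (\<Sum>i=1..n. h (Inl i)) + ((\<Sum>j=1..m. h (Inr (Inl j))) + (\<Sum>l\<in>J. h (Inr (Inr l))))"
      for h :: "nat + nat + 'l \<Rightarrow> real"
      using J by (simp add: sum.Plus)
    have "(\<Sum>i\<in>?I. \<Sum>j\<in>?I. w i * w j * k (pts i) (pts j)) \<le> 0"
    proof (rule cnd)
      show "finite ?I" using J by simp
      show "(\<Sum>i\<in>?I. w i) = 0" unfolding sP using J nz by (simp add: w_def sum_distrib_left[symmetric])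
      show "pts ` ?I \<subseteq> Sp" using Sp by (auto simp: pts_def)
    qed
    also have "(\<Sum>i\<in>?I. \<Sum>j\<in>?I. w i * w j * k (pts i) (pts j))
      = (SX / (real n)\<^sup>2 - SXY / (real n * real m) + t * GX / real n)
      + (- (\<Sum>j=1..m. \<Sum>i=1..n. k (y j) (x i)) / (real n * real m) + SY / (real m)\<^sup>2 - t * GY / real m)
      + (t * (\<Sum>l\<in>J. \<Sum>i=1..n. g l * k (z l) (x i)) / real n
         - t * (\<Sum>l\<in>J. \<Sum>i=1..m. g l * k (z l) (y i)) / real m + t\<^sup>2 * Q)"
      unfolding sP
      by (simp add: w_def pts_def SX_def SY_def SXY_def GX_def GY_def G_def Q_def sum.distrib
          sum_distrib_left sum_divide_distrib sum_negf power2_eq_square mult_ac sum_subtractf algebra_simps)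
    also have "(\<Sum>j=1..m. \<Sum>i=1..n. k (y j) (x i)) = SXY"
      unfolding SXY_def by (subst sum.swap) (intro sum.cong refl sym Sp)
    also have "(\<Sum>l\<in>J. \<Sum>i=1..n. g l * k (z l) (x i)) = GX"
      unfolding GX_def G_def by (subst sum.swap) (intro sum.cong refl arg_cong2[of _ _ _ _ "(*)"] sym Sp)
    also have "(\<Sum>l\<in>J. \<Sum>i=1..m. g l * k (z l) (y i)) = GY"
      unfolding GY_def G_def by (subst sum.swap) (intro sum.cong refl arg_cong2[of _ _ _ _ "(*)"] sym Sp)
    finally show ?thesis by (simp add: algebra_simps)
  qed
  define Gt where "Gt = (1 / real n) * GX - (1 / real m) * GY"
  have main: "2 / (real n * real m) * SXY - SX / (real n)\<^sup>2 - SY / (real m)\<^sup>2 \<ge> Gt\<^sup>2 / B"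
  proof -
    \<comment> \<open>The inequality holds for every multiple t of the test measure; t =
      \<open>Gt / B\<close> maximises 2 t Gt - B t^2.\<close>
    have "2 * (Gt / B) * Gt + (Gt / B)\<^sup>2 * Q \<le> 2 / (real n * real m) * SXY - SX / (real n)\<^sup>2 - SY / (real m)\<^sup>2"
      using quad[of "Gt / B"] unfolding Gt_def by linarith
    moreover have "(Gt / B)\<^sup>2 * Q \<ge> (Gt / B)\<^sup>2 * (- B)"
      using B by (intro mult_left_mono) (auto simp: Q_def)
    moreover have "(Gt / B)\<^sup>2 * (- B) = - (Gt\<^sup>2 / B)" "2 * (Gt / B) * Gt = 2 * (Gt\<^sup>2 / B)"
      using B by (simp_all add: power2_eq_square)
    ultimately show ?thesis by linarith
  qed
  have ch: "1 / real (N choose 2) = 2 / (real N * (real N - 1))" if "N \<ge> 2" for N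
    using that by (simp add: choose_two of_nat_diff real_of_nat_div)
  have tx: "1 / real (n choose 2) * (\<Sum>i=1..n. \<Sum>j=i+1..n. k (x i) (x j)) = (SX - real n * a0) / (real n * (real n - 1))"
  proof -
    have "SX = 2 * (\<Sum>i=1..n. \<Sum>j=i+1..n. k (x i) (x j)) + real n * a0"
      unfolding SX_def using sum_upper_triangle[of "\<lambda>i j. k (x i) (x j)" n] sym diag Sp by simp
    then show ?thesis using ch nm by simp
  qed
  have ty: "1 / real (m choose 2) * (\<Sum>i=1..m. \<Sum>j=i+1..m. k (y i) (y j)) = (SY - real m * a0) / (real m * (real m - 1))"
  proof -
    have "SY = 2 * (\<Sum>i=1..m. \<Sum>j=i+1..m. k (y i) (y j)) + real m * a0"
      unfolding SY_def using sum_upper_triangle[of "\<lambda>i j. k (y i) (y j)" m] sym diag Sp by simp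
    then show ?thesis using ch nm by simp
  qed
  \<comment> \<open>Passage from the mean over distinct pairs to the mean over all pairs, which is
    the form conditional negative definiteness speaks about. The correction has order 1/N.\<close>
  have bias: "(T - real N * a0) / (real N * (real N - 1)) = T / (real N)\<^sup>2 + (T / (real N)\<^sup>2 - a0) / (real N - 1)"
    if "2 \<le> N" for T N
  proof -
    have "real N \<noteq> 0" "real N - 1 \<noteq> 0" using that by auto
    then show ?thesis by (simp add: divide_simps power2_eq_square) (simp add: algebra_simps)
  qed
  have "energy_stat k n m x y = 2 / (real n * real m) * SXY - SX / (real n)\<^sup>2 - SY / (real m)\<^sup>2
      - (SX / (real n)\<^sup>2 - a0) / (real n - 1) - (SY / (real m)\<^sup>2 - a0) / (real m - 1)"
    unfolding energy_stat_def tx ty bias[OF nm(1)] bias[OF nm(2)] SXY_def by simp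
  then show ?thesis using main unfolding Gt_def GX_def GY_def SX_def SY_def by simp
qed

section \<open>Conditional negative definiteness of kernels\<close>

text \<open>The masses are placed on the index set and then transported, so that the points
  \<open>pts i\<close> need not be distinct.\<close>

definition weighted_points :: "'i set \<Rightarrow> ('i \<Rightarrow> real) \<Rightarrow> 'b measure \<Rightarrow> ('i \<Rightarrow> 'b) \<Rightarrow> 'b measure" where
  "weighted_points I w S pts = distr (density (count_space I) (\<lambda>i. ennreal (w i))) S pts"

lemma weighted_points:
  fixes w :: "'i \<Rightarrow> real"
  assumes I: "finite I" and w: "\<And>i. 0 \<le> w i" "(\<Sum>i\<in>I. w i) = 1" and pts: "pts ` I \<subseteq> space S"
  shows prob_space_weighted_points: "prob_space (weighted_points I w S pts)"
    and sets_weighted_points: "sets (weighted_points I w S pts) = sets S"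
    and integrable_weighted_points: "(h :: 'b \<Rightarrow> real) \<in> borel_measurable S \<Longrightarrow> integrable (weighted_points I w S pts) h"
proof -
  let ?D = "density (count_space I) (\<lambda>i. ennreal (w i))"
  have "emeasure ?D (space ?D) = (\<Sum>i\<in>I. ennreal (w i))"
    by (simp add: emeasure_density nn_integral_count_space_finite I)
  then have "emeasure ?D (space ?D) = 1"
    using w by (simp add: sum_ennreal)
  then interpret D: prob_space ?D by (rule prob_spaceI)
  have m: "pts \<in> ?D \<rightarrow>\<^sub>M S" using pts by auto
  show "prob_space (weighted_points I w S pts)"
    unfolding weighted_points_def by (rule D.prob_space_distr[OF m])
  show "sets (weighted_points I w S pts) = sets S" by (simp add: weighted_points_def)
  assume h: "(h :: 'b \<Rightarrow> real) \<in> borel_measurable S"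
  show "integrable (weighted_points I w S pts) h"
    unfolding weighted_points_def integrable_distr_eq[OF m h] using w I
    by (subst integrable_density) (auto intro!: integrable_count_space)
qed

lemma integral_weighted_points_pair:
  fixes w v :: "'i \<Rightarrow> real" and k :: "'b \<Rightarrow> 'b \<Rightarrow> real"
  assumes I: "finite I" and w: "\<And>i. 0 \<le> w i" "(\<Sum>i\<in>I. w i) = 1"
    and v: "\<And>i. 0 \<le> v i" "(\<Sum>i\<in>I. v i) = 1"
    and pts: "pts ` I \<subseteq> space S" and k: "(\<lambda>(x, y). k x y) \<in> borel_measurable (S \<Otimes>\<^sub>M S)"
  shows "(\<integral>(x, y). k x y \<partial>(weighted_points I w S pts \<Otimes>\<^sub>M weighted_points I v S pts))
    = (\<Sum>i\<in>I. \<Sum>j\<in>I. w i * v j * k (pts i) (pts j))"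
proof -
  let ?D = "\<lambda>w. density (count_space I) (\<lambda>i. ennreal (w i))"
  have m: "pts \<in> ?D w \<rightarrow>\<^sub>M S" "pts \<in> ?D v \<rightarrow>\<^sub>M S" using pts by auto
  interpret V: prob_space "weighted_points I v S pts"
    by (rule prob_space_weighted_points[OF I v pts])
  have sfD: "sigma_finite_measure (?D v)"
  proof -
    have "emeasure (?D v) (space (?D v)) = ennreal (\<Sum>i\<in>I. v i)"
      using v(1) by (simp add: emeasure_density nn_integral_count_space_finite I sum_ennreal)
    then interpret finite_measure "?D v" by (intro finite_measureI) simp
    show ?thesis by unfold_locales
  qed
  have D: "?D w \<Otimes>\<^sub>M ?D v = density (count_space (I \<times> I)) (\<lambda>(i, j). ennreal (w i * v j))"
  proof -
    have "?D w \<Otimes>\<^sub>M ?D v = density (count_space I \<Otimes>\<^sub>M count_space I) (\<lambda>(i, j). ennreal (w i) * ennreal (v j))"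
      by (rule pair_measure_density) (auto simp: sigma_finite_measure_count_space_finite I sfD)
    then show ?thesis by (simp add: pair_measure_count_space I ennreal_mult w v)
  qed
  have W: "weighted_points I w S pts \<Otimes>\<^sub>M weighted_points I v S pts
      = distr (?D w \<Otimes>\<^sub>M ?D v) (S \<Otimes>\<^sub>M S) (\<lambda>(i, j). (pts i, pts j))"
    unfolding weighted_points_def
    by (rule pair_measure_distr[OF m]) (use V.sigma_finite_measure in \<open>simp add: weighted_points_def\<close>)
  have m2: "(\<lambda>(i, j). (pts i, pts j)) \<in> ?D w \<Otimes>\<^sub>M ?D v \<rightarrow>\<^sub>M S \<Otimes>\<^sub>M S"
    using m by measurable
  have "(\<integral>(x, y). k x y \<partial>(weighted_points I w S pts \<Otimes>\<^sub>M weighted_points I v S pts))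
     = (\<integral>z. (case z of (i, j) \<Rightarrow> k (pts i) (pts j)) \<partial>density (count_space (I \<times> I)) (\<lambda>z. ennreal (case z of (i, j) \<Rightarrow> w i * v j)))"
    unfolding W D using integral_distr[OF m2[unfolded D] k] by (simp add: case_prod_unfold)
  also have "\<dots> = (\<integral>z. (case z of (i, j) \<Rightarrow> w i * v j) *\<^sub>R (case z of (i, j) \<Rightarrow> k (pts i) (pts j)) \<partial>count_space (I \<times> I))"
    using w v by (intro integral_density) auto
  also have "\<dots> = (\<Sum>i\<in>I. \<Sum>j\<in>I. w i * v j * k (pts i) (pts j))"
    using I by (simp add: lebesgue_integral_count_space_finite sum.cartesian_product case_prod_beta)
  finally show ?thesis .
qed

section \<open>Kernels of strong negative type\<close>

lemma strong_negative_typeD: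
  assumes k: "strong_negative_type p k"
  shows "(\<lambda>(x, y). k x y) \<in> borel_measurable (Rp p \<Otimes>\<^sub>M Rp p)"
    and "\<And>x y. x \<in> space (Rp p) \<Longrightarrow> y \<in> space (Rp p) \<Longrightarrow> k x y = 0 \<longleftrightarrow> x = y"
    and "\<And>P Q z. borel_prob p P \<Longrightarrow> borel_prob p Q \<Longrightarrow> P \<noteq> Q \<Longrightarrow> z \<in> space (Rp p) \<Longrightarrow>
      integrable P (\<lambda>u. k u z) \<Longrightarrow> integrable Q (\<lambda>u. k u z) \<Longrightarrow> diff_integral k P Q < 0"
proof -
  note r = k[unfolded strong_negative_type_def]
  show "(\<lambda>(x, y). k x y) \<in> borel_measurable (Rp p \<Otimes>\<^sub>M Rp p)"
    by (rule r[THEN conjunct1])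
  show "k x y = 0 \<longleftrightarrow> x = y" if "x \<in> space (Rp p)" "y \<in> space (Rp p)" for x y
    by (rule r[THEN conjunct2, THEN conjunct1, rule_format, OF that, THEN conjunct2])
  show "diff_integral k P Q < 0" if "borel_prob p P" "borel_prob p Q" "P \<noteq> Q" "z \<in> space (Rp p)"
    "integrable P (\<lambda>u. k u z)" "integrable Q (\<lambda>u. k u z)" for P Q z
    by (rule r[THEN conjunct2, THEN conjunct2, rule_format])
      (intro conjI bexI[of _ z] that)
qed

text \<open>The positive and the negative part of the weights have the same mass W because the
  weights sum to zero. Normalised, they are two probability measures whose
  \<open>diff_integral\<close> is the quadratic form divided by W^2.\<close>

lemma strong_negative_type_cnd:
  assumes k: "strong_negative_type p k"
    and I: "finite I" and w: "(\<Sum>i\<in>I. w i) = 0" and pts: "pts ` I \<subseteq> space (Rp p)"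
  shows "(\<Sum>i\<in>I. \<Sum>j\<in>I. w i * w j * k (pts i) (pts j)) \<le> (0 :: real)"
proof -
  define W where "W = (\<Sum>i\<in>I. max (w i) 0)"
  have W': "W = (\<Sum>i\<in>I. max (- w i) 0)"
  proof -
    have "W - (\<Sum>i\<in>I. max (- w i) 0) = (\<Sum>i\<in>I. w i)"
      unfolding W_def sum_subtractf[symmetric] by (intro sum.cong) auto
    then show ?thesis using w by simp
  qed
  have meas: "(\<lambda>(x, y). k x y) \<in> borel_measurable (Rp p \<Otimes>\<^sub>M Rp p)"
    by (rule strong_negative_typeD(1)[OF k])
  show ?thesis
  proof (cases "W = 0")
    case True
    then have "\<forall>i\<in>I. max (w i) 0 = 0" "\<forall>i\<in>I. max (- w i) 0 = 0"
      using I W' unfolding W_def by (subst (asm) sum_nonneg_eq_0_iff; simp)+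
    then have "w i = 0" if "i \<in> I" for i using that by (metis antisym max.absorb_iff2 neg_le_0_iff_le)
    then show ?thesis by simp
  next
    case False
    then have Wpos: "0 < W" using sum_nonneg[of I "\<lambda>i. max (w i) 0"] unfolding W_def by (simp add: order_less_le)
    define u where "u i = max (w i) 0 / W" for i
    define v where "v i = max (- w i) 0 / W" for i
    have u: "\<And>i. 0 \<le> u i" "(\<Sum>i\<in>I. u i) = 1"
      using Wpos by (auto simp: u_def sum_divide_distrib[symmetric] W_def[symmetric])
    have v: "\<And>i. 0 \<le> v i" "(\<Sum>i\<in>I. v i) = 1"
      using Wpos by (auto simp: v_def sum_divide_distrib[symmetric] W'[symmetric])
    define P where "P = weighted_points I u (Rp p) pts"
    define Q where "Q = weighted_points I v (Rp p) pts"
    have uv: "u i - v i = w i / W" for i by (auto simp: u_def v_def max_def diff_divide_distrib)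
    have "diff_integral k P Q = (\<Sum>i\<in>I. \<Sum>j\<in>I. (u i - v i) * (u j - v j) * k (pts i) (pts j))"
      unfolding diff_integral_def P_def Q_def
        integral_weighted_points_pair[OF I u u pts meas] integral_weighted_points_pair[OF I u v pts meas]
        integral_weighted_points_pair[OF I v u pts meas] integral_weighted_points_pair[OF I v v pts meas]
        sum_subtractf[symmetric] sum.distrib[symmetric]
      by (intro sum.cong refl) (simp add: algebra_simps)
    also have "\<dots> = (\<Sum>i\<in>I. \<Sum>j\<in>I. w i * w j * k (pts i) (pts j)) / W\<^sup>2"
      unfolding uv sum_divide_distrib by (intro sum.cong refl) (simp add: power2_eq_square)
    finally have eq: "diff_integral k P Q = (\<Sum>i\<in>I. \<Sum>j\<in>I. w i * w j * k (pts i) (pts j)) / W\<^sup>2" .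
    \<comment> \<open>Points may coincide, so nonzero weights can still give P = Q; strict
      negativity is only available when the measures differ.\<close>
    have "diff_integral k P Q \<le> 0"
    proof (cases "P = Q")
      case True then show ?thesis by (simp add: diff_integral_def)
    next
      case False
      obtain i where i: "i \<in> I" using u(2) by (cases "I = {}") auto
      then have z: "pts i \<in> space (Rp p)" using pts by auto
      have mz: "(\<lambda>x. k x (pts i)) \<in> borel_measurable (Rp p)"
        using measurable_compose[OF _ meas, of "\<lambda>x. (x, pts i)" "Rp p"] z
        by simp
      have "borel_prob p P" "borel_prob p Q"
        using prob_space_weighted_points[OF I u pts] prob_space_weighted_points[OF I v pts]
          sets_weighted_points[OF I u pts] sets_weighted_points[OF I v pts]
        by (simp_all add: borel_prob_def P_def Q_def)
      moreover have "integrable P (\<lambda>z. k z (pts i))" "integrable Q (\<lambda>z. k z (pts i))"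
        unfolding P_def Q_def
        by (rule integrable_weighted_points[OF I u pts mz] integrable_weighted_points[OF I v pts mz])+
      ultimately have "diff_integral k P Q < 0"
        by (intro strong_negative_typeD(3)[OF k _ _ False z])
      then show ?thesis by simp
    qed
    then show ?thesis using Wpos unfolding eq by (simp add: divide_le_0_iff)
  qed
qed

section \<open>Reproducing kernels\<close>

lemma rkhsD:
  assumes H: "rkhs S H ip K"
  shows "\<And>h x. h \<in> H \<Longrightarrow> x \<notin> S \<Longrightarrow> h x = 0"
    and "(\<lambda>x. 0) \<in> H"
    and "\<And>g h. g \<in> H \<Longrightarrow> h \<in> H \<Longrightarrow> (\<lambda>x. g x + h x) \<in> H"
    and "\<And>c h. h \<in> H \<Longrightarrow> (\<lambda>x. c * h x) \<in> H"
    and "\<And>g h. g \<in> H \<Longrightarrow> h \<in> H \<Longrightarrow> ip g h = ip h g"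
    and "\<And>g g' h. g \<in> H \<Longrightarrow> g' \<in> H \<Longrightarrow> h \<in> H \<Longrightarrow> ip (\<lambda>x. g x + g' x) h = ip g h + ip g' h"
    and "\<And>c g h. g \<in> H \<Longrightarrow> h \<in> H \<Longrightarrow> ip (\<lambda>x. c * g x) h = c * ip g h"
    and "\<And>h. h \<in> H \<Longrightarrow> 0 \<le> ip h h"
    and "\<And>x. x \<in> S \<Longrightarrow> (\<lambda>y. if y \<in> S then K y x else 0) \<in> H"
    and "\<And>x h. x \<in> S \<Longrightarrow> h \<in> H \<Longrightarrow> ip h (\<lambda>y. if y \<in> S then K y x else 0) = h x"
proof -
  note r0 = H[unfolded rkhs_def]
  note f1 = r0[THEN conjunct1] and r1 = r0[THEN conjunct2]
  note f2 = r1[THEN conjunct1] and r2 = r1[THEN conjunct2]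
  note f3 = r2[THEN conjunct1] and r3 = r2[THEN conjunct2]
  note f4 = r3[THEN conjunct1] and r4 = r3[THEN conjunct2]
  note f5 = r4[THEN conjunct1] and r5 = r4[THEN conjunct2]
  note f6 = r5[THEN conjunct1] and r6 = r5[THEN conjunct2]
  note f7 = r6[THEN conjunct1] and r7 = r6[THEN conjunct2]
  note f8 = r7[THEN conjunct1] and r8 = r7[THEN conjunct2]
  note f9 = r8[THEN conjunct1] and r9 = r8[THEN conjunct2]
  note f10 = r9[THEN conjunct1] and r10 = r9[THEN conjunct2]
  show "h x = 0" if "h \<in> H" "x \<notin> S" for h x
    using f1 that by blast
  show "(\<lambda>x. 0) \<in> H"
    by (rule f2)
  show "(\<lambda>x. g x + h x) \<in> H" if "g \<in> H" "h \<in> H" for g h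
    using f3 that by metis
  show "(\<lambda>x. c * h x) \<in> H" if "h \<in> H" for c h
    using f4 that by metis
  show "ip g h = ip h g" if "g \<in> H" "h \<in> H" for g h
    using f5 that by metis
  show "ip (\<lambda>x. g x + g' x) h = ip g h + ip g' h" if "g \<in> H" "g' \<in> H" "h \<in> H" for g g' h
    using f6 that by metis
  show "ip (\<lambda>x. c * g x) h = c * ip g h" if "g \<in> H" "h \<in> H" for c g h
    using f7 that by metis
  show "0 \<le> ip h h" if "h \<in> H" for h
    using f8 that by metis
  show "(\<lambda>y. if y \<in> S then K y x else 0) \<in> H" if "x \<in> S" for x
    by (rule r10[rule_format, OF that, THEN conjunct1])
  show "ip h (\<lambda>y. if y \<in> S then K y x else 0) = h x" if "x \<in> S" "h \<in> H" for x h
    by (rule r10[rule_format, OF that(1), THEN conjunct2, rule_format, OF that(2)])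
qed

text \<open>The quadratic form is the squared norm of the combination of the functions K(., pts i)
  with weights w i. Since \<open>rkhs\<close> only offers binary operations, the combination and its
  inner products are built together by induction on the index set.\<close>

lemma rkhs_cnd:
  fixes w :: "'i \<Rightarrow> real"
  assumes H: "rkhs S H ip K" and I: "finite I" and pts: "pts ` I \<subseteq> S"
  shows "0 \<le> (\<Sum>i\<in>I. \<Sum>j\<in>I. w i * w j * K (pts i) (pts j))"
proof -
  define e where "e x y = (if y \<in> S then K y x else 0)" for x y
  note zero = rkhsD(2)[OF H] and add = rkhsD(3)[OF H] and scale = rkhsD(4)[OF H]
    and ip_sym = rkhsD(5)[OF H] and ip_add = rkhsD(6)[OF H] and ip_scale = rkhsD(7)[OF H]
    and ip_nonneg = rkhsD(8)[OF H]
  have e: "\<And>x. x \<in> S \<Longrightarrow> e x \<in> H" and rep: "\<And>x h. x \<in> S \<Longrightarrow> h \<in> H \<Longrightarrow> ip h (e x) = h x"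
    using rkhsD(9,10)[OF H] unfolding e_def by auto
  have ip_zero: "ip (\<lambda>x. 0) h = 0" if "h \<in> H" for h
    using ip_scale[OF zero that, of 0] by simp
  have comb: "(\<lambda>y. \<Sum>i\<in>I. w i * e (pts i) y) \<in> H
      \<and> (\<forall>h\<in>H. ip (\<lambda>y. \<Sum>i\<in>I. w i * e (pts i) y) h = (\<Sum>i\<in>I. w i * h (pts i)))"
    using I pts
  proof (induction I rule: finite_induct)
    case empty then show ?case using zero ip_zero by simp
  next
    case (insert a I)
    have a: "(\<lambda>y. w a * e (pts a) y) \<in> H" using insert.prems scale e by simp
    have ipa: "ip (\<lambda>y. w a * e (pts a) y) h = w a * h (pts a)" if "h \<in> H" for h
    proof -
      have "ip (\<lambda>y. w a * e (pts a) y) h = w a * ip (e (pts a)) h"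
        using insert.prems that e by (intro ip_scale) auto
      also have "ip (e (pts a)) h = ip h (e (pts a))" using insert.prems that e by (intro ip_sym) auto
      also have "\<dots> = h (pts a)" using insert.prems that by (intro rep) auto
      finally show ?thesis .
    qed
    let ?g = "\<lambda>y. \<Sum>i\<in>I. w i * e (pts i) y"
    have g: "?g \<in> H" "\<And>h. h \<in> H \<Longrightarrow> ip ?g h = (\<Sum>i\<in>I. w i * h (pts i))"
      using insert.IH insert.prems by auto
    have eq: "(\<lambda>y. \<Sum>i\<in>insert a I. w i * e (pts i) y) = (\<lambda>y. w a * e (pts a) y + ?g y)"
      using insert.hyps by simp
    have "ip (\<lambda>y. w a * e (pts a) y + ?g y) h = (\<Sum>i\<in>insert a I. w i * h (pts i))" if "h \<in> H" for h
      unfolding ip_add[OF a g(1) that] ipa[OF that] g(2)[OF that] using insert.hyps by simp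
    then show ?case unfolding eq using add[OF a g(1)] by blast
  qed
  define h where "h y = (\<Sum>i\<in>I. w i * e (pts i) y)" for y
  have hH: "h \<in> H" using comb unfolding h_def by blast
  have "0 \<le> ip h h" by (rule ip_nonneg[OF hH])
  also have "ip h h = (\<Sum>i\<in>I. w i * h (pts i))" using comb hH unfolding h_def by blast
  also have "\<dots> = (\<Sum>i\<in>I. \<Sum>j\<in>I. w i * w j * K (pts i) (pts j))"
    unfolding h_def sum_distrib_left using pts by (intro sum.cong refl) (auto simp: e_def)
  finally show ?thesis .
qed

lemma is_kernel_cnd:
  fixes w :: "'i \<Rightarrow> real"
  assumes k: "is_kernel p k"
    and I: "finite I" and w: "(\<Sum>i\<in>I. w i) = 0" and pts: "pts ` I \<subseteq> space (Rp p)"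
  shows "(\<Sum>i\<in>I. \<Sum>j\<in>I. w i * w j * k (pts i) (pts j)) \<le> 0"
proof -
  consider "strong_negative_type p k" | H ip where "rkhs (space (Rp p)) H ip (\<lambda>x y. - k x y)"
    using k unfolding is_kernel_def by blast
  then show ?thesis
  proof cases
    case 1
    then show ?thesis by (rule strong_negative_type_cnd[OF _ I w pts])
  next
    case 2
    then show ?thesis using rkhs_cnd[OF 2 I pts, where w = w] by (simp add: sum_negf)
  qed
qed

text \<open>Needed to see that f(sqrt A) is nonzero. A null kernel contradicts strong negative type
  at two distinct points, which exist because p is at least 1. As a reproducing kernel it would
  force the space to be {0}, so that two different point masses would share their mean
  embedding.\<close>

lemma is_kernel_not_null:
  assumes k: "is_kernel p k" and p: "1 \<le> p"
  shows "\<exists>x\<in>space (Rp p). \<exists>y\<in>space (Rp p). k x y \<noteq> 0"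
proof (rule ccontr)
  assume "\<not> ?thesis"
  then have null: "\<And>x y. x \<in> space (Rp p) \<Longrightarrow> y \<in> space (Rp p) \<Longrightarrow> k x y = 0" by blast
  define a :: rvec where "a = (\<lambda>j\<in>{1..p}. 0)"
  define b :: rvec where "b = (\<lambda>j\<in>{1..p}. 1)"
  have ab: "a \<in> space (Rp p)" "b \<in> space (Rp p)" by (auto simp: a_def b_def Rp_def space_PiM)
  have ab1: "a 1 = 0" "b 1 = 1" using p by (auto simp: a_def b_def)
  then have "a \<noteq> b" by auto
  then have "\<not> strong_negative_type p k" using strong_negative_typeD(2)[of p k a b] null ab by auto
  then obtain H ip where H: "rkhs (space (Rp p)) H ip (\<lambda>x y. - k x y)" and c: "characteristic p H ip"
    using k unfolding is_kernel_def by blast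
  note zero = rkhsD(2)[OF H] and ip_sym = rkhsD(5)[OF H] and ip_scale = rkhsD(7)[OF H]
    and ext = rkhsD(1)[OF H] and rep = rkhsD(10)[OF H]
  have H0: "h = (\<lambda>x. 0)" if h: "h \<in> H" for h
  proof
    fix x
    show "h x = 0"
    proof (cases "x \<in> space (Rp p)")
      case True
      have "(\<lambda>y. if y \<in> space (Rp p) then - k y x else 0) = (\<lambda>x. 0)" using null True by auto
      then have "h x = ip h (\<lambda>x. 0)" using rep[OF True h] by simp
      also have "\<dots> = ip (\<lambda>x. 0 * 0) h" using ip_sym[OF h zero] by simp
      also have "\<dots> = 0" using ip_scale[OF zero h, of 0] by simp
      finally show ?thesis .
    qed (use ext h in auto)
  qed
  define P where "P = return (Rp p) a"
  define Q where "Q = return (Rp p) b"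
  have PQ: "borel_prob p P" "borel_prob p Q"
    using ab by (auto simp: borel_prob_def P_def Q_def prob_space_return)
  obtain h where h: "mean_embedding H ip P h" using c PQ unfolding characteristic_def by blast
  obtain h' where h': "mean_embedding H ip Q h'" using c PQ unfolding characteristic_def by blast
  have "h = h'" using H0 h h' unfolding mean_embedding_def by blast
  then have "P = Q" using c PQ h h' unfolding characteristic_def by blast
  moreover have [measurable]: "(\<lambda>x. x 1 :: real) \<in> borel_measurable (Rp p)"
    unfolding Rp_def using p by (intro measurable_component_singleton) auto
  then have S: "{x \<in> space (Rp p). x 1 = (0 :: real)} \<in> sets (Rp p)"
    by measurable
  have "emeasure P {x \<in> space (Rp p). x 1 = 0} = 1" "emeasure Q {x \<in> space (Rp p). x 1 = 0} = 0"
    unfolding P_def Q_def emeasure_return[OF S] using ab ab1 by (auto simp: indicator_def)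
  ultimately show False by simp
qed

section \<open>Moments under weak dependence\<close>

text \<open>Every term is at most the largest one, whose k-th power occurs on the right. Convexity
  would give the exponent k - 1 for the cardinality, but only constants are at stake.\<close>

lemma sum_power_le_card_power:
  fixes a :: "'i \<Rightarrow> real"
  assumes I: "finite I" and k: "0 < k"
  shows "\<bar>\<Sum>i\<in>I. a i\<bar> ^ k \<le> real (card I) ^ k * (\<Sum>i\<in>I. \<bar>a i\<bar> ^ k)"
proof (cases "I = {}")
  case False
  define m where "m = Max ((\<lambda>i. \<bar>a i\<bar>) ` I)"
  have m: "\<And>i. i \<in> I \<Longrightarrow> \<bar>a i\<bar> \<le> m" unfolding m_def using I by auto
  have "m \<in> (\<lambda>i. \<bar>a i\<bar>) ` I" unfolding m_def using I False by (intro Max_in) auto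
  then obtain i where i: "i \<in> I" "m = \<bar>a i\<bar>" by blast
  have "\<bar>\<Sum>i\<in>I. a i\<bar> \<le> (\<Sum>i\<in>I. \<bar>a i\<bar>)" by (rule sum_abs)
  also have "\<dots> \<le> real (card I) * m" using sum_bounded_above[of I "\<lambda>i. \<bar>a i\<bar>" m] m by simp
  finally have "\<bar>\<Sum>i\<in>I. a i\<bar> ^ k \<le> (real (card I) * m) ^ k" by (intro power_mono) auto
  also have "\<dots> = real (card I) ^ k * \<bar>a i\<bar> ^ k" by (simp add: power_mult_distrib i)
  also have "\<dots> \<le> real (card I) ^ k * (\<Sum>i\<in>I. \<bar>a i\<bar> ^ k)"
    using I i by (intro mult_left_mono member_le_sum) auto
  finally show ?thesis .
next
  case True
  then show ?thesis using k by (simp add: zero_power)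
qed

lemma add_power_le: "\<bar>a + b\<bar> ^ k \<le> 2 ^ k * (\<bar>a\<bar> ^ k + \<bar>b\<bar> ^ k)" for a b :: real
  using sum_power_le_card_power[of UNIV k "\<lambda>i. if i then a else b"]
  by (cases "k = 0") (simp_all add: UNIV_bool algebra_simps)

lemma power_le_one_plus:
  fixes t :: real
  assumes "r \<le> k"
  shows "\<bar>t\<bar> ^ r \<le> 1 + \<bar>t\<bar> ^ k"
proof (cases "\<bar>t\<bar> \<le> 1")
  case True
  then have "\<bar>t\<bar> ^ r \<le> 1" by (simp add: power_le_one)
  moreover have "0 \<le> \<bar>t\<bar> ^ k" by simp
  ultimately show ?thesis by linarith
next
  case False
  then have "\<bar>t\<bar> ^ r \<le> \<bar>t\<bar> ^ k" using assms by (intro power_increasing) auto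
  then show ?thesis by simp
qed

text \<open>One law in one dimension. \<open>K\<close> is a range of dependence that does not change
  with p: it bounds \<alpha>(p) for all large p, so any gap longer than \<open>K\<close> separates
  independent blocks.\<close>

locale weak_dependence = prob_space P for P :: "rvec measure" +
  fixes p K :: nat and U :: real
  assumes sets_P [measurable_cong]: "sets P = sets (Rp p)"
    and p_pos: "1 \<le> p" and U: "1 \<le> U"
    and moments: "\<And>j r. j \<in> {1..p} \<Longrightarrow> r \<in> {1..128} \<Longrightarrow> (\<integral>\<^sup>+x. ennreal (\<bar>x j\<bar> ^ r) \<partial>P) < ennreal U"
    and far_indep: "\<And>j l. 1 \<le> j \<Longrightarrow> K < l \<Longrightarrow> j + l \<le> p \<Longrightarrow>
      indep_var (\<Pi>\<^sub>M i\<in>{1..j}. borel) (\<lambda>x. restrict x {1..j})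
                (\<Pi>\<^sub>M i\<in>{j + l..p}. borel) (\<lambda>x. restrict x {j + l..p})"
begin

lemma space_P: "space P = space (Rp p)"
  by (rule sets_eq_imp_space_eq[OF sets_P])

lemma coord_measurable [measurable]: "j \<in> {1..p} \<Longrightarrow> (\<lambda>x. x j) \<in> borel_measurable P"
  unfolding measurable_cong_sets[OF sets_P refl] Rp_def
  by (rule measurable_component_singleton)

text \<open>Degree bookkeeping: every function to be integrated is a polynomial in the coordinates,
  possibly under absolute values, and degree at most 128 guarantees integrability by (D2). The
  constant \<open>B\<close> may depend on p, because quantitative bounds are derived
  separately.\<close>

definition poly_bdd :: "nat \<Rightarrow> (rvec \<Rightarrow> real) \<Rightarrow> bool" where
  "poly_bdd n g \<longleftrightarrow> g \<in> borel_measurable P \<and>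
     (\<exists>B\<ge>0. \<forall>x\<in>space P. \<bar>g x\<bar> \<le> B * (1 + (\<Sum>j=1..p. \<bar>x j\<bar>)) ^ n)"

lemma poly_bdd_const: "poly_bdd 0 (\<lambda>x. c)"
  unfolding poly_bdd_def by (auto intro!: exI[of _ "\<bar>c\<bar>"])

lemma poly_bdd_coord: "j \<in> {1..p} \<Longrightarrow> poly_bdd 1 (\<lambda>x. x j)"
  unfolding poly_bdd_def
  by (auto intro!: exI[of _ 1] order_trans[OF member_le_sum[of j "{1..p}" "\<lambda>j. \<bar>_ j\<bar>"]])

lemma poly_bdd_mono:
  assumes "poly_bdd n g" "n \<le> n'"
  shows "poly_bdd n' g"
proof -
  obtain B where B: "0 \<le> B" "\<And>x. x \<in> space P \<Longrightarrow> \<bar>g x\<bar> \<le> B * (1 + (\<Sum>j=1..p. \<bar>x j\<bar>)) ^ n"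
    and g: "g \<in> borel_measurable P" using assms unfolding poly_bdd_def by auto
  have "B * (1 + (\<Sum>j=1..p. \<bar>x j\<bar>)) ^ n \<le> B * (1 + (\<Sum>j=1..p. \<bar>x j\<bar>)) ^ n'" for x
    using B(1) assms(2) by (intro mult_left_mono power_increasing) (auto intro: sum_nonneg)
  then show ?thesis unfolding poly_bdd_def using B g by (meson order_trans)
qed

lemma poly_bdd_add_same:
  assumes "poly_bdd n g" "poly_bdd n h"
  shows "poly_bdd n (\<lambda>x. g x + h x)"
proof -
  obtain B where B: "0 \<le> B" "\<And>x. x \<in> space P \<Longrightarrow> \<bar>g x\<bar> \<le> B * (1 + (\<Sum>j=1..p. \<bar>x j\<bar>)) ^ n"
    and g[measurable]: "g \<in> borel_measurable P" using assms unfolding poly_bdd_def by auto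
  obtain B' where B': "0 \<le> B'" "\<And>x. x \<in> space P \<Longrightarrow> \<bar>h x\<bar> \<le> B' * (1 + (\<Sum>j=1..p. \<bar>x j\<bar>)) ^ n"
    and h[measurable]: "h \<in> borel_measurable P" using assms unfolding poly_bdd_def by auto
  have "\<bar>g x + h x\<bar> \<le> (B + B') * (1 + (\<Sum>j=1..p. \<bar>x j\<bar>)) ^ n" if "x \<in> space P" for x
    using B(2)[OF that] B'(2)[OF that] by (simp add: distrib_right)
  then show ?thesis unfolding poly_bdd_def using B(1) B'(1)
    by (auto intro!: exI[of _ "B + B'"])
qed

lemma poly_bdd_add: "poly_bdd a g \<Longrightarrow> poly_bdd b h \<Longrightarrow> poly_bdd (max a b) (\<lambda>x. g x + h x)"
  by (intro poly_bdd_add_same) (auto elim: poly_bdd_mono)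

lemma poly_bdd_mult:
  assumes "poly_bdd n g" "poly_bdd k h"
  shows "poly_bdd (n + k) (\<lambda>x. g x * h x)"
proof -
  obtain B where B: "0 \<le> B" "\<And>x. x \<in> space P \<Longrightarrow> \<bar>g x\<bar> \<le> B * (1 + (\<Sum>j=1..p. \<bar>x j\<bar>)) ^ n"
    and g[measurable]: "g \<in> borel_measurable P" using assms unfolding poly_bdd_def by auto
  obtain B' where B': "0 \<le> B'" "\<And>x. x \<in> space P \<Longrightarrow> \<bar>h x\<bar> \<le> B' * (1 + (\<Sum>j=1..p. \<bar>x j\<bar>)) ^ k"
    and h[measurable]: "h \<in> borel_measurable P" using assms unfolding poly_bdd_def by auto
  have "\<bar>g x * h x\<bar> \<le> (B * B') * (1 + (\<Sum>j=1..p. \<bar>x j\<bar>)) ^ (n + k)" if "x \<in> space P" for x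
  proof -
    have "\<bar>g x * h x\<bar> \<le> (B * (1 + (\<Sum>j=1..p. \<bar>x j\<bar>)) ^ n) * (B' * (1 + (\<Sum>j=1..p. \<bar>x j\<bar>)) ^ k)"
      unfolding abs_mult using B(1) B(2)[OF that] B'(2)[OF that]
      by (intro mult_mono) (auto intro!: mult_nonneg_nonneg add_nonneg_nonneg sum_nonneg)
    then show ?thesis by (simp add: power_add mult_ac)
  qed
  then show ?thesis unfolding poly_bdd_def using B(1) B'(1)
    by (auto intro!: exI[of _ "B * B'"])
qed

lemma poly_bdd_cmult: "poly_bdd n g \<Longrightarrow> poly_bdd n (\<lambda>x. c * g x)"
  using poly_bdd_mult[OF poly_bdd_const[of c]] by simp

lemma poly_bdd_diff: "poly_bdd a g \<Longrightarrow> poly_bdd b h \<Longrightarrow> poly_bdd (max a b) (\<lambda>x. g x - h x)"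
  using poly_bdd_add[of a g b "\<lambda>x. (-1) * h x"] poly_bdd_cmult[of b h "-1"] by simp

lemma poly_bdd_power: "poly_bdd n g \<Longrightarrow> poly_bdd (n * k) (\<lambda>x. g x ^ k)"
proof (induction k)
  case (Suc k)
  then show ?case using poly_bdd_mult[of n g "n * k" "\<lambda>x. g x ^ k"] by simp
qed (use poly_bdd_const in auto)

lemma poly_bdd_abs: "poly_bdd n g \<Longrightarrow> poly_bdd n (\<lambda>x. \<bar>g x\<bar>)"
  unfolding poly_bdd_def by auto

lemma poly_bdd_sum: "(\<And>i. i \<in> I \<Longrightarrow> poly_bdd n (g i)) \<Longrightarrow> poly_bdd n (\<lambda>x. \<Sum>i\<in>I. g i x)"
proof (induction I rule: infinite_finite_induct)
  case (insert i I)
  then show ?case using poly_bdd_add_same[of n "g i" "\<lambda>x. \<Sum>i\<in>I. g i x"] by simp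
qed (use poly_bdd_mono[OF poly_bdd_const[of 0]] in auto)

lemma integrable_coord_power:
  assumes "j \<in> {1..p}" "r \<in> {1..128}"
  shows "integrable P (\<lambda>x. \<bar>x j\<bar> ^ r)" and "expectation (\<lambda>x. \<bar>x j\<bar> ^ r) \<le> U"
proof -
  have fin: "(\<integral>\<^sup>+x. ennreal (\<bar>x j\<bar> ^ r) \<partial>P) < ennreal U" by (rule moments[OF assms])
  also have "\<dots> < \<infinity>" by simp
  finally show int: "integrable P (\<lambda>x. \<bar>x j\<bar> ^ r)"
    using assms by (intro integrableI_nonneg) auto
  have "ennreal (expectation (\<lambda>x. \<bar>x j\<bar> ^ r)) = (\<integral>\<^sup>+x. ennreal (\<bar>x j\<bar> ^ r) \<partial>P)"
    using int by (subst nn_integral_eq_integral) auto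
  then show "expectation (\<lambda>x. \<bar>x j\<bar> ^ r) \<le> U"
    using fin U ennreal_le_iff[of U "expectation (\<lambda>x. \<bar>x j\<bar> ^ r)"] by (simp add: order_less_imp_le)
qed

lemma integrable_poly_bdd:
  assumes g: "poly_bdd n g" and n: "n \<le> 128"
  shows "integrable P g"
proof -
  define k :: nat where "k = 128"
  have k: "k \<in> {1..128}" by (simp add: k_def)
  obtain B where B: "0 \<le> B" "\<And>x. x \<in> space P \<Longrightarrow> \<bar>g x\<bar> \<le> B * (1 + (\<Sum>j=1..p. \<bar>x j\<bar>)) ^ k"
    and gm: "g \<in> borel_measurable P"
    using poly_bdd_mono[OF g n] unfolding poly_bdd_def k_def by auto
  let ?b = "\<lambda>x. B * (2 ^ k * (1 + real (card {1..p}) ^ k * (\<Sum>j=1..p. \<bar>x j\<bar> ^ k)))"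
  have "integrable P ?b"
    by (intro integrable_mult_right Bochner_Integration.integrable_add Bochner_Integration.integrable_sum
        integrable_coord_power k) auto
  then show ?thesis
  proof (rule Bochner_Integration.integrable_bound[OF _ gm])
    have "\<bar>g x\<bar> \<le> ?b x" if x: "x \<in> space P" for x
    proof -
      have "0 \<le> (\<Sum>j=1..p. \<bar>x j\<bar>)" by (intro sum_nonneg) simp
      then have "(1 + (\<Sum>j=1..p. \<bar>x j\<bar>)) ^ k = \<bar>1 + (\<Sum>j=1..p. \<bar>x j\<bar>)\<bar> ^ k" by simp
      also have "\<dots> \<le> 2 ^ k * (\<bar>1\<bar> ^ k + \<bar>\<Sum>j=1..p. \<bar>x j\<bar>\<bar> ^ k)" by (rule add_power_le)
      also have "\<dots> \<le> 2 ^ k * (1 + real (card {1..p}) ^ k * (\<Sum>j=1..p. \<bar>x j\<bar> ^ k))"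
        using sum_power_le_card_power[of "{1..p}" k "\<lambda>j. \<bar>x j\<bar>"] k by (intro mult_left_mono) auto
      finally show ?thesis using B(2)[OF x] B(1) by (meson mult_left_mono order_trans)
    qed
    then show "AE x in P. norm (g x) \<le> norm (?b x)"
      unfolding real_norm_def by (intro AE_I2 order_trans[OF _ abs_ge_self])
  qed
qed

lemma poly_bdd_ctr: "j \<in> {1..p} \<Longrightarrow> poly_bdd 1 (ctr P j)"
  using poly_bdd_diff[OF poly_bdd_coord poly_bdd_const] unfolding ctr_def[abs_def] by simp

lemma poly_bdd_ctr_sq: "j \<in> {1..p} \<Longrightarrow> poly_bdd 2 (ctr_sq P j)"
  using poly_bdd_diff[OF poly_bdd_power[OF poly_bdd_ctr, of _ 2] poly_bdd_const] unfolding ctr_sq_def[abs_def] by simp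

lemma expectation_ctr: "j \<in> {1..p} \<Longrightarrow> expectation (ctr P j) = 0"
  unfolding ctr_def[abs_def] mean_def
  by (subst Bochner_Integration.integral_diff)
    (auto intro!: integrable_poly_bdd[OF poly_bdd_coord] simp: prob_space)

lemma cov_matrix_eq: "cov_matrix P i j = expectation (\<lambda>x. ctr P i x * ctr P j x)"
  unfolding cov_matrix_def cov_def ctr_def mean_def ..

lemma expectation_ctr_sq: "j \<in> {1..p} \<Longrightarrow> expectation (ctr_sq P j) = 0"
  unfolding ctr_sq_def[abs_def]
  by (subst Bochner_Integration.integral_diff)
    (auto intro!: integrable_poly_bdd[OF poly_bdd_power[OF poly_bdd_ctr]]
      simp: prob_space cov_matrix_eq power2_eq_square[symmetric])

text \<open>\<open>Bc\<close> bounds the centred moments up to order 12 and \<open>Bw\<close> those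
  of \<open>ctr_sq\<close> up to order 6; the latter need twice as many moments. The leading 1 pays
  for lower orders, by t^r \<le> 1 + t^k.\<close>

definition "Bc = 1 + 2 ^ 12 * (U + U ^ 12)"
definition "Bw = 1 + 2 ^ 6 * (Bc + Bc ^ 6)"

lemma Bc_ge_1: "1 \<le> Bc" using U by (simp add: Bc_def)
lemma Bw_ge_1: "1 \<le> Bw" using Bc_ge_1 by (simp add: Bw_def)

lemma abs_moment_le_one_plus:
  fixes g :: "rvec \<Rightarrow> real"
  assumes int: "integrable P (\<lambda>x. \<bar>g x\<bar> ^ k)" and gm: "g \<in> borel_measurable P" and r: "r \<le> k"
  shows "expectation (\<lambda>x. \<bar>g x\<bar> ^ r) \<le> 1 + expectation (\<lambda>x. \<bar>g x\<bar> ^ k)"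
proof -
  have "expectation (\<lambda>x. \<bar>g x\<bar> ^ r) \<le> expectation (\<lambda>x. 1 + \<bar>g x\<bar> ^ k)"
  proof (rule Bochner_Integration.integral_mono)
    show *: "integrable P (\<lambda>x. 1 + \<bar>g x\<bar> ^ k)" using int by auto
    show "integrable P (\<lambda>x. \<bar>g x\<bar> ^ r)"
      using power_le_one_plus[OF r] gm
      by (intro Bochner_Integration.integrable_bound[OF *]) auto
  qed (rule power_le_one_plus[OF r])
  then show ?thesis using int by (simp add: prob_space)
qed

lemma ctr_moment:
  assumes j: "j \<in> {1..p}" and r: "r \<le> 12"
  shows "expectation (\<lambda>x. \<bar>ctr P j x\<bar> ^ r) \<le> Bc"
proof -
  have i12: "integrable P (\<lambda>x. \<bar>ctr P j x\<bar> ^ 12)"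
    by (rule integrable_poly_bdd[OF poly_bdd_power[OF poly_bdd_abs[OF poly_bdd_ctr[OF j]]]]) simp
  have "\<bar>mean P j\<bar> \<le> expectation (\<lambda>x. \<bar>x j\<bar>)" unfolding mean_def by (rule integral_abs_bound)
  also have "\<dots> \<le> U" using integrable_coord_power(2)[OF j, of 1] by simp
  finally have m: "\<bar>mean P j\<bar> ^ 12 \<le> U ^ 12" by (intro power_mono) auto
  have "expectation (\<lambda>x. \<bar>ctr P j x\<bar> ^ 12) \<le> expectation (\<lambda>x. 2 ^ 12 * (\<bar>x j\<bar> ^ 12 + \<bar>mean P j\<bar> ^ 12))"
  proof (rule integral_mono[OF i12])
    show "integrable P (\<lambda>x. 2 ^ 12 * (\<bar>x j\<bar> ^ 12 + \<bar>mean P j\<bar> ^ 12))"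
      using integrable_coord_power(1)[OF j, of 12] by auto
    show "\<bar>ctr P j x\<bar> ^ 12 \<le> 2 ^ 12 * (\<bar>x j\<bar> ^ 12 + \<bar>mean P j\<bar> ^ 12)" for x
      using add_power_le[of "x j" "- mean P j" 12] unfolding ctr_def by simp
  qed
  also have "\<dots> = 2 ^ 12 * (expectation (\<lambda>x. \<bar>x j\<bar> ^ 12) + \<bar>mean P j\<bar> ^ 12)"
    using integrable_coord_power(1)[OF j, of 12] by (simp add: prob_space)
  also have "\<dots> \<le> 2 ^ 12 * (U + U ^ 12)"
    using integrable_coord_power(2)[OF j, of 12] m by (intro mult_left_mono add_mono) auto
  finally have "1 + expectation (\<lambda>x. \<bar>ctr P j x\<bar> ^ 12) \<le> Bc" unfolding Bc_def by simp
  moreover have "ctr P j \<in> borel_measurable P" using poly_bdd_ctr[OF j] by (simp add: poly_bdd_def)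
  ultimately show ?thesis using abs_moment_le_one_plus[OF i12 _ r] by simp
qed

lemma variance_le:
  assumes "j \<in> {1..p}"
  shows "cov_matrix P j j \<le> Bc" and "0 \<le> cov_matrix P j j"
  using ctr_moment[OF assms, of 2] by (simp_all add: cov_matrix_eq power2_eq_square[symmetric])

lemma ctr_sq_moment:
  assumes j: "j \<in> {1..p}" and r: "r \<le> 6"
  shows "expectation (\<lambda>x. \<bar>ctr_sq P j x\<bar> ^ r) \<le> Bw"
proof -
  have i6: "integrable P (\<lambda>x. \<bar>ctr_sq P j x\<bar> ^ 6)"
    by (rule integrable_poly_bdd[OF poly_bdd_power[OF poly_bdd_abs[OF poly_bdd_ctr_sq[OF j]]]]) simp
  have i12: "integrable P (\<lambda>x. \<bar>ctr P j x\<bar> ^ 12)"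
    by (rule integrable_poly_bdd[OF poly_bdd_power[OF poly_bdd_abs[OF poly_bdd_ctr[OF j]]]]) simp
  have m: "\<bar>cov_matrix P j j\<bar> ^ 6 \<le> Bc ^ 6" using variance_le[OF j] by (intro power_mono) auto
  have "expectation (\<lambda>x. \<bar>ctr_sq P j x\<bar> ^ 6) \<le> expectation (\<lambda>x. 2 ^ 6 * (\<bar>ctr P j x\<bar> ^ 12 + \<bar>cov_matrix P j j\<bar> ^ 6))"
  proof (rule integral_mono[OF i6])
    show "integrable P (\<lambda>x. 2 ^ 6 * (\<bar>ctr P j x\<bar> ^ 12 + \<bar>cov_matrix P j j\<bar> ^ 6))" using i12 by auto
    show "\<bar>ctr_sq P j x\<bar> ^ 6 \<le> 2 ^ 6 * (\<bar>ctr P j x\<bar> ^ 12 + \<bar>cov_matrix P j j\<bar> ^ 6)" for x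
      using add_power_le[of "(ctr P j x)\<^sup>2" "- cov_matrix P j j" 6] unfolding ctr_sq_def
      by (simp add: power_abs power_mult[symmetric])
  qed
  also have "\<dots> = 2 ^ 6 * (expectation (\<lambda>x. \<bar>ctr P j x\<bar> ^ 12) + \<bar>cov_matrix P j j\<bar> ^ 6)"
    using i12 by (simp add: prob_space)
  also have "\<dots> \<le> 2 ^ 6 * (Bc + Bc ^ 6)"
    using ctr_moment[OF j, of 12] m by (intro mult_left_mono add_mono) auto
  finally have "1 + expectation (\<lambda>x. \<bar>ctr_sq P j x\<bar> ^ 6) \<le> Bw" unfolding Bw_def by simp
  moreover have "ctr_sq P j \<in> borel_measurable P" using poly_bdd_ctr_sq[OF j] by (simp add: poly_bdd_def)
  ultimately show ?thesis using abs_moment_le_one_plus[OF i6 _ r] by simp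
qed

definition depends_on :: "nat set \<Rightarrow> (rvec \<Rightarrow> real) \<Rightarrow> bool" where
  "depends_on A g \<longleftrightarrow> (\<forall>x y. (\<forall>i\<in>A. x i = y i) \<longrightarrow> g x = g y)"

text \<open>Only the extreme indices matter: A lies in {1..Max A} and B in {Min B..p}, and these two
  blocks are separated by more than \<open>K\<close>.\<close>

lemma expectation_mult_far:
  assumes g: "depends_on A g" "poly_bdd a g" "a \<le> 128" and h: "depends_on B h" "poly_bdd b h" "b \<le> 128"
    and AB: "A \<subseteq> {1..p}" "B \<subseteq> {1..p}" "\<And>i j. i \<in> A \<Longrightarrow> j \<in> B \<Longrightarrow> i + K < j"
  shows "expectation (\<lambda>x. g x * h x) = expectation g * expectation h"
proof -
  have ig: "integrable P g" and ih: "integrable P h"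
    using integrable_poly_bdd g h by auto
  have gm: "g \<in> borel_measurable (Rp p)" "h \<in> borel_measurable (Rp p)"
    using g(2) h(2) unfolding poly_bdd_def measurable_cong_sets[OF sets_P refl] by auto
  \<comment> \<open>Max and Min require nonempty sets; a function that depends on no coordinate is
    constant.\<close>
  consider "A = {}" | "B = {}" | "A \<noteq> {}" "B \<noteq> {}" by blast
  then show ?thesis
  proof cases
    case 1
    then have "g = (\<lambda>x. g undefined)" using g(1) unfolding depends_on_def by auto
    then obtain c where "g = (\<lambda>x. c)" by blast
    then show ?thesis by (simp add: prob_space)
  next
    case 2
    then have "h = (\<lambda>x. h undefined)" using h(1) unfolding depends_on_def by auto
    then obtain c where "h = (\<lambda>x. c)" by blast
    then show ?thesis by (simp add: prob_space)
  next
    case 3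
    have fin: "finite A" "finite B" using finite_subset[OF AB(1)] finite_subset[OF AB(2)] by auto
    define j where "j = Max A"
    define q where "q = Min B"
    have j: "j \<in> A" "A \<subseteq> {1..j}" using Max_in[OF fin(1) 3(1)] Max_ge[OF fin(1)] AB(1) unfolding j_def by auto
    have q: "q \<in> B" "B \<subseteq> {q..p}" using Min_in[OF fin(2) 3(2)] Min_le[OF fin(2)] AB(2) unfolding q_def by auto
    have jq: "1 \<le> j" "j + K < q" "q \<le> p"
      using AB(3)[OF j(1) q(1)] subsetD[OF AB(1) j(1)] subsetD[OF AB(2) q(1)] by auto
    \<comment> \<open>Padding with zeros turns a point of a block into a point of the full space.
      Composed with it, \<open>g\<close> and \<open>h\<close> become measurable functions of their
      blocks, and the padding is invisible to them.\<close>
    have proj: "(\<lambda>z. \<lambda>i\<in>{1..p}. if i \<in> C then z i else 0) \<in> (\<Pi>\<^sub>M i\<in>C. borel) \<rightarrow>\<^sub>M Rp p"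
      if "C \<subseteq> {1..p}" for C :: "nat set"
      unfolding Rp_def
    proof (rule measurable_restrict)
      fix i assume "i \<in> {1..p}"
      show "(\<lambda>z. if i \<in> C then z i else (0::real)) \<in> (\<Pi>\<^sub>M i\<in>C. borel) \<rightarrow>\<^sub>M borel"
        by (cases "i \<in> C") (auto intro: measurable_component_singleton)
    qed
    define g' where "g' z = g (\<lambda>i\<in>{1..p}. if i \<in> {1..j} then z i else 0)" for z
    define h' where "h' z = h (\<lambda>i\<in>{1..p}. if i \<in> {q..p} then z i else 0)" for z
    have g': "g' \<in> borel_measurable (\<Pi>\<^sub>M i\<in>{1..j}. borel)"
      unfolding g'_def using jq by (intro measurable_compose[OF proj gm(1)]) auto
    have h': "h' \<in> borel_measurable (\<Pi>\<^sub>M i\<in>{q..p}. borel)"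
      unfolding h'_def using jq by (intro measurable_compose[OF proj gm(2)]) auto
    have "indep_var borel (g' \<circ> (\<lambda>x. restrict x {1..j})) borel (h' \<circ> (\<lambda>x. restrict x {q..p}))"
      using far_indep[of j "q - j"] jq by (intro indep_var_compose[OF _ g' h']) auto
    moreover have "g' \<circ> (\<lambda>x. restrict x {1..j}) = g"
    proof
      fix x
      have "g (\<lambda>i\<in>{1..p}. if i \<in> {1..j} then restrict x {1..j} i else 0) = g x"
        using g(1)[unfolded depends_on_def, rule_format, of "\<lambda>i\<in>{1..p}. if i \<in> {1..j} then restrict x {1..j} i else 0" x]
          j(2) AB(1) by (auto simp: subset_eq)
      then show "(g' \<circ> (\<lambda>x. restrict x {1..j})) x = g x" by (simp add: g'_def del: One_nat_def)
    qed
    moreover have "h' \<circ> (\<lambda>x. restrict x {q..p}) = h"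
    proof
      fix x
      have "h (\<lambda>i\<in>{1..p}. if i \<in> {q..p} then restrict x {q..p} i else 0) = h x"
        using h(1)[unfolded depends_on_def, rule_format, of "\<lambda>i\<in>{1..p}. if i \<in> {q..p} then restrict x {q..p} i else 0" x]
          q(2) AB(2) by (auto simp: subset_eq)
      then show "(h' \<circ> (\<lambda>x. restrict x {q..p})) x = h x" by (simp add: h'_def del: One_nat_def)
    qed
    ultimately have "indep_var borel g borel h" by simp
    then show ?thesis by (rule indep_var_lebesgue_integral[OF _ ig ih])
  qed
qed

lemma depends_on_ctr: "j \<in> A \<Longrightarrow> depends_on A (ctr P j)"
  by (simp add: depends_on_def ctr_def)

lemma depends_on_ctr_sq: "j \<in> A \<Longrightarrow> depends_on A (ctr_sq P j)"
  by (simp add: depends_on_def ctr_sq_def ctr_def)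

lemma depends_on_sum: "(\<And>i. i \<in> I \<Longrightarrow> depends_on A (g i)) \<Longrightarrow> depends_on A (\<lambda>x. \<Sum>i\<in>I. g i x)"
  unfolding depends_on_def by (intro allI impI sum.cong) auto

lemma depends_on_mult: "depends_on A g \<Longrightarrow> depends_on A h \<Longrightarrow> depends_on A (\<lambda>x. g x * h x)"
  unfolding depends_on_def by metis

lemma depends_on_power: "depends_on A g \<Longrightarrow> depends_on A (\<lambda>x. g x ^ k)"
  unfolding depends_on_def by metis

text \<open>Induction adds the largest index, whose summand is independent of the sum so far, and
  expands the power binomially. The orders 2, 4 and 6 are proved together because each step uses the
  lower ones. The constants close the induction: 6 = 3 * 2 in order 4, and 3 * 35 = 15 * 3 + 20 * 3
  in the quadratic coefficient of order 6.\<close>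

lemma moments_gapped:
  assumes J: "finite J" "J \<subseteq> {1..p}" "\<And>i j. i \<in> J \<Longrightarrow> j \<in> J \<Longrightarrow> i < j \<Longrightarrow> i + K < j"
  defines "S \<equiv> \<lambda>x. \<Sum>j\<in>J. ctr_sq P j x"
  shows "expectation (\<lambda>x. S x ^ 2) \<le> Bw * real (card J)
    \<and> expectation (\<lambda>x. S x ^ 4) \<le> 3 * Bw\<^sup>2 * real (card J) ^ 2
    \<and> expectation (\<lambda>x. S x ^ 6) \<le> 35 * Bw ^ 3 * real (card J) ^ 3"
  using J unfolding S_def
proof (induction J rule: finite_linorder_max_induct)
  case empty
  then show ?case by simp
next
  case (insert b J)
  let ?S = "\<lambda>x. \<Sum>j\<in>J. ctr_sq P j x" and ?w = "ctr_sq P b"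
  define n where "n = real (card J)"
  have b: "b \<in> {1..p}" and J: "J \<subseteq> {1..p}" and bJ: "b \<notin> J" using insert by auto
  have pS: "poly_bdd 2 ?S" using J by (intro poly_bdd_sum poly_bdd_ctr_sq) auto
  have pw: "poly_bdd 2 ?w" by (rule poly_bdd_ctr_sq[OF b])
  have intg: "integrable P (\<lambda>x. ?S x ^ i * ?w x ^ j)" if "i \<le> 6" "j \<le> 6" for i j
    using that by (intro integrable_poly_bdd[OF poly_bdd_mult[OF poly_bdd_power[OF pS] poly_bdd_power[OF pw]]]) auto
  have prod: "expectation (\<lambda>x. ?S x ^ i * ?w x ^ j) = expectation (\<lambda>x. ?S x ^ i) * expectation (\<lambda>x. ?w x ^ j)"
    if "i \<le> 6" "j \<le> 6" for i j
  proof (rule expectation_mult_far[where A = J and B = "{b}"])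
    show "depends_on J (\<lambda>x. ?S x ^ i)"
      by (intro depends_on_power depends_on_sum depends_on_ctr_sq)
    show "depends_on {b} (\<lambda>x. ?w x ^ j)" by (intro depends_on_power depends_on_ctr_sq) simp
    show "poly_bdd (2 * i) (\<lambda>x. ?S x ^ i)" "poly_bdd (2 * j) (\<lambda>x. ?w x ^ j)"
      by (intro poly_bdd_power pS pw)+
    show "2 * i \<le> 128" "2 * j \<le> 128" using that by auto
    show "i' + K < j'" if "i' \<in> J" "j' \<in> {b}" for i' j'
      using insert.prems(2)[of i' b] insert.hyps(2) that by auto
  qed (use b J in auto)
  have w1: "expectation ?w = 0" by (rule expectation_ctr_sq[OF b])
  have S1: "expectation ?S = 0"
    using J integrable_poly_bdd[OF poly_bdd_ctr_sq] by (subst Bochner_Integration.integral_sum) (auto intro!: sum.neutral expectation_ctr_sq)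
  define s where "s i = expectation (\<lambda>x. ?S x ^ i)" for i
  define v where "v i = expectation (\<lambda>x. ?w x ^ i)" for i
  have v: "\<bar>v i\<bar> \<le> Bw" if "i \<le> 6" for i
  proof -
    have "\<bar>v i\<bar> \<le> expectation (\<lambda>x. \<bar>?w x ^ i\<bar>)" unfolding v_def by (rule integral_abs_bound)
    also have "\<dots> = expectation (\<lambda>x. \<bar>?w x\<bar> ^ i)" by (simp only: power_abs)
    also have "\<dots> \<le> Bw" by (rule ctr_sq_moment[OF b that])
    finally show ?thesis .
  qed
  have v1: "v 1 = 0" "s 1 = 0" "s 0 = 1" "v 0 = 1" using w1 S1 by (auto simp: v_def s_def prob_space)
  have IH: "s 2 \<le> Bw * n" "s 4 \<le> 3 * Bw\<^sup>2 * n\<^sup>2" "s 6 \<le> 35 * Bw ^ 3 * n ^ 3"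
    using insert.IH insert.prems unfolding s_def n_def by auto
  have s_nonneg: "0 \<le> s 2" "0 \<le> s 4" unfolding s_def by (auto intro!: integral_nonneg)
  \<comment> \<open>The third moment need not vanish, but |t|^3 \<le> t^2 + t^4 makes it O(n^2),
    which order 6 can absorb.\<close>
  have s3: "\<bar>s 3\<bar> \<le> s 2 + s 4"
  proof -
    have "\<bar>s 3\<bar> \<le> expectation (\<lambda>x. \<bar>?S x ^ 3\<bar>)" unfolding s_def by (rule integral_abs_bound)
    also have "\<dots> \<le> expectation (\<lambda>x. ?S x ^ 2 + ?S x ^ 4)"
    proof (rule Bochner_Integration.integral_mono)
      show "integrable P (\<lambda>x. \<bar>?S x ^ 3\<bar>)" using intg[of 3 0] by simp
      show "integrable P (\<lambda>x. ?S x ^ 2 + ?S x ^ 4)" using intg[of 2 0] intg[of 4 0] by simp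
      show "\<bar>?S x ^ 3\<bar> \<le> ?S x ^ 2 + ?S x ^ 4" for x
      proof -
        have "0 \<le> (\<bar>?S x\<bar> * (\<bar>?S x\<bar> - 1))\<^sup>2 + \<bar>?S x ^ 3\<bar>" by simp
        then show ?thesis by (simp add: power2_eq_square eval_nat_numeral abs_mult algebra_simps)
      qed
    qed
    also have "\<dots> = s 2 + s 4" unfolding s_def using intg[of 2 0] intg[of 4 0] by simp
    finally show ?thesis .
  qed
  have card: "real (card (insert b J)) = n + 1" using insert.hyps(1) bJ by (simp add: n_def)
  have sum_eq: "(\<Sum>j\<in>insert b J. ctr_sq P j x) = ?S x + ?w x" for x
    using insert.hyps(1) bJ by simp
  have expand: "expectation (\<lambda>x. (?S x + ?w x) ^ k) = (\<Sum>i\<le>k. real (k choose i) * (s i * v (k - i)))" if "k \<le> 6" for k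
  proof -
    have "expectation (\<lambda>x. (?S x + ?w x) ^ k) = expectation (\<lambda>x. \<Sum>i\<le>k. real (k choose i) * (?S x ^ i * ?w x ^ (k - i)))"
      by (simp add: binomial_ring mult_ac)
    also have "\<dots> = (\<Sum>i\<le>k. real (k choose i) * (s i * v (k - i)))"
      using that intg prod by (subst Bochner_Integration.integral_sum) (auto intro!: sum.cong simp: s_def v_def)
    finally show ?thesis .
  qed
  have e2: "expectation (\<lambda>x. (?S x + ?w x) ^ 2) = s 2 + v 2"
    using expand[of 2] v1 by (simp add: eval_nat_numeral)
  have e4: "expectation (\<lambda>x. (?S x + ?w x) ^ 4) = s 4 + 6 * (s 2 * v 2) + v 4"
    using expand[of 4] v1 by (simp add: eval_nat_numeral)
  have e6: "expectation (\<lambda>x. (?S x + ?w x) ^ 6) = s 6 + 15 * (s 4 * v 2) + 20 * (s 3 * v 3) + 15 * (s 2 * v 4) + v 6"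
    using expand[of 6] v1 by (simp add: eval_nat_numeral)
  have B: "1 \<le> Bw" by (rule Bw_ge_1)
  have n: "0 \<le> n" by (simp add: n_def)
  have vv: "v 2 \<le> Bw" "v 4 \<le> Bw" "v 6 \<le> Bw" "\<bar>v 3\<bar> \<le> Bw"
    using v[of 2] v[of 4] v[of 6] v[of 3] by auto
  have BB: "Bw \<le> Bw\<^sup>2" "Bw\<^sup>2 \<le> Bw ^ 3" "Bw \<le> Bw ^ 3"
    using B power_increasing[of 1 2 Bw] power_increasing[of 2 3 Bw] power_increasing[of 1 3 Bw] by auto
  have s2v: "s 2 * c \<le> Bw\<^sup>2 * n" if "c \<le> Bw" for c
  proof -
    have "s 2 * c \<le> s 2 * Bw" using s_nonneg that by (intro mult_left_mono) auto
    also have "\<dots> \<le> Bw * n * Bw" using IH B by (intro mult_right_mono) auto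
    finally show ?thesis by (simp add: power2_eq_square mult_ac)
  qed
  have s4v: "s 4 * c \<le> 3 * Bw ^ 3 * n\<^sup>2" if "c \<le> Bw" for c
  proof -
    have "s 4 * c \<le> s 4 * Bw" using s_nonneg that by (intro mult_left_mono) auto
    also have "\<dots> \<le> 3 * Bw\<^sup>2 * n\<^sup>2 * Bw" using IH B by (intro mult_right_mono) auto
    finally show ?thesis by (simp add: power2_eq_square power3_eq_cube mult_ac)
  qed
  have s3v: "s 3 * v 3 \<le> 3 * Bw ^ 3 * n\<^sup>2 + Bw\<^sup>2 * n"
  proof -
    have "s 3 * v 3 \<le> \<bar>s 3\<bar> * \<bar>v 3\<bar>" by (metis abs_ge_self abs_mult)
    also have "\<dots> \<le> (s 2 + s 4) * Bw" using s3 vv by (intro mult_mono) auto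
    also have "\<dots> \<le> 3 * Bw ^ 3 * n\<^sup>2 + Bw\<^sup>2 * n" using s2v[of Bw] s4v[of Bw] by (simp add: distrib_right)
    finally show ?thesis .
  qed
  have 2: "s 2 + v 2 \<le> Bw * (n + 1)" using IH vv by (simp add: algebra_simps)
  have 4: "s 4 + 6 * (s 2 * v 2) + v 4 \<le> 3 * Bw\<^sup>2 * (n + 1)\<^sup>2"
  proof -
    have "3 * Bw\<^sup>2 * (n + 1)\<^sup>2 = 3 * Bw\<^sup>2 * n\<^sup>2 + 6 * (Bw\<^sup>2 * n) + 3 * Bw\<^sup>2"
      by (simp add: power2_eq_square algebra_simps)
    then show ?thesis using IH(2) s2v[OF vv(1)] vv(2) BB B by linarith
  qed
  have 6: "s 6 + 15 * (s 4 * v 2) + 20 * (s 3 * v 3) + 15 * (s 2 * v 4) + v 6 \<le> 35 * Bw ^ 3 * (n + 1) ^ 3"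
  proof -
    have "35 * Bw ^ 3 * (n + 1) ^ 3 = 35 * Bw ^ 3 * n ^ 3 + 105 * (Bw ^ 3 * n\<^sup>2) + 105 * (Bw ^ 3 * n) + 35 * Bw ^ 3"
      by (simp add: power2_eq_square power3_eq_cube algebra_simps)
    moreover have "Bw\<^sup>2 * n \<le> Bw ^ 3 * n" using BB n by (intro mult_right_mono) auto
    moreover have "0 \<le> Bw ^ 3 * n" using B n by auto
    ultimately show ?thesis using IH(3) s2v[OF vv(2)] s4v[OF vv(1)] s3v vv(3) BB B by linarith
  qed
  show ?case unfolding sum_eq card e2 e4 e6 using 2 4 6 by simp
qed

end

definition third_moment :: "rvec measure \<Rightarrow> nat \<Rightarrow> nat \<Rightarrow> nat \<Rightarrow> real" where
  "third_moment P i j k = (\<integral>x. ctr P i x * ctr P j x * ctr P k x \<partial>P)"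

text \<open>The centred squared norm |x - E x|^2 - E |x - E x|^2.\<close>

definition sq_dev :: "rvec measure \<Rightarrow> nat \<Rightarrow> rvec \<Rightarrow> real" where
  "sq_dev P p x = (\<Sum>j=1..p. ctr_sq P j x)"

lemma abs_sum_le_of_support:
  fixes g :: "nat \<Rightarrow> real"
  assumes "finite I" "\<And>i. i \<in> I \<Longrightarrow> \<bar>g i\<bar> \<le> c" "\<And>i. i \<in> I \<Longrightarrow> i \<notin> N \<Longrightarrow> g i = 0" "finite N" "card N \<le> n" "0 \<le> c"
  shows "\<bar>\<Sum>i\<in>I. g i\<bar> \<le> real n * c"
proof -
  have "(\<Sum>i\<in>I. g i) = (\<Sum>i\<in>I \<inter> N. g i)" using assms by (intro sum.mono_neutral_right) auto
  then have "\<bar>\<Sum>i\<in>I. g i\<bar> \<le> (\<Sum>i\<in>I \<inter> N. \<bar>g i\<bar>)" by simp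
  also have "\<dots> \<le> real (card (I \<inter> N)) * c" using assms by (intro sum_bounded_above) auto
  also have "\<dots> \<le> real n * c"
    using assms card_mono[of N "I \<inter> N"] by (intro mult_right_mono) auto
  finally show ?thesis .
qed

context weak_dependence
begin

lemma poly_bdd_sq_dev: "poly_bdd 2 (sq_dev P p)"
  unfolding sq_dev_def[abs_def] by (intro poly_bdd_sum poly_bdd_ctr_sq) auto

lemma expectation_sq_dev: "expectation (sq_dev P p) = 0"
  unfolding sq_dev_def[abs_def] using integrable_poly_bdd[OF poly_bdd_ctr_sq]
  by (subst Bochner_Integration.integral_sum) (auto intro!: sum.neutral expectation_ctr_sq)

definition "Cu = real (K + 1) ^ 7 * (35 * Bw ^ 3)"

text \<open>The coordinates are divided into residue classes modulo K + 1. Within a class the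
  summands are independent of one another, so \<open>moments_gapped\<close> applies. In
  \<open>Cu\<close>, six factors K + 1 come from the power inequality and the seventh from the
  number of classes.\<close>

lemma sq_dev_moment: "expectation (\<lambda>x. sq_dev P p x ^ 6) \<le> Cu * real p ^ 3"
proof -
  define J where "J r = {j \<in> {1..p}. j mod (K + 1) = r}" for r
  define S where "S r x = (\<Sum>j\<in>J r. ctr_sq P j x)" for r x
  have fin: "finite (J r)" "J r \<subseteq> {1..p}" for r by (auto simp: J_def)
  have gap: "i + K < j" if "i \<in> J r" "j \<in> J r" "i < j" for i j r
  proof -
    have "(K + 1) dvd (j - i)" using that by (simp add: J_def mod_eq_dvd_iff_nat[symmetric])
    then have "K + 1 \<le> j - i" using that by (intro dvd_imp_le) auto
    then show ?thesis using that by simp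
  qed
  have split: "sq_dev P p x = (\<Sum>r\<in>{..<K+1}. S r x)" for x
    unfolding sq_dev_def S_def J_def by (rule sum.group[symmetric]) auto
  have S6: "expectation (\<lambda>x. S r x ^ 6) \<le> 35 * Bw ^ 3 * real p ^ 3" for r
  proof -
    have "expectation (\<lambda>x. S r x ^ 6) \<le> 35 * Bw ^ 3 * real (card (J r)) ^ 3"
      unfolding S_def using moments_gapped[of "J r"] fin gap by blast
    also have "\<dots> \<le> 35 * Bw ^ 3 * real p ^ 3"
      using card_mono[OF _ fin(2)[of r]] Bw_ge_1 by (intro mult_left_mono power_mono) auto
    finally show ?thesis .
  qed
  have iS: "integrable P (\<lambda>x. S r x ^ 6)" for r
    unfolding S_def using fin(2)[of r]
    by (intro integrable_poly_bdd[OF poly_bdd_power[OF poly_bdd_sum[OF poly_bdd_ctr_sq]]]) auto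
  have "expectation (\<lambda>x. sq_dev P p x ^ 6) \<le> expectation (\<lambda>x. real (K + 1) ^ 6 * (\<Sum>r\<in>{..<K+1}. S r x ^ 6))"
  proof (rule Bochner_Integration.integral_mono)
    show "integrable P (\<lambda>x. sq_dev P p x ^ 6)"
      by (rule integrable_poly_bdd[OF poly_bdd_power[OF poly_bdd_sq_dev]]) simp
    show "integrable P (\<lambda>x. real (K + 1) ^ 6 * (\<Sum>r\<in>{..<K+1}. S r x ^ 6))" using iS by auto
    show "sq_dev P p x ^ 6 \<le> real (K + 1) ^ 6 * (\<Sum>r\<in>{..<K+1}. S r x ^ 6)" for x
      unfolding split using sum_power_le_card_power[of "{..<K+1}" 6 "\<lambda>r. S r x"]
      by (simp del: sum.lessThan_Suc)
  qed
  also have "\<dots> = real (K + 1) ^ 6 * (\<Sum>r\<in>{..<K+1}. expectation (\<lambda>x. S r x ^ 6))"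
    using iS by simp
  also have "\<dots> \<le> real (K + 1) ^ 6 * (real (card {..<K+1}) * (35 * Bw ^ 3 * real p ^ 3))"
    using S6 by (intro mult_left_mono sum_bounded_above) auto
  also have "\<dots> = Cu * real p ^ 3" unfolding Cu_def by (simp add: eval_nat_numeral mult_ac)
  finally show ?thesis .
qed

lemma expectation_isolated:
  assumes i: "i \<in> {1..p}" and w: "depends_on {i} w" "poly_bdd a w" "a \<le> 128" "expectation w = 0"
    and F: "depends_on A F" "poly_bdd b F" "b \<le> 128" and A: "A \<subseteq> {1..p}"
    and far: "(\<forall>j\<in>A. i + K < j) \<or> (\<forall>j\<in>A. j + K < i)"
  shows "expectation (\<lambda>x. w x * F x) = 0"
  using far
proof
  assume "\<forall>j\<in>A. i + K < j"
  then show ?thesis using expectation_mult_far[OF w(1-3) F _ A] i w(4) by auto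
next
  assume "\<forall>j\<in>A. j + K < i"
  then have "expectation (\<lambda>x. F x * w x) = expectation F * expectation w"
    using i by (intro expectation_mult_far[OF F w(1-3) A]) auto
  then show ?thesis using w(4) by (simp add: mult.commute)
qed

lemma third_moment_commute: "third_moment P i j k = third_moment P j i k"
    "third_moment P i j k = third_moment P i k j"
  unfolding third_moment_def by (simp_all add: mult_ac)

lemma third_moment_sorted_far:
  assumes ijk: "i \<in> {1..p}" "j \<in> {1..p}" "k \<in> {1..p}" "i \<le> j" "j \<le> k" and far: "i + K < j \<or> j + K < k"
  shows "third_moment P i j k = 0"
  using far
proof
  note pb = poly_bdd_mult[OF poly_bdd_ctr poly_bdd_ctr]
  have dep: "depends_on {a, b} (\<lambda>x. ctr P a x * ctr P b x)" for a b
    by (intro depends_on_mult depends_on_ctr) auto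
  {
    assume "i + K < j"
    then have "expectation (\<lambda>x. ctr P i x * (ctr P j x * ctr P k x)) = 0"
      using ijk by (intro expectation_isolated[OF _ depends_on_ctr poly_bdd_ctr _ expectation_ctr dep pb]) auto
    then show ?thesis by (simp add: third_moment_def mult_ac)
  next
    assume "j + K < k"
    then have "expectation (\<lambda>x. ctr P k x * (ctr P i x * ctr P j x)) = 0"
      using ijk by (intro expectation_isolated[OF _ depends_on_ctr poly_bdd_ctr _ expectation_ctr dep pb]) auto
    then show ?thesis by (simp add: third_moment_def mult_ac)
  }
qed

text \<open>After sorting, an outer index separated from the middle one by more than
  \<open>K\<close> splits off a centred factor. Hence both adjacent gaps are at most
  \<open>K\<close>, and any two indices differ by at most 2K.\<close>

lemma third_moment_near:
  assumes ijk: "i \<in> {1..p}" "j \<in> {1..p}" "k \<in> {1..p}" and nz: "third_moment P i j k \<noteq> 0"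
  shows "i \<le> j + 2 * K \<and> j \<le> i + 2 * K \<and> i \<le> k + 2 * K \<and> k \<le> i + 2 * K \<and> j \<le> k + 2 * K \<and> k \<le> j + 2 * K"
proof -
  have *: "b \<le> a + K \<and> c \<le> b + K" if "third_moment P a b c \<noteq> 0" "a \<le> b" "b \<le> c"
    "a \<in> {1..p}" "b \<in> {1..p}" "c \<in> {1..p}" for a b c
    using third_moment_sorted_far[of a b c] that by (meson not_le)
  consider "i \<le> j" "j \<le> k" | "i \<le> k" "k \<le> j" | "j \<le> i" "i \<le> k" | "j \<le> k" "k \<le> i" | "k \<le> i" "i \<le> j" | "k \<le> j" "j \<le> i"
    by linarith
  then show ?thesis
  proof cases
    case 1 then show ?thesis using *[of i j k] nz ijk by simp
  next
    case 2 then show ?thesis using *[of i k j] nz ijk third_moment_commute(2)[of i j k] by simp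
  next
    case 3 then show ?thesis using *[of j i k] nz ijk third_moment_commute(1)[of i j k] by simp
  next
    case 4 then show ?thesis using *[of j k i] nz ijk third_moment_commute(1)[of i j k] third_moment_commute(2)[of j i k] by simp
  next
    case 5 then show ?thesis using *[of k i j] nz ijk third_moment_commute(2)[of i j k] third_moment_commute(1)[of i k j] by simp
  next
    case 6 then show ?thesis using *[of k j i] nz ijk third_moment_commute(1)[of i j k] third_moment_commute(2)[of j i k]
        third_moment_commute(1)[of j k i] by simp
  qed
qed

text \<open>Only the \<open>O(1)\<close> summands of \<open>sq_dev\<close> near the support of \<open>F\<close> are correlated with \<open>F\<close>.\<close>

lemma expectation_sq_dev_mult:
  assumes F: "depends_on {lo..hi} F" "poly_bdd b F" "b \<le> 64" and lh: "1 \<le> lo" "lo \<le> hi" "hi \<le> p"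
    and C: "expectation (\<lambda>x. (F x)\<^sup>2) \<le> C"
  shows "\<bar>expectation (\<lambda>x. sq_dev P p x * F x)\<bar> \<le> real (hi - lo + 1 + 2 * K) * (Bw + C)"
proof -
  have int: "integrable P (\<lambda>x. ctr_sq P i x * F x)" if "i \<in> {1..p}" for i
    using F(3) by (intro integrable_poly_bdd[OF poly_bdd_mult[OF poly_bdd_ctr_sq[OF that] F(2)]]) simp
  have iF: "integrable P (\<lambda>x. (F x)\<^sup>2)"
    using F(3) by (intro integrable_poly_bdd[OF poly_bdd_power[OF F(2)]]) simp
  have "expectation (\<lambda>x. sq_dev P p x * F x) = (\<Sum>i=1..p. expectation (\<lambda>x. ctr_sq P i x * F x))"
    unfolding sq_dev_def sum_distrib_right using int by (intro Bochner_Integration.integral_sum) auto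
  also have "\<bar>\<dots>\<bar> \<le> real (hi - lo + 1 + 2 * K) * (Bw + C)"
  proof (rule abs_sum_le_of_support[where N = "{lo - K..hi + K}"])
    fix i assume i: "i \<in> {1..p}"
    have iw: "integrable P (\<lambda>x. (ctr_sq P i x)\<^sup>2)"
      by (rule integrable_poly_bdd[OF poly_bdd_power[OF poly_bdd_ctr_sq[OF i]]]) simp
    have "\<bar>expectation (\<lambda>x. ctr_sq P i x * F x)\<bar> \<le> expectation (\<lambda>x. \<bar>ctr_sq P i x * F x\<bar>)"
      by (rule integral_abs_bound)
    also have "\<dots> \<le> expectation (\<lambda>x. (ctr_sq P i x)\<^sup>2 + (F x)\<^sup>2)"
    proof (rule Bochner_Integration.integral_mono)
      show "integrable P (\<lambda>x. \<bar>ctr_sq P i x * F x\<bar>)" using int[OF i] by simp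
      show "integrable P (\<lambda>x. (ctr_sq P i x)\<^sup>2 + (F x)\<^sup>2)" using iF iw by simp
      show "\<bar>ctr_sq P i x * F x\<bar> \<le> (ctr_sq P i x)\<^sup>2 + (F x)\<^sup>2" for x
      proof -
        have "0 \<le> (\<bar>ctr_sq P i x\<bar> - \<bar>F x\<bar>)\<^sup>2 + \<bar>ctr_sq P i x * F x\<bar>" by simp
        then show ?thesis by (simp add: power2_diff abs_mult mult_ac)
      qed
    qed
    also have "\<dots> = expectation (\<lambda>x. (ctr_sq P i x)\<^sup>2) + expectation (\<lambda>x. (F x)\<^sup>2)" using iF iw by simp
    also have "\<dots> \<le> Bw + C" using ctr_sq_moment[OF i, of 2] C by simp
    finally show "\<bar>expectation (\<lambda>x. ctr_sq P i x * F x)\<bar> \<le> Bw + C" .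
    assume "i \<notin> {lo - K..hi + K}"
    then show "expectation (\<lambda>x. ctr_sq P i x * F x) = 0"
      using i lh F by (intro expectation_isolated[OF i depends_on_ctr_sq poly_bdd_ctr_sq _ expectation_ctr_sq F(1,2)]) auto
  next
    have "0 \<le> expectation (\<lambda>x. (F x)\<^sup>2)" by simp
    then show "0 \<le> Bw + C" using C Bw_ge_1 by linarith
  qed (use lh in auto)
  finally show ?thesis .
qed

text \<open>A partition of three elements with more than one block has a singleton block, since
  blocks of size at least 2 would give 2 (card \<pi>) \<le> 3. A singleton contributes the mean of a
  centred variable, which is 0, so only the one-block term survives.\<close>

lemma cumulant_3:
  assumes ijk: "i \<in> {1..p}" "j \<in> {1..p}" "k \<in> {1..p}"
  shows "cumulant P [ctr P i, ctr P j, ctr P k] = third_moment P i j k"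
proof -
  define gs where "gs = [ctr P i, ctr P j, ctr P k]"
  define h where "h \<pi> = (-1) ^ (card \<pi> - 1) * fact (card \<pi> - 1) * (\<Prod>B\<in>\<pi>. expectation (\<lambda>x. \<Prod>i\<in>B. (gs ! i) x))"
    for \<pi> :: "nat set set"
  have zero: "expectation (gs ! a) = 0" if "a < 3" for a
    using that ijk expectation_ctr by (auto simp: gs_def less_Suc_eq numeral_3_eq_3)
  have "cumulant P gs = (\<Sum>\<pi> | partition_on {..<3} \<pi>. h \<pi>)"
  proof -
    have "length gs = 3" by (simp add: gs_def)
    then show ?thesis unfolding cumulant_def h_def by simp
  qed
  also have "\<dots> = (\<Sum>\<pi>\<in>{{{..<3}}}. h \<pi>)"
  proof (rule sum.mono_neutral_right)
    show "finite {\<pi>. partition_on {..<3::nat} \<pi>}" by (rule finitely_many_partition_on) simp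
    show "{{{..<3}}} \<subseteq> {\<pi>. partition_on {..<3::nat} \<pi>}"
      using lessThan_empty_iff[of "3::nat"] by (auto simp: partition_on_def disjoint_def simp del: lessThan_empty_iff)
    show "\<forall>\<pi>\<in>{\<pi>. partition_on {..<3::nat} \<pi>} - {{{..<3}}}. h \<pi> = 0"
    proof
      fix \<pi> assume "\<pi> \<in> {\<pi>. partition_on {..<3::nat} \<pi>} - {{{..<3}}}"
      then have \<pi>: "partition_on {..<3::nat} \<pi>" "\<pi> \<noteq> {{..<3}}" by auto
      have fin: "finite \<pi>" using \<pi>(1) finite_elements by blast
      have finB: "finite B" "B \<noteq> {}" "B \<subseteq> {..<3}" if "B \<in> \<pi>" for B
        using \<pi>(1) that finite_subset[of B "{..<3}"] by (auto simp: partition_on_def)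
      have "\<exists>B\<in>\<pi>. card B = 1"
      proof (rule ccontr)
        assume "\<not> ?thesis"
        then have two: "2 \<le> card B" if "B \<in> \<pi>" for B
          using that finB[OF that] card_gt_0_iff[of B] by (metis One_nat_def Suc_leI le_neq_implies_less numeral_2_eq_2)
        have "(\<Sum>B\<in>\<pi>. card B) = card (\<Union>\<pi>)"
          using \<pi>(1) finB by (intro card_Union_disjoint[symmetric]) (auto simp: partition_on_def)
        also have "\<dots> = 3" using \<pi>(1) by (simp add: partition_on_def)
        finally have sum3: "(\<Sum>B\<in>\<pi>. card B) = 3" .
        have "2 * card \<pi> \<le> 3" using sum_bounded_below[of \<pi> 2 card] two sum3 by (simp add: mult.commute)
        then have "card \<pi> \<le> 1" by simp
        moreover have "\<pi> \<noteq> {}" using sum3 by auto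
        ultimately have "card \<pi> = 1" using fin by (simp add: le_Suc_eq)
        then obtain B where "\<pi> = {B}" by (auto simp: card_1_singleton_iff)
        then have "\<pi> = {{..<3}}" using \<pi>(1) by (simp add: partition_on_def)
        then show False using \<pi>(2) by simp
      qed
      then obtain B where B: "B \<in> \<pi>" "card B = 1" by blast
      then obtain a where a: "B = {a}" by (auto simp: card_1_singleton_iff)
      then have "a < 3" using finB[OF B(1)] by auto
      then have "expectation (\<lambda>x. \<Prod>i\<in>B. (gs ! i) x) = 0" using zero a by simp
      then have "(\<Prod>B\<in>\<pi>. expectation (\<lambda>x. \<Prod>i\<in>B. (gs ! i) x)) = 0" using B(1) fin by (auto intro: prod_zero)
      then show "h \<pi> = 0" by (simp add: h_def)
    qed
  qed
  also have "\<dots> = third_moment P i j k"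
  proof -
    have "{..<3::nat} = {0, 1, 2}" by auto
    then show ?thesis by (simp add: h_def gs_def third_moment_def mult_ac)
  qed
  finally show ?thesis by (simp add: gs_def)
qed

lemma cov_sq_ctr:
  assumes "i \<in> {1..p}" "j \<in> {1..p}"
  shows "cov P (ctr_sq P i) (ctr P j) = third_moment P i i j"
proof -
  have "cov P (ctr_sq P i) (ctr P j) = expectation (\<lambda>x. ctr P i x * ctr P i x * ctr P j x - cov_matrix P i i * ctr P j x)"
    unfolding cov_def expectation_ctr[OF assms(2)] expectation_ctr_sq[OF assms(1)]
    by (simp add: ctr_sq_def power2_eq_square algebra_simps)
  also have "\<dots> = third_moment P i i j - cov_matrix P i i * expectation (ctr P j)"
    using integrable_poly_bdd[OF poly_bdd_ctr[OF assms(2)]]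
      integrable_poly_bdd[OF poly_bdd_mult[OF poly_bdd_mult[OF poly_bdd_ctr[OF assms(1)] poly_bdd_ctr[OF assms(1)]] poly_bdd_ctr[OF assms(2)]]]
    unfolding third_moment_def by (subst Bochner_Integration.integral_diff) auto
  finally show ?thesis by (simp add: expectation_ctr[OF assms(2)])
qed

text \<open>Identifies the third quantity of the assumptions with the variance of |x - E x|^2, the
  form in which a test potential can detect it.\<close>

lemma sum_cov_sq_sq:
  "(\<Sum>i=1..p. \<Sum>j=1..p. cov P (ctr_sq P i) (ctr_sq P j)) = expectation (\<lambda>x. (sq_dev P p x)\<^sup>2)"
proof -
  have int: "integrable P (\<lambda>x. ctr_sq P i x * ctr_sq P j x)" if "i \<in> {1..p}" "j \<in> {1..p}" for i j
    by (rule integrable_poly_bdd[OF poly_bdd_mult[OF poly_bdd_ctr_sq[OF that(1)] poly_bdd_ctr_sq[OF that(2)]]]) simp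
  have "expectation (\<lambda>x. (sq_dev P p x)\<^sup>2) = expectation (\<lambda>x. \<Sum>i=1..p. \<Sum>j=1..p. ctr_sq P i x * ctr_sq P j x)"
    unfolding sq_dev_def power2_eq_square sum_product ..
  also have "\<dots> = (\<Sum>i=1..p. expectation (\<lambda>x. \<Sum>j=1..p. ctr_sq P i x * ctr_sq P j x))"
    using int by (intro Bochner_Integration.integral_sum Bochner_Integration.integrable_sum) auto
  also have "\<dots> = (\<Sum>i=1..p. \<Sum>j=1..p. expectation (\<lambda>x. ctr_sq P i x * ctr_sq P j x))"
    using int by (intro sum.cong refl Bochner_Integration.integral_sum) auto
  also have "\<dots> = (\<Sum>i=1..p. \<Sum>j=1..p. cov P (ctr_sq P i) (ctr_sq P j))"
    unfolding cov_def by (intro sum.cong refl) (simp add: expectation_ctr_sq)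
  finally show ?thesis by simp
qed

end

section \<open>Expansion of test potentials\<close>

lemma edist_sq: "(edist p x y)\<^sup>2 = (\<Sum>j=1..p. (x j - y j)\<^sup>2)"
  unfolding edist_def L2_set_def by (simp add: sum_nonneg)

text \<open>All that the test potentials need from the kernel: a quartic in L with coefficients
  \<open>c\<close> and an O(L^5) remainder. \<open>A\<close> and \<open>c\<close> are parameters so
  that two laws can be expanded with the same ones.\<close>

locale radial_expansion = weak_dependence P p K U for P p K U +
  fixes k :: "rvec \<Rightarrow> rvec \<Rightarrow> real" and A L0 U0 R :: real and c :: "nat \<Rightarrow> real"
  assumes A_eq: "A = 2 * (\<Sum>j=1..p. cov_matrix P j j)"
    and L0: "0 < L0" "L0 * real p \<le> A" and U0: "A \<le> U0 * real p"
    and k_measurable: "\<And>z. z \<in> space (Rp p) \<Longrightarrow> (\<lambda>x. k x z) \<in> borel_measurable (Rp p)"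
    and k_approx: "\<And>x z L. x \<in> space (Rp p) \<Longrightarrow> z \<in> space (Rp p) \<Longrightarrow> L = (edist p x z)\<^sup>2 / A - 1 \<Longrightarrow>
      \<bar>k x z - (c 0 + c 1 * L + c 2 * L\<^sup>2 + c 3 * L ^ 3 + c 4 * L ^ 4)\<bar> \<le> R * \<bar>L\<bar> ^ 5"
    and R: "0 \<le> R" "\<bar>c 4\<bar> \<le> R" "\<bar>c 3\<bar> \<le> R"
begin

abbreviation "q \<equiv> sqrt (real p)"

lemma q: "1 \<le> q" "q\<^sup>2 = real p" "0 < q" using p_pos by simp_all

lemma A_pos: "0 < A"
proof -
  have "0 < L0 * real p" using L0 p_pos by simp
  then show ?thesis using L0 by linarith
qed

lemma U0_pos: "0 < U0"
proof -
  have "0 < U0 * real p" using A_pos U0 by linarith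
  then show ?thesis using p_pos by (simp add: zero_less_mult_iff)
qed

text \<open>A / 2 is the trace of the covariance matrix. A test point at squared distance A / 2 from
  the mean therefore contributes as much as x does on average, and the subtracted 1 leaves no
  constant beyond \<tau>.\<close>

lemma dist_eq:
  assumes "(\<Sum>j=1..p. (e j)\<^sup>2) = A / 2 + \<tau>"
  shows "(edist p x (\<lambda>j\<in>{1..p}. mean P j + e j))\<^sup>2 / A - 1
    = (sq_dev P p x + \<tau> - 2 * (\<Sum>j=1..p. ctr P j x * e j)) / A"
proof -
  have "(edist p x (\<lambda>j\<in>{1..p}. mean P j + e j))\<^sup>2
      = (\<Sum>j=1..p. ctr_sq P j x + cov_matrix P j j - 2 * (ctr P j x * e j) + (e j)\<^sup>2)"
    unfolding edist_sq by (intro sum.cong refl) (simp add: ctr_sq_def ctr_def power2_eq_square algebra_simps)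
  also have "\<dots> = sq_dev P p x + A / 2 - 2 * (\<Sum>j=1..p. ctr P j x * e j) + (A / 2 + \<tau>)"
    unfolding sum.distrib sum_subtractf assms sum_distrib_left[symmetric] by (simp add: sq_dev_def A_eq)
  finally show ?thesis using A_pos by (simp add: field_simps)
qed

text \<open>In \<open>Cw\<close>, 64 = 2^6 splits a sum of two terms and 2188 = 3^7 + 1 bounds a sum
  of three centred coordinates together with a single one. In \<open>CL\<close>, 3^6 splits the
  three summands of L and 64 = 2^6 comes from the factor -2.\<close>

definition "Cw = 64 * (U0 + 1) ^ 3 * (2188 * Bc)"
definition "CL = 3 ^ 6 * (Cu + 1 + 64 * Cw) / L0 ^ 6"

lemma Cu_nonneg: "0 \<le> Cu"
  unfolding Cu_def using Bw_ge_1 by (intro mult_nonneg_nonneg) auto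

lemma Cw_nonneg: "0 \<le> Cw"
  unfolding Cw_def using Bc_ge_1 U0_pos by simp

lemma CL_nonneg: "0 \<le> CL"
  unfolding CL_def using Cu_nonneg Cw_nonneg L0 by simp

text \<open>The numerator has sixth moment O(p^3) and A has order p. Lower orders follow by applying
  t^r \<le> 1 + t^6 to q |L|. The restriction on \<tau> lets the radius vary only on the scale on
  which |x - E x|^2 fluctuates anyway.\<close>

lemma L_moment:
  fixes W :: "rvec \<Rightarrow> real"
  assumes W: "poly_bdd 1 W" "expectation (\<lambda>x. W x ^ 6) \<le> Cw * real p ^ 3" and \<tau>: "\<bar>\<tau>\<bar> \<le> q" and r: "r \<le> 6"
  defines "L \<equiv> \<lambda>x. (sq_dev P p x + \<tau> - 2 * W x) / A"
  shows "integrable P (\<lambda>x. \<bar>L x\<bar> ^ r)" and "expectation (\<lambda>x. \<bar>L x\<bar> ^ r) \<le> (1 + CL) / q ^ r"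
proof -
  note pbs = poly_bdd_diff[OF poly_bdd_add[OF poly_bdd_sq_dev poly_bdd_const] poly_bdd_cmult[OF W(1)]]
  have pbL: "poly_bdd 2 L"
    using poly_bdd_cmult[OF pbs, of "1 / A" \<tau> 2] unfolding L_def by (simp add: numeral_2_eq_2)
  have int: "integrable P (\<lambda>x. \<bar>L x\<bar> ^ i)" if "i \<le> 6" for i
    using that by (intro integrable_poly_bdd[OF poly_bdd_power[OF poly_bdd_abs[OF pbL]]]) simp
  show "integrable P (\<lambda>x. \<bar>L x\<bar> ^ r)" by (rule int[OF r])
  have iu: "integrable P (\<lambda>x. sq_dev P p x ^ 6)" "integrable P (\<lambda>x. W x ^ 6)"
    by (rule integrable_poly_bdd[OF poly_bdd_power[OF poly_bdd_sq_dev]] integrable_poly_bdd[OF poly_bdd_power[OF W(1)]], simp)+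
  have Ap: "(L0 * real p) ^ 6 \<le> A ^ 6" using L0 by (intro power_mono) auto
  have Lp: "0 < (L0 * real p) ^ 6" using L0 p_pos by simp
  have pw: "\<bar>L x\<bar> ^ 6 \<le> 3 ^ 6 * (sq_dev P p x ^ 6 + real p ^ 3 + 64 * W x ^ 6) / (L0 * real p) ^ 6" for x
  proof -
    have "\<bar>sq_dev P p x + \<tau> - 2 * W x\<bar> ^ 6 \<le> 3 ^ 6 * (sq_dev P p x ^ 6 + \<tau> ^ 6 + 64 * W x ^ 6)"
      using sum_power_le_card_power[of "{0,1,2::nat}" 6 "\<lambda>i. if i = 0 then sq_dev P p x else if i = 1 then \<tau> else - 2 * W x"]
      by (simp add: power_mult_distrib add.assoc add_diff_eq)
    also have "\<tau> ^ 6 \<le> real p ^ 3"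
    proof -
      have "\<tau> ^ 6 = \<bar>\<tau>\<bar> ^ 6" by simp
      also have "\<dots> \<le> q ^ 6" using \<tau> by (intro power_mono) auto
      also have "\<dots> = (q\<^sup>2) ^ 3" by (simp only: power_mult[symmetric]) simp
      finally show ?thesis by (simp only: q)
    qed
    finally have *: "\<bar>sq_dev P p x + \<tau> - 2 * W x\<bar> ^ 6 \<le> 3 ^ 6 * (sq_dev P p x ^ 6 + real p ^ 3 + 64 * W x ^ 6)" by simp
    have "\<bar>L x\<bar> ^ 6 = \<bar>sq_dev P p x + \<tau> - 2 * W x\<bar> ^ 6 / A ^ 6"
      using A_pos by (simp add: L_def power_divide)
    also have "\<dots> \<le> 3 ^ 6 * (sq_dev P p x ^ 6 + real p ^ 3 + 64 * W x ^ 6) / (L0 * real p) ^ 6"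
      using * Ap Lp by (intro frac_le) auto
    finally show ?thesis .
  qed
  have "expectation (\<lambda>x. \<bar>L x\<bar> ^ 6) \<le> expectation (\<lambda>x. 3 ^ 6 * (sq_dev P p x ^ 6 + real p ^ 3 + 64 * W x ^ 6) / (L0 * real p) ^ 6)"
    by (intro Bochner_Integration.integral_mono pw) (use iu int[of 6] in auto)
  also have "\<dots> = 3 ^ 6 * (expectation (\<lambda>x. sq_dev P p x ^ 6) + real p ^ 3 + 64 * expectation (\<lambda>x. W x ^ 6)) / (L0 * real p) ^ 6"
    using iu by (simp add: prob_space)
  also have "\<dots> \<le> 3 ^ 6 * (Cu * real p ^ 3 + real p ^ 3 + 64 * (Cw * real p ^ 3)) / (L0 * real p) ^ 6"
    using Lp sq_dev_moment W(2) by (intro divide_right_mono mult_left_mono add_mono) auto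
  also have "\<dots> = CL / real p ^ 3"
    using p_pos L0 by (simp add: CL_def field_simps power_mult_distrib eval_nat_numeral)
  finally have m6: "expectation (\<lambda>x. \<bar>L x\<bar> ^ 6) \<le> CL / real p ^ 3" .
  have q6: "q ^ 6 = real p ^ 3"
  proof -
    have "q ^ 6 = (q\<^sup>2) ^ 3" by (simp only: power_mult[symmetric]) simp
    then show ?thesis by (simp only: q)
  qed
  have "expectation (\<lambda>x. q ^ r * \<bar>L x\<bar> ^ r) \<le> expectation (\<lambda>x. 1 + q ^ 6 * \<bar>L x\<bar> ^ 6)"
  proof (rule Bochner_Integration.integral_mono)
    show "q ^ r * \<bar>L x\<bar> ^ r \<le> 1 + q ^ 6 * \<bar>L x\<bar> ^ 6" for x
      using power_le_one_plus[OF r, of "q * L x"] q by (simp add: abs_mult power_mult_distrib)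
  qed (use int[OF r] int[of 6] in auto)
  also have "\<dots> = 1 + q ^ 6 * expectation (\<lambda>x. \<bar>L x\<bar> ^ 6)" using int[of 6] by (simp add: prob_space)
  also have "\<dots> \<le> 1 + CL"
    using m6 p_pos unfolding q6 by (simp add: field_simps)
  finally show "expectation (\<lambda>x. \<bar>L x\<bar> ^ r) \<le> (1 + CL) / q ^ r"
    using q int[OF r] by (simp add: field_simps)
qed

text \<open>Two precisions are offered. Keeping the quartic term leaves an error of order p^(-5/2),
  as the cubic test requires; moving it into the error gives p^(-2), which is enough for the test
  with two radii.\<close>

lemma test_function_expansion:
  fixes e :: "'l \<Rightarrow> nat \<Rightarrow> real" and g \<tau> :: "'l \<Rightarrow> real"
  assumes J: "finite J"
    and e: "\<And>l. l \<in> J \<Longrightarrow> (\<Sum>j=1..p. (e l j)\<^sup>2) = A / 2 + \<tau> l" and \<tau>: "\<And>l. l \<in> J \<Longrightarrow> \<bar>\<tau> l\<bar> \<le> q"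
    and W6: "\<And>l. l \<in> J \<Longrightarrow> expectation (\<lambda>x. (\<Sum>j=1..p. ctr P j x * e l j) ^ 6) \<le> Cw * real p ^ 3"
  defines "z \<equiv> \<lambda>l. \<lambda>j\<in>{1..p}. mean P j + e l j"
    and "L \<equiv> \<lambda>l x. (sq_dev P p x + \<tau> l - 2 * (\<Sum>j=1..p. ctr P j x * e l j)) / A"
  shows "\<bar>expectation (\<lambda>x. \<Sum>l\<in>J. g l * k x (z l))
      - expectation (\<lambda>x. \<Sum>l\<in>J. g l * (c 0 + c 1 * L l x + c 2 * (L l x)\<^sup>2 + c 3 * L l x ^ 3 + c 4 * L l x ^ 4))\<bar>
      \<le> (\<Sum>l\<in>J. \<bar>g l\<bar>) * R * (1 + CL) / q ^ 5"
    and "\<bar>expectation (\<lambda>x. \<Sum>l\<in>J. g l * k x (z l))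
      - expectation (\<lambda>x. \<Sum>l\<in>J. g l * (c 0 + c 1 * L l x + c 2 * (L l x)\<^sup>2 + c 3 * L l x ^ 3))\<bar>
      \<le> 2 * (\<Sum>l\<in>J. \<bar>g l\<bar>) * R * (1 + CL) / q ^ 4"
    and "integrable P (\<lambda>x. \<Sum>l\<in>J. g l * k x (z l))"
proof -
  have pbW: "poly_bdd 1 (\<lambda>x. \<Sum>j=1..p. ctr P j x * e l j)" for l
    using poly_bdd_sum[of "{1..p}" 1 "\<lambda>j x. e l j * ctr P j x"] poly_bdd_cmult[OF poly_bdd_ctr]
    by (simp add: mult.commute)
  have pbL: "poly_bdd 2 (L l)" for l
    using poly_bdd_cmult[OF poly_bdd_diff[OF poly_bdd_add[OF poly_bdd_sq_dev poly_bdd_const] poly_bdd_cmult[OF pbW]], of "1 / A" "\<tau> l" 2]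
    unfolding L_def by (simp add: numeral_2_eq_2)
  have zS: "z l \<in> space (Rp p)" for l unfolding z_def Rp_def space_PiM by auto
  have Leq: "L l x = (edist p x (z l))\<^sup>2 / A - 1" if "l \<in> J" for l x
    using dist_eq[OF e[OF that]] unfolding L_def z_def by simp
  have iL: "integrable P (\<lambda>x. \<bar>L l x\<bar> ^ r)" "expectation (\<lambda>x. \<bar>L l x\<bar> ^ r) \<le> (1 + CL) / q ^ r" if "l \<in> J" "r \<le> 6" for l r
    using L_moment[OF pbW W6[OF that(1)] \<tau>[OF that(1)] that(2)] unfolding L_def by auto
  have iL': "integrable P (\<lambda>x. L l x ^ r)" if "r \<le> 6" for l r
    using that by (intro integrable_poly_bdd[OF poly_bdd_power[OF pbL]]) simp
  define H where "H l x = c 0 + c 1 * L l x + c 2 * (L l x)\<^sup>2 + c 3 * L l x ^ 3 + c 4 * L l x ^ 4" for l x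
  define H3 where "H3 l x = c 0 + c 1 * L l x + c 2 * (L l x)\<^sup>2 + c 3 * L l x ^ 3" for l x
  have iH: "integrable P (H l)" "integrable P (H3 l)" for l
    unfolding H_def[abs_def] H3_def[abs_def] using iL'[of 1 l] iL'[of 2 l] iL'[of 3 l] iL'[of 4 l] by auto
  have diff: "\<bar>k x (z l) - H l x\<bar> \<le> R * \<bar>L l x\<bar> ^ 5" if "l \<in> J" "x \<in> space P" for l x
    unfolding H_def using k_approx[OF _ zS Leq[OF that(1)]] that by (simp add: space_P)
  have km: "(\<lambda>x. k x (z l)) \<in> borel_measurable P" for l
    using k_measurable[OF zS] unfolding measurable_cong_sets[OF sets_P refl] .
  have id: "integrable P (\<lambda>x. k x (z l) - H l x)" if "l \<in> J" for l
  proof (rule Bochner_Integration.integrable_bound)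
    show "integrable P (\<lambda>x. R * \<bar>L l x\<bar> ^ 5)" using iL[OF that, of 5] by simp
    show "(\<lambda>x. k x (z l) - H l x) \<in> borel_measurable P" using km iH by (intro borel_measurable_diff) auto
    show "AE x in P. norm (k x (z l) - H l x) \<le> norm (R * \<bar>L l x\<bar> ^ 5)"
      using diff[OF that] R by (intro AE_I2) simp
  qed
  have ik: "integrable P (\<lambda>x. k x (z l))" if "l \<in> J" for l
    using Bochner_Integration.integrable_add[OF id[OF that] iH(1)[of l]] by simp
  show intG: "integrable P (\<lambda>x. \<Sum>l\<in>J. g l * k x (z l))" using ik by auto
  have d5: "\<bar>expectation (\<lambda>x. k x (z l)) - expectation (H l)\<bar> \<le> R * (1 + CL) / q ^ 5" if "l \<in> J" for l
  proof -
    have "\<bar>expectation (\<lambda>x. k x (z l)) - expectation (H l)\<bar> = \<bar>expectation (\<lambda>x. k x (z l) - H l x)\<bar>"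
      using ik[OF that] iH by simp
    also have "\<dots> \<le> expectation (\<lambda>x. \<bar>k x (z l) - H l x\<bar>)" by (rule integral_abs_bound)
    also have "\<dots> \<le> expectation (\<lambda>x. R * \<bar>L l x\<bar> ^ 5)"
      using id[OF that] iL[OF that, of 5] diff[OF that] by (intro Bochner_Integration.integral_mono) auto
    also have "\<dots> \<le> R * ((1 + CL) / q ^ 5)"
      using mult_left_mono[OF iL(2)[OF that, of 5] R(1)] by simp
    finally show ?thesis by simp
  qed
  have d4: "\<bar>expectation (\<lambda>x. k x (z l)) - expectation (H3 l)\<bar> \<le> 2 * (R * (1 + CL) / q ^ 4)" if "l \<in> J" for l
  proof -
    have "\<bar>expectation (H l) - expectation (H3 l)\<bar> = \<bar>c 4 * expectation (\<lambda>x. L l x ^ 4)\<bar>"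
      unfolding H_def[abs_def] H3_def[abs_def] using iL'[of 1 l] iL'[of 2 l] iL'[of 3 l] iL'[of 4 l] by simp
    also have "\<dots> \<le> R * ((1 + CL) / q ^ 4)"
      unfolding abs_mult using R iL(2)[OF that, of 4] by (intro mult_mono) (auto simp: abs_of_nonneg)
    finally have 1: "\<bar>expectation (H l) - expectation (H3 l)\<bar> \<le> R * (1 + CL) / q ^ 4" by simp
    have "R * (1 + CL) / q ^ 5 \<le> R * (1 + CL) / q ^ 4"
      using R CL_nonneg q power_increasing[of 4 5 q] by (intro divide_left_mono) auto
    then show ?thesis using 1 d5[OF that] by linarith
  qed
  have sums: "\<bar>expectation (\<lambda>x. \<Sum>l\<in>J. g l * k x (z l)) - expectation (\<lambda>x. \<Sum>l\<in>J. g l * h l x)\<bar> \<le> (\<Sum>l\<in>J. \<bar>g l\<bar>) * D"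
    if h: "\<And>l. integrable P (h l)" "\<And>l. l \<in> J \<Longrightarrow> \<bar>expectation (\<lambda>x. k x (z l)) - expectation (h l)\<bar> \<le> D" for h D
  proof -
    have "expectation (\<lambda>x. \<Sum>l\<in>J. g l * k x (z l)) - expectation (\<lambda>x. \<Sum>l\<in>J. g l * h l x)
        = (\<Sum>l\<in>J. g l * (expectation (\<lambda>x. k x (z l)) - expectation (h l)))"
      using ik h(1) by (simp add: right_diff_distrib sum_subtractf)
    also have "\<bar>\<dots>\<bar> \<le> (\<Sum>l\<in>J. \<bar>g l\<bar> * D)"
      using h(2) by (intro order_trans[OF sum_abs] sum_mono) (simp add: abs_mult mult_left_mono)
    finally show ?thesis by (simp add: sum_distrib_right)
  qed
  show "\<bar>expectation (\<lambda>x. \<Sum>l\<in>J. g l * k x (z l))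
      - expectation (\<lambda>x. \<Sum>l\<in>J. g l * (c 0 + c 1 * L l x + c 2 * (L l x)\<^sup>2 + c 3 * L l x ^ 3 + c 4 * L l x ^ 4))\<bar>
      \<le> (\<Sum>l\<in>J. \<bar>g l\<bar>) * R * (1 + CL) / q ^ 5"
    using sums[of H, OF iH(1) d5] unfolding H_def by (simp only: times_divide_eq_right mult_ac)
  show "\<bar>expectation (\<lambda>x. \<Sum>l\<in>J. g l * k x (z l))
      - expectation (\<lambda>x. \<Sum>l\<in>J. g l * (c 0 + c 1 * L l x + c 2 * (L l x)\<^sup>2 + c 3 * L l x ^ 3))\<bar>
      \<le> 2 * (\<Sum>l\<in>J. \<bar>g l\<bar>) * R * (1 + CL) / q ^ 4"
    using sums[of H3, OF iH(2) d4] unfolding H3_def by (simp only: times_divide_eq_right mult_ac)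
qed

end

section \<open>Test measures\<close>

text \<open>The vector v = e_j1 + s2 e_j2 + s3 e_j3. It is written as a sum because the three
  indices may coincide.\<close>

definition dir :: "nat \<Rightarrow> nat \<Rightarrow> nat \<Rightarrow> real \<Rightarrow> real \<Rightarrow> nat \<Rightarrow> real" where
  "dir j1 j2 j3 s2 s3 j = (if j = j1 then 1 else 0) + s2 * (if j = j2 then 1 else 0) + s3 * (if j = j3 then 1 else 0)"

definition dir_sq :: "nat \<Rightarrow> nat \<Rightarrow> nat \<Rightarrow> nat \<Rightarrow> real \<Rightarrow> real \<Rightarrow> real" where
  "dir_sq p j1 j2 j3 s2 s3 = (\<Sum>j=1..p. (dir j1 j2 j3 s2 s3 j)\<^sup>2)"

definition pm :: "bool \<Rightarrow> real" where "pm s = (if s then 1 else -1)"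

text \<open>
  Test points on the sphere of radius \<open>sqrt (A/2)\<close> around the mean: \<open>\<beta> v \<plusminus> \<zeta> e\<^sub>l\<close> with
  \<open>\<beta> \<in> {-2b, -b, b, 2b}\<close>, weighted so that even and linear terms in \<open>\<beta>\<close> and odd terms in \<open>\<zeta>\<close> cancel.
\<close>

definition cubic_pts :: "nat \<Rightarrow> real \<Rightarrow> real \<Rightarrow> nat \<Rightarrow> nat \<Rightarrow> nat \<Rightarrow> real \<Rightarrow> real \<Rightarrow> nat \<Rightarrow> int \<times> bool \<Rightarrow> nat \<Rightarrow> real" where
  "cubic_pts p A b j1 j2 j3 s2 s3 l = (\<lambda>(i, s) j. real_of_int i * b * dir j1 j2 j3 s2 s3 j
     + pm s * sqrt (A / 2 - (real_of_int i * b)\<^sup>2 * dir_sq p j1 j2 j3 s2 s3) * (if j = l then 1 else 0))"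

definition cubic_wts :: "int \<times> bool \<Rightarrow> real" where
  "cubic_wts = (\<lambda>(i, s). if i = 2 then 1 else if i = -2 then -1 else if i = 1 then -2 else 2)"

abbreviation cubic_idx :: "(int \<times> bool) set" where
  "cubic_idx \<equiv> {-2, -1, 1, 2} \<times> UNIV"

text \<open>Two spheres whose squared radii differ by \<open>q\<close>; odd terms cancel.\<close>

definition radius_pts :: "real \<Rightarrow> real \<Rightarrow> int \<times> bool \<Rightarrow> nat \<Rightarrow> real" where
  "radius_pts A q = (\<lambda>(i, s) j. pm s * sqrt (A / 2 + real_of_int i * q) * (if j = 1 then 1 else 0))"

definition radius_wts :: "int \<times> bool \<Rightarrow> real" where
  "radius_wts = (\<lambda>(i, s). if i = 1 then 1 else -1)"

abbreviation radius_idx :: "(int \<times> bool) set" where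
  "radius_idx \<equiv> {0, 1} \<times> UNIV"

section \<open>Algebra of the two test measures\<close>

lemma sum_cubic_idx:
  "(\<Sum>l\<in>cubic_idx. h l) = h (-2, True) + h (-2, False) + (h (-1, True) + h (-1, False))
     + (h (1, True) + h (1, False)) + (h (2, True) + h (2, False))" for h :: "int \<times> bool \<Rightarrow> real"
  by (subst sum.cartesian_product') (simp add: UNIV_bool add_ac)

lemma sum_radius_idx:
  "(\<Sum>l\<in>radius_idx. h l) = h (0, True) + h (0, False) + (h (1, True) + h (1, False))" for h :: "int \<times> bool \<Rightarrow> real"
  by (subst sum.cartesian_product') (simp add: UNIV_bool add_ac)

lemma sum_mult_indicator:
  fixes h :: "nat \<Rightarrow> real"
  assumes "a \<in> {1..p}"
  shows "(\<Sum>j=1..p. h j * (if j = a then 1 else 0)) = h a"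
  using assms by (simp add: if_distrib sum.delta cong: if_cong)

lemma sum_mult_dir:
  assumes "j1 \<in> {1..p}" "j2 \<in> {1..p}" "j3 \<in> {1..p}"
  shows "(\<Sum>j=1..p. h j * dir j1 j2 j3 s2 s3 j) = h j1 + s2 * h j2 + s3 * h j3"
proof -
  have "(\<Sum>j=1..p. h j * dir j1 j2 j3 s2 s3 j) = (\<Sum>j=1..p. h j * (if j = j1 then 1 else 0))
     + s2 * (\<Sum>j=1..p. h j * (if j = j2 then 1 else 0)) + s3 * (\<Sum>j=1..p. h j * (if j = j3 then 1 else 0))"
    unfolding sum_distrib_left sum.distrib[symmetric] by (intro sum.cong refl) (simp add: dir_def algebra_simps)
  then show ?thesis using assms by (simp only: sum_mult_indicator)
qed

lemma dir_sq_le: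
  assumes j: "j1 \<in> {1..p}" "j2 \<in> {1..p}" "j3 \<in> {1..p}" and s: "\<bar>s2\<bar> = 1" "\<bar>s3\<bar> = 1"
  shows "dir_sq p j1 j2 j3 s2 s3 \<le> 9" "0 \<le> dir_sq p j1 j2 j3 s2 s3"
proof -
  \<comment> \<open>Where indices coincide an entry can reach 3 in absolute value, and t^2 \<le> 3 t
    for t between 0 and 3 only bounds the version with positive signs, which dominates.\<close>
  have "dir j1 j2 j3 s2 s3 j * dir j1 j2 j3 s2 s3 j \<le> 3 * dir j1 j2 j3 1 1 j" for j
    using s by (auto simp: dir_def abs_if split: if_splits)
  then have "dir_sq p j1 j2 j3 s2 s3 \<le> (\<Sum>j=1..p. 3 * dir j1 j2 j3 1 1 j)"
    unfolding dir_sq_def power2_eq_square by (intro sum_mono)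
  also have "\<dots> = 9" using sum_mult_dir[OF j, of "\<lambda>_. 3" 1 1] by simp
  finally show "dir_sq p j1 j2 j3 s2 s3 \<le> 9" .
  show "0 \<le> dir_sq p j1 j2 j3 s2 s3" unfolding dir_sq_def by (intro sum_nonneg) simp
qed

text \<open>Symmetrisation over the sign of the auxiliary coordinate: only s^2 is left, so the
  square root defining \<zeta> disappears and polynomial algebra suffices.\<close>

lemma quartic_pair:
  fixes y s c0 c1 c2 c3 c4 :: real
  defines "h \<equiv> \<lambda>y. c0 + c1 * y + c2 * y\<^sup>2 + c3 * y ^ 3 + c4 * y ^ 4"
  shows "h (y - s) + h (y + s) = 2 * c0 + 2 * c1 * y + c2 * (2 * y\<^sup>2 + 2 * s\<^sup>2)
    + c3 * (2 * y ^ 3 + 6 * y * s\<^sup>2) + c4 * (2 * y ^ 4 + 12 * y\<^sup>2 * s\<^sup>2 + 2 * (s\<^sup>2)\<^sup>2)"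
  unfolding h_def by (simp add: power2_eq_square eval_nat_numeral algebra_simps)

text \<open>The square of \<open>\<zeta> i\<close> is quadratic in \<beta> = i b, so after
  symmetrisation everything is polynomial in \<beta>. Weights odd in \<beta> remove even powers, in
  particular u^3 and u^4, and the ratio 1 : -2 removes the first power. The weighted sum of
  \<beta>^3 is 24 b^3; with the factor (-2)^3 it gives -192 for the cubic and, with 4 u from the
  fourth power, -768 for the quartic term.\<close>

lemma cubic_identity:
  fixes u a e t v b A :: real and \<zeta> :: "int \<Rightarrow> real" and c :: "nat \<Rightarrow> real"
  assumes \<zeta>: "\<And>i. i \<in> {-2, -1, 1, 2} \<Longrightarrow> (\<zeta> i)\<^sup>2 = t - (real_of_int i * b)\<^sup>2 * v" and A: "A \<noteq> 0"
  defines "L \<equiv> \<lambda>(i, s). (u - 2 * (real_of_int i * b * a + pm s * \<zeta> i * e)) / A"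
  shows "(\<Sum>l\<in>cubic_idx. cubic_wts l * (c 0 + c 1 * L l + c 2 * (L l)\<^sup>2 + c 3 * L l ^ 3 + c 4 * L l ^ 4))
    = (c 3 * (- 192 * b ^ 3) / A ^ 3) * (a ^ 3 - 3 * v * (a * e\<^sup>2))
    + (c 4 * (- 768 * b ^ 3) / A ^ 4) * (u * (a ^ 3 - 3 * v * (a * e\<^sup>2)))"
proof -
  define d where "d i = c i / A ^ i" for i
  define h where "h y = c 0 + d 1 * y + d 2 * y\<^sup>2 + d 3 * y ^ 3 + d 4 * y ^ 4" for y
  define Y where "Y i = u - 2 * (real_of_int i * b * a)" for i
  have hL: "c 0 + c 1 * L (i, s) + c 2 * (L (i, s))\<^sup>2 + c 3 * L (i, s) ^ 3 + c 4 * L (i, s) ^ 4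
      = h (Y i - pm s * (2 * \<zeta> i * e))" for i s
  proof -
    have "L (i, s) = (Y i - pm s * (2 * \<zeta> i * e)) / A" unfolding L_def Y_def by (simp add: algebra_simps)
    then show ?thesis unfolding h_def d_def by (simp add: power_divide)
  qed
  have pair: "h (Y i - 2 * \<zeta> i * e) + h (Y i + 2 * \<zeta> i * e) =
      2 * c 0 + 2 * d 1 * Y i + d 2 * (2 * (Y i)\<^sup>2 + 2 * S)
    + d 3 * (2 * Y i ^ 3 + 6 * Y i * S) + d 4 * (2 * Y i ^ 4 + 12 * (Y i)\<^sup>2 * S + 2 * S\<^sup>2)"
    if "i \<in> {-2, -1, 1, 2}" "S = 4 * e\<^sup>2 * (t - (real_of_int i * b)\<^sup>2 * v)" for i S
  proof -
    have "(2 * \<zeta> i * e)\<^sup>2 = S" using \<zeta>[OF that(1)] that(2) by (simp add: power_mult_distrib)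
    then show ?thesis unfolding h_def using quartic_pair[of "c 0" "d 1" "Y i" "2 * \<zeta> i * e" "d 2" "d 3" "d 4"] by simp
  qed
  have "(\<Sum>l\<in>cubic_idx. cubic_wts l * (c 0 + c 1 * L l + c 2 * (L l)\<^sup>2 + c 3 * L l ^ 3 + c 4 * L l ^ 4))
    = - (h (Y (-2) - 2 * \<zeta> (-2) * e) + h (Y (-2) + 2 * \<zeta> (-2) * e))
      + 2 * (h (Y (-1) - 2 * \<zeta> (-1) * e) + h (Y (-1) + 2 * \<zeta> (-1) * e))
      - 2 * (h (Y 1 - 2 * \<zeta> 1 * e) + h (Y 1 + 2 * \<zeta> 1 * e))
      + (h (Y 2 - 2 * \<zeta> 2 * e) + h (Y 2 + 2 * \<zeta> 2 * e))"
    unfolding sum_cubic_idx hL by (simp add: cubic_wts_def pm_def)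
  also have "\<dots> = d 3 * (- 192 * b ^ 3) * (a ^ 3 - 3 * v * (a * e\<^sup>2))
    + d 4 * (- 768 * b ^ 3) * (u * (a ^ 3 - 3 * v * (a * e\<^sup>2)))"
    unfolding pair[OF insertI1 refl] pair[OF insertI2[OF insertI1] refl]
      pair[OF insertI2[OF insertI2[OF insertI1]] refl] pair[OF insertI2[OF insertI2[OF insertI2[OF insertI1]]] refl]
    unfolding Y_def
    by (simp add: power2_eq_square eval_nat_numeral algebra_simps)
  finally show ?thesis by (simp add: d_def)
qed

text \<open>The two spheres carry opposite weights, so u^3 cancels and the shift by q leaves 3 q u^2
  for each sign. Thus the second moment of u enters, while its third moment does not.\<close>

lemma radius_identity:
  fixes u e A q :: real and \<zeta> :: "int \<Rightarrow> real" and c :: "nat \<Rightarrow> real"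
  assumes \<zeta>: "\<And>i. i \<in> {0, 1} \<Longrightarrow> (\<zeta> i)\<^sup>2 = A / 2 + real_of_int i * q"
  defines "L \<equiv> \<lambda>(i, s). (u + real_of_int i * q - 2 * (pm s * \<zeta> i * e)) / A"
  shows "(\<Sum>l\<in>radius_idx. radius_wts l * (c 0 + c 1 * L l + c 2 * (L l)\<^sup>2 + c 3 * L l ^ 3))
    = 2 * q * c 1 / A + c 2 / A\<^sup>2 * (4 * q * u + 2 * q\<^sup>2 + 8 * q * e\<^sup>2)
      + c 3 / A ^ 3 * (6 * q * u\<^sup>2 + 6 * q\<^sup>2 * u + 2 * q ^ 3 + 24 * q * (u * e\<^sup>2) + 24 * q * (A / 2 + q) * e\<^sup>2)"
proof -
  define d where "d i = c i / A ^ i" for i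
  define h where "h y = c 0 + d 1 * y + d 2 * y\<^sup>2 + d 3 * y ^ 3 + 0 * y ^ 4" for y
  define Y where "Y i = u + real_of_int i * q" for i
  have hL: "c 0 + c 1 * L (i, s) + c 2 * (L (i, s))\<^sup>2 + c 3 * L (i, s) ^ 3
      = h (Y i - pm s * (2 * \<zeta> i * e))" for i s
  proof -
    have "L (i, s) = (Y i - pm s * (2 * \<zeta> i * e)) / A" unfolding L_def Y_def by (simp add: algebra_simps)
    then show ?thesis unfolding h_def d_def by (simp add: power_divide)
  qed
  have pair: "h (Y i - 2 * \<zeta> i * e) + h (Y i + 2 * \<zeta> i * e) =
      2 * c 0 + 2 * d 1 * Y i + d 2 * (2 * (Y i)\<^sup>2 + 2 * S) + d 3 * (2 * Y i ^ 3 + 6 * Y i * S)"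
    if "i \<in> {0, 1}" "S = 4 * e\<^sup>2 * (A / 2 + real_of_int i * q)" for i S
  proof -
    have "(2 * \<zeta> i * e)\<^sup>2 = S" using \<zeta>[OF that(1)] that(2) by (simp add: power_mult_distrib)
    then show ?thesis unfolding h_def using quartic_pair[of "c 0" "d 1" "Y i" "2 * \<zeta> i * e" "d 2" "d 3" 0] by simp
  qed
  have "(\<Sum>l\<in>radius_idx. radius_wts l * (c 0 + c 1 * L l + c 2 * (L l)\<^sup>2 + c 3 * L l ^ 3))
    = - (h (Y 0 - 2 * \<zeta> 0 * e) + h (Y 0 + 2 * \<zeta> 0 * e)) + (h (Y 1 - 2 * \<zeta> 1 * e) + h (Y 1 + 2 * \<zeta> 1 * e))"
    unfolding sum_radius_idx hL by (simp add: radius_wts_def pm_def)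
  also have "\<dots> = 2 * q * d 1 + d 2 * (4 * q * u + 2 * q\<^sup>2 + 8 * q * e\<^sup>2)
      + d 3 * (6 * q * u\<^sup>2 + 6 * q\<^sup>2 * u + 2 * q ^ 3 + 24 * q * (u * e\<^sup>2) + 24 * q * (A / 2 + q) * e\<^sup>2)"
    unfolding pair[OF insertI1 refl] pair[OF insertI2[OF insertI1] refl]
    unfolding Y_def
    by (simp add: power2_eq_square eval_nat_numeral algebra_simps)
  finally show ?thesis by (simp add: d_def)
qed

section \<open>Expectations of the two test potentials\<close>

context radial_expansion
begin

text \<open>\<open>Cf\<close> bounds the second moment of a^3 - 3 v a e^2, with v at most 9: 1458 =
  18 * 81 and 1460 = 1458 + 2. In \<open>C_cubic\<close> and \<open>C_radius\<close> the first
  summand is the expansion error, total weight included, and the second a mixed moment that is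
  estimated instead of cancelled.\<close>

definition "Cf = 1460 * (2187 * Bc) + 1458 * Bc"
definition "C_cubic = 12 * (1 + CL) + 768 * sqrt (L0 / 144) ^ 3 / L0 ^ 4 * (real (6 * K + 2) * (Bw + Cf))"
definition "C_radius = 8 * (1 + CL) + 12 * (1 + Cu + Bc) / L0 ^ 3"

lemma p_pow: "real p ^ i = q ^ (2 * i)"
  by (simp add: power_mult)

lemma ctr_pow6: "j \<in> {1..p} \<Longrightarrow> expectation (\<lambda>x. ctr P j x ^ 6) \<le> Bc"
  using ctr_moment[of j 6] by simp

lemma integrable_ctr_pow: "j \<in> {1..p} \<Longrightarrow> r \<le> 128 \<Longrightarrow> integrable P (\<lambda>x. ctr P j x ^ r)"
  using integrable_poly_bdd[OF poly_bdd_power[OF poly_bdd_ctr]] by simp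

lemma W_moment:
  assumes a: "poly_bdd 1 a" "expectation (\<lambda>x. a x ^ 6) \<le> 2187 * Bc" and l: "l \<in> {1..p}"
    and st: "s\<^sup>2 \<le> (U0 + 1) * real p" "t\<^sup>2 \<le> (U0 + 1) * real p"
  shows "expectation (\<lambda>x. (s * a x + t * ctr P l x) ^ 6) \<le> Cw * real p ^ 3"
proof -
  have ia: "integrable P (\<lambda>x. a x ^ 6)" by (rule integrable_poly_bdd[OF poly_bdd_power[OF a(1)]]) simp
  have ic: "integrable P (\<lambda>x. ctr P l x ^ 6)" using l by (intro integrable_ctr_pow) auto
  have iW: "integrable P (\<lambda>x. (s * a x + t * ctr P l x) ^ 6)"
    by (rule integrable_poly_bdd[OF poly_bdd_power[OF poly_bdd_add[OF poly_bdd_cmult[OF a(1)] poly_bdd_cmult[OF poly_bdd_ctr[OF l]]]]]) simp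
  define B where "B = (U0 + 1) ^ 3 * real p ^ 3"
  have pow6: "r ^ 6 \<le> B" if "r\<^sup>2 \<le> (U0 + 1) * real p" for r :: real
  proof -
    have "r ^ 6 = (r\<^sup>2) ^ 3" by (simp flip: power_mult)
    also have "\<dots> \<le> ((U0 + 1) * real p) ^ 3" using that by (intro power_mono) auto
    finally show ?thesis by (simp add: B_def power_mult_distrib)
  qed
  have B0: "0 \<le> B" unfolding B_def using U0_pos by simp
  have "expectation (\<lambda>x. (s * a x + t * ctr P l x) ^ 6) \<le> expectation (\<lambda>x. 64 * (B * a x ^ 6 + B * ctr P l x ^ 6))"
  proof (rule Bochner_Integration.integral_mono[OF iW])
    show "integrable P (\<lambda>x. 64 * (B * a x ^ 6 + B * ctr P l x ^ 6))" using ia ic by auto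
    fix x
    have "(s * a x + t * ctr P l x) ^ 6 \<le> 64 * (s ^ 6 * a x ^ 6 + t ^ 6 * ctr P l x ^ 6)"
      using add_power_le[of "s * a x" "t * ctr P l x" 6] by (simp add: power_mult_distrib)
    also have "\<dots> \<le> 64 * (B * a x ^ 6 + B * ctr P l x ^ 6)"
      using pow6[OF st(1)] pow6[OF st(2)] by (intro mult_left_mono add_mono mult_right_mono) auto
    finally show "(s * a x + t * ctr P l x) ^ 6 \<le> 64 * (B * a x ^ 6 + B * ctr P l x ^ 6)" .
  qed
  also have "\<dots> = 64 * (B * expectation (\<lambda>x. a x ^ 6) + B * expectation (\<lambda>x. ctr P l x ^ 6))"
    using ia ic by simp
  also have "\<dots> \<le> 64 * (B * (2187 * Bc) + B * Bc)"
    using a(2) ctr_pow6[OF l] B0 by (intro mult_left_mono add_mono) auto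
  also have "\<dots> = Cw * real p ^ 3" unfolding Cw_def B_def by (simp add: algebra_simps)
  finally show ?thesis .
qed

text \<open>The auxiliary coordinate \<open>l\<close> sits exactly 2K + 1 beyond the block of the
  three indices. That is far enough for third moments mixing it with the block to vanish, and near
  enough for the surviving function to depend on boundedly many coordinates, so that its correlation
  with \<open>sq_dev\<close> is O(1).\<close>

lemma cubic_test:
  fixes j1 j2 j3 l lo hi :: nat and s2 s3 :: real
  assumes j: "j1 \<in> {lo..hi}" "j2 \<in> {lo..hi}" "j3 \<in> {lo..hi}" and lh: "1 \<le> lo" "hi \<le> p" "hi \<le> lo + 2 * K"
    and l: "l \<in> {1..p}" "l = hi + 2 * K + 1 \<or> lo = l + 2 * K + 1" and s: "\<bar>s2\<bar> = 1" "\<bar>s3\<bar> = 1"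
  defines "b \<equiv> sqrt (L0 * real p / 144)"
  defines "G \<equiv> \<lambda>x. \<Sum>i\<in>cubic_idx. cubic_wts i * k x (\<lambda>j\<in>{1..p}. mean P j + cubic_pts p A b j1 j2 j3 s2 s3 l i j)"
  shows "\<bar>expectation G - c 3 * (- 192 * b ^ 3) / A ^ 3
      * expectation (\<lambda>x. (ctr P j1 x + s2 * ctr P j2 x + s3 * ctr P j3 x) ^ 3)\<bar> \<le> R * C_cubic / q ^ 5"
    and "integrable P G"
    and "\<And>i. i \<in> cubic_idx \<Longrightarrow> (\<Sum>j=1..p. (cubic_pts p A b j1 j2 j3 s2 s3 l i j)\<^sup>2) = A / 2"
proof -
  have jp: "j1 \<in> {1..p}" "j2 \<in> {1..p}" "j3 \<in> {1..p}" using j lh by auto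
  have lj: "l \<noteq> j1" "l \<noteq> j2" "l \<noteq> j3" using j l by auto
  define a where "a x = ctr P j1 x + s2 * ctr P j2 x + s3 * ctr P j3 x" for x
  define e where "e = ctr P l"
  define v where "v = dir_sq p j1 j2 j3 s2 s3"
  have v: "v \<le> 9" "0 \<le> v" unfolding v_def by (rule dir_sq_le[OF jp s])+
  define \<zeta> where "\<zeta> i = sqrt (A / 2 - (real_of_int i * b)\<^sup>2 * v)" for i
  have b2: "b\<^sup>2 = L0 * real p / 144" unfolding b_def using L0 by simp
  have ib2: "(real_of_int i * b)\<^sup>2 \<le> L0 * real p / 36" if "i \<in> {-2, -1, 1, 2}" for i
  proof -
    have "(real_of_int i)\<^sup>2 \<le> 4" using that by auto
    then have "(real_of_int i)\<^sup>2 * b\<^sup>2 \<le> 4 * b\<^sup>2" by (intro mult_right_mono) auto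
    then have "(real_of_int i * b)\<^sup>2 \<le> 4 * b\<^sup>2" by (simp only: power_mult_distrib)
    then show ?thesis by (simp add: b2)
  qed
  \<comment> \<open>The reason for the 144 in \<open>b\<close>: (2 b)^2 times the bound 9 for
    \<open>v\<close> equals L0 p / 4, which stays below A / 2, so \<zeta> is the root of a
    nonnegative number.\<close>
  have le: "(real_of_int i * b)\<^sup>2 * v \<le> A / 2" if "i \<in> {-2, -1, 1, 2}" for i
  proof -
    have "(real_of_int i * b)\<^sup>2 * v \<le> (L0 * real p / 36) * 9" using ib2[OF that] v L0(1) by (intro mult_mono) auto
    also have "\<dots> \<le> A / 2" using L0 p_pos A_pos by linarith
    finally show ?thesis .
  qed
  have \<zeta>: "(\<zeta> i)\<^sup>2 = A / 2 - (real_of_int i * b)\<^sup>2 * v" if "i \<in> {-2, -1, 1, 2}" for i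
    unfolding \<zeta>_def using le[OF that] by simp
  have dl: "dir j1 j2 j3 s2 s3 l = 0" using lj by (simp add: dir_def)
  have pts: "cubic_pts p A b j1 j2 j3 s2 s3 l (i, t) j
      = real_of_int i * b * dir j1 j2 j3 s2 s3 j + pm t * \<zeta> i * (if j = l then 1 else 0)" for i t j
    unfolding cubic_pts_def \<zeta>_def v_def by simp
  have norm: "(\<Sum>j=1..p. (cubic_pts p A b j1 j2 j3 s2 s3 l (i, t) j)\<^sup>2) = A / 2" if "i \<in> {-2, -1, 1, 2}" for i t
  proof -
    have "(cubic_pts p A b j1 j2 j3 s2 s3 l (i, t) j)\<^sup>2
        = (real_of_int i * b)\<^sup>2 * (dir j1 j2 j3 s2 s3 j)\<^sup>2 + (\<zeta> i)\<^sup>2 * (if j = l then 1 else 0)" for j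
      unfolding pts using dl by (auto simp: power_mult_distrib pm_def)
    then have "(\<Sum>j=1..p. (cubic_pts p A b j1 j2 j3 s2 s3 l (i, t) j)\<^sup>2)
        = (real_of_int i * b)\<^sup>2 * v + (\<zeta> i)\<^sup>2"
      unfolding v_def dir_sq_def using sum_mult_indicator[OF l(1), of "\<lambda>_. (\<zeta> i)\<^sup>2"]
      by (simp only: sum.distrib sum_distrib_left[symmetric])
    then show ?thesis using \<zeta>[OF that] by simp
  qed
  show "(\<Sum>j=1..p. (cubic_pts p A b j1 j2 j3 s2 s3 l i j)\<^sup>2) = A / 2" if "i \<in> cubic_idx" for i
    using norm that by (cases i) auto
  have W: "(\<Sum>j=1..p. ctr P j x * cubic_pts p A b j1 j2 j3 s2 s3 l (i, t) j)
      = (real_of_int i * b) * a x + (pm t * \<zeta> i) * e x" for i t x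
  proof -
    have "(\<Sum>j=1..p. ctr P j x * cubic_pts p A b j1 j2 j3 s2 s3 l (i, t) j)
       = (real_of_int i * b) * (\<Sum>j=1..p. ctr P j x * dir j1 j2 j3 s2 s3 j)
        + (pm t * \<zeta> i) * (\<Sum>j=1..p. ctr P j x * (if j = l then 1 else 0))"
      unfolding pts sum_distrib_left sum.distrib[symmetric] by (intro sum.cong refl) (simp add: algebra_simps)
    then show ?thesis
      unfolding sum_mult_dir[OF jp] sum_mult_indicator[OF l(1)] a_def e_def .
  qed
  have pba: "poly_bdd 1 a"
    using poly_bdd_add[OF poly_bdd_add[OF poly_bdd_ctr poly_bdd_cmult[OF poly_bdd_ctr]] poly_bdd_cmult[OF poly_bdd_ctr], OF jp, of s2 s3]
    unfolding a_def by simp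
  have pbe: "poly_bdd 1 e" unfolding e_def by (rule poly_bdd_ctr[OF l(1)])
  have ia: "integrable P (\<lambda>x. a x ^ r)" if "r \<le> 6" for r
    using that by (intro integrable_poly_bdd[OF poly_bdd_power[OF pba]]) simp
  have ie: "integrable P (\<lambda>x. e x ^ r)" if "r \<le> 6" for r
    using that by (intro integrable_poly_bdd[OF poly_bdd_power[OF pbe]]) simp
  have a6: "expectation (\<lambda>x. a x ^ 6) \<le> 2187 * Bc"
  proof -
    have s6: "s2 ^ 6 = 1" "s3 ^ 6 = 1" using s by (metis power_even_abs_numeral even_numeral power_one)+
    have "expectation (\<lambda>x. a x ^ 6) \<le> expectation (\<lambda>x. 3 ^ 6 * (ctr P j1 x ^ 6 + ctr P j2 x ^ 6 + ctr P j3 x ^ 6))"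
    proof (rule Bochner_Integration.integral_mono[OF ia])
      show "integrable P (\<lambda>x. 3 ^ 6 * (ctr P j1 x ^ 6 + ctr P j2 x ^ 6 + ctr P j3 x ^ 6))"
        using integrable_ctr_pow[of _ 6] jp by auto
      show "a x ^ 6 \<le> 3 ^ 6 * (ctr P j1 x ^ 6 + ctr P j2 x ^ 6 + ctr P j3 x ^ 6)" for x
        using sum_power_le_card_power[of "{0,1,2::nat}" 6 "\<lambda>i. if i = 0 then ctr P j1 x else if i = 1 then s2 * ctr P j2 x else s3 * ctr P j3 x"]
        unfolding a_def by (simp add: power_mult_distrib s6 add.assoc)
    qed simp
    also have "\<dots> = 3 ^ 6 * (expectation (\<lambda>x. ctr P j1 x ^ 6) + expectation (\<lambda>x. ctr P j2 x ^ 6) + expectation (\<lambda>x. ctr P j3 x ^ 6))"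
      using integrable_ctr_pow[of _ 6] jp by simp
    also have "\<dots> \<le> 3 ^ 6 * (Bc + Bc + Bc)"
      using ctr_pow6 jp by (intro mult_left_mono add_mono) auto
    finally show ?thesis by simp
  qed
  have W6: "expectation (\<lambda>x. (\<Sum>j=1..p. ctr P j x * cubic_pts p A b j1 j2 j3 s2 s3 l i j) ^ 6) \<le> Cw * real p ^ 3"
    if i_in: "i \<in> cubic_idx" for i
  proof -
    obtain i' t where i: "i = (i', t)" "i' \<in> {-2, -1, 1, 2}" using i_in by (cases i) auto
    have p1: "1 \<le> real p" using p_pos by simp
    have "0 \<le> U0 * real p" using U0_pos by simp
    then have "L0 * real p / 36 \<le> U0 * real p + real p" using L0(2) U0 p1 by linarith
    then have "L0 * real p / 36 \<le> (U0 + 1) * real p" by (simp only: distrib_right mult_1)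
    then have 1: "(real_of_int i' * b)\<^sup>2 \<le> (U0 + 1) * real p" using ib2[OF i(2)] by linarith
    have "(pm t * \<zeta> i')\<^sup>2 = (\<zeta> i')\<^sup>2" by (simp add: pm_def power_mult_distrib)
    also have "\<dots> \<le> A / 2" using \<zeta>[OF i(2)] v by simp
    also have "\<dots> \<le> (U0 + 1) * real p" using U0 A_pos p1 by (simp add: distrib_right)
    finally show ?thesis unfolding i(1) W e_def using W_moment[OF pba a6 l(1) 1] by simp
  qed
  have exp0: "\<And>i. i \<in> cubic_idx \<Longrightarrow> (\<Sum>j=1..p. (cubic_pts p A b j1 j2 j3 s2 s3 l i j)\<^sup>2) = A / 2 + 0"
    using norm by auto
  have fin: "finite cubic_idx" by simp
  note te = test_function_expansion[OF fin exp0 _ W6, where g = cubic_wts, simplified]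
  define F where "F x = a x ^ 3 - 3 * v * (a x * (e x)\<^sup>2)" for x
  define L where "L i x = (sq_dev P p x - 2 * (\<Sum>j=1..p. ctr P j x * cubic_pts p A b j1 j2 j3 s2 s3 l i j)) / A" for i x
  have poly: "(\<Sum>i\<in>cubic_idx. cubic_wts i * (c 0 + c 1 * L i x + c 2 * (L i x)\<^sup>2 + c 3 * L i x ^ 3 + c 4 * L i x ^ 4))
      = (c 3 * (- 192 * b ^ 3) / A ^ 3) * F x + (c 4 * (- 768 * b ^ 3) / A ^ 4) * (sq_dev P p x * F x)" for x
  proof -
    have "L i x = (\<lambda>(i, t). (sq_dev P p x - 2 * (real_of_int i * b * a x + pm t * \<zeta> i * e x)) / A) i" for i
      unfolding L_def by (cases i) (simp add: W del: One_nat_def)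
    then show ?thesis using cubic_identity[OF \<zeta>, where A = A and u = "sq_dev P p x" and a = "a x" and e = "e x" and c = c] A_pos
      unfolding F_def by simp
  qed
  show "integrable P G" using te(3) unfolding G_def by simp
  have wts: "(\<Sum>i\<in>cubic_idx. \<bar>cubic_wts i\<bar>) = 12" unfolding sum_cubic_idx by (simp add: cubic_wts_def)
  have pbF: "poly_bdd 3 F"
    using poly_bdd_diff[OF poly_bdd_power[OF pba, of 3] poly_bdd_cmult[OF poly_bdd_mult[OF pba poly_bdd_power[OF pbe, of 2]], of "3 * v"]]
    unfolding F_def[abs_def] by (simp add: numeral_3_eq_3)
  have iF: "integrable P F" by (rule integrable_poly_bdd[OF pbF]) simp
  have iuF: "integrable P (\<lambda>x. sq_dev P p x * F x)"
    by (rule integrable_poly_bdd[OF poly_bdd_mult[OF poly_bdd_sq_dev pbF]]) simp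
  have iae: "integrable P (\<lambda>x. a x * (e x)\<^sup>2)"
    by (rule integrable_poly_bdd[OF poly_bdd_mult[OF pba poly_bdd_power[OF pbe]]]) simp
  \<comment> \<open>\<open>l\<close> is more than 2K away from each of the three indices, so the
    mean of a e^2 is a combination of vanishing third moments.\<close>
  have EF: "expectation F = expectation (\<lambda>x. a x ^ 3)"
  proof -
    have T0: "third_moment P i l l = 0" if "i \<in> {lo..hi}" for i
    proof (rule ccontr)
      assume "third_moment P i l l \<noteq> 0"
      then have "i \<le> l + 2 * K \<and> l \<le> i + 2 * K"
        using third_moment_near[of i l l] that lh l(1) by auto
      then show False using that l(2) by auto
    qed
    have it: "integrable P (\<lambda>x. ctr P i x * ctr P l x * ctr P l x)" if "i \<in> {1..p}" for i
      using integrable_poly_bdd[OF poly_bdd_mult[OF poly_bdd_mult[OF poly_bdd_ctr[OF that] poly_bdd_ctr[OF l(1)]] poly_bdd_ctr[OF l(1)]]] by simp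
    have "expectation (\<lambda>x. a x * (e x)\<^sup>2) = expectation (\<lambda>x. ctr P j1 x * ctr P l x * ctr P l x
        + s2 * (ctr P j2 x * ctr P l x * ctr P l x) + s3 * (ctr P j3 x * ctr P l x * ctr P l x))"
      unfolding a_def e_def power2_eq_square by (intro Bochner_Integration.integral_cong refl) (simp add: algebra_simps)
    also have "\<dots> = third_moment P j1 l l + s2 * third_moment P j2 l l + s3 * third_moment P j3 l l"
      using it jp unfolding third_moment_def by simp
    also have "\<dots> = 0" using T0 j by simp
    finally have "expectation (\<lambda>x. a x * (e x)\<^sup>2) = 0" .
    then show ?thesis unfolding F_def[abs_def] using iae ia[of 3] by simp
  qed
  \<comment> \<open>\<open>F\<close> lives on an interval of at most 4K + 2 coordinates; widened by
    \<open>K\<close> on both sides it has 6K + 2.\<close>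
  have EuF: "\<bar>expectation (\<lambda>x. sq_dev P p x * F x)\<bar> \<le> real (6 * K + 2) * (Bw + Cf)"
  proof -
    define lo' hi' where "lo' = min lo l" and "hi' = max hi l"
    have dep: "depends_on {lo'..hi'} F"
    proof -
      have *: "ctr P i x = ctr P i y" if "\<forall>i\<in>{lo'..hi'}. x i = y i" "i \<in> {j1, j2, j3, l}" for i x y
      proof -
        have "i \<in> {lo'..hi'}" using that(2) j by (auto simp: lo'_def hi'_def)
        then show ?thesis using that(1) by (simp add: ctr_def)
      qed
      have "F x = F y" if "\<forall>i\<in>{lo'..hi'}. x i = y i" for x y
        using *[OF that, of j1] *[OF that, of j2] *[OF that, of j3] *[OF that, of l]
        unfolding F_def a_def e_def by simp
      then show ?thesis unfolding depends_on_def by blast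
    qed
    have C: "expectation (\<lambda>x. (F x)\<^sup>2) \<le> Cf"
    proof -
      have "expectation (\<lambda>x. (F x)\<^sup>2) \<le> expectation (\<lambda>x. 1460 * a x ^ 6 + 1458 * e x ^ 6)"
      proof (rule Bochner_Integration.integral_mono)
        show "integrable P (\<lambda>x. (F x)\<^sup>2)" by (rule integrable_poly_bdd[OF poly_bdd_power[OF pbF]]) simp
        show "integrable P (\<lambda>x. 1460 * a x ^ 6 + 1458 * e x ^ 6)" using ia[of 6] ie[of 6] by auto
        fix x
        have y: "(a x)\<^sup>2 * e x ^ 4 \<le> a x ^ 6 + e x ^ 6"
        proof (cases "(a x)\<^sup>2 \<le> (e x)\<^sup>2")
          case True
          then have "(a x)\<^sup>2 * e x ^ 4 \<le> (e x)\<^sup>2 * e x ^ 4" by (intro mult_right_mono) auto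
          also have "\<dots> = e x ^ 6" by (simp flip: power_add)
          finally show ?thesis by (simp add: add_increasing)
        next
          case False
          then have "(e x)\<^sup>2 \<le> (a x)\<^sup>2" by simp
          then have "((e x)\<^sup>2)\<^sup>2 \<le> ((a x)\<^sup>2)\<^sup>2" by (rule power_mono) simp
          moreover have "((e x)\<^sup>2)\<^sup>2 = e x ^ 4" "((a x)\<^sup>2)\<^sup>2 = a x ^ 4" by (simp_all flip: power_mult)
          ultimately have "(a x)\<^sup>2 * e x ^ 4 \<le> (a x)\<^sup>2 * a x ^ 4" by (intro mult_left_mono) auto
          also have "\<dots> = a x ^ 6" by (simp flip: power_add)
          finally show ?thesis by (simp add: add_increasing2)
        qed
        have "(F x)\<^sup>2 \<le> 2 * (a x ^ 3)\<^sup>2 + 2 * (3 * v * (a x * (e x)\<^sup>2))\<^sup>2"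
        proof -
          have "0 \<le> (a x ^ 3 + 3 * v * (a x * (e x)\<^sup>2))\<^sup>2" by simp
          then show ?thesis unfolding F_def by (simp add: power2_sum power2_diff)
        qed
        also have "\<dots> = 2 * a x ^ 6 + 18 * v\<^sup>2 * ((a x)\<^sup>2 * e x ^ 4)"
          by (simp add: power_mult_distrib flip: power_mult)
        also have "\<dots> \<le> 2 * a x ^ 6 + 18 * 81 * (a x ^ 6 + e x ^ 6)"
        proof -
          have "v\<^sup>2 \<le> 9\<^sup>2" using v by (intro power_mono) auto
          then have "18 * v\<^sup>2 \<le> 18 * 81" by simp
          then show ?thesis using y by (intro add_left_mono mult_mono) auto
        qed
        finally show "(F x)\<^sup>2 \<le> 1460 * a x ^ 6 + 1458 * e x ^ 6" by simp
      qed
      also have "\<dots> = 1460 * expectation (\<lambda>x. a x ^ 6) + 1458 * expectation (\<lambda>x. e x ^ 6)"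
        using ia[of 6] ie[of 6] by simp
      also have "\<dots> \<le> Cf" unfolding Cf_def using a6 ctr_pow6[OF l(1)] unfolding e_def by (intro add_mono mult_left_mono) auto
      finally show ?thesis .
    qed
    have "\<bar>expectation (\<lambda>x. sq_dev P p x * F x)\<bar> \<le> real (hi' - lo' + 1 + 2 * K) * (Bw + Cf)"
      using lh l j by (intro expectation_sq_dev_mult[OF dep pbF _ _ _ _ C]) (auto simp: lo'_def hi'_def)
    also have "\<dots> \<le> real (6 * K + 2) * (Bw + Cf)"
    proof (intro mult_right_mono)
      show "real (hi' - lo' + 1 + 2 * K) \<le> real (6 * K + 2)"
        using l(2) lh j unfolding lo'_def hi'_def by (intro of_nat_mono) auto
      show "0 \<le> Bw + Cf" using Bw_ge_1 Bc_ge_1 by (simp add: Cf_def)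
    qed
    finally show ?thesis .
  qed
  have E: "expectation (\<lambda>x. \<Sum>i\<in>cubic_idx. cubic_wts i * (c 0 + c 1 * L i x + c 2 * (L i x)\<^sup>2 + c 3 * L i x ^ 3 + c 4 * L i x ^ 4))
      = c 3 * (- 192 * b ^ 3) / A ^ 3 * expectation (\<lambda>x. a x ^ 3)
        + c 4 * (- 768 * b ^ 3) / A ^ 4 * expectation (\<lambda>x. sq_dev P p x * F x)"
    unfolding poly using iF iuF by (simp add: EF)
  have b3: "b ^ 3 = sqrt (L0 / 144) ^ 3 * q ^ 3" "0 \<le> b ^ 3"
    unfolding b_def using L0(1) by (simp_all add: real_sqrt_mult real_sqrt_divide power_mult_distrib power_divide)
  have err: "\<bar>c 4 * (- 768 * b ^ 3) / A ^ 4 * expectation (\<lambda>x. sq_dev P p x * F x)\<bar>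
     \<le> R * (768 * sqrt (L0 / 144) ^ 3 / L0 ^ 4 * (real (6 * K + 2) * (Bw + Cf))) / q ^ 5"
  proof -
    have "\<bar>c 4 * (- 768 * b ^ 3) / A ^ 4\<bar> \<le> R * (768 * b ^ 3) / (L0 * real p) ^ 4"
      unfolding abs_mult abs_divide using R b3(2) L0 p_pos A_pos
      by (intro frac_le mult_mono power_mono) (auto simp: abs_mult)
    \<comment> \<open>b^3 grows like q^3 and A^4 like q^8, which leaves the desired q^5 in the
      denominator.\<close>
    also have "\<dots> = R * (768 * sqrt (L0 / 144) ^ 3 / L0 ^ 4) / q ^ 5"
    proof -
      have eq: "(L0 * real p) ^ 4 = L0 ^ 4 * (q ^ 5 * q ^ 3)"
        unfolding power_mult_distrib p_pow by (simp flip: power_add)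
      show ?thesis unfolding b3(1) eq using q(3) L0(1) by (simp add: field_simps)
    qed
    finally have cA: "\<bar>c 4 * (- 768 * b ^ 3) / A ^ 4\<bar> \<le> R * (768 * sqrt (L0 / 144) ^ 3 / L0 ^ 4) / q ^ 5" .
    have "\<bar>c 4 * (- 768 * b ^ 3) / A ^ 4 * expectation (\<lambda>x. sq_dev P p x * F x)\<bar>
        \<le> R * (768 * sqrt (L0 / 144) ^ 3 / L0 ^ 4) / q ^ 5 * (real (6 * K + 2) * (Bw + Cf))"
      unfolding abs_mult[of "c 4 * (- 768 * b ^ 3) / A ^ 4"]
      by (rule mult_mono[OF cA EuF order_trans[OF abs_ge_zero cA] abs_ge_zero])
    then show ?thesis by (simp only: times_divide_eq_left times_divide_eq_right mult.assoc)
  qed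
  have "\<bar>expectation G - expectation (\<lambda>x. \<Sum>i\<in>cubic_idx. cubic_wts i * (c 0 + c 1 * L i x + c 2 * (L i x)\<^sup>2 + c 3 * L i x ^ 3 + c 4 * L i x ^ 4))\<bar>
      \<le> 12 * R * (1 + CL) / q ^ 5"
    using te(1) unfolding G_def L_def wts by simp
  then have "\<bar>expectation G - c 3 * (- 192 * b ^ 3) / A ^ 3 * expectation (\<lambda>x. a x ^ 3)\<bar>
     \<le> 12 * R * (1 + CL) / q ^ 5 + R * (768 * sqrt (L0 / 144) ^ 3 / L0 ^ 4 * (real (6 * K + 2) * (Bw + Cf))) / q ^ 5"
  proof -
    have tri: "\<bar>x - y\<bar> \<le> d + d'" if "\<bar>x - (y + y')\<bar> \<le> d" "\<bar>y'\<bar> \<le> d'" for x y y' d d' :: real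
      using that by linarith
    assume "\<bar>expectation G - expectation (\<lambda>x. \<Sum>i\<in>cubic_idx. cubic_wts i * (c 0 + c 1 * L i x + c 2 * (L i x)\<^sup>2 + c 3 * L i x ^ 3 + c 4 * L i x ^ 4))\<bar>
      \<le> 12 * R * (1 + CL) / q ^ 5"
    then show ?thesis unfolding E by (rule tri[OF _ err])
  qed
  also have "\<dots> = R * C_cubic / q ^ 5" unfolding C_cubic_def by (simp add: distrib_left add_divide_distrib mult_ac)
  finally show "\<bar>expectation G - c 3 * (- 192 * b ^ 3) / A ^ 3
      * expectation (\<lambda>x. (ctr P j1 x + s2 * ctr P j2 x + s3 * ctr P j3 x) ^ 3)\<bar> \<le> R * C_cubic / q ^ 5"
    unfolding a_def .
qed

text \<open>Everything subtracted except the last term depends only on \<open>A\<close>, the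
  coefficients and one variance, hence cancels between laws with equal covariances. The last term
  carries the second moment of \<open>sq_dev\<close>. The mixed moment of u e^2 goes into the error
  by a crude bound of order q.\<close>

lemma radius_test:
  defines "G \<equiv> \<lambda>x. \<Sum>i\<in>radius_idx. radius_wts i * k x (\<lambda>j\<in>{1..p}. mean P j + radius_pts A q i j)"
  shows "\<bar>expectation G - (2 * q * c 1 / A + c 2 / A\<^sup>2 * (2 * q\<^sup>2 + 8 * q * cov_matrix P 1 1)
        + c 3 / A ^ 3 * (2 * q ^ 3 + 24 * q * (A / 2 + q) * cov_matrix P 1 1)
        + c 3 / A ^ 3 * (6 * q) * expectation (\<lambda>x. (sq_dev P p x)\<^sup>2))\<bar> \<le> R * C_radius / q ^ 4"
    and "integrable P G"
    and "\<And>i. i \<in> radius_idx \<Longrightarrow> (\<Sum>j=1..p. (radius_pts A q i j)\<^sup>2) = A / 2 + real_of_int (fst i) * q"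
proof -
  have l: "1 \<in> {1..p}" using p_pos by simp
  define e where "e = ctr P 1"
  define \<zeta> where "\<zeta> i = sqrt (A / 2 + real_of_int i * q)" for i
  have \<zeta>: "(\<zeta> i)\<^sup>2 = A / 2 + real_of_int i * q" if "i \<in> {0, 1}" for i
    unfolding \<zeta>_def using that A_pos q(3) by auto
  have pts: "radius_pts A q (i, t) j = pm t * \<zeta> i * (if j = 1 then 1 else 0)" for i t j
    unfolding radius_pts_def \<zeta>_def by simp
  have norm: "(\<Sum>j=1..p. (radius_pts A q (i, t) j)\<^sup>2) = A / 2 + real_of_int i * q" if "i \<in> {0, 1}" for i t
  proof -
    have "(radius_pts A q (i, t) j)\<^sup>2 = (\<zeta> i)\<^sup>2 * (if j = 1 then 1 else 0)" for j
      unfolding pts by (auto simp: power_mult_distrib pm_def)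
    then show ?thesis using sum_mult_indicator[OF l, of "\<lambda>_. (\<zeta> i)\<^sup>2"] \<zeta>[OF that] by simp
  qed
  show "(\<Sum>j=1..p. (radius_pts A q i j)\<^sup>2) = A / 2 + real_of_int (fst i) * q" if "i \<in> radius_idx" for i
    using norm that by (cases i) auto
  have W: "(\<Sum>j=1..p. ctr P j x * radius_pts A q (i, t) j) = 0 * e x + (pm t * \<zeta> i) * e x" for i t x
  proof -
    have "(\<Sum>j=1..p. ctr P j x * radius_pts A q (i, t) j)
       = (pm t * \<zeta> i) * (\<Sum>j=1..p. ctr P j x * (if j = 1 then 1 else 0))"
      unfolding pts sum_distrib_left by (intro sum.cong refl) (simp add: algebra_simps)
    then show ?thesis unfolding sum_mult_indicator[OF l] e_def by simp
  qed
  have pbe: "poly_bdd 1 e" unfolding e_def by (rule poly_bdd_ctr[OF l])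
  have ie: "integrable P (\<lambda>x. e x ^ r)" if "r \<le> 6" for r
    using that by (intro integrable_poly_bdd[OF poly_bdd_power[OF pbe]]) simp
  have e6: "expectation (\<lambda>x. e x ^ 6) \<le> 2187 * Bc" using ctr_pow6[OF l] Bc_ge_1 unfolding e_def by simp
  have W6: "expectation (\<lambda>x. (\<Sum>j=1..p. ctr P j x * radius_pts A q i j) ^ 6) \<le> Cw * real p ^ 3"
    if i_in: "i \<in> radius_idx" for i
  proof -
    obtain i' t where i: "i = (i', t)" "i' \<in> {0, 1}" using i_in by (cases i) auto
    have p1: "1 \<le> real p" "q \<le> real p" using p_pos q self_le_power[of q 2] by auto
    have 1: "0\<^sup>2 \<le> (U0 + 1) * real p" using U0_pos by simp
    have "(pm t * \<zeta> i')\<^sup>2 = (\<zeta> i')\<^sup>2" by (simp add: pm_def power_mult_distrib)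
    also have "\<dots> \<le> A / 2 + q" using \<zeta>[OF i(2)] i(2) q by auto
    also have "\<dots> \<le> (U0 + 1) * real p" using U0 A_pos p1 by (simp add: distrib_right)
    finally show ?thesis unfolding i(1) W using W_moment[OF pbe e6 l 1] unfolding e_def by simp
  qed
  have exp: "\<And>i. i \<in> radius_idx \<Longrightarrow> (\<Sum>j=1..p. (radius_pts A q i j)\<^sup>2) = A / 2 + real_of_int (fst i) * q"
    using norm by auto
  have \<tau>: "\<And>i. i \<in> radius_idx \<Longrightarrow> \<bar>real_of_int (fst i) * q\<bar> \<le> q" using q by auto
  have fin: "finite radius_idx" by simp
  note te = test_function_expansion[OF fin exp \<tau> W6, where g = radius_wts]
  define u where "u = sq_dev P p"
  define L where "L i x = (sq_dev P p x + real_of_int (fst i) * q - 2 * (\<Sum>j=1..p. ctr P j x * radius_pts A q i j)) / A"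
    for i :: "int \<times> bool" and x
  have poly: "(\<Sum>i\<in>radius_idx. radius_wts i * (c 0 + c 1 * L i x + c 2 * (L i x)\<^sup>2 + c 3 * L i x ^ 3))
      = 2 * q * c 1 / A + c 2 / A\<^sup>2 * (4 * q * u x + 2 * q\<^sup>2 + 8 * q * (e x)\<^sup>2)
      + c 3 / A ^ 3 * (6 * q * (u x)\<^sup>2 + 6 * q\<^sup>2 * u x + 2 * q ^ 3 + 24 * q * (u x * (e x)\<^sup>2) + 24 * q * (A / 2 + q) * (e x)\<^sup>2)" for x
  proof -
    have "L i x = (\<lambda>(i, t). (u x + real_of_int i * q - 2 * (pm t * \<zeta> i * e x)) / A) i" for i
      unfolding L_def u_def by (cases i) (simp add: W del: One_nat_def)
    then show ?thesis using radius_identity[OF \<zeta>, where u = "u x" and e = "e x" and c = c] by simp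
  qed
  show "integrable P G" using te(3) unfolding G_def by simp
  have wts: "(\<Sum>i\<in>radius_idx. \<bar>radius_wts i\<bar>) = 4" unfolding sum_radius_idx by (simp add: radius_wts_def)
  have pbu: "poly_bdd 2 u" unfolding u_def by (rule poly_bdd_sq_dev)
  have iu: "integrable P (\<lambda>x. u x ^ r)" if "r \<le> 6" for r
    using that by (intro integrable_poly_bdd[OF poly_bdd_power[OF pbu]]) simp
  have iue: "integrable P (\<lambda>x. u x * (e x)\<^sup>2)"
    by (rule integrable_poly_bdd[OF poly_bdd_mult[OF pbu poly_bdd_power[OF pbe]]]) simp
  have Eu: "expectation u = 0" unfolding u_def by (rule expectation_sq_dev)
  have Ee: "expectation (\<lambda>x. (e x)\<^sup>2) = cov_matrix P 1 1"
    unfolding e_def cov_matrix_eq by (simp add: power2_eq_square)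
  have E: "expectation (\<lambda>x. \<Sum>i\<in>radius_idx. radius_wts i * (c 0 + c 1 * L i x + c 2 * (L i x)\<^sup>2 + c 3 * L i x ^ 3))
     = (2 * q * c 1 / A + c 2 / A\<^sup>2 * (2 * q\<^sup>2 + 8 * q * cov_matrix P 1 1)
        + c 3 / A ^ 3 * (2 * q ^ 3 + 24 * q * (A / 2 + q) * cov_matrix P 1 1)
        + c 3 / A ^ 3 * (6 * q) * expectation (\<lambda>x. (sq_dev P p x)\<^sup>2))
       + c 3 / A ^ 3 * (24 * q) * expectation (\<lambda>x. u x * (e x)\<^sup>2)"
    unfolding poly using iu[of 1] iu[of 2] ie[of 2] iue Eu Ee
    by (simp add: prob_space u_def[symmetric] distrib_left add.assoc del: One_nat_def)
  \<comment> \<open>Dividing u by its scale q before using 2 s t \<le> s^2 + t^2 balances the two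
    squares, both of order 1.\<close>
  have ue: "\<bar>expectation (\<lambda>x. u x * (e x)\<^sup>2)\<bar> \<le> q * (1 + Cu + Bc) / 2"
  proof -
    have "\<bar>expectation (\<lambda>x. u x * (e x)\<^sup>2)\<bar> \<le> expectation (\<lambda>x. \<bar>u x * (e x)\<^sup>2\<bar>)" by (rule integral_abs_bound)
    also have "\<dots> \<le> expectation (\<lambda>x. q / 2 * (1 + u x ^ 6 / q ^ 6 + e x ^ 4))"
    proof (rule Bochner_Integration.integral_mono)
      show "integrable P (\<lambda>x. \<bar>u x * (e x)\<^sup>2\<bar>)" using iue by simp
      show "integrable P (\<lambda>x. q / 2 * (1 + u x ^ 6 / q ^ 6 + e x ^ 4))" using iu[of 6] ie[of 4] by auto
      fix x
      have "0 \<le> (\<bar>u x / q\<bar> - (e x)\<^sup>2)\<^sup>2" by simp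
      then have "2 * (\<bar>u x / q\<bar> * (e x)\<^sup>2) \<le> \<bar>u x / q\<bar> ^ 2 + ((e x)\<^sup>2)\<^sup>2" by (simp add: power2_diff)
      also have "\<bar>u x / q\<bar> ^ 2 \<le> 1 + \<bar>u x / q\<bar> ^ 6" by (rule power_le_one_plus) simp
      finally have "2 * (\<bar>u x / q\<bar> * (e x)\<^sup>2) \<le> 1 + u x ^ 6 / q ^ 6 + e x ^ 4"
        by (simp add: power_divide flip: power_mult)
      then have "q / 2 * (2 * (\<bar>u x / q\<bar> * (e x)\<^sup>2)) \<le> q / 2 * (1 + u x ^ 6 / q ^ 6 + e x ^ 4)"
        using q by (intro mult_left_mono) auto
      then show "\<bar>u x * (e x)\<^sup>2\<bar> \<le> q / 2 * (1 + u x ^ 6 / q ^ 6 + e x ^ 4)"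
        using q(3) by (simp add: abs_mult)
    qed
    also have "\<dots> = q / 2 * (1 + expectation (\<lambda>x. u x ^ 6) / q ^ 6 + expectation (\<lambda>x. e x ^ 4))"
      using iu[of 6] ie[of 4] by (simp add: prob_space)
    also have "\<dots> \<le> q / 2 * (1 + Cu + Bc)"
    proof -
      have "q ^ 6 = real p ^ 3"
        unfolding p_pow by simp
      then have "expectation (\<lambda>x. u x ^ 6) / q ^ 6 \<le> Cu"
        using sq_dev_moment p_pos unfolding u_def by (simp add: field_simps)
      moreover have "expectation (\<lambda>x. e x ^ 4) \<le> Bc" using ctr_moment[OF l, of 4] by (simp add: e_def)
      ultimately show ?thesis using q by (intro mult_left_mono) auto
    qed
    finally show ?thesis by simp
  qed
  have err: "\<bar>c 3 / A ^ 3 * (24 * q) * expectation (\<lambda>x. u x * (e x)\<^sup>2)\<bar> \<le> R * (12 * (1 + Cu + Bc) / L0 ^ 3) / q ^ 4"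
  proof -
    have "\<bar>c 3 / A ^ 3 * (24 * q) * expectation (\<lambda>x. u x * (e x)\<^sup>2)\<bar>
        \<le> R / (L0 * real p) ^ 3 * (24 * q) * (q * (1 + Cu + Bc) / 2)"
      unfolding abs_mult abs_divide using R ue L0 p_pos A_pos q Cu_nonneg Bc_ge_1
      by (intro mult_mono frac_le power_mono) (auto simp: abs_mult)
    also have "\<dots> = R * (12 * (1 + Cu + Bc) / L0 ^ 3) / q ^ 4"
    proof -
      have eq: "(L0 * real p) ^ 3 = L0 ^ 3 * (q ^ 4 * q * q)"
        unfolding power_mult_distrib p_pow by (simp flip: power_add power_Suc2)
      have aux: "R / (l * (r4 * r * r)) * (24 * r) * (r * y / 2) = R * (12 * y / l) / r4"
        if "l \<noteq> 0" "r \<noteq> 0" "r4 \<noteq> 0" for l r r4 y :: real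
        using that by (simp add: field_simps)
      show ?thesis unfolding eq using q(3) L0(1) by (intro aux) auto
    qed
    finally show ?thesis .
  qed
  have "\<bar>expectation G - expectation (\<lambda>x. \<Sum>i\<in>radius_idx. radius_wts i * (c 0 + c 1 * L i x + c 2 * (L i x)\<^sup>2 + c 3 * L i x ^ 3))\<bar>
      \<le> 2 * 4 * R * (1 + CL) / q ^ 4"
    using te(2) unfolding G_def L_def wts .
  moreover have "R * C_radius / q ^ 4 = 2 * 4 * R * (1 + CL) / q ^ 4 + R * (12 * (1 + Cu + Bc) / L0 ^ 3) / q ^ 4"
    unfolding C_radius_def by (simp add: distrib_left add_divide_distrib mult_ac)
  ultimately show "\<bar>expectation G - (2 * q * c 1 / A + c 2 / A\<^sup>2 * (2 * q\<^sup>2 + 8 * q * cov_matrix P 1 1)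
        + c 3 / A ^ 3 * (2 * q ^ 3 + 24 * q * (A / 2 + q) * cov_matrix P 1 1)
        + c 3 / A ^ 3 * (6 * q) * expectation (\<lambda>x. (sq_dev P p x)\<^sup>2))\<bar> \<le> R * C_radius / q ^ 4"
    unfolding E using err by linarith
qed

end

text \<open>The cross terms vanish because the means agree. Nonnegative integrals are used on the
  product space, so that Tonelli yields the value without integrability being proved there
  beforehand.\<close>

lemma mean_sq_dist_eq:
  assumes P: "weak_dependence P p K U" and Q: "weak_dependence Q p K U"
    and mean: "\<And>j. j \<in> {1..p} \<Longrightarrow> mean P j = mean Q j"
  shows "mean_sq_dist p P Q = (\<Sum>j=1..p. cov_matrix P j j + cov_matrix Q j j)"
proof -
  interpret P: weak_dependence P p K U by (rule P)
  interpret Q: weak_dependence Q p K U by (rule Q)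
  define t where "t = (\<Sum>j=1..p. cov_matrix Q j j)"
  have m: "(\<lambda>(u, v). (edist p u v)\<^sup>2) \<in> borel_measurable (P \<Otimes>\<^sub>M Q)"
    unfolding edist_sq by measurable
  have inner: "(\<integral>\<^sup>+v. ennreal ((edist p u v)\<^sup>2) \<partial>Q) = ennreal ((\<Sum>j=1..p. (ctr P j u)\<^sup>2) + t)" for u
  proof -
    have i1: "integrable Q (ctr Q j)" "integrable Q (\<lambda>v. (ctr Q j v)\<^sup>2)" if "j \<in> {1..p}" for j
      using Q.integrable_poly_bdd[OF Q.poly_bdd_ctr[OF that]]
        Q.integrable_poly_bdd[OF Q.poly_bdd_power[OF Q.poly_bdd_ctr[OF that], of 2]] by auto
    have eq: "(edist p u v)\<^sup>2 = (\<Sum>j=1..p. (ctr P j u)\<^sup>2 - 2 * ctr P j u * ctr Q j v + (ctr Q j v)\<^sup>2)" for v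
      unfolding edist_sq by (intro sum.cong refl) (simp add: ctr_def mean power2_eq_square algebra_simps)
    have ieq: "integrable Q (\<lambda>v. (edist p u v)\<^sup>2)" unfolding eq using i1 by auto
    have "(\<integral>v. (edist p u v)\<^sup>2 \<partial>Q) = (\<Sum>j=1..p. \<integral>v. (ctr P j u)\<^sup>2 - 2 * ctr P j u * ctr Q j v + (ctr Q j v)\<^sup>2 \<partial>Q)"
      unfolding eq using i1 by (intro Bochner_Integration.integral_sum) auto
    also have "\<dots> = (\<Sum>j=1..p. (ctr P j u)\<^sup>2 + cov_matrix Q j j)"
      using i1 by (intro sum.cong refl) (simp add: Q.prob_space Q.expectation_ctr Q.cov_matrix_eq power2_eq_square)
    finally have "(\<integral>v. (edist p u v)\<^sup>2 \<partial>Q) = (\<Sum>j=1..p. (ctr P j u)\<^sup>2) + t" by (simp add: sum.distrib t_def)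
    then show ?thesis using ieq by (subst nn_integral_eq_integral) auto
  qed
  have t0: "0 \<le> t" unfolding t_def using Q.variance_le by (intro sum_nonneg) auto
  have iP: "integrable P (\<lambda>u. (ctr P j u)\<^sup>2)" if "j \<in> {1..p}" for j
    using P.integrable_poly_bdd[OF P.poly_bdd_power[OF P.poly_bdd_ctr[OF that], of 2]] by simp
  have iS: "integrable P (\<lambda>u. \<Sum>j=1..p. (ctr P j u)\<^sup>2)"
    by (rule Bochner_Integration.integrable_sum[OF iP])
  have outer: "(\<integral>u. (\<Sum>j=1..p. (ctr P j u)\<^sup>2) + t \<partial>P) = (\<Sum>j=1..p. cov_matrix P j j) + t"
  proof -
    have "(\<integral>u. (\<Sum>j=1..p. (ctr P j u)\<^sup>2) \<partial>P) = (\<Sum>j=1..p. cov_matrix P j j)"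
      by (subst Bochner_Integration.integral_sum[OF iP]) (simp_all add: P.cov_matrix_eq power2_eq_square)
    then show ?thesis using iS by (simp add: P.prob_space)
  qed
  have "(\<integral>\<^sup>+z. ennreal (case z of (u, v) \<Rightarrow> (edist p u v)\<^sup>2) \<partial>(P \<Otimes>\<^sub>M Q))
      = (\<integral>\<^sup>+u. (\<integral>\<^sup>+v. ennreal ((edist p u v)\<^sup>2) \<partial>Q) \<partial>P)"
    using m by (subst Q.nn_integral_fst[symmetric]) auto
  also have "\<dots> = ennreal ((\<Sum>j=1..p. cov_matrix P j j) + t)"
    unfolding inner outer[symmetric] using iS t0
    by (intro nn_integral_eq_integral) (auto intro!: add_nonneg_nonneg sum_nonneg)
  finally have nn: "(\<integral>\<^sup>+z. ennreal (case z of (u, v) \<Rightarrow> (edist p u v)\<^sup>2) \<partial>(P \<Otimes>\<^sub>M Q))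
      = ennreal ((\<Sum>j=1..p. cov_matrix P j j) + t)" .
  have "0 \<le> (\<Sum>j=1..p. cov_matrix P j j) + t" using t0 P.variance_le by (intro add_nonneg_nonneg sum_nonneg) auto
  then have "mean_sq_dist p P Q = (\<Sum>j=1..p. cov_matrix P j j) + t"
    unfolding mean_sq_dist_def using m nn by (subst integral_eq_nn_integral) auto
  then show ?thesis by (simp add: t_def sum.distrib)
qed

section \<open>Two laws with equal means and variances\<close>

locale two_laws = P: radial_expansion P p K U k A L0 U0 R c + Q: radial_expansion Q p K U k A L0 U0 R c
  for P Q p K U k A L0 U0 R c +
  assumes mean_eq: "\<And>j. j \<in> {1..p} \<Longrightarrow> mean P j = mean Q j"
    and var_eq: "\<And>j. j \<in> {1..p} \<Longrightarrow> cov_matrix P j j = cov_matrix Q j j"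
begin

lemma ctr_eq: "j \<in> {1..p} \<Longrightarrow> ctr Q j = ctr P j"
  unfolding ctr_def[abs_def] using mean_eq by simp

lemma sq_dev_eq: "sq_dev Q p = sq_dev P p"
  unfolding sq_dev_def[abs_def] by (intro ext sum.cong refl) (simp add: ctr_sq_def ctr_eq var_eq)

lemma pts_eq: "(\<lambda>j\<in>{1..p}. mean Q j + e j) = (\<lambda>j\<in>{1..p}. mean P j + e j)"
  using mean_eq by auto

text \<open>The interface between the construction of a test measure and its use. The bound 12 is
  the total weight of the cubic measure, and (1 + 1 / L0) A covers both radii since q \<le> p \<le>
  A / L0.\<close>

definition "good_test J g (z :: int \<times> bool \<Rightarrow> rvec) \<gamma> \<longleftrightarrow> finite J \<and> (\<Sum>i\<in>J. g i) = 0 \<and> (\<Sum>i\<in>J. \<bar>g i\<bar>) \<le> 12 \<and>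
    (\<forall>i. z i \<in> space (Rp p)) \<and> (\<forall>i\<in>J. (\<Sum>j=1..p. (z i j - mean P j)\<^sup>2) \<le> (1 + 1 / L0) * A) \<and>
    integrable P (\<lambda>x. \<Sum>i\<in>J. g i * k x (z i)) \<and> integrable Q (\<lambda>x. \<Sum>i\<in>J. g i * k x (z i)) \<and>
    \<gamma> \<le> \<bar>(\<integral>x. (\<Sum>i\<in>J. g i * k x (z i)) \<partial>P) - (\<integral>x. (\<Sum>i\<in>J. g i * k x (z i)) \<partial>Q)\<bar>"

text \<open>1152 = 6 * 192, with 6 from polarization and 192 from \<open>cubic_identity\<close>. The
  subtracted term counts the expansion error once for each law.\<close>

definition "cubic_gap \<theta> = \<bar>c 3\<bar> * (1152 * sqrt (L0 / 144) ^ 3 / U0 ^ 3) * \<theta> / sqrt (real p) ^ 3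
    - 2 * R * P.C_cubic / sqrt (real p) ^ 5"

definition "radius_gap \<theta> = \<bar>c 3\<bar> * (6 / U0 ^ 3) * \<theta> / sqrt (real p) ^ 5 - 2 * R * P.C_radius / sqrt (real p) ^ 4"

text \<open>24 x y z is the signed sum of the four cubes (x + s2 y + s3 z)^3 with signs s2 s3. Hence
  at least one of the four differences reaches a quarter of 24.\<close>

lemma polarization:
  assumes j: "j1 \<in> {1..p}" "j2 \<in> {1..p}" "j3 \<in> {1..p}"
  shows "\<exists>s2\<in>{1,-1}. \<exists>s3\<in>{1,-1}. 6 * \<bar>third_moment P j1 j2 j3 - third_moment Q j1 j2 j3\<bar>
    \<le> \<bar>(\<integral>x. (ctr P j1 x + s2 * ctr P j2 x + s3 * ctr P j3 x) ^ 3 \<partial>P) - (\<integral>x. (ctr P j1 x + s2 * ctr P j2 x + s3 * ctr P j3 x) ^ 3 \<partial>Q)\<bar>"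
proof -
  define a where "a s2 s3 x = ctr P j1 x + s2 * ctr P j2 x + s3 * ctr P j3 x" for s2 s3 x
  define D where "D s2 s3 = (\<integral>x. a s2 s3 x ^ 3 \<partial>P) - (\<integral>x. a s2 s3 x ^ 3 \<partial>Q)" for s2 s3
  have aQ: "a s2 s3 x = ctr Q j1 x + s2 * ctr Q j2 x + s3 * ctr Q j3 x" for s2 s3 x
    unfolding a_def using j by (simp add: ctr_eq)
  have iP: "integrable P (\<lambda>x. a s2 s3 x ^ 3)" for s2 s3
    unfolding a_def
    by (rule P.integrable_poly_bdd[OF P.poly_bdd_power[OF P.poly_bdd_add[OF P.poly_bdd_add[OF P.poly_bdd_ctr P.poly_bdd_cmult[OF P.poly_bdd_ctr]] P.poly_bdd_cmult[OF P.poly_bdd_ctr], OF j]]]) simp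
  have iQ: "integrable Q (\<lambda>x. a s2 s3 x ^ 3)" for s2 s3
    unfolding aQ
    by (rule Q.integrable_poly_bdd[OF Q.poly_bdd_power[OF Q.poly_bdd_add[OF Q.poly_bdd_add[OF Q.poly_bdd_ctr Q.poly_bdd_cmult[OF Q.poly_bdd_ctr]] Q.poly_bdd_cmult[OF Q.poly_bdd_ctr], OF j]]]) simp
  have id: "24 * (ctr P j1 x * ctr P j2 x * ctr P j3 x) = a 1 1 x ^ 3 - a 1 (-1) x ^ 3 - a (-1) 1 x ^ 3 + a (-1) (-1) x ^ 3" for x
    unfolding a_def by (simp add: power3_eq_cube algebra_simps)
  have TP: "24 * third_moment P j1 j2 j3 = (\<integral>x. a 1 1 x ^ 3 \<partial>P) - (\<integral>x. a 1 (-1) x ^ 3 \<partial>P) - (\<integral>x. a (-1) 1 x ^ 3 \<partial>P) + (\<integral>x. a (-1) (-1) x ^ 3 \<partial>P)"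
    unfolding third_moment_def integral_mult_right_zero[symmetric] id using iP by simp
  have TQ: "24 * third_moment Q j1 j2 j3 = (\<integral>x. a 1 1 x ^ 3 \<partial>Q) - (\<integral>x. a 1 (-1) x ^ 3 \<partial>Q) - (\<integral>x. a (-1) 1 x ^ 3 \<partial>Q) + (\<integral>x. a (-1) (-1) x ^ 3 \<partial>Q)"
    unfolding third_moment_def ctr_eq[OF j(1)] ctr_eq[OF j(2)] ctr_eq[OF j(3)]
      integral_mult_right_zero[symmetric] id using iQ by simp
  have "24 * (third_moment P j1 j2 j3 - third_moment Q j1 j2 j3) = D 1 1 - D 1 (-1) - D (-1) 1 + D (-1) (-1)"
    unfolding D_def using TP TQ by simp
  then have "6 * \<bar>third_moment P j1 j2 j3 - third_moment Q j1 j2 j3\<bar> \<le> \<bar>D 1 1\<bar>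
      \<or> 6 * \<bar>third_moment P j1 j2 j3 - third_moment Q j1 j2 j3\<bar> \<le> \<bar>D 1 (-1)\<bar>
      \<or> 6 * \<bar>third_moment P j1 j2 j3 - third_moment Q j1 j2 j3\<bar> \<le> \<bar>D (-1) 1\<bar>
      \<or> 6 * \<bar>third_moment P j1 j2 j3 - third_moment Q j1 j2 j3\<bar> \<le> \<bar>D (-1) (-1)\<bar>" by linarith
  then show ?thesis unfolding D_def a_def by auto
qed

lemma cubic_gap:
  assumes j: "j1 \<in> {1..p}" "j2 \<in> {1..p}" "j3 \<in> {1..p}" and p: "6 * K + 2 < p"
    and \<theta>: "0 < \<theta>" "\<theta> \<le> \<bar>third_moment P j1 j2 j3 - third_moment Q j1 j2 j3\<bar>"
  shows "\<exists>J g z. good_test J g z (cubic_gap \<theta>)"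
proof -
  define lo where "lo = min j1 (min j2 j3)"
  define hi where "hi = max j1 (max j2 j3)"
  have lh: "1 \<le> lo" "hi \<le> p" using j by (auto simp: lo_def hi_def)
  have jlh: "j1 \<in> {lo..hi}" "j2 \<in> {lo..hi}" "j3 \<in> {lo..hi}" by (auto simp: lo_def hi_def)
  \<comment> \<open>A positive gap requires a nonzero third moment under one of the laws, which
    confines the indices to a block of width 2K.\<close>
  have "third_moment P j1 j2 j3 \<noteq> 0 \<or> third_moment Q j1 j2 j3 \<noteq> 0" using \<theta> by auto
  then have w: "hi \<le> lo + 2 * K"
    using P.third_moment_near[OF j] Q.third_moment_near[OF j] unfolding lo_def hi_def by auto
  \<comment> \<open>If there is no room above the block, it lies so high that p > 6K + 2 leaves room
    below it: then lo \<ge> hi - 2K \<ge> p - 4K > 2K + 1.\<close>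
  define l where "l = (if hi + 2 * K + 1 \<le> p then hi + 2 * K + 1 else lo - 2 * K - 1)"
  have l: "l \<in> {1..p}" "l = hi + 2 * K + 1 \<or> lo = l + 2 * K + 1"
    using p w lh jlh by (auto simp: l_def)
  obtain s2 s3 where s: "s2 \<in> {1,-1}" "s3 \<in> {1,-1}" and
    D: "6 * \<bar>third_moment P j1 j2 j3 - third_moment Q j1 j2 j3\<bar>
    \<le> \<bar>(\<integral>x. (ctr P j1 x + s2 * ctr P j2 x + s3 * ctr P j3 x) ^ 3 \<partial>P) - (\<integral>x. (ctr P j1 x + s2 * ctr P j2 x + s3 * ctr P j3 x) ^ 3 \<partial>Q)\<bar>"
    using polarization[OF j] by blast
  have s': "\<bar>s2\<bar> = 1" "\<bar>s3\<bar> = 1" using s by auto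
  define b where "b = sqrt (L0 * real p / 144)"
  define z where "z i = (\<lambda>j\<in>{1..p}. mean P j + cubic_pts p A b j1 j2 j3 s2 s3 l i j)" for i
  define G where "G x = (\<Sum>i\<in>cubic_idx. cubic_wts i * k x (z i))" for x
  define q where "q = sqrt (real p)"
  define EP where "EP = (\<integral>x. (ctr P j1 x + s2 * ctr P j2 x + s3 * ctr P j3 x) ^ 3 \<partial>P)"
  define EQ where "EQ = (\<integral>x. (ctr P j1 x + s2 * ctr P j2 x + s3 * ctr P j3 x) ^ 3 \<partial>Q)"
  define \<alpha> where "\<alpha> = c 3 * (- 192 * b ^ 3) / A ^ 3"
  note tP = P.cubic_test[OF jlh lh w l s']
  note tQ = Q.cubic_test[OF jlh lh w l s', unfolded pts_eq ctr_eq[OF j(1)] ctr_eq[OF j(2)] ctr_eq[OF j(3)]]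
  have 1: "\<bar>(\<integral>x. G x \<partial>P) - \<alpha> * EP\<bar> \<le> R * P.C_cubic / q ^ 5"
    using tP(1) unfolding G_def z_def b_def \<alpha>_def EP_def q_def .
  have 2: "\<bar>(\<integral>x. G x \<partial>Q) - \<alpha> * EQ\<bar> \<le> R * P.C_cubic / q ^ 5"
    using tQ(1) unfolding G_def z_def b_def \<alpha>_def EQ_def q_def .
  have b3: "b ^ 3 = sqrt (L0 / 144) ^ 3 * q ^ 3" "0 \<le> b ^ 3"
    unfolding b_def q_def using P.L0 by (simp_all add: real_sqrt_mult real_sqrt_divide power_mult_distrib power_divide)
  have q: "0 < q" unfolding q_def using P.q by simp
  have "\<bar>c 3\<bar> * (192 * sqrt (L0 / 144) ^ 3 / U0 ^ 3) / q ^ 3 \<le> \<bar>\<alpha>\<bar>"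
  proof -
    have "\<bar>c 3\<bar> * (192 * sqrt (L0 / 144) ^ 3 / U0 ^ 3) / q ^ 3 = \<bar>c 3\<bar> * (192 * b ^ 3) / (U0 * real p) ^ 3"
    proof -
      have "(U0 * real p) ^ 3 = U0 ^ 3 * (q ^ 3 * q ^ 3)"
        unfolding power_mult_distrib q_def P.p_pow by (simp flip: power_add)
      then show ?thesis unfolding b3 using q P.U0_pos by (simp add: field_simps)
    qed
    also have "\<dots> \<le> \<bar>c 3\<bar> * (192 * b ^ 3) / A ^ 3"
      using P.U0 P.A_pos P.U0_pos P.p_pos b3 by (intro divide_left_mono power_mono mult_nonneg_nonneg mult_pos_pos zero_less_power) auto
    also have "\<dots> = \<bar>\<alpha>\<bar>" unfolding \<alpha>_def using b3(2) P.A_pos by (simp add: abs_mult)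
    finally show ?thesis .
  qed
  then have "(\<bar>c 3\<bar> * (192 * sqrt (L0 / 144) ^ 3 / U0 ^ 3) / q ^ 3) * (6 * \<theta>) \<le> \<bar>\<alpha>\<bar> * \<bar>EP - EQ\<bar>"
    using D \<theta> unfolding EP_def EQ_def by (intro mult_mono) auto
  then have "\<bar>c 3\<bar> * (1152 * sqrt (L0 / 144) ^ 3 / U0 ^ 3) * \<theta> / q ^ 3 \<le> \<bar>\<alpha> * EP - \<alpha> * EQ\<bar>"
    unfolding right_diff_distrib[symmetric] abs_mult[of \<alpha>] by (simp add: mult_ac)
  moreover have "\<bar>\<alpha> * EP - \<alpha> * EQ\<bar> - 2 * (R * P.C_cubic / q ^ 5) \<le> \<bar>(\<integral>x. G x \<partial>P) - (\<integral>x. G x \<partial>Q)\<bar>"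
    using 1 2 by linarith
  ultimately have gap: "cubic_gap \<theta> \<le> \<bar>(\<integral>x. G x \<partial>P) - (\<integral>x. G x \<partial>Q)\<bar>"
    unfolding cubic_gap_def q_def[symmetric] by linarith
  have "good_test cubic_idx cubic_wts z (cubic_gap \<theta>)"
    unfolding good_test_def
  proof (intro conjI ballI allI)
    show "(\<Sum>i\<in>cubic_idx. cubic_wts i) = 0" unfolding sum_cubic_idx by (simp add: cubic_wts_def)
    show "(\<Sum>i\<in>cubic_idx. \<bar>cubic_wts i\<bar>) \<le> 12" unfolding sum_cubic_idx by (simp add: cubic_wts_def)
    show "z i \<in> space (Rp p)" for i unfolding z_def Rp_def space_PiM by auto
    show "(\<Sum>j=1..p. (z i j - mean P j)\<^sup>2) \<le> (1 + 1 / L0) * A" if "i \<in> cubic_idx" for i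
    proof -
      have "(\<Sum>j=1..p. (z i j - mean P j)\<^sup>2) = A / 2" using tP(3)[OF that] unfolding z_def b_def by simp
      also have "\<dots> \<le> (1 + 1 / L0) * A" using P.A_pos P.L0(1) by (simp add: distrib_right)
      finally show ?thesis .
    qed
    show "integrable P (\<lambda>x. \<Sum>i\<in>cubic_idx. cubic_wts i * k x (z i))" using tP(2) unfolding z_def b_def .
    show "integrable Q (\<lambda>x. \<Sum>i\<in>cubic_idx. cubic_wts i * k x (z i))" using tQ(2) unfolding z_def b_def .
  qed (use gap G_def in simp_all)
  then show ?thesis by blast
qed

lemma radius_gap:
  assumes \<theta>: "0 \<le> \<theta>" "\<theta> \<le> \<bar>(\<integral>x. (sq_dev P p x)\<^sup>2 \<partial>P) - (\<integral>x. (sq_dev P p x)\<^sup>2 \<partial>Q)\<bar>"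
  shows "\<exists>J g z. good_test J g z (radius_gap \<theta>)"
proof -
  define q where "q = sqrt (real p)"
  define z where "z i = (\<lambda>j\<in>{1..p}. mean P j + radius_pts A q i j)" for i
  define G where "G x = (\<Sum>i\<in>radius_idx. radius_wts i * k x (z i))" for x
  define EP where "EP = (\<integral>x. (sq_dev P p x)\<^sup>2 \<partial>P)"
  define EQ where "EQ = (\<integral>x. (sq_dev P p x)\<^sup>2 \<partial>Q)"
  define \<alpha> where "\<alpha> = c 3 / A ^ 3 * (6 * q)"
  \<comment> \<open>The part of the expectation that is the same under both laws and disappears in
    their difference.\<close>
  define \<beta> where "\<beta> = 2 * q * c 1 / A + c 2 / A\<^sup>2 * (2 * q\<^sup>2 + 8 * q * cov_matrix P 1 1)
        + c 3 / A ^ 3 * (2 * q ^ 3 + 24 * q * (A / 2 + q) * cov_matrix P 1 1)"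
  have v1: "cov_matrix Q 1 1 = cov_matrix P 1 1" using var_eq[of 1] P.p_pos by simp
  note tP = P.radius_test
  note tQ = Q.radius_test[unfolded pts_eq v1 sq_dev_eq]
  have 1: "\<bar>(\<integral>x. G x \<partial>P) - (\<beta> + \<alpha> * EP)\<bar> \<le> R * P.C_radius / q ^ 4"
    using tP(1) unfolding G_def z_def \<alpha>_def \<beta>_def EP_def q_def .
  have 2: "\<bar>(\<integral>x. G x \<partial>Q) - (\<beta> + \<alpha> * EQ)\<bar> \<le> R * P.C_radius / q ^ 4"
    using tQ(1) unfolding G_def z_def \<alpha>_def \<beta>_def EQ_def q_def .
  have q: "0 < q" unfolding q_def using P.q by simp
  have "\<bar>c 3\<bar> * (6 / U0 ^ 3) / q ^ 5 \<le> \<bar>\<alpha>\<bar>"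
  proof -
    have "\<bar>c 3\<bar> * (6 / U0 ^ 3) / q ^ 5 = \<bar>c 3\<bar> / (U0 * real p) ^ 3 * (6 * q)"
    proof -
      have "(U0 * real p) ^ 3 = U0 ^ 3 * (q ^ 5 * q)"
        unfolding power_mult_distrib q_def P.p_pow by (simp flip: power_Suc2)
      then show ?thesis using q P.U0_pos by (simp add: field_simps)
    qed
    also have "\<dots> \<le> \<bar>c 3\<bar> / A ^ 3 * (6 * q)"
      using P.U0 P.A_pos P.U0_pos P.p_pos q
      by (intro mult_right_mono divide_left_mono power_mono mult_nonneg_nonneg mult_pos_pos zero_less_power) auto
    also have "\<dots> = \<bar>\<alpha>\<bar>" unfolding \<alpha>_def using q P.A_pos by (simp add: abs_mult)
    finally show ?thesis .
  qed
  then have "(\<bar>c 3\<bar> * (6 / U0 ^ 3) / q ^ 5) * \<theta> \<le> \<bar>\<alpha>\<bar> * \<bar>EP - EQ\<bar>"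
    using \<theta> unfolding EP_def EQ_def by (intro mult_mono) auto
  then have "\<bar>c 3\<bar> * (6 / U0 ^ 3) * \<theta> / q ^ 5 \<le> \<bar>\<alpha> * EP - \<alpha> * EQ\<bar>"
    unfolding right_diff_distrib[symmetric] abs_mult[of \<alpha>] by (simp add: mult_ac)
  moreover have "\<bar>\<alpha> * EP - \<alpha> * EQ\<bar> - 2 * (R * P.C_radius / q ^ 4) \<le> \<bar>(\<integral>x. G x \<partial>P) - (\<integral>x. G x \<partial>Q)\<bar>"
    using 1 2 by linarith
  ultimately have gap: "radius_gap \<theta> \<le> \<bar>(\<integral>x. G x \<partial>P) - (\<integral>x. G x \<partial>Q)\<bar>"
    unfolding radius_gap_def q_def[symmetric] by linarith
  have "good_test radius_idx radius_wts z (radius_gap \<theta>)"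
    unfolding good_test_def
  proof (intro conjI ballI allI)
    show "(\<Sum>i\<in>radius_idx. radius_wts i) = 0" unfolding sum_radius_idx by (simp add: radius_wts_def)
    show "(\<Sum>i\<in>radius_idx. \<bar>radius_wts i\<bar>) \<le> 12" unfolding sum_radius_idx by (simp add: radius_wts_def)
    show "z i \<in> space (Rp p)" for i unfolding z_def Rp_def space_PiM by auto
    show "(\<Sum>j=1..p. (z i j - mean P j)\<^sup>2) \<le> (1 + 1 / L0) * A" if "i \<in> radius_idx" for i
    proof -
      have "(\<Sum>j=1..p. (z i j - mean P j)\<^sup>2) = A / 2 + real_of_int (fst i) * q"
        using tP(3)[OF that] unfolding z_def q_def by simp
      also have "\<dots> \<le> A / 2 + q" using that q by auto
      also have "q \<le> real p" using P.q self_le_power[of q 2] unfolding q_def by simp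
      also have "real p \<le> A / L0" using P.L0 by (simp add: field_simps)
      finally show ?thesis using P.A_pos by (simp add: distrib_right)
    qed
    show "integrable P (\<lambda>x. \<Sum>i\<in>radius_idx. radius_wts i * k x (z i))" using tP(2) unfolding z_def q_def .
    show "integrable Q (\<lambda>x. \<Sum>i\<in>radius_idx. radius_wts i * k x (z i))" using tQ(2) unfolding z_def q_def .
  qed (use gap G_def in simp_all)
  then show ?thesis by blast
qed

end

section \<open>Power of the test in a fixed dimension\<close>

lemma (in prob_space) second_moment_indep_sum:
  fixes \<xi> :: "'i \<Rightarrow> 'a \<Rightarrow> real"
  assumes "finite I" "indep_vars (\<lambda>_. borel) \<xi> I"
    and "\<And>i. i \<in> I \<Longrightarrow> integrable M (\<xi> i)" "\<And>i. i \<in> I \<Longrightarrow> integrable M (\<lambda>\<omega>. (\<xi> i \<omega>)\<^sup>2)"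
    and "\<And>i. i \<in> I \<Longrightarrow> expectation (\<xi> i) = 0"
  shows "integrable M (\<lambda>\<omega>. (\<Sum>i\<in>I. \<xi> i \<omega>)\<^sup>2) \<and>
    expectation (\<lambda>\<omega>. (\<Sum>i\<in>I. \<xi> i \<omega>)\<^sup>2) = (\<Sum>i\<in>I. expectation (\<lambda>\<omega>. (\<xi> i \<omega>)\<^sup>2))"
  using assms
proof (induction I rule: finite_induct)
  case (insert i I)
  let ?S = "\<lambda>\<omega>. \<Sum>i\<in>I. \<xi> i \<omega>"
  have IH: "integrable M (\<lambda>\<omega>. (?S \<omega>)\<^sup>2)" "expectation (\<lambda>\<omega>. (?S \<omega>)\<^sup>2) = (\<Sum>i\<in>I. expectation (\<lambda>\<omega>. (\<xi> i \<omega>)\<^sup>2))"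
    using insert indep_vars_subset[OF insert.prems(1), of I] by auto
  have iS: "integrable M ?S" using insert.prems by auto
  have ind: "indep_var borel (\<xi> i) borel ?S"
    using insert.hyps insert.prems(1) by (intro indep_vars_sum) auto
  have ii: "integrable M (\<xi> i)" "integrable M (\<lambda>\<omega>. (\<xi> i \<omega>)\<^sup>2)" "expectation (\<xi> i) = 0"
    using insert.prems by auto
  have ip: "integrable M (\<lambda>\<omega>. \<xi> i \<omega> * ?S \<omega>)" "expectation (\<lambda>\<omega>. \<xi> i \<omega> * ?S \<omega>) = 0"
    using indep_var_integrable[OF ind ii(1) iS] indep_var_lebesgue_integral[OF ind ii(1) iS] ii(3) by auto
  have eq: "(\<Sum>i\<in>insert i I. \<xi> i \<omega>)\<^sup>2 = (\<xi> i \<omega>)\<^sup>2 + 2 * (\<xi> i \<omega> * ?S \<omega>) + (?S \<omega>)\<^sup>2" for \<omega>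
    using insert.hyps by (simp add: power2_sum algebra_simps)
  show ?case unfolding eq using IH ii ip insert.hyps by simp
qed simp

definition sq_radius :: "nat \<Rightarrow> (nat \<Rightarrow> real) \<Rightarrow> real \<Rightarrow> rvec \<Rightarrow> real" where
  "sq_radius p \<mu> A x = (\<Sum>j=1..p. (x j - \<mu> j)\<^sup>2) / A"

text \<open>Bound, relative to the kernel scale, for the energy of a test measure: 144 = 12^2 is its
  squared total weight and 2 + 8 \<rho> the growth bound at two points of squared radius
  \<rho>.\<close>

definition test_norm :: "real \<Rightarrow> real" where
  "test_norm \<rho> = 144 * (2 + 8 * \<rho>)"

text \<open>Lower bound for N / F times the energy statistic in terms of the signal S = sqrt N
  |\<gamma>| / F: half of the signal survives, squared, and each of the two samples costs a bias (8
  + 16 S / \<eta>) / \<eta>.\<close>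

definition margin :: "real \<Rightarrow> real \<Rightarrow> real \<Rightarrow> real" where
  "margin \<eta> \<rho> S = S\<^sup>2 / (4 * test_norm \<rho>) - (16 + 32 * S / \<eta>) / \<eta>"

text \<open>Bound for the mean of the quantity to which Markov's inequality is applied: 1 for the
  average squared radius and the rest for the variance of the linear statistic.\<close>

definition tail_const :: "real \<Rightarrow> real \<Rightarrow> real" where
  "tail_const \<eta> \<rho> = 1 + 288 / \<eta> * (6 + 4 * \<rho>)"

text \<open>\<open>margin\<close> is quadratic in S while everything competing with it grows at most
  linearly. The square root is replaced by 480 S, where 480 = 48 * 10 and S \<ge> 1.\<close>

lemma margin_dominates:
  assumes "0 < \<eta>" "0 \<le> \<rho>" "0 < C" "1 \<le> S" and S: "(480 * C + 16 + 32 / \<eta>) * (4 * test_norm \<rho>) / \<eta> < S"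
  shows "C * sqrt (48 * (2 + 8 * S)) < \<eta> * margin \<eta> \<rho> S"
proof -
  define b where "b = 4 * test_norm \<rho>"
  have b: "0 < b" using assms by (simp add: b_def test_norm_def)
  have "sqrt (48 * (2 + 8 * S)) \<le> 480 * S"
  proof (rule real_le_lsqrt)
    have "48 * (2 + 8 * S) \<le> 480 * S" using assms by simp
    also have "\<dots> \<le> (480 * S)\<^sup>2" using assms by (intro self_le_power) auto
    finally show "48 * (2 + 8 * S) \<le> (480 * S)\<^sup>2" .
  qed (use assms in auto)
  then have 1: "C * sqrt (48 * (2 + 8 * S)) \<le> 480 * C * S" using assms by simp
  have "(480 * C + 16 + 32 / \<eta>) * b < S * \<eta>"
    using S assms unfolding b_def[symmetric] by (simp add: pos_divide_less_eq)
  then have "(480 * C + 16 + 32 / \<eta>) * S < \<eta> * (S\<^sup>2 / b)"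
    using b assms mult_strict_right_mono[of "(480 * C + 16 + 32 / \<eta>) * b" "S * \<eta>" S]
    by (simp add: pos_less_divide_eq power2_eq_square mult_ac)
  moreover have "16 + 32 / \<eta> * S \<le> (16 + 32 / \<eta>) * S" using assms by (simp add: distrib_right)
  moreover have "\<eta> * margin \<eta> \<rho> S = \<eta> * (S\<^sup>2 / b) - (16 + 32 / \<eta> * S)"
    using assms unfolding margin_def b_def by (simp add: right_diff_distrib)
  ultimately show ?thesis using 1 by (simp add: algebra_simps)
qed

text \<open>Dimension and sample sizes are fixed here. The kernel enters only through its growth
  relative to \<open>f0\<close> on the scale \<open>F\<close>; as the squared growth is linear in
  the squared radii, second moments of the laws suffice.\<close>

locale test_setting = prob_space M for M :: "'a measure" +
  fixes P Q :: "rvec measure" and p n m :: nat and X Y :: "nat \<Rightarrow> 'a \<Rightarrow> rvec"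
    and k :: "rvec \<Rightarrow> rvec \<Rightarrow> real" and a0 f0 F A \<eta> \<rho>z :: real and \<mu> :: "nat \<Rightarrow> real"
    and J :: "(int \<times> bool) set" and g :: "int \<times> bool \<Rightarrow> real" and z :: "int \<times> bool \<Rightarrow> rvec"
  assumes X [measurable]: "\<And>i. 1 \<le> i \<Longrightarrow> X i \<in> M \<rightarrow>\<^sub>M Rp p" and X_distr: "\<And>i. 1 \<le> i \<Longrightarrow> distr M (Rp p) (X i) = P"
    and Y [measurable]: "\<And>i. 1 \<le> i \<Longrightarrow> Y i \<in> M \<rightarrow>\<^sub>M Rp p" and Y_distr: "\<And>i. 1 \<le> i \<Longrightarrow> distr M (Rp p) (Y i) = Q"
    and indep: "indep_vars (\<lambda>_. Rp p) (case_sum X Y) ({1..} <+> {1..})"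
    and k_cnd: "\<And>(w :: nat + nat + (int \<times> bool) \<Rightarrow> real) pts I. finite I \<Longrightarrow> (\<Sum>i\<in>I. w i) = 0 \<Longrightarrow>
      pts ` I \<subseteq> space (Rp p) \<Longrightarrow> (\<Sum>i\<in>I. \<Sum>j\<in>I. w i * w j * k (pts i) (pts j)) \<le> 0"
    and k_sym: "\<And>x y. x \<in> space (Rp p) \<Longrightarrow> y \<in> space (Rp p) \<Longrightarrow> k x y = k y x"
    and k_diag: "\<And>x. x \<in> space (Rp p) \<Longrightarrow> k x x = a0"
    and k_meas [measurable]: "(\<lambda>(x, y). k x y) \<in> borel_measurable (Rp p \<Otimes>\<^sub>M Rp p)"
    and k_growth: "\<And>x y. x \<in> space (Rp p) \<Longrightarrow> y \<in> space (Rp p) \<Longrightarrow>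
      (k x y - f0)\<^sup>2 \<le> F\<^sup>2 * (2 + 4 * sq_radius p \<mu> A x + 4 * sq_radius p \<mu> A y)"
    and F: "0 < F" and A: "0 < A"
    and rP: "integrable P (sq_radius p \<mu> A)" "(\<integral>x. sq_radius p \<mu> A x \<partial>P) \<le> 1"
    and rQ: "integrable Q (sq_radius p \<mu> A)" "(\<integral>x. sq_radius p \<mu> A x \<partial>Q) \<le> 1"
    and nm: "2 \<le> n" "2 \<le> m" and \<eta>: "0 < \<eta>" "\<eta> * real (n + m) \<le> real n" "\<eta> * real (n + m) \<le> real m"
    and J: "finite J" "(\<Sum>i\<in>J. g i) = 0" "(\<Sum>i\<in>J. \<bar>g i\<bar>) \<le> 12"
    and z: "\<And>i. z i \<in> space (Rp p)" "\<And>i. i \<in> J \<Longrightarrow> sq_radius p \<mu> A (z i) \<le> \<rho>z" and \<rho>z: "0 \<le> \<rho>z"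
begin

abbreviation "r \<equiv> sq_radius p \<mu> A"
abbreviation "N \<equiv> n + m"

definition "G x = (\<Sum>i\<in>J. g i * k x (z i))"
definition "\<gamma> = (\<integral>x. G x \<partial>P) - (\<integral>x. G x \<partial>Q)"
definition "Gt \<omega> = (1 / real n) * (\<Sum>i=1..n. G (X i \<omega>)) - (1 / real m) * (\<Sum>j=1..m. G (Y j \<omega>))"
text \<open>The average squared radius of the pooled sample. This single quantity controls both the
  diagonal bias of the energy statistic and the variance estimator.\<close>

definition "Qb \<omega> = (1 / real N) * ((\<Sum>i=1..n. r (X i \<omega>)) + (\<Sum>j=1..m. r (Y j \<omega>)))"
abbreviation "b0 \<equiv> test_norm \<rho>z"
abbreviation "\<Phi> \<equiv> margin \<eta> \<rho>z"
abbreviation "C1 \<equiv> tail_const \<eta> \<rho>z"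
abbreviation "energy \<omega> \<equiv> energy_stat k n m (\<lambda>i. X i \<omega>) (\<lambda>j. Y j \<omega>)"
abbreviation "V \<omega> \<equiv> V_star k a0 n m (\<lambda>i. X i \<omega>) (\<lambda>j. Y j \<omega>)"

lemma r_nonneg: "0 \<le> r x" unfolding sq_radius_def using A by (intro divide_nonneg_pos sum_nonneg) auto

lemma N_pos: "4 \<le> real N" "0 < real N" "0 < real n" "0 < real m" using nm by auto

lemma r_measurable [measurable]: "r \<in> borel_measurable (Rp p)"
proof -
  have [measurable]: "(\<lambda>x. x j :: real) \<in> borel_measurable (Rp p)" if "j \<in> {1..p}" for j
    unfolding Rp_def using that by (rule measurable_component_singleton)
  show ?thesis unfolding sq_radius_def[abs_def] by measurable
qed

lemma k_z_measurable: "(\<lambda>x. k x (z i)) \<in> borel_measurable (Rp p)"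
  using measurable_compose[OF _ k_meas, of "\<lambda>x. (x, z i)" "Rp p"] z by simp

lemma G_measurable [measurable]: "G \<in> borel_measurable (Rp p)"
  unfolding G_def[abs_def] using k_z_measurable by auto

lemma k_abs:
  assumes "x \<in> space (Rp p)" "y \<in> space (Rp p)"
  shows "\<bar>k x y - f0\<bar> \<le> F * (2 + 4 * r x + 4 * r y)"
proof -
  define t where "t = 2 + 4 * r x + 4 * r y"
  have t: "1 \<le> t" unfolding t_def using r_nonneg[of x] r_nonneg[of y] by simp
  have "(k x y - f0)\<^sup>2 \<le> F\<^sup>2 * t" unfolding t_def by (rule k_growth[OF assms])
  also have "\<dots> \<le> F\<^sup>2 * t\<^sup>2" using t self_le_power[of t 2] by (intro mult_left_mono) auto
  also have "\<dots> = (F * t)\<^sup>2" by (simp add: power_mult_distrib)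
  finally have "\<bar>k x y - f0\<bar> \<le> \<bar>F * t\<bar>" by (simp add: abs_le_square_iff)
  then show ?thesis using F t unfolding t_def by simp
qed

lemma a0_le: "\<bar>a0 - f0\<bar> \<le> 2 * F"
proof -
  \<comment> \<open>At the centre \<mu> the radius vanishes, so the growth bound there is the best
    available one for the diagonal value.\<close>
  define o' where "o' = (\<lambda>j\<in>{1..p}. \<mu> j)"
  have "o' \<in> space (Rp p)" unfolding o'_def Rp_def space_PiM by auto
  moreover have "r o' = 0" unfolding sq_radius_def o'_def by simp
  ultimately show ?thesis using k_abs[of o' o'] k_diag[of o'] by simp
qed

text \<open>Mass zero permits subtracting \<open>f0\<close> from every kernel value without changing
  \<open>G\<close>, so only deviations from \<open>f0\<close> count.\<close>

lemma G_sq_le: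
  assumes x: "x \<in> space (Rp p)"
  shows "(G x)\<^sup>2 \<le> 144 * F\<^sup>2 * (2 + 4 * r x + 4 * \<rho>z)"
proof -
  define t where "t = 2 + 4 * r x + 4 * \<rho>z"
  have t: "0 \<le> t" unfolding t_def using r_nonneg[of x] \<rho>z by simp
  have b: "\<bar>k x (z i) - f0\<bar> \<le> F * sqrt t" if "i \<in> J" for i
  proof -
    have "(k x (z i) - f0)\<^sup>2 \<le> F\<^sup>2 * (2 + 4 * r x + 4 * r (z i))" by (rule k_growth[OF x z(1)])
    also have "\<dots> \<le> F\<^sup>2 * t" unfolding t_def using z(2)[OF that] by (intro mult_left_mono) auto
    also have "\<dots> = (F * sqrt t)\<^sup>2" using t by (simp add: power_mult_distrib)
    finally have "\<bar>k x (z i) - f0\<bar> \<le> \<bar>F * sqrt t\<bar>" by (simp add: abs_le_square_iff)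
    then show ?thesis using F t by simp
  qed
  have "G x = (\<Sum>i\<in>J. g i * (k x (z i) - f0))"
    unfolding G_def right_diff_distrib sum_subtractf sum_distrib_right[symmetric] J(2) by simp
  then have "\<bar>G x\<bar> \<le> (\<Sum>i\<in>J. \<bar>g i\<bar> * (F * sqrt t))"
    using b by (simp add: abs_mult order_trans[OF sum_abs] sum_mono mult_left_mono)
  also have "\<dots> \<le> 12 * (F * sqrt t)"
    unfolding sum_distrib_right[symmetric] using J(3) F t by (intro mult_right_mono) auto
  finally have "\<bar>G x\<bar>\<^sup>2 \<le> (12 * (F * sqrt t))\<^sup>2" by (intro power_mono) auto
  also have "\<dots> = 144 * F\<^sup>2 * t" using t by (simp add: power_mult_distrib)
  finally show ?thesis unfolding t_def by simp
qed

lemma X_space: "\<omega> \<in> space M \<Longrightarrow> 1 \<le> i \<Longrightarrow> X i \<omega> \<in> space (Rp p)"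
  using measurable_space[OF X] by blast

lemma Y_space: "\<omega> \<in> space M \<Longrightarrow> 1 \<le> i \<Longrightarrow> Y i \<omega> \<in> space (Rp p)"
  using measurable_space[OF Y] by blast

lemma test_quadratic: "- (\<Sum>i\<in>J. \<Sum>i'\<in>J. g i * g i' * k (z i) (z i')) \<le> F * b0"
proof -
  have "- (\<Sum>i\<in>J. \<Sum>i'\<in>J. g i * g i' * k (z i) (z i')) = - (\<Sum>i\<in>J. \<Sum>i'\<in>J. g i * g i' * (k (z i) (z i') - f0))"
  proof -
    have "(\<Sum>i\<in>J. \<Sum>i'\<in>J. g i * g i' * f0) = (\<Sum>i\<in>J. g i) * (\<Sum>i\<in>J. g i) * f0"
      by (simp add: sum_distrib_left[symmetric] sum_distrib_right[symmetric])
    then have "(\<Sum>i\<in>J. \<Sum>i'\<in>J. g i * g i' * f0) = 0" using J(2) by simp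
    then show ?thesis by (simp only: right_diff_distrib sum_subtractf diff_zero)
  qed
  also have "\<dots> \<le> \<bar>\<Sum>i\<in>J. \<Sum>i'\<in>J. g i * g i' * (k (z i) (z i') - f0)\<bar>" by simp
  also have "\<dots> \<le> (\<Sum>i\<in>J. \<Sum>i'\<in>J. \<bar>g i\<bar> * \<bar>g i'\<bar> * (F * (2 + 8 * \<rho>z)))"
  proof (intro order_trans[OF sum_abs] sum_mono)
    fix i i' assume i: "i \<in> J" "i' \<in> J"
    have "\<bar>k (z i) (z i') - f0\<bar> \<le> F * (2 + 4 * r (z i) + 4 * r (z i'))" by (rule k_abs[OF z(1) z(1)])
    also have "\<dots> \<le> F * (2 + 8 * \<rho>z)" using z(2)[OF i(1)] z(2)[OF i(2)] F by (intro mult_left_mono) auto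
    finally show "\<bar>g i * g i' * (k (z i) (z i') - f0)\<bar> \<le> \<bar>g i\<bar> * \<bar>g i'\<bar> * (F * (2 + 8 * \<rho>z))"
      by (simp add: abs_mult mult_left_mono)
  qed
  also have "\<dots> = (\<Sum>i\<in>J. \<bar>g i\<bar>) * (\<Sum>i\<in>J. \<bar>g i\<bar>) * (F * (2 + 8 * \<rho>z))"
    by (simp add: sum_distrib_left[symmetric] sum_distrib_right[symmetric])
  also have "\<dots> \<le> 12 * 12 * (F * (2 + 8 * \<rho>z))"
    using J(3) F \<rho>z by (intro mult_right_mono mult_mono) (auto intro: sum_nonneg)
  finally show ?thesis by (simp add: test_norm_def mult_ac)
qed

lemma b0_pos: "0 < b0" using \<rho>z by (simp add: test_norm_def)

lemma bias_le:
  fixes x :: "nat \<Rightarrow> rvec" and l :: nat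
  assumes l: "2 \<le> l" "\<eta> * real N \<le> real l" and x: "\<And>i. i \<in> {1..l} \<Longrightarrow> x i \<in> space (Rp p)"
    and S: "(\<Sum>i=1..l. r (x i)) \<le> real N * S" "0 \<le> S"
  shows "((\<Sum>i=1..l. \<Sum>j=1..l. k (x i) (x j)) / (real l)\<^sup>2 - a0) / (real l - 1)
    \<le> F / real N * (8 + 16 * S / \<eta>) / \<eta>"
proof -
  have l0: "0 < real l" "0 < real l - 1" using l by auto
  have "(\<Sum>i=1..l. \<Sum>j=1..l. k (x i) (x j)) / (real l)\<^sup>2 - a0
      = (\<Sum>i=1..l. \<Sum>j=1..l. k (x i) (x j) - f0) / (real l)\<^sup>2 - (a0 - f0)"
    using l0 by (simp add: sum_subtractf diff_divide_distrib power2_eq_square)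
  also have "\<dots> \<le> (\<Sum>i=1..l. \<Sum>j=1..l. F * (2 + 4 * r (x i) + 4 * r (x j))) / (real l)\<^sup>2 + 2 * F"
  proof -
    have "(\<Sum>i=1..l. \<Sum>j=1..l. k (x i) (x j) - f0) \<le> (\<Sum>i=1..l. \<Sum>j=1..l. F * (2 + 4 * r (x i) + 4 * r (x j)))"
      using k_abs x by (intro sum_mono) (simp add: abs_le_iff)
    then have "(\<Sum>i=1..l. \<Sum>j=1..l. k (x i) (x j) - f0) / (real l)\<^sup>2
        \<le> (\<Sum>i=1..l. \<Sum>j=1..l. F * (2 + 4 * r (x i) + 4 * r (x j))) / (real l)\<^sup>2"
      by (intro divide_right_mono) auto
    then show ?thesis using a0_le by linarith
  qed
  also have "(\<Sum>i=1..l. \<Sum>j=1..l. F * (2 + 4 * r (x i) + 4 * r (x j))) = F * (2 * (real l)\<^sup>2 + 8 * (real l * (\<Sum>i=1..l. r (x i))))"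
    by (simp add: sum.distrib sum_distrib_left[symmetric] power2_eq_square algebra_simps)
  also have "F * (2 * (real l)\<^sup>2 + 8 * (real l * (\<Sum>i=1..l. r (x i)))) / (real l)\<^sup>2 + 2 * F
      = F * (4 + 8 * ((\<Sum>i=1..l. r (x i)) / real l))"
    using l0 by (simp add: field_simps power2_eq_square)
  also have "\<dots> \<le> F * (4 + 8 * (S / \<eta>))"
  proof -
    have "(\<Sum>i=1..l. r (x i)) / real l \<le> real N * S / (\<eta> * real N)"
      using S l \<eta> N_pos by (intro frac_le) auto
    then show ?thesis using \<eta>(1) N_pos F by (intro mult_left_mono) auto
  qed
  finally have 1: "(\<Sum>i=1..l. \<Sum>j=1..l. k (x i) (x j)) / (real l)\<^sup>2 - a0 \<le> F * (4 + 8 * (S / \<eta>))" .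
  have 2: "0 \<le> F * (4 + 8 * (S / \<eta>))" using F S \<eta> by simp
  have "\<eta> * real N / 2 \<le> real l - 1" using l by linarith
  then have "((\<Sum>i=1..l. \<Sum>j=1..l. k (x i) (x j)) / (real l)\<^sup>2 - a0) / (real l - 1) \<le> F * (4 + 8 * (S / \<eta>)) / (\<eta> * real N / 2)"
    using 1 2 \<eta>(1) N_pos by (intro frac_le) auto
  also have "\<dots> = F / real N * (8 + 16 * S / \<eta>) / \<eta>" by (simp add: field_simps)
  finally show ?thesis .
qed

text \<open>On the good event (Gt - \<gamma>)^2 \<le> F^2 S / N, and S \<ge> 4 turns this into at
  most (\<gamma> / 2)^2. So the empirical difference keeps half of \<gamma>, which
  \<open>energy_stat_lower\<close> squares.\<close>

lemma energy_lower:
  assumes \<omega>: "\<omega> \<in> space M" and S: "4 \<le> S" "real N * \<gamma>\<^sup>2 / F\<^sup>2 = S\<^sup>2"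
    and good: "Qb \<omega> \<le> S" "real N * (Gt \<omega> - \<gamma>)\<^sup>2 / F\<^sup>2 \<le> S"
  shows "F / real N * \<Phi> S \<le> energy \<omega>"
proof -
  have x: "X i \<omega> \<in> space (Rp p)" "Y i \<omega> \<in> space (Rp p)" if "1 \<le> i" for i
    using that X_space Y_space \<omega> by auto
  \<comment> \<open>\<open>energy_stat_lower\<close> asks for points of the space at every index,
    whereas the samples are constrained only from index 1 on.\<close>
  define x' where "x' i = (if 1 \<le> i then X i \<omega> else X 1 \<omega>)" for i
  define y' where "y' i = (if 1 \<le> i then Y i \<omega> else Y 1 \<omega>)" for i
  have xy': "x' i \<in> space (Rp p)" "y' i \<in> space (Rp p)" for i using x by (auto simp: x'_def y'_def)
  have low: "energy_stat k n m x' y' \<ge>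
      ((1 / real n) * (\<Sum>i=1..n. \<Sum>l\<in>J. g l * k (x' i) (z l)) - (1 / real m) * (\<Sum>j=1..m. \<Sum>l\<in>J. g l * k (y' j) (z l)))\<^sup>2 / (F * b0)
      - ((\<Sum>i=1..n. \<Sum>j=1..n. k (x' i) (x' j)) / (real n)\<^sup>2 - a0) / (real n - 1)
      - ((\<Sum>i=1..m. \<Sum>j=1..m. k (y' i) (y' j)) / (real m)\<^sup>2 - a0) / (real m - 1)"
  proof (rule energy_stat_lower[where Sp = "space (Rp p)" and B = "F * b0"])
    show "(\<Sum>i\<in>I. \<Sum>j\<in>I. w i * w j * k (pts i) (pts j)) \<le> 0"
      if "finite I" "(\<Sum>i\<in>I. w i) = 0" "pts ` I \<subseteq> space (Rp p)"
      for w :: "nat + nat + (int \<times> bool) \<Rightarrow> real" and pts I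
      by (rule k_cnd[OF that])
    show "0 < F * b0" using F b0_pos by simp
  qed (rule xy' z(1) J(1,2) nm k_diag test_quadratic k_sym | assumption)+
  have eqs: "energy_stat k n m x' y' = energy \<omega>"
    "(\<Sum>i=1..n. \<Sum>l\<in>J. g l * k (x' i) (z l)) = (\<Sum>i=1..n. G (X i \<omega>))"
    "(\<Sum>i=1..m. \<Sum>l\<in>J. g l * k (y' i) (z l)) = (\<Sum>i=1..m. G (Y i \<omega>))"
    unfolding energy_stat_def x'_def y'_def G_def by (auto intro!: sum.cong arg_cong2[of _ _ _ _ "(-)"])
  have sums: "(\<Sum>i=1..n. r (X i \<omega>)) + (\<Sum>j=1..m. r (Y j \<omega>)) \<le> real N * S"
    using good(1) N_pos unfolding Qb_def by (simp add: field_simps)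
  have "0 \<le> (\<Sum>i=1..n. r (X i \<omega>))" "0 \<le> (\<Sum>j=1..m. r (Y j \<omega>))" by (auto intro!: sum_nonneg r_nonneg)
  then have sx: "(\<Sum>i=1..n. r (x' i)) \<le> real N * S" and sy: "(\<Sum>i=1..m. r (y' i)) \<le> real N * S"
    using sums by (auto simp: x'_def y'_def)
  have bX: "((\<Sum>i=1..n. \<Sum>j=1..n. k (x' i) (x' j)) / (real n)\<^sup>2 - a0) / (real n - 1) \<le> F / real N * (8 + 16 * S / \<eta>) / \<eta>"
    using S by (intro bias_le nm \<eta> xy' sx) auto
  have bY: "((\<Sum>i=1..m. \<Sum>j=1..m. k (y' i) (y' j)) / (real m)\<^sup>2 - a0) / (real m - 1) \<le> F / real N * (8 + 16 * S / \<eta>) / \<eta>"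
    using S by (intro bias_le nm \<eta> xy' sy) auto
  have Sp: "0 < S" using S by simp
  have gam: "\<gamma>\<^sup>2 = F\<^sup>2 * S\<^sup>2 / real N" using S(2) F N_pos by (simp add: field_simps)
  have "(Gt \<omega> - \<gamma>)\<^sup>2 \<le> F\<^sup>2 * S / real N" using good(2) F N_pos by (simp add: field_simps)
  also have "\<dots> \<le> F\<^sup>2 * (S\<^sup>2 / 4) / real N"
    using S Sp by (intro divide_right_mono mult_left_mono) (auto simp: power2_eq_square)
  also have "\<dots> = (\<gamma> / 2)\<^sup>2" using gam by (simp add: power_divide)
  finally have "\<bar>Gt \<omega> - \<gamma>\<bar> \<le> \<bar>\<gamma> / 2\<bar>" by (simp only: abs_le_square_iff)
  then have "\<bar>\<gamma> / 2\<bar> \<le> \<bar>Gt \<omega>\<bar>" by linarith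
  then have "(\<gamma> / 2)\<^sup>2 \<le> (Gt \<omega>)\<^sup>2" by (simp only: abs_le_square_iff)
  then have "F\<^sup>2 * S\<^sup>2 / real N / 4 / (F * b0) \<le> (Gt \<omega>)\<^sup>2 / (F * b0)"
    using F b0_pos gam by (intro divide_right_mono) (auto simp: power_divide)
  moreover have "F\<^sup>2 * S\<^sup>2 / real N / 4 / (F * b0) = F / real N * (S\<^sup>2 / (4 * b0))"
    using F by (simp add: power2_eq_square)
  moreover have "F / real N * \<Phi> S = F / real N * (S\<^sup>2 / (4 * b0)) - F / real N * (8 + 16 * S / \<eta>) / \<eta> - F / real N * (8 + 16 * S / \<eta>) / \<eta>"
  proof -
    define W where "W = (8 + 16 * S / \<eta>) / \<eta>"
    have "\<Phi> S = S\<^sup>2 / (4 * b0) - 2 * W" unfolding margin_def W_def by (simp add: add_divide_distrib)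
    moreover have "F / real N * (8 + 16 * S / \<eta>) / \<eta> = F / real N * W" by (simp add: W_def)
    ultimately show ?thesis by (simp add: right_diff_distrib)
  qed
  ultimately show ?thesis using low bX bY unfolding eqs Gt_def by linarith
qed

lemma c_nm_bounds: "0 < c_nm n m" "c_nm n m \<le> 12 / (\<eta> * real N)\<^sup>2"
proof -
  have n1: "real n / 2 \<le> real n - 1" "real m / 2 \<le> real m - 1" using nm by auto
  have a: "(\<eta> * real N)\<^sup>2 / 2 \<le> real l * (real l - 1)" if "\<eta> * real N \<le> real l" "real l / 2 \<le> real l - 1" for l
  proof -
    have "(\<eta> * real N) * (\<eta> * real N / 2) \<le> real l * (real l - 1)"
      using that \<eta>(1) by (intro mult_mono) auto
    then show ?thesis by (simp add: power2_eq_square)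
  qed
  have p: "0 < (\<eta> * real N)\<^sup>2" using \<eta>(1) N_pos by simp
  have 1: "2 / (real l * (real l - 1)) \<le> 4 / (\<eta> * real N)\<^sup>2" if "\<eta> * real N \<le> real l" "real l / 2 \<le> real l - 1" for l
  proof -
    have "2 / (real l * (real l - 1)) \<le> 2 / ((\<eta> * real N)\<^sup>2 / 2)"
      using a[OF that] p by (intro frac_le) auto
    then show ?thesis by simp
  qed
  have 2: "4 / (real n * real m) \<le> 4 / (\<eta> * real N)\<^sup>2"
    unfolding power2_eq_square using \<eta> N_pos by (intro frac_le mult_mono mult_pos_pos) auto
  show "c_nm n m \<le> 12 / (\<eta> * real N)\<^sup>2"
    unfolding c_nm_def using 1[OF \<eta>(2) n1(1)] 1[OF \<eta>(3) n1(2)] 2 by simp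
  show "0 < c_nm n m" unfolding c_nm_def using nm by (intro add_pos_pos divide_pos_pos mult_pos_pos) auto
qed

text \<open>Averaged over all pairs, the growth bound becomes F^2 (2 + 8 Qb). The factor 4 bounds N
  / (N - 3), which is largest at N = 4.\<close>

lemma V_bounds:
  assumes \<omega>: "\<omega> \<in> space M" and S: "Qb \<omega> \<le> S"
  shows "energy \<omega> \<noteq> 0 \<Longrightarrow> 0 < V \<omega>" and "V \<omega> \<le> 4 * F\<^sup>2 * (2 + 8 * S)"
proof -
  text \<open>The value of the samples at index 0 is irrelevant but has to lie in the domain of the kernel.\<close>
  define x' where "x' i = (if 1 \<le> i then X i \<omega> else X 1 \<omega>)" for i
  define y' where "y' i = (if 1 \<le> i then Y i \<omega> else Y 1 \<omega>)" for i
  have xy': "pooled n x' y' s \<in> space (Rp p)" for s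
    using X_space[OF \<omega>] Y_space[OF \<omega>] by (auto simp: x'_def y'_def pooled_def)
  interpret U: two_sample_values k a0 f0 n m x' y'
  proof
    show "k (pooled n x' y' s) (pooled n x' y' t) = k (pooled n x' y' t) (pooled n x' y' s)" for s t
      by (rule k_sym[OF xy' xy'])
    show "k (pooled n x' y' s) (pooled n x' y' s) = a0" for s by (rule k_diag[OF xy'])
  qed (rule nm)+
  have pool: "pooled n x' y' s = pooled n (\<lambda>i. X i \<omega>) (\<lambda>j. Y j \<omega>) s" if "1 \<le> s" for s
    using that by (auto simp: pooled_def x'_def y'_def)
  have energy_eq: "energy_stat k n m x' y' = energy \<omega>"
    unfolding energy_stat_def x'_def y'_def by (auto intro!: sum.cong arg_cong2[of _ _ _ _ "(-)"])
  have A_eq: "A_star (n + m) (\<lambda>s t. k (pooled n x' y' s) (pooled n x' y' t)) s t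
      = A_star (n + m) (\<lambda>s t. k (pooled n (\<lambda>i. X i \<omega>) (\<lambda>j. Y j \<omega>) s) (pooled n (\<lambda>i. X i \<omega>) (\<lambda>j. Y j \<omega>) t)) s t"
    if "1 \<le> s" "1 \<le> t" for s t
    unfolding A_star_def using that by (simp add: pool)
  have V_eq: "V_star k a0 n m x' y' = V \<omega>"
    unfolding V_star_def Let_def by (simp add: A_eq)
  show "energy \<omega> \<noteq> 0 \<Longrightarrow> 0 < V \<omega>" using U.V_star_pos unfolding energy_eq V_eq .
  have N3: "0 < real (n + m) - 3" "0 < real (n + m)" "real (n + m) \<le> 4 * (real (n + m) - 3)" using nm by auto
  have rs: "(\<Sum>s=1..n+m. r (pooled n x' y' s)) = real (n + m) * Qb \<omega>"
  proof -
    have "(\<Sum>s=1..n+m. r (pooled n x' y' s)) = (\<Sum>s=1..n. r (pooled n x' y' s)) + (\<Sum>s=n+1..n+m. r (pooled n x' y' s))"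
      by (rule sum.ub_add_nat) simp
    also have "(\<Sum>s=n+1..n+m. r (pooled n x' y' s)) = (\<Sum>j=1..m. r (pooled n x' y' (j + n)))"
      using sum.shift_bounds_cl_nat_ivl[of "\<lambda>s. r (pooled n x' y' s)" 1 n m] by (simp add: add.commute)
    also have "(\<Sum>s=1..n. r (pooled n x' y' s)) = (\<Sum>i=1..n. r (X i \<omega>))" by (simp add: pooled_def x'_def)
    also have "(\<Sum>j=1..m. r (pooled n x' y' (j + n))) = (\<Sum>j=1..m. r (Y j \<omega>))" by (simp add: pooled_def y'_def)
    finally show ?thesis using N3 by (simp add: Qb_def)
  qed
  have "V \<omega> \<le> 1 / (real (n + m) * (real (n + m) - 3)) * (\<Sum>s=1..n+m. \<Sum>t=1..n+m. (k (pooled n x' y' s) (pooled n x' y' t) - f0)\<^sup>2)"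
    using U.V_star_le unfolding V_eq .
  also have "\<dots> \<le> 1 / (real (n + m) * (real (n + m) - 3)) * (\<Sum>s=1..n+m. \<Sum>t=1..n+m. F\<^sup>2 * (2 + 4 * r (pooled n x' y' s) + 4 * r (pooled n x' y' t)))"
    using N3 by (intro mult_left_mono sum_mono k_growth xy') auto
  also have "(\<Sum>s=1..n+m. \<Sum>t=1..n+m. F\<^sup>2 * (2 + 4 * r (pooled n x' y' s) + 4 * r (pooled n x' y' t)))
      = F\<^sup>2 * (real (n + m) * (real (n + m) * 2 + 8 * (\<Sum>s=1..n+m. r (pooled n x' y' s))))"
    unfolding sum_distrib_left[symmetric] by (simp add: sum.distrib sum_distrib_left[symmetric] algebra_simps)
  also have "1 / (real (n + m) * (real (n + m) - 3)) * \<dots> = real (n + m) / (real (n + m) - 3) * (F\<^sup>2 * (2 + 8 * Qb \<omega>))"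
  proof -
    have *: "1 / (a * (a - 3)) * (f * (a * (a * 2 + 8 * (a * y)))) = a / (a - 3) * (f * (2 + 8 * y))"
      if "a \<noteq> 0" for a f y :: real
    proof -
      have "f * (a * (a * 2 + 8 * (a * y))) = a * (a * (f * (2 + 8 * y)))" by (simp add: algebra_simps)
      then show ?thesis using that by simp
    qed
    show ?thesis unfolding rs by (rule *) (use N3 in simp)
  qed
  also have "\<dots> \<le> 4 * (F\<^sup>2 * (2 + 8 * S))"
  proof (rule mult_mono)
    show "real (n + m) / (real (n + m) - 3) \<le> 4" using N3 by (simp add: divide_le_eq)
    show "F\<^sup>2 * (2 + 8 * Qb \<omega>) \<le> F\<^sup>2 * (2 + 8 * S)" using S by (intro mult_left_mono) auto
    have "0 \<le> Qb \<omega>" unfolding Qb_def by (intro mult_nonneg_nonneg add_nonneg_nonneg sum_nonneg r_nonneg) auto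
    then show "0 \<le> F\<^sup>2 * (2 + 8 * Qb \<omega>)" by simp
  qed simp
  finally show "V \<omega> \<le> 4 * F\<^sup>2 * (2 + 8 * S)" by simp
qed

text \<open>Numerator and denominator both scale like F / N, so the ratio is bounded below in terms
  of S and \<eta> alone. The 48 is 12 from \<open>c_nm\<close> times 4 from
  \<open>V_bounds\<close>.\<close>

lemma statistic_gt:
  assumes \<omega>: "\<omega> \<in> space M" and S: "4 \<le> S" "real N * \<gamma>\<^sup>2 / F\<^sup>2 = S\<^sup>2" and C: "0 < C"
    and big: "C * sqrt (48 * (2 + 8 * S)) < \<eta> * \<Phi> S"
    and good: "Qb \<omega> \<le> S" "real N * (Gt \<omega> - \<gamma>)\<^sup>2 / F\<^sup>2 \<le> S"
  shows "C < energy \<omega> / sqrt (c_nm n m * V \<omega>)"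
proof -
  have s0: "0 < sqrt (48 * (2 + 8 * S))" using S by simp
  have \<Phi>: "0 < \<Phi> S"
  proof -
    have "0 < \<eta> * \<Phi> S" using big mult_pos_pos[OF C s0] by linarith
    then show ?thesis using \<eta>(1) by (simp add: zero_less_mult_iff)
  qed
  have e: "F / real N * \<Phi> S \<le> energy \<omega>" by (rule energy_lower[OF \<omega> S good])
  have "0 < F / real N * \<Phi> S" using F N_pos \<Phi> by simp
  then have V: "0 < V \<omega>" using V_bounds(1)[OF \<omega> good(1)] e by simp
  have cV: "0 < c_nm n m * V \<omega>" using V c_nm_bounds by simp
  have "c_nm n m * V \<omega> \<le> 12 / (\<eta> * real N)\<^sup>2 * (4 * F\<^sup>2 * (2 + 8 * S))"
    using c_nm_bounds V V_bounds(2)[OF \<omega> good(1)] by (intro mult_mono) auto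
  also have "\<dots> = (F / (\<eta> * real N))\<^sup>2 * (48 * (2 + 8 * S))" by (simp add: power_divide)
  finally have "sqrt (c_nm n m * V \<omega>) \<le> sqrt ((F / (\<eta> * real N))\<^sup>2 * (48 * (2 + 8 * S)))" by simp
  also have "\<dots> = F / (\<eta> * real N) * sqrt (48 * (2 + 8 * S))"
    using F \<eta>(1) by (simp only: real_sqrt_mult real_sqrt_abs) simp
  finally have "C * sqrt (c_nm n m * V \<omega>) \<le> C * (F / (\<eta> * real N) * sqrt (48 * (2 + 8 * S)))"
    using C by (intro mult_left_mono) auto
  also have "\<dots> = F / (\<eta> * real N) * (C * sqrt (48 * (2 + 8 * S)))" by simp
  also have "\<dots> < F / (\<eta> * real N) * (\<eta> * \<Phi> S)"
    using big F \<eta>(1) N_pos by (intro mult_strict_left_mono) auto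
  also have "\<dots> = F / real N * \<Phi> S" using \<eta>(1) by simp
  also have "\<dots> \<le> energy \<omega>" by (rule e)
  finally show ?thesis using cV by (simp add: pos_less_divide_eq)
qed

section \<open>Measurability and moments of the random quantities\<close>

lemma kXY_measurable:
  assumes "1 \<le> s" "1 \<le> t"
  shows "(\<lambda>\<omega>. k (pooled n (\<lambda>i. X i \<omega>) (\<lambda>j. Y j \<omega>) s) (pooled n (\<lambda>i. X i \<omega>) (\<lambda>j. Y j \<omega>) t)) \<in> borel_measurable M"
proof -
  have W: "(\<lambda>\<omega>. pooled n (\<lambda>i. X i \<omega>) (\<lambda>j. Y j \<omega>) s) \<in> M \<rightarrow>\<^sub>M Rp p" if "1 \<le> s" for s
    unfolding pooled_def using that by (cases "s \<le> n") auto
  show ?thesis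
    using measurable_compose[OF measurable_Pair[OF W[OF assms(1)] W[OF assms(2)]] k_meas] by simp
qed

lemma energy_measurable: "energy \<in> borel_measurable M"
proof -
  have 1: "(\<lambda>\<omega>. k (X i \<omega>) (X j \<omega>)) \<in> borel_measurable M" "(\<lambda>\<omega>. k (X i \<omega>) (Y j \<omega>)) \<in> borel_measurable M"
    "(\<lambda>\<omega>. k (Y i \<omega>) (Y j \<omega>)) \<in> borel_measurable M" if "1 \<le> i" "1 \<le> j" for i j
    using measurable_compose[OF measurable_Pair[OF X[OF that(1)] X[OF that(2)]] k_meas]
      measurable_compose[OF measurable_Pair[OF X[OF that(1)] Y[OF that(2)]] k_meas]
      measurable_compose[OF measurable_Pair[OF Y[OF that(1)] Y[OF that(2)]] k_meas] by simp_all
  show ?thesis unfolding energy_stat_def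
    by (intro borel_measurable_diff borel_measurable_times borel_measurable_const borel_measurable_sum 1) auto
qed

lemma V_measurable: "V \<in> borel_measurable M"
  unfolding V_star_def Let_def A_star_def
  by (intro borel_measurable_diff borel_measurable_add borel_measurable_times borel_measurable_const
      borel_measurable_sum borel_measurable_power kXY_measurable) auto

lemma integrable_G_sq:
  assumes "prob_space D" "sets D = sets (Rp p)" "integrable D r" "(\<integral>x. r x \<partial>D) \<le> 1"
  shows "integrable D G" "integrable D (\<lambda>x. (G x)\<^sup>2)"
    and "(\<integral>x. (G x - (\<integral>x. G x \<partial>D))\<^sup>2 \<partial>D) \<le> 144 * F\<^sup>2 * (6 + 4 * \<rho>z)"
proof -
  interpret D: prob_space D by fact
  have Gm [measurable]: "G \<in> borel_measurable D"
    using G_measurable unfolding measurable_cong_sets[OF assms(2) refl] .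
  have sp: "space D = space (Rp p)" by (rule sets_eq_imp_space_eq[OF assms(2)])
  have ib: "integrable D (\<lambda>x. 144 * F\<^sup>2 * (2 + 4 * r x + 4 * \<rho>z))" using assms(3) by auto
  show i2: "integrable D (\<lambda>x. (G x)\<^sup>2)"
  proof (rule Bochner_Integration.integrable_bound[OF ib])
    show "AE x in D. norm ((G x)\<^sup>2) \<le> norm (144 * F\<^sup>2 * (2 + 4 * r x + 4 * \<rho>z))"
      unfolding real_norm_def abs_power2 by (intro AE_I2 order_trans[OF G_sq_le abs_ge_self]) (simp add: sp)
  qed simp
  show i1: "integrable D G" by (rule D.square_integrable_imp_integrable[OF Gm i2])
  have "(\<integral>x. (G x - (\<integral>x. G x \<partial>D))\<^sup>2 \<partial>D) = (\<integral>x. (G x)\<^sup>2 \<partial>D) - (\<integral>x. G x \<partial>D)\<^sup>2"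
    by (rule D.variance_eq[OF i1 i2])
  also have "\<dots> \<le> (\<integral>x. (G x)\<^sup>2 \<partial>D)" by simp
  also have "\<dots> \<le> (\<integral>x. 144 * F\<^sup>2 * (2 + 4 * r x + 4 * \<rho>z) \<partial>D)"
    using G_sq_le sp by (intro Bochner_Integration.integral_mono[OF i2 ib]) auto
  also have "\<dots> = 144 * F\<^sup>2 * (2 + 4 * (\<integral>x. r x \<partial>D) + 4 * \<rho>z)"
    using assms(3) by (simp add: D.prob_space)
  also have "\<dots> \<le> 144 * F\<^sup>2 * (6 + 4 * \<rho>z)" using assms(4) by (intro mult_left_mono) auto
  finally show "(\<integral>x. (G x - (\<integral>x. G x \<partial>D))\<^sup>2 \<partial>D) \<le> 144 * F\<^sup>2 * (6 + 4 * \<rho>z)" .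
qed

lemma laws: "prob_space P" "prob_space Q" "sets P = sets (Rp p)" "sets Q = sets (Rp p)"
  using X_distr[of 1] Y_distr[of 1] prob_space_distr[OF X[of 1]] prob_space_distr[OF Y[of 1]] by auto

lemma transfer_X:
  assumes "1 \<le> i" "(h :: rvec \<Rightarrow> real) \<in> borel_measurable (Rp p)"
  shows "integrable P h \<Longrightarrow> integrable M (\<lambda>\<omega>. h (X i \<omega>))" "expectation (\<lambda>\<omega>. h (X i \<omega>)) = (\<integral>x. h x \<partial>P)"
  using integrable_distr_eq[OF X[OF assms(1)] assms(2)] integral_distr[OF X[OF assms(1)] assms(2)]
  unfolding X_distr[OF assms(1)] by auto

lemma transfer_Y:
  assumes "1 \<le> i" "(h :: rvec \<Rightarrow> real) \<in> borel_measurable (Rp p)"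
  shows "integrable Q h \<Longrightarrow> integrable M (\<lambda>\<omega>. h (Y i \<omega>))" "expectation (\<lambda>\<omega>. h (Y i \<omega>)) = (\<integral>x. h x \<partial>Q)"
  using integrable_distr_eq[OF Y[OF assms(1)] assms(2)] integral_distr[OF Y[OF assms(1)] assms(2)]
  unfolding Y_distr[OF assms(1)] by auto

lemma Qb_expectation: "integrable M Qb" "expectation Qb \<le> 1"
proof -
  have ix: "integrable M (\<lambda>\<omega>. r (X i \<omega>))" "expectation (\<lambda>\<omega>. r (X i \<omega>)) \<le> 1" if "1 \<le> i" for i
    using transfer_X[OF that r_measurable] rP by auto
  have iy: "integrable M (\<lambda>\<omega>. r (Y i \<omega>))" "expectation (\<lambda>\<omega>. r (Y i \<omega>)) \<le> 1" if "1 \<le> i" for i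
    using transfer_Y[OF that r_measurable] rQ by auto
  have sx: "integrable M (\<lambda>\<omega>. \<Sum>i=1..n. r (X i \<omega>))"
      "expectation (\<lambda>\<omega>. \<Sum>i=1..n. r (X i \<omega>)) = (\<Sum>i=1..n. expectation (\<lambda>\<omega>. r (X i \<omega>)))"
    by (intro Bochner_Integration.integrable_sum Bochner_Integration.integral_sum ix, simp)+
  have sy: "integrable M (\<lambda>\<omega>. \<Sum>j=1..m. r (Y j \<omega>))"
      "expectation (\<lambda>\<omega>. \<Sum>j=1..m. r (Y j \<omega>)) = (\<Sum>j=1..m. expectation (\<lambda>\<omega>. r (Y j \<omega>)))"
    by (intro Bochner_Integration.integrable_sum Bochner_Integration.integral_sum iy, simp)+
  show "integrable M Qb" unfolding Qb_def[abs_def]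
    using sx(1) sy(1) by (intro integrable_mult_right Bochner_Integration.integrable_add)
  have "expectation Qb = (1 / real N) * ((\<Sum>i=1..n. expectation (\<lambda>\<omega>. r (X i \<omega>))) + (\<Sum>j=1..m. expectation (\<lambda>\<omega>. r (Y j \<omega>))))"
    unfolding Qb_def[abs_def] sx(2)[symmetric] sy(2)[symmetric]
    using Bochner_Integration.integral_add[OF sx(1) sy(1)] by simp
  also have "\<dots> \<le> (1 / real N) * (real (card {1..n}) * 1 + real (card {1..m}) * 1)"
    using ix iy by (intro mult_left_mono add_mono sum_bounded_above) auto
  also have "\<dots> = 1" using N_pos by simp
  finally show "expectation Qb \<le> 1" .
qed

text \<open>Gt - \<gamma> is a sum of n + m independent centred terms, indexed by the disjoint union
  of the two samples. Each sample contributes at most 144 F^2 (6 + 4 \<open>\<rho>z\<close>) /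
  (\<eta> N), hence the 288.\<close>

lemma Gt_second_moment:
  "integrable M (\<lambda>\<omega>. (Gt \<omega> - \<gamma>)\<^sup>2)" "expectation (\<lambda>\<omega>. (Gt \<omega> - \<gamma>)\<^sup>2) \<le> 288 * F\<^sup>2 * (6 + 4 * \<rho>z) / (\<eta> * real N)"
proof -
  define mP where "mP = (\<integral>x. G x \<partial>P)"
  define mQ where "mQ = (\<integral>x. G x \<partial>Q)"
  define h :: "nat + nat \<Rightarrow> rvec \<Rightarrow> real" where "h = case_sum (\<lambda>i x. (G x - mP) / real n) (\<lambda>j x. - (G x - mQ) / real m)"
  define \<xi> where "\<xi> i \<omega> = h i (case_sum X Y i \<omega>)" for i \<omega>
  let ?I = "{1..n} <+> {1..m}"
  interpret P: prob_space P by (rule laws)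
  interpret Q: prob_space Q by (rule laws)
  note GP = integrable_G_sq[OF laws(1,3) rP] and GQ = integrable_G_sq[OF laws(2,4) rQ]
  have hm: "h i \<in> borel_measurable (Rp p)" for i 
  proof (cases i)
    case (Inl j)
    then have "h i = (\<lambda>x. (G x - mP) / real n)" by (simp add: h_def)
    then show ?thesis by simp
  next
    case (Inr j)
    then have "h i = (\<lambda>x. - (G x - mQ) / real m)" by (simp add: h_def)
    then show ?thesis by simp
  qed
  have ind: "indep_vars (\<lambda>_. borel) \<xi> ?I"
    unfolding \<xi>_def[abs_def]
    by (rule indep_vars_compose2[OF indep_vars_subset[OF indep] hm]) auto
  have h1P: "integrable P (h (Inl i))" "integrable P (\<lambda>x. (h (Inl i) x)\<^sup>2)" "(\<integral>x. h (Inl i) x \<partial>P) = 0" for i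
  proof -
    show "integrable P (h (Inl i))" unfolding h_def using GP(1) by simp
    have "integrable P (\<lambda>x. (G x - mP)\<^sup>2)"
      unfolding power2_diff using GP by auto
    then show "integrable P (\<lambda>x. (h (Inl i) x)\<^sup>2)" unfolding h_def by (simp add: power_divide)
    show "(\<integral>x. h (Inl i) x \<partial>P) = 0" unfolding h_def using GP(1) by (simp add: mP_def P.prob_space)
  qed
  have h1Q: "integrable Q (h (Inr i))" "integrable Q (\<lambda>x. (h (Inr i) x)\<^sup>2)" "(\<integral>x. h (Inr i) x \<partial>Q) = 0" for i
  proof -
    show "integrable Q (h (Inr i))" unfolding h_def using GQ(1) by simp
    have "integrable Q (\<lambda>x. (G x - mQ)\<^sup>2)"
      unfolding power2_diff using GQ by auto
    then show "integrable Q (\<lambda>x. (h (Inr i) x)\<^sup>2)" unfolding h_def by (simp add: power_divide power2_commute)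
    show "(\<integral>x. h (Inr i) x \<partial>Q) = 0" unfolding h_def using GQ(1) by (simp add: mQ_def Q.prob_space)
  qed
  have hm2: "(\<lambda>x. (h i x)\<^sup>2) \<in> borel_measurable (Rp p)" for i using hm by (intro borel_measurable_power)
  have \<xi>: "integrable M (\<xi> i)" "integrable M (\<lambda>\<omega>. (\<xi> i \<omega>)\<^sup>2)" "expectation (\<xi> i) = 0" if "i \<in> ?I" for i
  proof -
    have "integrable M (\<xi> i) \<and> integrable M (\<lambda>\<omega>. (\<xi> i \<omega>)\<^sup>2) \<and> expectation (\<xi> i) = 0"
      using that
    proof
      fix j assume "i = Inl j" "j \<in> {1..n}"
      then show ?thesis
        using transfer_X[OF _ hm, of j "Inl j"] transfer_X[OF _ hm2, of j "Inl j"] h1P[of j] by (simp add: \<xi>_def[abs_def])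
    next
      fix j assume "i = Inr j" "j \<in> {1..m}"
      then show ?thesis
        using transfer_Y[OF _ hm, of j "Inr j"] transfer_Y[OF _ hm2, of j "Inr j"] h1Q[of j] by (simp add: \<xi>_def[abs_def])
    qed
    then show "integrable M (\<xi> i)" "integrable M (\<lambda>\<omega>. (\<xi> i \<omega>)\<^sup>2)" "expectation (\<xi> i) = 0" by auto
  qed
  have sum_\<xi>: "(\<Sum>i\<in>?I. \<xi> i \<omega>) = Gt \<omega> - \<gamma>" for \<omega>
  proof -
    have "(\<Sum>i\<in>?I. \<xi> i \<omega>) = (\<Sum>i=1..n. (G (X i \<omega>) - mP) / real n) + (\<Sum>j=1..m. - (G (Y j \<omega>) - mQ) / real m)"
      by (subst sum.Plus) (auto simp: \<xi>_def h_def)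
    also have "\<dots> = Gt \<omega> - \<gamma>"
      unfolding Gt_def \<gamma>_def mP_def[symmetric] mQ_def[symmetric] sum_divide_distrib[symmetric] sum_negf sum_subtractf
      using N_pos by (simp add: field_simps)
    finally show ?thesis .
  qed
  have sm: "integrable M (\<lambda>\<omega>. (\<Sum>i\<in>?I. \<xi> i \<omega>)\<^sup>2)"
    "expectation (\<lambda>\<omega>. (\<Sum>i\<in>?I. \<xi> i \<omega>)\<^sup>2) = (\<Sum>i\<in>?I. expectation (\<lambda>\<omega>. (\<xi> i \<omega>)\<^sup>2))"
    using second_moment_indep_sum[OF _ ind \<xi>] by simp_all
  show "integrable M (\<lambda>\<omega>. (Gt \<omega> - \<gamma>)\<^sup>2)" using sm(1) unfolding sum_\<xi> .
  define c where "c = 144 * F\<^sup>2 * (6 + 4 * \<rho>z)"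
  have c0: "0 \<le> c" unfolding c_def using \<rho>z by simp
  have x2: "expectation (\<lambda>\<omega>. (\<xi> (Inl i) \<omega>)\<^sup>2) \<le> c / (real n)\<^sup>2" if "1 \<le> i" for i
  proof -
    have "expectation (\<lambda>\<omega>. (\<xi> (Inl i) \<omega>)\<^sup>2) = (\<integral>x. (h (Inl i) x)\<^sup>2 \<partial>P)"
      unfolding \<xi>_def using transfer_X(2)[OF that hm2] by simp
    also have "\<dots> = (\<integral>x. (G x - mP)\<^sup>2 \<partial>P) / (real n)\<^sup>2" unfolding h_def by (simp add: power_divide)
    also have "\<dots> \<le> c / (real n)\<^sup>2" using GP(3) unfolding mP_def c_def by (intro divide_right_mono) auto
    finally show ?thesis .
  qed
  have y2: "expectation (\<lambda>\<omega>. (\<xi> (Inr i) \<omega>)\<^sup>2) \<le> c / (real m)\<^sup>2" if "1 \<le> i" for i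
  proof -
    have "expectation (\<lambda>\<omega>. (\<xi> (Inr i) \<omega>)\<^sup>2) = (\<integral>x. (h (Inr i) x)\<^sup>2 \<partial>Q)"
      unfolding \<xi>_def using transfer_Y(2)[OF that hm2] by simp
    also have "\<dots> = (\<integral>x. (G x - mQ)\<^sup>2 \<partial>Q) / (real m)\<^sup>2" unfolding h_def by (simp add: power_divide power2_commute)
    also have "\<dots> \<le> c / (real m)\<^sup>2" using GQ(3) unfolding mQ_def c_def by (intro divide_right_mono) auto
    finally show ?thesis .
  qed
  have "expectation (\<lambda>\<omega>. (Gt \<omega> - \<gamma>)\<^sup>2) = (\<Sum>i=1..n. expectation (\<lambda>\<omega>. (\<xi> (Inl i) \<omega>)\<^sup>2)) + (\<Sum>i=1..m. expectation (\<lambda>\<omega>. (\<xi> (Inr i) \<omega>)\<^sup>2))"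
    using sm(2) unfolding sum_\<xi> by (simp add: sum.Plus)
  also have "\<dots> \<le> real (card {1..n}) * (c / (real n)\<^sup>2) + real (card {1..m}) * (c / (real m)\<^sup>2)"
    using x2 y2 by (intro add_mono sum_bounded_above) auto
  also have "\<dots> = c / real n + c / real m" using N_pos by (simp add: power2_eq_square)
  also have "\<dots> \<le> c / (\<eta> * real N) + c / (\<eta> * real N)"
    using \<eta> N_pos c0 by (intro add_mono divide_left_mono) auto
  also have "\<dots> = 288 * F\<^sup>2 * (6 + 4 * \<rho>z) / (\<eta> * real N)" by (simp add: c_def)
  finally show "expectation (\<lambda>\<omega>. (Gt \<omega> - \<gamma>)\<^sup>2) \<le> 288 * F\<^sup>2 * (6 + 4 * \<rho>z) / (\<eta> * real N)" .
qed

text \<open>The two conditions of the good event concern nonnegative quantities, so they follow from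
  their sum being below S. The sum has bounded mean, and one Markov bound gives a failure
  probability of order 1 / S.\<close>

lemma prob_statistic_gt:
  assumes S: "4 \<le> S" "real N * \<gamma>\<^sup>2 / F\<^sup>2 = S\<^sup>2" and C: "0 < C"
    and big: "C * sqrt (48 * (2 + 8 * S)) < \<eta> * \<Phi> S"
  shows "1 - C1 / S \<le> prob {\<omega> \<in> space M. C < energy \<omega> / sqrt (c_nm n m * V \<omega>)}"
proof -
  define u where "u \<omega> = Qb \<omega> + real N * (Gt \<omega> - \<gamma>)\<^sup>2 / F\<^sup>2" for \<omega>
  have iu: "integrable M u" unfolding u_def[abs_def] using Qb_expectation Gt_second_moment by auto
  have um: "u \<in> borel_measurable M" using iu by auto
  have Qb0: "0 \<le> Qb \<omega>" for \<omega>
    unfolding Qb_def by (intro mult_nonneg_nonneg add_nonneg_nonneg sum_nonneg r_nonneg) auto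
  have sq0: "0 \<le> real N * (Gt \<omega> - \<gamma>)\<^sup>2 / F\<^sup>2" for \<omega> by simp
  have Eu: "expectation u \<le> C1"
  proof -
    have "expectation u = expectation Qb + real N / F\<^sup>2 * expectation (\<lambda>\<omega>. (Gt \<omega> - \<gamma>)\<^sup>2)"
      unfolding u_def[abs_def] using Qb_expectation Gt_second_moment by simp
    also have "\<dots> \<le> 1 + real N / F\<^sup>2 * (288 * F\<^sup>2 * (6 + 4 * \<rho>z) / (\<eta> * real N))"
      using Qb_expectation Gt_second_moment by (intro add_mono mult_left_mono) auto
    also have "\<dots> = C1"
    proof -
      have "a / b * (288 * b * c / (\<eta> * a)) = 288 / \<eta> * c" if "a \<noteq> 0" "b \<noteq> 0" for a b c :: real
        using that by simp
      then show ?thesis unfolding tail_const_def using F N_pos by simp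
    qed
    finally show ?thesis .
  qed
  have "measure M {\<omega> \<in> space M. u \<omega> \<ge> S} \<le> expectation u / S"
    using S by (intro integral_Markov_inequality_measure[OF iu, where A = "{}"]) (auto simp: u_def Qb0)
  also have "\<dots> \<le> C1 / S" using Eu S by (intro divide_right_mono) auto
  finally have bad: "prob {\<omega> \<in> space M. S \<le> u \<omega>} \<le> C1 / S" .
  have ev: "{\<omega> \<in> space M. S \<le> u \<omega>} \<in> events" using um by measurable
  have "1 - C1 / S \<le> prob (space M - {\<omega> \<in> space M. S \<le> u \<omega>})"
    using bad by (simp add: prob_compl[OF ev])
  also have "\<dots> \<le> prob {\<omega> \<in> space M. C < energy \<omega> / sqrt (c_nm n m * V \<omega>)}"
  proof (rule finite_measure_mono)
    show "{\<omega> \<in> space M. C < energy \<omega> / sqrt (c_nm n m * V \<omega>)} \<in> events"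
      using energy_measurable V_measurable by measurable
    show "space M - {\<omega> \<in> space M. S \<le> u \<omega>} \<subseteq> {\<omega> \<in> space M. C < energy \<omega> / sqrt (c_nm n m * V \<omega>)}"
    proof safe
      fix \<omega> assume \<omega>: "\<omega> \<in> space M" and "\<not> S \<le> u \<omega>"
      then have "Qb \<omega> \<le> S" "real N * (Gt \<omega> - \<gamma>)\<^sup>2 / F\<^sup>2 \<le> S"
        using Qb0[of \<omega>] sq0[of \<omega>] unfolding u_def by linarith+
      then show "C < energy \<omega> / sqrt (c_nm n m * V \<omega>)" by (rule statistic_gt[OF \<omega> S C big])
    qed
  qed
  finally show ?thesis .
qed

end

text \<open>One kernel and one pair of laws in a fixed dimension, expanded at sqrt A with A the mean
  squared distance between the laws. The constants \<open>K\<close>, \<open>U\<close>,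
  \<open>L0\<close>, \<open>U0\<close>, \<open>M2\<close> and \<open>M4\<close> are parameters
  because they will be shared by all large p. Normalising \<open>M2\<close> and \<open>M4\<close> to
  be at least 1 permits division by them.\<close>

locale radial_pair =
  fixes P Q :: "rvec measure" and p K :: nat and U L0 U0 M2 M4 :: real
    and f :: "real \<Rightarrow> real" and D :: "real set" and k :: "rvec \<Rightarrow> rvec \<Rightarrow> real"
  assumes wdP: "weak_dependence P p K U" and wdQ: "weak_dependence Q p K U"
    and means: "\<And>j. j \<in> {1..p} \<Longrightarrow> mean P j = mean Q j"
    and vars: "\<And>j. j \<in> {1..p} \<Longrightarrow> cov_matrix P j j = cov_matrix Q j j"
    and kernel: "is_kernel p k"
    and D: "is_interval D" "{0..} \<subseteq> D"
    and f_diff: "\<And>s. s \<in> D \<Longrightarrow> f differentiable (at s within D)"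
    and k_eq: "\<And>x y. x \<in> space (Rp p) \<Longrightarrow> y \<in> space (Rp p) \<Longrightarrow> k x y = f (edist p x y)"
    and L0: "0 < L0" "L0 * real p \<le> mean_sq_dist p P Q" and U0: "mean_sq_dist p P Q \<le> U0 * real p"
    and K1: "\<And>s. s \<in> D \<Longrightarrow> \<exists>\<xi>\<in>closed_segment s (sqrt (mean_sq_dist p P Q)).
          f s = (\<Sum>i=0..6. 1 / fact i * nth_deriv D i f (sqrt (mean_sq_dist p P Q)) * (s - sqrt (mean_sq_dist p P Q)) ^ i)
                + 1 / fact 7 * nth_deriv D 7 f \<xi> * (s - sqrt (mean_sq_dist p P Q)) ^ 7"
    and K2: "\<And>i s. i \<in> {1..7} \<Longrightarrow> s \<in> D \<Longrightarrow>
          \<bar>nth_deriv D i f s\<bar> * \<bar>sqrt (mean_sq_dist p P Q) ^ i\<bar> \<le> M2 * \<bar>f (sqrt (mean_sq_dist p P Q))\<bar>"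
    and M2: "1 \<le> M2" and M4: "1 \<le> M4"
    and K4: "\<bar>f (sqrt (mean_sq_dist p P Q))\<bar> \<le> M4 *
          \<bar>1/16 * nth_deriv D 1 f (sqrt (mean_sq_dist p P Q)) * sqrt (mean_sq_dist p P Q)
           - 1/16 * nth_deriv D 2 f (sqrt (mean_sq_dist p P Q)) * (sqrt (mean_sq_dist p P Q))\<^sup>2
           + 1/48 * nth_deriv D 3 f (sqrt (mean_sq_dist p P Q)) * sqrt (mean_sq_dist p P Q) ^ 3\<bar>"
begin

sublocale P: weak_dependence P p K U by (rule wdP)
sublocale Q: weak_dependence Q p K U by (rule wdQ)

definition "A = mean_sq_dist p P Q"
definition "s0 = sqrt A"
definition "f0 = f s0"
text \<open>Derivatives in the scale-free variable s / s0, so that (K2) bounds all of them by the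
  single number \<open>F\<close>. The coefficients \<open>c\<close> are those of
  \<open>taylor_in_square\<close>, and \<open>c 3\<close> is the quantity kept away from zero by
  (K4).\<close>

definition "d i = nth_deriv D i f s0 * s0 ^ i"
definition "c i = (if i = 0 then d 0 else if i = 1 then 1/2 * d 1 else if i = 2 then - 1/8 * d 1 + 1/8 * d 2
   else if i = 3 then 1/16 * d 1 - 1/16 * d 2 + 1/48 * d 3
   else - 5/128 * d 1 + 5/128 * d 2 - 1/64 * d 3 + 1/384 * d (4::nat))" for i :: nat
definition "F = M2 * \<bar>f0\<bar>"

lemma A_pos: "0 < A"
proof -
  have "0 < L0 * real p" using L0 P.p_pos by simp
  then show ?thesis using L0 unfolding A_def by linarith
qed

lemma s0: "0 < s0" "s0\<^sup>2 = A" "s0 \<in> D"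
  using A_pos D unfolding s0_def by auto

lemma A_eq: "A = 2 * (\<Sum>j=1..p. cov_matrix P j j)"
proof -
  have "A = (\<Sum>j=1..p. cov_matrix P j j + cov_matrix Q j j)"
    unfolding A_def by (rule mean_sq_dist_eq[OF wdP wdQ means])
  also have "\<dots> = (\<Sum>j=1..p. 2 * cov_matrix P j j)" by (intro sum.cong refl) (simp add: vars)
  finally show ?thesis by (simp add: sum_distrib_left)
qed

lemma A_eq_Q: "A = 2 * (\<Sum>j=1..p. cov_matrix Q j j)"
proof -
  have "(\<Sum>j=1..p. cov_matrix P j j) = (\<Sum>j=1..p. cov_matrix Q j j)" by (intro sum.cong refl vars)
  then show ?thesis using A_eq by simp
qed

lemma d_le: "i \<in> {1..7} \<Longrightarrow> \<bar>d i\<bar> \<le> F"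
  using K2[of i s0] s0 unfolding d_def F_def f0_def s0_def A_def by (simp add: abs_mult)

text \<open>(K2) with i = 1 bounds the derivative by F / s0 on the whole of \<open>D\<close>, not
  only near s0, and \<open>D\<close> is convex, so the mean value inequality applies
  globally.\<close>

lemma f_lipschitz:
  assumes s: "s \<in> D"
  shows "\<bar>f s - f0\<bar> \<le> F * \<bar>s / s0 - 1\<bar>"
proof -
  have "norm (f s - f s0) \<le> F / s0 * norm (s - s0)"
  proof (rule differentiable_bound[where S = D and f' = "\<lambda>x h. h *\<^sub>R vector_derivative f (at x within D)"])
    show "convex D" using D(1) by (simp add: is_interval_convex)
    show "s \<in> D" "s0 \<in> D" by (fact s, fact s0(3))
    fix x assume x: "x \<in> D"
    show "(f has_derivative (\<lambda>h. h *\<^sub>R vector_derivative f (at x within D))) (at x within D)"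
      using f_diff[OF x] unfolding vector_derivative_works has_vector_derivative_def .
    have "\<bar>vector_derivative f (at x within D)\<bar> * s0 \<le> F"
      using K2[of 1 x] x s0(1) unfolding F_def f0_def s0_def A_def by (simp add: nth_deriv_def)
    then have *: "\<bar>vector_derivative f (at x within D)\<bar> \<le> F / s0" using s0(1) by (simp add: field_simps)
    show "onorm (\<lambda>h. h *\<^sub>R vector_derivative f (at x within D)) \<le> F / s0"
    proof (rule onorm_le)
      show "norm (h *\<^sub>R vector_derivative f (at x within D)) \<le> F / s0 * norm h" for h
        using mult_right_mono[OF *, of "\<bar>h\<bar>"] by (simp add: abs_mult mult.commute)
    qed
  qed
  also have "\<dots> = F * \<bar>s / s0 - 1\<bar>"
  proof -
    have "s - s0 = s0 * (s / s0 - 1)" using s0(1) by (simp add: right_diff_distrib)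
    then show ?thesis using s0(1) by (simp add: abs_mult)
  qed
  finally show ?thesis by (simp add: f0_def)
qed

lemma edist_in_D: "edist p x y \<in> D"
  using D(2) by (auto simp: edist_def L2_set_nonneg)

text \<open>If f(s0) were 0, then F = 0 and the Lipschitz bound would make f, hence the kernel,
  vanish identically.\<close>

lemma f0_nonzero: "f0 \<noteq> 0"
proof
  assume "f0 = 0"
  then have "f s = 0" if "s \<in> D" for s using f_lipschitz[OF that] by (simp add: F_def)
  then have "k x y = 0" if "x \<in> space (Rp p)" "y \<in> space (Rp p)" for x y
    using k_eq[OF that] edist_in_D by simp
  then show False using is_kernel_not_null[OF kernel P.p_pos] by blast
qed

lemma F_pos: "0 < F" using f0_nonzero M2 by (simp add: F_def)

lemma c3_ge: "\<bar>f0\<bar> \<le> M4 * \<bar>c 3\<bar>"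
  using K4 unfolding c_def d_def f0_def s0_def A_def by simp

lemma c_le: "\<bar>c 3\<bar> \<le> 8 * F" "\<bar>c 4\<bar> \<le> 8 * F"
proof -
  note b = d_le[of 1] d_le[of 2] d_le[of 3] d_le[of 4]
  show "\<bar>c 3\<bar> \<le> 8 * F" using b unfolding c_def by simp
  show "\<bar>c 4\<bar> \<le> 8 * F" using b unfolding c_def by simp
qed

lemma k_expansion:
  assumes x: "x \<in> space (Rp p)" and z: "z \<in> space (Rp p)" and L: "L = (edist p x z)\<^sup>2 / A - 1"
  shows "\<bar>k x z - (c 0 + c 1 * L + c 2 * L\<^sup>2 + c 3 * L ^ 3 + c 4 * L ^ 4)\<bar> \<le> 8 * F * \<bar>L\<bar> ^ 5"
proof -
  define s where "s = edist p x z"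
  have sD: "s \<in> D" unfolding s_def by (rule edist_in_D)
  have s_nonneg: "0 \<le> s" by (simp add: s_def edist_def L2_set_nonneg)
  define h where "h = s / s0 - 1"
  have sh: "s - s0 = s0 * h" unfolding h_def using s0(1) by (simp add: right_diff_distrib)
  obtain \<xi> where \<xi>: "\<xi> \<in> closed_segment s s0" and
    fs: "f s = (\<Sum>i=0..6. 1 / fact i * nth_deriv D i f s0 * (s - s0) ^ i) + 1 / fact 7 * nth_deriv D 7 f \<xi> * (s - s0) ^ 7"
    using K1[OF sD] unfolding s0_def A_def by blast
  have \<xi>D: "\<xi> \<in> D"
    using \<xi> closed_segment_subset[OF sD s0(3)] D(1) by (auto simp: is_interval_convex)
  \<comment> \<open>The Lagrange remainder is treated as a seventh Taylor term with its derivative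
    taken at \<xi>. Convexity of \<open>D\<close> keeps \<xi> in the range where (K2) bounds
    it.\<close>
  define d' where "d' i = (if i = 7 then nth_deriv D 7 f \<xi> * s0 ^ 7 else d i)" for i :: nat
  have "\<bar>f s - (d' 0 + (1/2 * d' 1) * L + (- 1/8 * d' 1 + 1/8 * d' 2) * L\<^sup>2
            + (1/16 * d' 1 - 1/16 * d' 2 + 1/48 * d' 3) * L ^ 3
            + (- 5/128 * d' 1 + 5/128 * d' 2 - 1/64 * d' 3 + 1/384 * d' 4) * L ^ 4)\<bar> \<le> 8 * F * \<bar>L\<bar> ^ 5"
  proof (rule taylor_in_square)
    show "- 1 \<le> h" unfolding h_def using s_nonneg s0(1) by simp
    show "L = h * (h + 2)"
      unfolding L h_def s0(2)[symmetric] s_def[symmetric] using s0(1) by (simp add: power2_eq_square field_simps)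
    show "\<bar>d' i\<bar> \<le> F" if "i \<in> {1..7}" for i
      using d_le[OF that] K2[of 7 \<xi>] \<xi>D s0(1) unfolding d'_def F_def f0_def s0_def A_def by (auto simp: abs_mult)
    have "(\<Sum>i=0..6. 1 / fact i * nth_deriv D i f s0 * (s - s0) ^ i) = (\<Sum>i=0..6. 1 / fact i * d' i * h ^ i)"
      unfolding sh by (intro sum.cong refl) (simp add: d'_def d_def power_mult_distrib)
    then show "f s = (\<Sum>i=0..6. 1 / fact i * d' i * h ^ i) + 1 / fact 7 * d' 7 * h ^ 7"
      unfolding fs unfolding sh by (simp add: d'_def power_mult_distrib)
  qed
  then show ?thesis using k_eq[OF x z] unfolding s_def by (simp add: c_def d'_def)
qed

lemma f_continuous: "continuous_on {0..} f"
proof (rule continuous_on_subset[OF _ D(2)])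
  show "continuous_on D f"
    unfolding continuous_on_eq_continuous_within
    using f_diff by (auto intro: differentiable_imp_continuous_within)
qed

lemma k_measurable: "(\<lambda>(x, y). k x y) \<in> borel_measurable (Rp p \<Otimes>\<^sub>M Rp p)"
proof -
  have [measurable]: "(\<lambda>x. x j :: real) \<in> borel_measurable (Rp p)" if "j \<in> {1..p}" for j
    unfolding Rp_def using that by (rule measurable_component_singleton)
  have e: "(\<lambda>(x, y). edist p x y) \<in> borel_measurable (Rp p \<Otimes>\<^sub>M Rp p)"
    unfolding edist_def L2_set_def by measurable
  \<comment> \<open>f is only known to be continuous on its domain; truncating the argument at 0
    makes it continuous on the line without changing it at distances.\<close>
  have "continuous_on UNIV (\<lambda>s. f (max 0 s))"
    by (rule continuous_on_compose2[OF f_continuous]) (auto intro!: continuous_intros)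
  then have "(\<lambda>s. f (max 0 s)) \<in> borel_measurable borel" by (rule borel_measurable_continuous_onI)
  then have "(\<lambda>z. f (max 0 (case z of (x, y) \<Rightarrow> edist p x y))) \<in> borel_measurable (Rp p \<Otimes>\<^sub>M Rp p)"
    by (rule measurable_compose[OF e])
  moreover have "max 0 (edist p x y) = edist p x y" for x y by (simp add: edist_def L2_set_nonneg)
  ultimately show ?thesis
    by (subst measurable_cong[where g = "\<lambda>z. f (max 0 (case z of (x, y) \<Rightarrow> edist p x y))"])
      (auto simp: space_pair_measure k_eq)
qed

lemma k_measurable_fst: "z \<in> space (Rp p) \<Longrightarrow> (\<lambda>x. k x z) \<in> borel_measurable (Rp p)"
  using measurable_compose[OF _ k_measurable, of "\<lambda>x. (x, z)" "Rp p"] by simp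

sublocale laws: two_laws P Q p K U k A L0 U0 "8 * F" c
proof unfold_locales
  show "A = 2 * (\<Sum>j=1..p. cov_matrix P j j)" by (rule A_eq)
  show "A = 2 * (\<Sum>j=1..p. cov_matrix Q j j)" by (rule A_eq_Q)
  show "0 < L0" "L0 * real p \<le> A" "A \<le> U0 * real p" using L0 U0 by (auto simp: A_def)
  show "0 \<le> 8 * F" using F_pos by simp
qed (rule k_measurable_fst k_expansion c_le means vars; assumption)+

lemma sq_radius_integral:
  assumes "weak_dependence R p K U" "\<And>j. j \<in> {1..p} \<Longrightarrow> mean R j = mean P j" "\<And>j. j \<in> {1..p} \<Longrightarrow> cov_matrix R j j = cov_matrix P j j"
  shows "integrable R (sq_radius p (mean P) A)" "(\<integral>x. sq_radius p (mean P) A x \<partial>R) \<le> 1"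
proof -
  interpret R: weak_dependence R p K U by fact
  have i: "integrable R (\<lambda>x. (ctr R j x)\<^sup>2)" if "j \<in> {1..p}" for j
    using R.integrable_poly_bdd[OF R.poly_bdd_power[OF R.poly_bdd_ctr[OF that], of 2]] by simp
  have eq: "sq_radius p (mean P) A x = (\<Sum>j=1..p. (ctr R j x)\<^sup>2) / A" for x
    unfolding sq_radius_def by (simp add: ctr_def assms(2))
  have iS: "integrable R (\<lambda>x. \<Sum>j=1..p. (ctr R j x)\<^sup>2)" by (rule Bochner_Integration.integrable_sum[OF i])
  show "integrable R (sq_radius p (mean P) A)" unfolding eq[abs_def] using iS by simp
  have "(\<integral>x. (\<Sum>j=1..p. (ctr R j x)\<^sup>2) \<partial>R) = (\<Sum>j=1..p. cov_matrix R j j)"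
    by (subst Bochner_Integration.integral_sum[OF i]) (simp_all add: R.cov_matrix_eq power2_eq_square)
  also have "\<dots> = A / 2" unfolding A_eq using assms(3) by simp
  finally show "(\<integral>x. sq_radius p (mean P) A x \<partial>R) \<le> 1" unfolding eq using A_pos by simp
qed

text \<open>The Lipschitz bound is squared and the distance replaced by distances to the mean,
  through |x - y|^2 \<le> 2 |x - \<mu>|^2 + 2 |y - \<mu>|^2.\<close>

lemma k_growth:
  assumes x: "x \<in> space (Rp p)" and y: "y \<in> space (Rp p)"
  shows "(k x y - f0)\<^sup>2 \<le> F\<^sup>2 * (2 + 4 * sq_radius p (mean P) A x + 4 * sq_radius p (mean P) A y)"
proof -
  define s where "s = edist p x y"
  have "\<bar>k x y - f0\<bar> \<le> F * \<bar>s / s0 - 1\<bar>" using f_lipschitz[OF edist_in_D] k_eq[OF x y] unfolding s_def by simp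
  then have "(k x y - f0)\<^sup>2 \<le> (F * \<bar>s / s0 - 1\<bar>)\<^sup>2"
    using F_pos by (simp add: abs_le_square_iff[symmetric] abs_mult)
  also have "\<dots> = F\<^sup>2 * (s / s0 - 1)\<^sup>2" by (simp add: power_mult_distrib)
  also have "\<dots> \<le> F\<^sup>2 * (2 + 4 * sq_radius p (mean P) A x + 4 * sq_radius p (mean P) A y)"
  proof (rule mult_left_mono)
    have "(s / s0 - 1)\<^sup>2 \<le> 2 + 2 * (s / s0)\<^sup>2"
    proof -
      have "0 \<le> (s / s0 + 1)\<^sup>2" by simp
      then show ?thesis by (simp add: power2_sum power2_diff)
    qed
    also have "(s / s0)\<^sup>2 = (\<Sum>j=1..p. (x j - y j)\<^sup>2) / A"
      unfolding power_divide s0(2) s_def edist_sq ..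
    also have "\<dots> \<le> (\<Sum>j=1..p. 2 * (x j - mean P j)\<^sup>2 + 2 * (y j - mean P j)\<^sup>2) / A"
    proof (intro divide_right_mono sum_mono)
      fix j
      have "0 \<le> ((x j - mean P j) + (y j - mean P j))\<^sup>2" by simp
      then show "(x j - y j)\<^sup>2 \<le> 2 * (x j - mean P j)\<^sup>2 + 2 * (y j - mean P j)\<^sup>2"
        by (simp add: power2_eq_square algebra_simps)
    qed (use A_pos in simp)
    also have "\<dots> = 2 * sq_radius p (mean P) A x + 2 * sq_radius p (mean P) A y"
      unfolding sq_radius_def by (simp add: sum.distrib sum_distrib_left[symmetric] add_divide_distrib)
    finally show "(s / s0 - 1)\<^sup>2 \<le> 2 + 4 * sq_radius p (mean P) A x + 4 * sq_radius p (mean P) A y" by simp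
  qed simp
  finally show ?thesis .
qed

text \<open>\<open>\<gamma>0\<close> is only a lower bound for the true gap, so the true signal S'
  may exceed S. This is why \<open>big\<close> is required for every larger value; the failure
  probability only improves.\<close>

lemma power_bound:
  fixes M :: "'a measure" and X Y :: "nat \<Rightarrow> 'a \<Rightarrow> rvec" and S :: real
  assumes M: "prob_space M"
    and X: "\<And>i. 1 \<le> i \<Longrightarrow> X i \<in> M \<rightarrow>\<^sub>M Rp p" "\<And>i. 1 \<le> i \<Longrightarrow> distr M (Rp p) (X i) = P"
    and Y: "\<And>i. 1 \<le> i \<Longrightarrow> Y i \<in> M \<rightarrow>\<^sub>M Rp p" "\<And>i. 1 \<le> i \<Longrightarrow> distr M (Rp p) (Y i) = Q"
    and indep: "prob_space.indep_vars M (\<lambda>_. Rp p) (case_sum X Y) ({1..} <+> {1..})"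
    and nm: "2 \<le> n" "2 \<le> m" and \<eta>: "0 < \<eta>" "\<eta> * real (n + m) \<le> real n" "\<eta> * real (n + m) \<le> real m"
    and gt: "laws.good_test J g z \<gamma>0" and \<gamma>0: "0 < \<gamma>0"
    and S: "4 \<le> S" "S\<^sup>2 \<le> real (n + m) * \<gamma>0\<^sup>2 / F\<^sup>2" and C: "0 < C"
    and big: "\<And>S'. S \<le> S' \<Longrightarrow> C * sqrt (48 * (2 + 8 * S')) < \<eta> * margin \<eta> (1 + 1 / L0) S'"
  shows "1 - tail_const \<eta> (1 + 1 / L0) / S
    \<le> measure M {\<omega> \<in> space M. C < T_stat p k n m (\<lambda>i. X i \<omega>) (\<lambda>j. Y j \<omega>)}"
proof -
  interpret M: prob_space M by (rule M)
  note gt' = gt[unfolded laws.good_test_def]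
  have \<mu>r: "sq_radius p (mean P) A (z i) \<le> 1 + 1 / L0" if "i \<in> J" for i
  proof -
    have "(\<Sum>j=1..p. (z i j - mean P j)\<^sup>2) \<le> (1 + 1 / L0) * A" using gt' that by blast
    then show ?thesis unfolding sq_radius_def using A_pos by (simp add: pos_divide_le_eq)
  qed
  interpret T: test_setting M P Q p n m X Y k "f 0" f0 F A \<eta> "1 + 1 / L0" "mean P" J g z
  proof unfold_locales
    show "(\<Sum>i\<in>I. \<Sum>j\<in>I. w i * w j * k (pts i) (pts j)) \<le> 0"
      if "finite I" "(\<Sum>i\<in>I. w i) = 0" "pts ` I \<subseteq> space (Rp p)"
      for w :: "nat + nat + (int \<times> bool) \<Rightarrow> real" and pts I
      by (rule is_kernel_cnd[OF kernel that])
    show "k x y = k y x" if "x \<in> space (Rp p)" "y \<in> space (Rp p)" for x y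
      using kernel that unfolding is_kernel_def by blast
    show "k x x = f 0" if "x \<in> space (Rp p)" for x
      using k_eq[OF that that] by (simp add: edist_def L2_set_def)
    show "integrable P (sq_radius p (mean P) A)" "(\<integral>x. sq_radius p (mean P) A x \<partial>P) \<le> 1"
      using sq_radius_integral[OF wdP] by auto
    show "integrable Q (sq_radius p (mean P) A)" "(\<integral>x. sq_radius p (mean P) A x \<partial>Q) \<le> 1"
      using sq_radius_integral[OF wdQ] means vars by auto
    show "0 \<le> 1 + 1 / L0" using L0 by simp
    show "sq_radius p (mean P) A (z i) \<le> 1 + 1 / L0" if "i \<in> J" for i by (rule \<mu>r[OF that])
    show "finite J" "(\<Sum>i\<in>J. g i) = 0" "(\<Sum>i\<in>J. \<bar>g i\<bar>) \<le> 12" using gt' by blast+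
    show "z i \<in> space (Rp p)" for i using gt' by blast
  qed (fact X Y indep k_measurable F_pos A_pos nm \<eta> | rule k_growth X Y; assumption)+
  have g: "\<gamma>0 \<le> \<bar>T.\<gamma>\<bar>" using gt' unfolding T.\<gamma>_def T.G_def by blast
  define S' where "S' = sqrt (real (n + m) * T.\<gamma>\<^sup>2 / F\<^sup>2)"
  have S'2: "S'\<^sup>2 = real (n + m) * T.\<gamma>\<^sup>2 / F\<^sup>2" unfolding S'_def by simp
  have "\<gamma>0\<^sup>2 \<le> T.\<gamma>\<^sup>2" using g \<gamma>0 by (simp add: abs_le_square_iff[symmetric])
  then have "S\<^sup>2 \<le> S'\<^sup>2" unfolding S'2
    by (intro order_trans[OF S(2)] divide_right_mono mult_left_mono) auto
  moreover have "0 \<le> S'" unfolding S'_def by simp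
  ultimately have SS: "S \<le> S'" by (rule power2_le_imp_le)
  have "1 - tail_const \<eta> (1 + 1 / L0) / S \<le> 1 - tail_const \<eta> (1 + 1 / L0) / S'"
  proof -
    have "0 \<le> tail_const \<eta> (1 + 1 / L0)" unfolding tail_const_def using \<eta>(1) L0 by simp
    then show ?thesis using SS S(1) by (intro diff_left_mono divide_left_mono) auto
  qed
  also have "\<dots> \<le> measure M {\<omega> \<in> space M. C < energy_stat k n m (\<lambda>i. X i \<omega>) (\<lambda>j. Y j \<omega>)
        / sqrt (c_nm n m * V_star k (f 0) n m (\<lambda>i. X i \<omega>) (\<lambda>j. Y j \<omega>))}"
    using SS S(1) big S'2 by (intro T.prob_statistic_gt C) auto
  finally have main: "1 - tail_const \<eta> (1 + 1 / L0) / S \<le> measure M {\<omega> \<in> space M. C < energy_stat k n m (\<lambda>i. X i \<omega>) (\<lambda>j. Y j \<omega>)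
        / sqrt (c_nm n m * V_star k (f 0) n m (\<lambda>i. X i \<omega>) (\<lambda>j. Y j \<omega>))}" .
  have "(\<lambda>j\<in>{1..p}. 0) \<in> space (Rp p)" unfolding Rp_def space_PiM by auto
  then have "k (\<lambda>j\<in>{1..p}. 0) (\<lambda>j\<in>{1..p}. 0) = f 0" by (rule T.k_diag)
  then show ?thesis using main unfolding T_stat_def Let_def by simp
qed

text \<open>The scale \<open>F\<close> is factored out of the gaps: \<open>c 3\<close> is at least F
  / (M2 M4), and 16 F = 2 R since R = 8 F. What remains depends only on the parameters shared by all
  dimensions.\<close>

definition "k_cubic = 1152 * sqrt (L0 / 144) ^ 3 / U0 ^ 3 / (M2 * M4)"
definition "e_cubic = 16 * laws.P.C_cubic"
definition "k_radius = 6 / U0 ^ 3 / (M2 * M4)"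
definition "e_radius = 16 * laws.P.C_radius"

lemma k_pos: "0 < k_cubic" "0 < k_radius"
  using L0 laws.P.U0_pos M2 M4 by (auto simp: k_cubic_def k_radius_def)

lemma good_test_mono: "laws.good_test J g z \<gamma> \<Longrightarrow> \<gamma>' \<le> \<gamma> \<Longrightarrow> laws.good_test J g z \<gamma>'"
  unfolding laws.good_test_def
  by (elim conjE, intro conjI) (assumption | (rule order_trans, assumption, assumption))+

lemma c3_rel: "F / (M2 * M4) \<le> \<bar>c 3\<bar>"
proof -
  have "F / (M2 * M4) = \<bar>f0\<bar> / M4" using M2 by (simp add: F_def)
  also have "\<dots> \<le> \<bar>c 3\<bar>" using c3_ge M4 by (simp add: divide_le_eq mult.commute)
  finally show ?thesis .
qed

definition "T_diff i j l = third_moment P i j l - third_moment Q i j l"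

lemma cubic_test_exists:
  assumes j: "j1 \<in> {1..p}" "j2 \<in> {1..p}" "j3 \<in> {1..p}" and p: "6 * K + 2 < p"
    and \<theta>: "0 < \<theta>" "\<theta> \<le> \<bar>T_diff j1 j2 j3\<bar>"
  shows "\<exists>J g z. laws.good_test J g z (F * (k_cubic * \<theta> / sqrt (real p) ^ 3 - e_cubic / sqrt (real p) ^ 5))"
proof -
  obtain J g z where t: "laws.good_test J g z (laws.cubic_gap \<theta>)"
    using laws.cubic_gap[OF j p \<theta>(1)] \<theta>(2) unfolding T_diff_def by blast
  have "F / (M2 * M4) * (1152 * sqrt (L0 / 144) ^ 3 / U0 ^ 3 * \<theta> / sqrt (real p) ^ 3)
      \<le> \<bar>c 3\<bar> * (1152 * sqrt (L0 / 144) ^ 3 / U0 ^ 3 * \<theta> / sqrt (real p) ^ 3)"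
    using c3_rel \<theta>(1) L0 laws.P.U0_pos by (intro mult_right_mono) auto
  then have "F * (k_cubic * \<theta> / sqrt (real p) ^ 3 - e_cubic / sqrt (real p) ^ 5) \<le> laws.cubic_gap \<theta>"
    unfolding laws.cubic_gap_def k_cubic_def e_cubic_def by (simp add: right_diff_distrib mult_ac)
  then show ?thesis using good_test_mono[OF t] by blast
qed

lemma radius_test_exists:
  assumes \<theta>: "0 \<le> \<theta>" "\<theta> \<le> \<bar>(\<integral>x. (sq_dev P p x)\<^sup>2 \<partial>P) - (\<integral>x. (sq_dev P p x)\<^sup>2 \<partial>Q)\<bar>"
  shows "\<exists>J g z. laws.good_test J g z (F * (k_radius * \<theta> / sqrt (real p) ^ 5 - e_radius / sqrt (real p) ^ 4))"
proof -
  obtain J g z where t: "laws.good_test J g z (laws.radius_gap \<theta>)"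
    using laws.radius_gap[OF \<theta>] by blast
  have "F / (M2 * M4) * (6 / U0 ^ 3 * \<theta> / sqrt (real p) ^ 5) \<le> \<bar>c 3\<bar> * (6 / U0 ^ 3 * \<theta> / sqrt (real p) ^ 5)"
    using c3_rel \<theta>(1) laws.P.U0_pos by (intro mult_right_mono) auto
  then have "F * (k_radius * \<theta> / sqrt (real p) ^ 5 - e_radius / sqrt (real p) ^ 4) \<le> laws.radius_gap \<theta>"
    unfolding laws.radius_gap_def k_radius_def e_radius_def by (simp add: right_diff_distrib mult_ac)
  then show ?thesis using good_test_mono[OF t] by blast
qed

section \<open>Locating one large difference of third cumulants\<close>

lemma T_diff_near:
  assumes "i \<in> {1..p}" "j \<in> {1..p}" "l \<in> {1..p}" "j \<notin> {i - 2 * K..i + 2 * K} \<or> l \<notin> {i - 2 * K..i + 2 * K}"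
  shows "T_diff i j l = 0"
proof (rule ccontr)
  assume "T_diff i j l \<noteq> 0"
  then have "third_moment P i j l \<noteq> 0 \<or> third_moment Q i j l \<noteq> 0" by (auto simp: T_diff_def)
  then show False using P.third_moment_near[OF assms(1-3)] Q.third_moment_near[OF assms(1-3)] assms(4) by auto
qed

lemma near_card: "card {i - 2 * K..i + 2 * K} \<le> 4 * K + 1"
  by simp

text \<open>For a fixed first index at most 4K + 1 values of each other index contribute. Both sums
  therefore have p outer terms and (4K + 1)^2 as the price of the inner ones; in the second sum the
  square of a row provides that factor.\<close>

lemma sum_T_diff_sq_le:
  assumes m: "\<And>i j l. i \<in> {1..p} \<Longrightarrow> j \<in> {1..p} \<Longrightarrow> l \<in> {1..p} \<Longrightarrow> \<bar>T_diff i j l\<bar> \<le> m"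
  shows "(\<Sum>i=1..p. \<Sum>j=1..p. \<Sum>l=1..p. (T_diff i j l)\<^sup>2) \<le> real p * real (4 * K + 1) ^ 2 * m\<^sup>2"
    and "(\<Sum>j=1..p. (\<Sum>i=1..p. T_diff i i j)\<^sup>2) \<le> real p * real (4 * K + 1) ^ 2 * m\<^sup>2"
proof -
  have m0: "0 \<le> m" using m[of 1 1 1] P.p_pos by auto
  have sq: "\<bar>(T_diff i j l)\<^sup>2\<bar> \<le> m\<^sup>2" if "i \<in> {1..p}" "j \<in> {1..p}" "l \<in> {1..p}" for i j l
    using m[OF that] power_mono[of "\<bar>T_diff i j l\<bar>" m 2] by simp
  have in1: "\<bar>\<Sum>l=1..p. (T_diff i j l)\<^sup>2\<bar> \<le> real (4 * K + 1) * m\<^sup>2" if "i \<in> {1..p}" "j \<in> {1..p}" for i j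
    by (rule abs_sum_le_of_support[where N = "{i - 2 * K..i + 2 * K}"]) (use that sq T_diff_near near_card in auto)
  have in2: "\<bar>\<Sum>j=1..p. \<Sum>l=1..p. (T_diff i j l)\<^sup>2\<bar> \<le> real (4 * K + 1) * (real (4 * K + 1) * m\<^sup>2)" if i: "i \<in> {1..p}" for i
  proof (rule abs_sum_le_of_support[where N = "{i - 2 * K..i + 2 * K}"])
    show "(\<Sum>l=1..p. (T_diff i j l)\<^sup>2) = 0" if "j \<in> {1..p}" "j \<notin> {i - 2 * K..i + 2 * K}" for j
      using i that T_diff_near by (intro sum.neutral) auto
  qed (use i in1 near_card in auto)
  have "(\<Sum>i=1..p. \<Sum>j=1..p. \<Sum>l=1..p. (T_diff i j l)\<^sup>2) \<le> real (card {1..p}) * (real (4 * K + 1) * (real (4 * K + 1) * m\<^sup>2))"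
    using in2 by (intro sum_bounded_above) (simp only: abs_le_iff)
  then show "(\<Sum>i=1..p. \<Sum>j=1..p. \<Sum>l=1..p. (T_diff i j l)\<^sup>2) \<le> real p * real (4 * K + 1) ^ 2 * m\<^sup>2"
    by (simp add: power2_eq_square mult_ac)
  have row: "(\<Sum>i=1..p. T_diff i i j)\<^sup>2 \<le> (real (4 * K + 1) * m)\<^sup>2" if j: "j \<in> {1..p}" for j
  proof -
    have "\<bar>\<Sum>i=1..p. T_diff i i j\<bar> \<le> real (4 * K + 1) * m"
    proof (rule abs_sum_le_of_support[where N = "{j - 2 * K..j + 2 * K}"])
      show "T_diff i i j = 0" if "i \<in> {1..p}" "i \<notin> {j - 2 * K..j + 2 * K}" for i
      proof -
        have "j \<notin> {i - 2 * K..i + 2 * K}" using that(2) unfolding atLeastAtMost_iff by linarith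
        then show ?thesis using T_diff_near[of i i j] j that(1) by blast
      qed
    qed (use j m m0 near_card in auto)
    then have "\<bar>\<Sum>i=1..p. T_diff i i j\<bar> ^ 2 \<le> (real (4 * K + 1) * m)\<^sup>2" by (intro power_mono) auto
    then show ?thesis by simp
  qed
  have "(\<Sum>j=1..p. (\<Sum>i=1..p. T_diff i i j)\<^sup>2) \<le> real (card {1..p}) * (real (4 * K + 1) * m)\<^sup>2"
    using row by (intro sum_bounded_above)
  then show "(\<Sum>j=1..p. (\<Sum>i=1..p. T_diff i i j)\<^sup>2) \<le> real p * real (4 * K + 1) ^ 2 * m\<^sup>2"
    by (simp add: power_mult_distrib mult_ac)
qed

text \<open>The pigeonhole step: with m the largest difference, either sum is at most p (4K + 1)^2
  m^2, so a lower bound for one of them is a lower bound for m.\<close>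

lemma large_T_diff:
  assumes s: "0 < s" and or: "s \<le> (\<Sum>i=1..p. \<Sum>j=1..p. \<Sum>l=1..p. (T_diff i j l)\<^sup>2) \<or> s \<le> (\<Sum>j=1..p. (\<Sum>i=1..p. T_diff i i j)\<^sup>2)"
  shows "\<exists>j1\<in>{1..p}. \<exists>j2\<in>{1..p}. \<exists>j3\<in>{1..p}. sqrt (s / real p) / real (4 * K + 1) \<le> \<bar>T_diff j1 j2 j3\<bar>"
proof -
  define I where "I = {1..p} \<times> {1..p} \<times> {1..p}"
  define h where "h = (\<lambda>(i, j, l). \<bar>T_diff i j l\<bar>)"
  have fin: "finite I" "I \<noteq> {}" using P.p_pos by (auto simp: I_def)
  define m where "m = Max (h ` I)"
  have "m \<in> h ` I" unfolding m_def using fin by (intro Max_in) auto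
  then obtain j1 j2 j3 where j: "j1 \<in> {1..p}" "j2 \<in> {1..p}" "j3 \<in> {1..p}" "m = \<bar>T_diff j1 j2 j3\<bar>"
    by (auto simp: I_def h_def)
  have m: "\<bar>T_diff i j l\<bar> \<le> m" if "i \<in> {1..p}" "j \<in> {1..p}" "l \<in> {1..p}" for i j l
  proof -
    have "(i, j, l) \<in> I" using that by (simp add: I_def)
    then have "h (i, j, l) \<le> m" unfolding m_def using fin by (intro Max_ge) auto
    then show ?thesis by (simp add: h_def)
  qed
  have "s \<le> real p * real (4 * K + 1) ^ 2 * m\<^sup>2"
    using or sum_T_diff_sq_le[OF m] by linarith
  then have "s / real p \<le> (real (4 * K + 1) * m)\<^sup>2"
    using P.p_pos by (simp add: divide_le_eq power_mult_distrib mult_ac)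
  then have "sqrt (s / real p) \<le> real (4 * K + 1) * m"
    using j(4) by (intro real_le_lsqrt) auto
  then have "sqrt (s / real p) / real (4 * K + 1) \<le> m" by (simp add: divide_le_eq mult.commute)
  then show ?thesis using j by blast
qed

lemma cumulant_T_diff:
  assumes "i \<in> {1..p}" "j \<in> {1..p}" "l \<in> {1..p}"
  shows "cumulant P [ctr P i, ctr P j, ctr P l] - cumulant Q [ctr Q i, ctr Q j, ctr Q l] = T_diff i j l"
  unfolding T_diff_def P.cumulant_3[OF assms] Q.cumulant_3[OF assms] ..

lemma cov_T_diff:
  assumes "i \<in> {1..p}" "j \<in> {1..p}"
  shows "cov P (ctr_sq P i) (ctr P j) - cov Q (ctr_sq Q i) (ctr Q j) = T_diff i i j"
  unfolding T_diff_def P.cov_sq_ctr[OF assms] Q.cov_sq_ctr[OF assms] ..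

lemma cov_sq_diff:
  "(\<Sum>i=1..p. \<Sum>j=1..p. cov P (ctr_sq P i) (ctr_sq P j) - cov Q (ctr_sq Q i) (ctr_sq Q j))
     = (\<integral>x. (sq_dev P p x)\<^sup>2 \<partial>P) - (\<integral>x. (sq_dev P p x)\<^sup>2 \<partial>Q)"
  unfolding sum_subtractf P.sum_cov_sq_sq Q.sum_cov_sq_sq laws.sq_dev_eq ..

text \<open>The gap is measured in units of \<open>F\<close>, which may vary arbitrarily with p; in
  these units it can be compared across dimensions.\<close>

definition "has_gap \<gamma> \<longleftrightarrow> (\<exists>J g z. laws.good_test J g z (F * \<gamma>))"

text \<open>The sample size enters only through p^w \<le> n + m, so the signal sqrt (n + m) \<gamma>
  is replaced by the deterministic quantity p^(w/2) \<gamma>, a function of p alone.\<close>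

lemma power_bound_rel:
  fixes M :: "'a measure" and X Y :: "nat \<Rightarrow> 'a \<Rightarrow> rvec" and S :: real
  assumes sample: "prob_space M"
     "\<And>i. 1 \<le> i \<Longrightarrow> X i \<in> M \<rightarrow>\<^sub>M Rp p" "\<And>i. 1 \<le> i \<Longrightarrow> distr M (Rp p) (X i) = P"
     "\<And>i. 1 \<le> i \<Longrightarrow> Y i \<in> M \<rightarrow>\<^sub>M Rp p" "\<And>i. 1 \<le> i \<Longrightarrow> distr M (Rp p) (Y i) = Q"
     "prob_space.indep_vars M (\<lambda>_. Rp p) (case_sum X Y) ({1..} <+> {1..})"
    and nm: "2 \<le> n" "2 \<le> m" and \<eta>: "0 < \<eta>" "\<eta> * real (n + m) \<le> real n" "\<eta> * real (n + m) \<le> real m"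
    and gt: "has_gap \<gamma>"
    and S: "4 \<le> S" "S = real p powr (w / 2) * \<gamma>" "real p powr w \<le> real (n + m)" and C: "0 < C"
    and big: "\<And>S'. S \<le> S' \<Longrightarrow> C * sqrt (48 * (2 + 8 * S')) < \<eta> * margin \<eta> (1 + 1 / L0) S'"
  shows "1 - tail_const \<eta> (1 + 1 / L0) / S
    \<le> measure M {\<omega> \<in> space M. C < T_stat p k n m (\<lambda>i. X i \<omega>) (\<lambda>j. Y j \<omega>)}"
proof -
  obtain J g z where t: "laws.good_test J g z (F * \<gamma>)" using gt unfolding has_gap_def by blast
  have "0 < S" using S(1) by simp
  then have \<gamma>: "0 < \<gamma>" unfolding S(2) using P.p_pos by (simp add: zero_less_mult_iff)
  have "S\<^sup>2 = real p powr w * \<gamma>\<^sup>2"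
    unfolding S(2) power_mult_distrib using P.p_pos by (simp add: powr_power)
  also have "\<dots> \<le> real (n + m) * \<gamma>\<^sup>2" using S(3) by (intro mult_right_mono) auto
  also have "\<dots> = real (n + m) * (F * \<gamma>)\<^sup>2 / F\<^sup>2" using F_pos by (simp add: power_mult_distrib)
  finally have "S\<^sup>2 \<le> real (n + m) * (F * \<gamma>)\<^sup>2 / F\<^sup>2" .
  then show ?thesis
    using F_pos \<gamma> by (intro power_bound[OF sample nm \<eta> t _ S(1) _ C big]) auto
qed

end

section \<open>Asymptotics\<close>

lemma filterlim_powr_diff_at_top:
  fixes a b :: real
  assumes "0 < c" "0 < a" "b < a"
  shows "filterlim (\<lambda>x. c * x powr a - d * x powr b) at_top at_top"
proof -
  have "((\<lambda>x::real. x powr (b - a)) \<longlongrightarrow> 0) at_top"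
    using assms by (intro tendsto_neg_powr filterlim_ident) auto
  then have 1: "((\<lambda>x. c - d * x powr (b - a)) \<longlongrightarrow> c - d * 0) at_top"
    by (intro tendsto_intros)
  have 2: "filterlim (\<lambda>x::real. x powr a) at_top at_top"
  proof (rule filterlim_mono_eventually[OF _ order_refl order_refl])
    show "filterlim (\<lambda>x::real. exp (a * ln x)) at_top at_top"
      using assms by (intro filterlim_compose[OF exp_at_top] filterlim_tendsto_pos_mult_at_top[OF tendsto_const _ ln_at_top])
    show "eventually (\<lambda>x::real. exp (a * ln x) = x powr a) at_top"
      using eventually_gt_at_top[of 0] by eventually_elim (simp add: powr_def)
  qed
  have "filterlim (\<lambda>x. (c - d * x powr (b - a)) * x powr a) at_top at_top"
    by (rule filterlim_tendsto_pos_mult_at_top[OF 1 _ 2]) (use assms in simp)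
  then show ?thesis
  proof (rule filterlim_mono_eventually[OF _ order_refl order_refl])
    show "eventually (\<lambda>x. (c - d * x powr (b - a)) * x powr a = c * x powr a - d * x powr b) at_top"
      using eventually_gt_at_top[of 0]
      by eventually_elim (simp add: left_diff_distrib mult.assoc flip: powr_add)
  qed
qed

theorem proposition24:
  fixes \<C> :: "kernel_seq set"
    and f :: "kernel_seq \<Rightarrow> nat \<Rightarrow> real \<Rightarrow> real"
    and D D0 :: "kernel_seq \<Rightarrow> nat \<Rightarrow> real set"
    and M :: "nat \<Rightarrow> 'a measure"
    and PX PY PZ :: "nat \<Rightarrow> rvec measure"
    and X Y :: "nat \<Rightarrow> nat \<Rightarrow> 'a \<Rightarrow> rvec"
    and \<alpha> :: "nat \<Rightarrow> nat"
    and \<rho> L\<^sub>4 U\<^sub>4 \<delta>\<^sub>5 \<delta>\<^sub>6 \<delta>\<^sub>7 C :: real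
    and n m p :: "nat \<Rightarrow> nat"
    and k :: kernel_seq
  assumes sampling: "two_samples M PX PY X Y"
    and rho: "0 < \<rho>" "\<rho> < 1"
    and PZ: "\<And>p. p \<ge> 1 \<Longrightarrow> PZ p = mixture \<rho> (PX p) (PY p)"
    and kernels: "radial_kernels \<C> f D"
    and D0: "\<And>k p. k \<in> \<C> \<Longrightarrow> p \<ge> 1 \<Longrightarrow>
               D0 k p \<subseteq> D k p \<and>
               sqrt (mean_sq_dist p (PZ p) (PZ p)) \<in> D0 k p \<and>
               sqrt (mean_sq_dist p (PX p) (PY p)) \<in> D0 k p"
    and K1: "cond_K1 \<C> f D D0"
    and K2: "cond_K2 \<C> f D D0"
    and K3: "cond_K3 \<C> f D D0"
    and K4: "cond_K4 \<C> f D D0"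
    and D1: "cond_D1 \<alpha> PX PY"
    and D2: "cond_D2 PX PY"
    and D3: "cond_D3 PX PY"
    and D4: "cond_D4 \<alpha> PX PY"
    and alpha: "(\<lambda>p. real (\<alpha> p)) \<in> O(\<lambda>p. 1)"
    and equal_means: "\<And>p. p \<ge> 1 \<Longrightarrow> L2_set (\<lambda>j. mean (PX p) j - mean (PY p) j) {1..p} = 0"
    and equal_covs: "\<And>p. p \<ge> 1 \<Longrightarrow>
          frob_norm p (\<lambda>i j. cov_matrix (PX p) i j - cov_matrix (PY p) i j) = 0"
    and constants: "0 < L\<^sub>4" "0 < U\<^sub>4"
    and exponents: "0 \<le> \<delta>\<^sub>5" "\<delta>\<^sub>5 < 1" "0 \<le> \<delta>\<^sub>6" "\<delta>\<^sub>6 < 1" "0 \<le> \<delta>\<^sub>7" "\<delta>\<^sub>7 < 1"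
          "1 + max \<delta>\<^sub>5 \<delta>\<^sub>6 \<noteq> 2 * \<delta>\<^sub>7" "max (max \<delta>\<^sub>5 \<delta>\<^sub>6) \<delta>\<^sub>7 > 0"
    and third_cumulants: "\<And>p. p \<ge> 1 \<Longrightarrow>
          (\<Sum>j\<^sub>1=1..p. \<Sum>j\<^sub>2=1..p. \<Sum>j\<^sub>3=1..p.
             (cumulant (PX p) [ctr (PX p) j\<^sub>1, ctr (PX p) j\<^sub>2, ctr (PX p) j\<^sub>3]
              - cumulant (PY p) [ctr (PY p) j\<^sub>1, ctr (PY p) j\<^sub>2, ctr (PY p) j\<^sub>3])\<^sup>2)
          \<in> {L\<^sub>4 * real p powr \<delta>\<^sub>5 .. U\<^sub>4 * real p powr \<delta>\<^sub>5}"
    and square_linear_covs: "\<And>p. p \<ge> 1 \<Longrightarrow>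
          (\<Sum>j\<^sub>2=1..p. (\<Sum>j\<^sub>1=1..p.
             cov (PX p) (ctr_sq (PX p) j\<^sub>1) (ctr (PX p) j\<^sub>2)
             - cov (PY p) (ctr_sq (PY p) j\<^sub>1) (ctr (PY p) j\<^sub>2))\<^sup>2)
          \<in> {L\<^sub>4 * real p powr \<delta>\<^sub>6 .. U\<^sub>4 * real p powr \<delta>\<^sub>6}"
    and square_square_covs: "\<And>p. p \<ge> 1 \<Longrightarrow>
          (\<Sum>j\<^sub>1=1..p. \<Sum>j\<^sub>2=1..p.
             cov (PX p) (ctr_sq (PX p) j\<^sub>1) (ctr_sq (PX p) j\<^sub>2)
             - cov (PY p) (ctr_sq (PY p) j\<^sub>1) (ctr_sq (PY p) j\<^sub>2))\<^sup>2
          \<in> {L\<^sub>4 * real p powr (2 * \<delta>\<^sub>7) .. U\<^sub>4 * real p powr (2 * \<delta>\<^sub>7)}"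
    and fourth_moment: "\<And>k p. k \<in> \<C> \<Longrightarrow> p \<ge> 1 \<Longrightarrow>
          integrable (PZ p \<Otimes>\<^sub>M PZ p) (\<lambda>(z, z'). (k p z z') ^ 4)"
    and in_class: "k \<in> \<C>"
    and C_pos: "0 < C"
    and to_infinity: "filterlim n at_top sequentially" "filterlim m at_top sequentially"
          "filterlim p at_top sequentially"
    and balance: "(\<lambda>t. real (n t) / real (n t + m t) - \<rho>) \<in> O(\<lambda>t. 1 / real (n t + m t))"
    and rate: "(\<lambda>t. real (p t)) \<in>
          o(\<lambda>t. real (n t + m t) powr (1 / (7 - 2 * max (1 + max \<delta>\<^sub>5 \<delta>\<^sub>6) (2 * \<delta>\<^sub>7))))"
  shows "(\<lambda>t. measure (M (p t))
           {\<omega> \<in> space (M (p t)).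
              T_stat (p t) (k (p t)) (n t) (m t) (\<lambda>i. X (p t) i \<omega>) (\<lambda>j. Y (p t) j \<omega>) > C})
         \<longlonglongrightarrow> 1"
proof -
  define \<delta> where "\<delta> = max \<delta>\<^sub>5 \<delta>\<^sub>6"
  define w where "w = 7 - 2 * max (1 + \<delta>) (2 * \<delta>\<^sub>7)"
  have \<delta>: "0 \<le> \<delta>" "\<delta> < 1" using exponents by (auto simp: \<delta>_def)
  have w_pos: "0 < w" using exponents \<delta> by (simp add: w_def max_def)
  obtain c where c: "0 < c" "eventually (\<lambda>p. norm (real (\<alpha> p)) \<le> c * norm (1::real)) at_top"
    using alpha by (elim landau_o.bigE)
  \<comment> \<open>An integer bound for \<alpha>(p), valid for all large p only; every later use is
    restricted to such p.\<close>
  define K where "K = nat \<lceil>c\<rceil>"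
  have ev_alpha: "eventually (\<lambda>p. \<alpha> p \<le> K) at_top"
    using c(2)
  proof eventually_elim
    case (elim p)
    then have "real (\<alpha> p) \<le> c" by simp
    also have "c \<le> real K" unfolding K_def by (rule real_nat_ceiling_ge)
    finally show ?case by simp
  qed
  obtain U' where U': "0 < U'" "\<And>p j r P. p \<ge> 1 \<Longrightarrow> j \<in> {1..p} \<Longrightarrow> r \<in> {1..128} \<Longrightarrow> P \<in> {PX p, PY p} \<Longrightarrow>
      (\<integral>\<^sup>+x. ennreal (\<bar>x j\<bar> ^ r) \<partial>P) < ennreal U'"
    using D2 unfolding cond_D2_def by blast
  define U where "U = max 1 U'"
  obtain L0 U0 where L0: "0 < L0" "0 < U0" and A_bounds: "\<And>p. p \<ge> 1 \<Longrightarrow> L0 * real p \<le> mean_sq_dist p (PX p) (PY p)"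
      "\<And>p. p \<ge> 1 \<Longrightarrow> mean_sq_dist p (PX p) (PY p) \<le> U0 * real p"
    using D3 unfolding cond_D3_def by blast
  obtain M2' where M2': "\<And>p s0 i s. p \<ge> 1 \<Longrightarrow> s0 \<in> D0 k p \<Longrightarrow> i \<in> {1..7} \<Longrightarrow> s \<in> D k p \<Longrightarrow>
      \<bar>nth_deriv (D k p) i (f k p) s\<bar> * \<bar>s0 ^ i\<bar> \<le> M2' * \<bar>f k p s0\<bar>"
    using K2 in_class unfolding cond_K2_def by blast
  define M2 where "M2 = max 1 M2'"
  obtain M4' where M4': "\<And>p s0. p \<ge> 1 \<Longrightarrow> s0 \<in> D0 k p \<Longrightarrow> \<bar>f k p s0\<bar> \<le> M4' * min
          \<bar>1/16 * nth_deriv (D k p) 1 (f k p) s0 * s0 - 1/16 * nth_deriv (D k p) 2 (f k p) s0 * s0\<^sup>2 + 1/48 * nth_deriv (D k p) 3 (f k p) s0 * s0 ^ 3\<bar>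
          \<bar>- 5/128 * nth_deriv (D k p) 1 (f k p) s0 * s0 + 5/128 * nth_deriv (D k p) 2 (f k p) s0 * s0\<^sup>2
            - 1/64 * nth_deriv (D k p) 3 (f k p) s0 * s0 ^ 3 + 1/384 * nth_deriv (D k p) 4 (f k p) s0 * s0 ^ 4\<bar>"
    using K4 in_class unfolding cond_K4_def Let_def by blast
  define M4 where "M4 = max 1 M4'"
  have X: "prob_space (M p)" "\<And>i. 1 \<le> i \<Longrightarrow> X p i \<in> M p \<rightarrow>\<^sub>M Rp p" "\<And>i. 1 \<le> i \<Longrightarrow> distr (M p) (Rp p) (X p i) = PX p"
     "\<And>i. 1 \<le> i \<Longrightarrow> Y p i \<in> M p \<rightarrow>\<^sub>M Rp p" "\<And>i. 1 \<le> i \<Longrightarrow> distr (M p) (Rp p) (Y p i) = PY p"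
     "prob_space.indep_vars (M p) (\<lambda>_. Rp p) (case_sum (X p) (Y p)) ({1..} <+> {1..})" if "1 \<le> p" for p
    using sampling that unfolding two_samples_def by blast+
  have wd: "weak_dependence P p K U" if p: "1 \<le> p" "\<alpha> p \<le> K" and P: "P \<in> {PX p, PY p}" for p P
  proof -
    have "prob_space P \<and> sets P = sets (Rp p)"
      using P prob_space.prob_space_distr[OF X(1)[OF p(1)] X(2)[OF p(1), of 1]] X(3)[OF p(1), of 1]
        prob_space.prob_space_distr[OF X(1)[OF p(1)] X(4)[OF p(1), of 1]] X(5)[OF p(1), of 1] by (auto dest: sym)
    then interpret prob_space P by simp
    show ?thesis
    proof unfold_locales
      show "sets P = sets (Rp p)" using \<open>prob_space P \<and> _\<close> by simp
      show "1 \<le> p" by (rule p)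
      show "1 \<le> U" by (simp add: U_def)
      show "(\<integral>\<^sup>+x. ennreal (\<bar>x j\<bar> ^ r) \<partial>P) < ennreal U" if "j \<in> {1..p}" "r \<in> {1..128}" for j r
        by (rule less_le_trans[OF U'(2)[OF p(1) that P]]) (simp add: U_def ennreal_leI)
      show "indep_var (\<Pi>\<^sub>M i\<in>{1..j}. borel) (\<lambda>x. restrict x {1..j}) (\<Pi>\<^sub>M i\<in>{j + l..p}. borel) (\<lambda>x. restrict x {j + l..p})"
        if "1 \<le> j" "K < l" "j + l \<le> p" for j l
      proof -
        have "1 \<le> j \<and> j + \<alpha> p + 1 \<le> p \<and> \<alpha> p < l" using that p(2) by auto
        then show ?thesis using D1 p(1) P unfolding cond_D1_def by blast
      qed
    qed
  qed
  have pair: "radial_pair (PX p) (PY p) p K U L0 U0 M2 M4 (f k p) (D k p) (k p)" if p: "1 \<le> p" "\<alpha> p \<le> K" for p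
  proof -
    have s0: "sqrt (mean_sq_dist p (PX p) (PY p)) \<in> D0 k p" "D0 k p \<subseteq> D k p" using D0[OF in_class p(1)] by auto
    have rk: "is_kernel p (k p)" "is_interval (D k p)" "{0..} \<subseteq> D k p"
      "\<forall>i<7. \<forall>s\<in>D k p. nth_deriv (D k p) i (f k p) differentiable (at s within D k p)"
      "\<And>x y. x \<in> space (Rp p) \<Longrightarrow> y \<in> space (Rp p) \<Longrightarrow> k p x y = f k p (edist p x y)"
      using kernels in_class p(1) unfolding radial_kernels_def by blast+
    show ?thesis
    proof (rule radial_pair.intro)
      show "weak_dependence (PX p) p K U" "weak_dependence (PY p) p K U" using wd[OF p] by auto
      show "mean (PX p) j = mean (PY p) j" if "j \<in> {1..p}" for j
        using equal_means[OF p(1)] that by (simp add: L2_set_eq_0_iff)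
      show "cov_matrix (PX p) j j = cov_matrix (PY p) j j" if j: "j \<in> {1..p}" for j
      proof -
        have "(\<Sum>i=1..p. \<Sum>j=1..p. (cov_matrix (PX p) i j - cov_matrix (PY p) i j)\<^sup>2) = 0"
          using equal_covs[OF p(1)] by (simp add: frob_norm_def)
        then have "\<forall>i\<in>{1..p}. \<forall>j\<in>{1..p}. (cov_matrix (PX p) i j - cov_matrix (PY p) i j)\<^sup>2 = 0"
          by (simp add: sum_nonneg_eq_0_iff sum_nonneg)
        then show ?thesis using j by simp
      qed
      show "f k p differentiable (at s within D k p)" if "s \<in> D k p" for s
        using rk(4)[rule_format, of 0 s] that by (simp add: nth_deriv_def)
      show "\<exists>\<xi>\<in>closed_segment s (sqrt (mean_sq_dist p (PX p) (PY p))).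
          f k p s = (\<Sum>i=0..6. 1 / fact i * nth_deriv (D k p) i (f k p) (sqrt (mean_sq_dist p (PX p) (PY p))) * (s - sqrt (mean_sq_dist p (PX p) (PY p))) ^ i)
                + 1 / fact 7 * nth_deriv (D k p) 7 (f k p) \<xi> * (s - sqrt (mean_sq_dist p (PX p) (PY p))) ^ 7" if "s \<in> D k p" for s
        using K1 in_class p(1) that s0(1) unfolding cond_K1_def by blast
      show "\<bar>nth_deriv (D k p) i (f k p) s\<bar> * \<bar>sqrt (mean_sq_dist p (PX p) (PY p)) ^ i\<bar> \<le> M2 * \<bar>f k p (sqrt (mean_sq_dist p (PX p) (PY p)))\<bar>"
        if "i \<in> {1..7}" "s \<in> D k p" for i s
        by (rule order_trans[OF M2'[OF p(1) s0(1) that]]) (simp add: M2_def mult_right_mono)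
      show "1 \<le> M2" "1 \<le> M4" by (simp_all add: M2_def M4_def)
      show "\<bar>f k p (sqrt (mean_sq_dist p (PX p) (PY p)))\<bar> \<le> M4 *
          \<bar>1/16 * nth_deriv (D k p) 1 (f k p) (sqrt (mean_sq_dist p (PX p) (PY p))) * sqrt (mean_sq_dist p (PX p) (PY p))
           - 1/16 * nth_deriv (D k p) 2 (f k p) (sqrt (mean_sq_dist p (PX p) (PY p))) * (sqrt (mean_sq_dist p (PX p) (PY p)))\<^sup>2
           + 1/48 * nth_deriv (D k p) 3 (f k p) (sqrt (mean_sq_dist p (PX p) (PY p))) * sqrt (mean_sq_dist p (PX p) (PY p)) ^ 3\<bar>"
      proof -
        have mm: "M4' * min u v \<le> M4 * u" if "0 \<le> u" "0 \<le> v" for u v :: real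
        proof -
          have "M4' * min u v \<le> M4 * min u v" using that by (intro mult_right_mono) (auto simp: M4_def)
          also have "\<dots> \<le> M4 * u" by (intro mult_left_mono) (auto simp: M4_def)
          finally show ?thesis .
        qed
        show ?thesis by (rule order_trans[OF M4'[OF p(1) s0(1)] mm]) auto
      qed
    qed (use rk A_bounds[OF p(1)] L0 in blast)+
  qed
  \<comment> \<open>Both cases are brought into one form: a gap given by a function of a real
    variable, so that its growth can be studied over the reals and then composed with p.\<close>
  have "\<exists>\<gamma>. filterlim (\<lambda>x. x powr (w / 2) * \<gamma> x) at_top at_top \<and>
      (\<forall>p. 1 \<le> p \<longrightarrow> \<alpha> p \<le> K \<longrightarrow> 6 * K + 2 < p \<longrightarrow>
        radial_pair.has_gap (PX p) (PY p) p L0 M2 (f k p) (k p) (\<gamma> (real p)))"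
  proof (cases "2 * \<delta>\<^sub>7 < 1 + \<delta>")
    case True
    define kc where "kc = radial_pair.k_cubic L0 U0 M2 M4"
    define ec where "ec = radial_pair.e_cubic K U L0 U0"
    define \<theta> where "\<theta> x = sqrt (L\<^sub>4 * x powr \<delta> / x) / real (4 * K + 1)" for x
    define \<gamma> where "\<gamma> x = kc * \<theta> x / sqrt x ^ 3 - ec / sqrt x ^ 5" for x
    have w: "w = 5 - 2 * \<delta>" using True by (simp add: w_def)
    have gap: "radial_pair.has_gap (PX p) (PY p) p L0 M2 (f k p) (k p) (\<gamma> (real p))"
      if p: "1 \<le> p" "\<alpha> p \<le> K" "6 * K + 2 < p" for p
    proof -
      interpret R: radial_pair "PX p" "PY p" p K U L0 U0 M2 M4 "f k p" "D k p" "k p" by (rule pair[OF p(1,2)])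
      define s where "s = L\<^sub>4 * real p powr \<delta>"
      have s: "0 < s" using constants p(1) by (simp add: s_def)
      have "s \<le> (\<Sum>i=1..p. \<Sum>j=1..p. \<Sum>l=1..p. (R.T_diff i j l)\<^sup>2) \<or> s \<le> (\<Sum>j=1..p. (\<Sum>i=1..p. R.T_diff i i j)\<^sup>2)"
      proof (cases "\<delta>\<^sub>6 \<le> \<delta>\<^sub>5")
        case True
        then have "s = L\<^sub>4 * real p powr \<delta>\<^sub>5" by (simp add: s_def \<delta>_def max_def)
        also have "\<dots> \<le> (\<Sum>i=1..p. \<Sum>j=1..p. \<Sum>l=1..p. (R.T_diff i j l)\<^sup>2)"
        proof -
          have "(\<Sum>i=1..p. \<Sum>j=1..p. \<Sum>l=1..p. (R.T_diff i j l)\<^sup>2)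
            = (\<Sum>i=1..p. \<Sum>j=1..p. \<Sum>l=1..p. (cumulant (PX p) [ctr (PX p) i, ctr (PX p) j, ctr (PX p) l]
              - cumulant (PY p) [ctr (PY p) i, ctr (PY p) j, ctr (PY p) l])\<^sup>2)"
            by (intro sum.cong refl arg_cong2[of _ _ _ _ "(^)"] R.cumulant_T_diff[symmetric])
          then show ?thesis using third_cumulants[OF p(1)] by simp
        qed
        finally show ?thesis by blast
      next
        case False
        then have "s = L\<^sub>4 * real p powr \<delta>\<^sub>6" by (simp add: s_def \<delta>_def max_def)
        also have "\<dots> \<le> (\<Sum>j=1..p. (\<Sum>i=1..p. R.T_diff i i j)\<^sup>2)"
        proof -
          have "(\<Sum>j=1..p. (\<Sum>i=1..p. R.T_diff i i j)\<^sup>2) = (\<Sum>j=1..p. (\<Sum>i=1..p. cov (PX p) (ctr_sq (PX p) i) (ctr (PX p) j)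
              - cov (PY p) (ctr_sq (PY p) i) (ctr (PY p) j))\<^sup>2)"
            by (intro sum.cong refl arg_cong2[of _ _ _ _ "(^)"] R.cov_T_diff[symmetric])
          then show ?thesis using square_linear_covs[OF p(1)] by simp
        qed
        finally show ?thesis by blast
      qed
      then obtain j1 j2 j3 where j: "j1 \<in> {1..p}" "j2 \<in> {1..p}" "j3 \<in> {1..p}"
        "sqrt (s / real p) / real (4 * K + 1) \<le> \<bar>R.T_diff j1 j2 j3\<bar>"
        using R.large_T_diff[OF s] by blast
      have pos: "0 < sqrt (s / real p) / real (4 * K + 1)" using s p(1) by simp
      show ?thesis
        using R.cubic_test_exists[OF j(1-3) p(3) pos j(4)]
        unfolding R.has_gap_def \<gamma>_def \<theta>_def kc_def ec_def s_def .
    qed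
    \<comment> \<open>Positivity is a fact of the locale, although the constant does not depend on
      p; so one dimension in which the locale holds has to be exhibited.\<close>
    have kc: "0 < kc"
    proof -
      have "eventually (\<lambda>p. 1 \<le> p \<and> \<alpha> p \<le> K) at_top" using ev_alpha eventually_ge_at_top[of 1] by eventually_elim simp
      then obtain p where p: "1 \<le> p" "\<alpha> p \<le> K" using eventually_happens by fastforce
      show ?thesis using radial_pair.k_pos(1)[OF pair[OF p]] by (simp add: kc_def)
    qed
    \<comment> \<open>With w / 2 = 5/2 - \<delta> the signal has exponent w/2 + (\<delta> - 1)/2 -
      3/2 = (1 - \<delta>)/2 > 0, and the error, of order p^(-5/2), is turned into
      p^(-\<delta>).\<close>
    have "filterlim (\<lambda>x. (kc * sqrt L\<^sub>4 / real (4 * K + 1)) * x powr ((1 - \<delta>) / 2) - ec * x powr (- \<delta>)) at_top at_top"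
      using kc constants \<delta> by (intro filterlim_powr_diff_at_top) auto
    then have "filterlim (\<lambda>x. x powr (w / 2) * \<gamma> x) at_top at_top"
    proof (rule filterlim_mono_eventually[OF _ order_refl order_refl])
      show "eventually (\<lambda>x. (kc * sqrt L\<^sub>4 / real (4 * K + 1)) * x powr ((1 - \<delta>) / 2) - ec * x powr (- \<delta>)
          = x powr (w / 2) * \<gamma> x) at_top"
        using eventually_gt_at_top[of 0]
      proof eventually_elim
        case (elim x)
        have sq: "sqrt x ^ i = x powr (real i / 2)" for i
          using elim by (simp add: powr_half_sqrt[symmetric] powr_power)
        have "L\<^sub>4 * x powr \<delta> / x = L\<^sub>4 * x powr (\<delta> - 1)" using elim by (simp add: powr_diff)
        then have th: "\<theta> x = sqrt L\<^sub>4 * x powr ((\<delta> - 1) / 2) / real (4 * K + 1)"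
          using elim by (simp add: \<theta>_def real_sqrt_mult powr_half_sqrt[symmetric] powr_powr)
        have 1: "x powr (w / 2) * (x powr ((\<delta> - 1) / 2) / x powr (3 / 2)) = x powr ((1 - \<delta>) / 2)"
          unfolding powr_diff[symmetric] powr_add[symmetric] w by (rule arg_cong[of _ _ "(powr) x"]) (simp add: field_simps)
        have 2: "x powr (w / 2) / x powr (5 / 2) = x powr (- \<delta>)"
          unfolding powr_diff[symmetric] w by (rule arg_cong[of _ _ "(powr) x"]) (simp add: field_simps)
        have "x powr (w / 2) * \<gamma> x = kc * sqrt L\<^sub>4 / real (4 * K + 1) * (x powr (w / 2) * (x powr ((\<delta> - 1) / 2) / x powr (3 / 2)))
            - ec * (x powr (w / 2) / x powr (5 / 2))"
          unfolding \<gamma>_def th sq by (simp add: right_diff_distrib ac_simps)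
        then show ?case unfolding 1 2 by simp
      qed
    qed
    then show ?thesis using gap by blast
  next
    case False
    \<comment> \<open>Equality is excluded by the assumption on the exponents, so the case
      distinction is strict on both sides.\<close>
    then have \<delta>7: "1 + \<delta> < 2 * \<delta>\<^sub>7" using exponents(7) by (simp add: \<delta>_def)
    define kr where "kr = radial_pair.k_radius U0 M2 M4"
    define er where "er = radial_pair.e_radius K U L0 U0"
    define \<gamma> where "\<gamma> x = kr * (sqrt L\<^sub>4 * x powr \<delta>\<^sub>7) / sqrt x ^ 5 - er / sqrt x ^ 4" for x
    have w: "w = 7 - 4 * \<delta>\<^sub>7" using \<delta>7 by (simp add: w_def)
    have gap: "radial_pair.has_gap (PX p) (PY p) p L0 M2 (f k p) (k p) (\<gamma> (real p))"
      if p: "1 \<le> p" "\<alpha> p \<le> K" "6 * K + 2 < p" for p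
    proof -
      interpret R: radial_pair "PX p" "PY p" p K U L0 U0 M2 M4 "f k p" "D k p" "k p" by (rule pair[OF p(1,2)])
      have "(sqrt L\<^sub>4 * real p powr \<delta>\<^sub>7)\<^sup>2 = L\<^sub>4 * real p powr (2 * \<delta>\<^sub>7)"
        using constants p(1) by (simp add: power_mult_distrib powr_power)
      also have "\<dots> \<le> ((\<integral>x. (sq_dev (PX p) p x)\<^sup>2 \<partial>PX p) - (\<integral>x. (sq_dev (PX p) p x)\<^sup>2 \<partial>PY p))\<^sup>2"
        using square_square_covs[OF p(1)] unfolding R.cov_sq_diff by simp
      finally have "\<bar>sqrt L\<^sub>4 * real p powr \<delta>\<^sub>7\<bar>
          \<le> \<bar>(\<integral>x. (sq_dev (PX p) p x)\<^sup>2 \<partial>PX p) - (\<integral>x. (sq_dev (PX p) p x)\<^sup>2 \<partial>PY p)\<bar>"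
        by (simp only: abs_le_square_iff)
      moreover have "0 \<le> sqrt L\<^sub>4 * real p powr \<delta>\<^sub>7" using constants by simp
      ultimately show ?thesis
        using R.radius_test_exists[of "sqrt L\<^sub>4 * real p powr \<delta>\<^sub>7"]
        unfolding R.has_gap_def \<gamma>_def kr_def er_def by simp
    qed
    have kr: "0 < kr"
    proof -
      have "eventually (\<lambda>p. 1 \<le> p \<and> \<alpha> p \<le> K) at_top" using ev_alpha eventually_ge_at_top[of 1] by eventually_elim simp
      then obtain p where p: "1 \<le> p" "\<alpha> p \<le> K" using eventually_happens by fastforce
      show ?thesis using radial_pair.k_pos(2)[OF pair[OF p]] by (simp add: kr_def)
    qed
    \<comment> \<open>The signal exponent 1 - \<open>\<delta>\<^sub>7\<close> exceeds the error
      exponent 3/2 - 2 \<open>\<delta>\<^sub>7\<close> precisely when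
      \<open>\<delta>\<^sub>7\<close> > 1/2, which this case guarantees.\<close>
    have "filterlim (\<lambda>x. (kr * sqrt L\<^sub>4) * x powr (1 - \<delta>\<^sub>7) - er * x powr (3 / 2 - 2 * \<delta>\<^sub>7)) at_top at_top"
      using kr constants \<delta> \<delta>7 exponents by (intro filterlim_powr_diff_at_top) auto
    then have "filterlim (\<lambda>x. x powr (w / 2) * \<gamma> x) at_top at_top"
    proof (rule filterlim_mono_eventually[OF _ order_refl order_refl])
      show "eventually (\<lambda>x. (kr * sqrt L\<^sub>4) * x powr (1 - \<delta>\<^sub>7) - er * x powr (3 / 2 - 2 * \<delta>\<^sub>7) = x powr (w / 2) * \<gamma> x) at_top"
        using eventually_gt_at_top[of 0]
      proof eventually_elim
        case (elim x)
        have sq: "sqrt x ^ i = x powr (real i / 2)" for i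
          using elim by (simp add: powr_half_sqrt[symmetric] powr_power)
        have 1: "x powr (w / 2) * (x powr \<delta>\<^sub>7 / x powr (5 / 2)) = x powr (1 - \<delta>\<^sub>7)"
          unfolding powr_diff[symmetric] powr_add[symmetric] w by (rule arg_cong[of _ _ "(powr) x"]) (simp add: field_simps)
        have 2: "x powr (w / 2) / x powr (4 / 2) = x powr (3 / 2 - 2 * \<delta>\<^sub>7)"
          unfolding powr_diff[symmetric] w by (rule arg_cong[of _ _ "(powr) x"]) (simp add: field_simps)
        have "x powr (w / 2) * \<gamma> x = kr * sqrt L\<^sub>4 * (x powr (w / 2) * (x powr \<delta>\<^sub>7 / x powr (5 / 2)))
            - er * (x powr (w / 2) / x powr (4 / 2))"
          unfolding \<gamma>_def sq by (simp add: right_diff_distrib ac_simps)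
        then show ?case unfolding 1 2 by simp
      qed
    qed
    then show ?thesis using gap by blast
  qed
  then obtain \<gamma> where \<gamma>: "filterlim (\<lambda>x. x powr (w / 2) * \<gamma> x) at_top at_top"
    and gap: "\<And>p. 1 \<le> p \<Longrightarrow> \<alpha> p \<le> K \<Longrightarrow> 6 * K + 2 < p \<Longrightarrow>
        radial_pair.has_gap (PX p) (PY p) p L0 M2 (f k p) (k p) (\<gamma> (real p))" by blast
  define S where "S t = real (p t) powr (w / 2) * \<gamma> (real (p t))" for t
  have S_lim: "filterlim S at_top sequentially"
    unfolding S_def using filterlim_compose[OF \<gamma> filterlim_compose[OF filterlim_real_sequentially to_infinity(3)]] .
  \<comment> \<open>Any positive number strictly below both limiting sample fractions \<rho> and 1 -
    \<rho> would do; strictness makes the bound hold eventually.\<close>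
  define \<eta> where "\<eta> = min \<rho> (1 - \<rho>) / 2"
  have \<eta>: "0 < \<eta>" "\<eta> < \<rho>" "\<eta> < 1 - \<rho>" using rho by (auto simp: \<eta>_def min_def)
  have ev_n: "eventually (\<lambda>t. 2 \<le> n t) sequentially" "eventually (\<lambda>t. 2 \<le> m t) sequentially"
    using to_infinity(1,2) by (auto simp: filterlim_at_top)
  have N_lim: "filterlim (\<lambda>t. real (n t + m t)) at_top sequentially"
  proof (rule filterlim_at_top_mono[OF filterlim_compose[OF filterlim_real_sequentially to_infinity(1)]])
    show "eventually (\<lambda>t. real (n t) \<le> real (n t + m t)) sequentially" by simp
  qed
  have ratio: "(\<lambda>t. real (n t) / real (n t + m t)) \<longlonglongrightarrow> \<rho>"
  proof -
    have "((\<lambda>t. 1 / real (n t + m t)) \<longlongrightarrow> 0) sequentially"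
      using N_lim by (intro tendsto_divide_0[OF tendsto_const] filterlim_at_top_imp_at_infinity)
    then have "(\<lambda>t. 1 / real (n t + m t)) \<in> o(\<lambda>_. 1)" by (intro smalloI_tendsto) auto
    then have "(\<lambda>t. real (n t) / real (n t + m t) - \<rho>) \<in> o(\<lambda>_. 1)" using balance by (rule landau_o.big_small_trans[rotated])
    then have "((\<lambda>t. real (n t) / real (n t + m t) - \<rho>) \<longlongrightarrow> 0) sequentially" by (auto dest: smalloD_tendsto)
    then show ?thesis by (rule LIM_zero_cancel)
  qed
  have ev_bal: "eventually (\<lambda>t. \<eta> * real (n t + m t) \<le> real (n t) \<and> \<eta> * real (n t + m t) \<le> real (m t)) sequentially"
  proof -
    have "eventually (\<lambda>t. \<eta> < real (n t) / real (n t + m t)) sequentially" "eventually (\<lambda>t. real (n t) / real (n t + m t) < 1 - \<eta>) sequentially"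
      using order_tendstoD[OF ratio] \<eta> by auto
    then show ?thesis using ev_n
    proof eventually_elim
      case (elim t)
      have N: "0 < real (n t + m t)" using elim by simp
      have "\<eta> * real (n t + m t) < real (n t)" using elim(1) N by (simp add: pos_less_divide_eq)
      moreover have "real (n t) < (1 - \<eta>) * real (n t + m t)" using elim(2) N by (simp add: pos_divide_less_eq)
      ultimately show ?case by (simp add: left_diff_distrib)
    qed
  qed
  have ev_rate: "eventually (\<lambda>t. real (p t) powr w \<le> real (n t + m t)) sequentially"
  proof -
    have "eventually (\<lambda>t. norm (real (p t)) \<le> 1 * norm (real (n t + m t) powr (1 / w))) sequentially"
      using landau_o.smallD[OF rate[folded \<delta>_def, folded w_def], of 1] by simp
    then show ?thesis using ev_n
    proof eventually_elim
      case (elim t)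
      have "real (p t) powr w \<le> (real (n t + m t) powr (1 / w)) powr w"
        using elim(1) w_pos by (intro powr_mono2) auto
      also have "\<dots> = real (n t + m t)" using w_pos elim(2) by (simp add: powr_powr)
      finally show ?case .
    qed
  qed
  have ev_p: "eventually (\<lambda>t. 1 \<le> p t \<and> \<alpha> (p t) \<le> K \<and> 6 * K + 2 < p t) sequentially"
  proof (rule eventually_compose_filterlim[OF _ to_infinity(3)])
    show "eventually (\<lambda>p. 1 \<le> p \<and> \<alpha> p \<le> K \<and> 6 * K + 2 < p) at_top"
      using ev_alpha eventually_ge_at_top[of 1] eventually_gt_at_top[of "6 * K + 2"] by eventually_elim simp
  qed
  \<comment> \<open>The threshold beyond which both requirements on the signal hold: 4 for
    \<open>energy_lower\<close>, and the bound of \<open>margin_dominates\<close> raised by 1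
    because the inequality there is strict.\<close>
  define S1 where "S1 = max 4 ((480 * C + 16 + 32 / \<eta>) * (4 * test_norm (1 + 1 / L0)) / \<eta> + 1)"
  define c1 where "c1 = tail_const \<eta> (1 + 1 / L0)"
  define pr where "pr t = measure (M (p t)) {\<omega> \<in> space (M (p t)).
              T_stat (p t) (k (p t)) (n t) (m t) (\<lambda>i. X (p t) i \<omega>) (\<lambda>j. Y (p t) j \<omega>) > C}" for t
  have "eventually (\<lambda>t. S1 \<le> S t) sequentially" using S_lim by (simp add: filterlim_at_top)
  then have low: "eventually (\<lambda>t. 1 - c1 / S t \<le> pr t) sequentially"
    using ev_n ev_bal ev_rate ev_p
  proof eventually_elim
    case (elim t)
    have p: "1 \<le> p t" "\<alpha> (p t) \<le> K" "6 * K + 2 < p t" using elim by auto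
    interpret R: radial_pair "PX (p t)" "PY (p t)" "p t" K U L0 U0 M2 M4 "f k (p t)" "D k (p t)" "k (p t)" by (rule pair[OF p(1,2)])
    show ?case unfolding pr_def c1_def
    proof (rule R.power_bound_rel[OF X(1)[OF p(1)] X(2)[OF p(1)] X(3)[OF p(1)] X(4)[OF p(1)] X(5)[OF p(1)] X(6)[OF p(1)]])
      show "R.has_gap (\<gamma> (real (p t)))" by (rule gap[OF p])
      show "S t = real (p t) powr (w / 2) * \<gamma> (real (p t))" by (simp add: S_def)
      show "4 \<le> S t" using elim(1) by (simp add: S1_def)
      show "C * sqrt (48 * (2 + 8 * S')) < \<eta> * margin \<eta> (1 + 1 / L0) S'" if "S t \<le> S'" for S'
        using elim(1) that L0 \<eta> C_pos unfolding S1_def by (intro margin_dominates) auto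
    qed (use elim \<eta> C_pos in auto)
  qed
  have up: "eventually (\<lambda>t. pr t \<le> 1) sequentially"
    using ev_p
  proof eventually_elim
    case (elim t)
    then show ?case unfolding pr_def using prob_space.prob_le_1[OF X(1)] by blast
  qed
  have "(\<lambda>t. c1 / S t) \<longlonglongrightarrow> 0"
    using S_lim by (intro tendsto_divide_0[OF tendsto_const] filterlim_at_top_imp_at_infinity)
  then have "(\<lambda>t. 1 - c1 / S t) \<longlonglongrightarrow> 1 - 0" by (intro tendsto_diff tendsto_const)
  then have "pr \<longlonglongrightarrow> 1" using low up by (intro tendsto_sandwich[of "\<lambda>t. 1 - c1 / S t" pr _ "\<lambda>_. 1"]) auto
  then show ?thesis unfolding pr_def .
qed

end
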